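(* Let $k\neq 0$ be a commutative ring, let $\lambda\in k^\Xi$, and let $H^0$, $H^\lambda$, $A(\lambda)$ be the Hopf algebras and the $(H^0,H^\lambda)$-bicomodule algebra over $k$ defined in the context, with the filtrations on $A(\lambda)$ and $H^\lambda$ induced from the grading of $F=TV\rtimes\Gamma$. Then: (1) $\operatorname{gr}A(\lambda)$ is an $(H^0,\operatorname{gr}H^\lambda)$-bicleft object. (2) The canonical graded algebra map $H^0\to\operatorname{gr}A(\lambda)$ is an isomorphism. (3) The canonical graded Hopf algebra map $H^0\to\operatorname{gr}H^\lambda$ is an isomorphism.
   Context: Cleft objects. For a Hopf algebra $H$, a left $H$-comodule algebra $A$ (coaction $\rho$) is cleft if there is a convolution-invertible left $H$-colinear map $H\to A$; it is an $H$-cleft object if moreover $\{a\in A\mid\rho(a)=1\otimes a\}=k$. Right cleft objects are defined symmetrically. An $(L,H)$-bicleft object is an $(L,H)$-bicomodule algebra that is a left $L$-cleft object and a right $H$-cleft object. Setting. $\Gamma$ is an abelian group, $\hat\Gamma=\mathrm{Hom}(\Gamma,k^\times)$, $I$ a non-empty finite set; $g_i\in\Gamma$, $\chi_i\in\hat\Gamma$, $q_{ij}:=\chi_j(g_i)$. $V=\bigoplus_{i\in I}kx_i$ is free, a Yetter–Drinfeld module over $k\Gamma$ with $x_i$ of degree $g_i$ and $gx_i=\chi_i(g)x_i$; its braiding $c(x_i\otimes x_j)=q_{ij}x_j\otimes x_i$ makes $T^lV$ a $kB_l$-module ($B_l$ the braid group). $TV$ is a graded braided Hopf algebra with $V$ primitive;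 $F=TV\rtimes\Gamma$ is its bosonization: $TV\otimes k\Gamma$ with $gx_i=\chi_i(g)x_ig$, $\Delta(g)=g\otimes g$, $\Delta(x_i)=x_i\otimes1+g_i\otimes x_i$. Put $(\mathrm{ad}_c\,x_i)(x_j)=x_i\otimes x_j-q_{ij}x_j\otimes x_i$. Fix a partition $I=I_1\sqcup\cdots\sqcup I_N$ into non-empty subsets; $|i|=r$ if $i\in I_r$; assume $q_{ij}q_{ji}=1$ whenever $|i|\ne|j|$. $\Theta=\{(i,j)\mid|i|>|j|\}$, $\Xi=\{(i,j)\in\Theta\mid\chi_i\chi_j=1\}$. $\mathcal R\subset TV$ is a set of elements $\xi(x_{i_1}\otimes\cdots\otimes x_{i_l})$ ($l\ge2$, $\xi\in kB_l$, $|i_1|=\cdots=|i_l|$), with a finite chain $\emptyset=\mathcal R_{(0)}\subset\cdots\subset\mathcal R_{(L)}=\mathcal R$ such that every element of $\mathcal R_{(h)}$ ($0<h\le L$) is primitive in $TV$ modulo the ideal $(\mathcal R_{(h-1)})$. For $\lambda\in k^\Xi$ set $\lambda_{ij}=0$ on $\Theta\setminus\Xi$, and define quotients of $F$: $H^0=F/(\mathcal R\cup\{(\mathrm{ad}_c\,x_i)(x_j)\}_{\Theta})$ (graded Hopf algebra), $H^\lambda=F/(\mathcal R\cup\{(\mathrm{ad}_c\,x_i)(x_j)-\lambda_{ij}(g_ig_j-1)\}_\Theta)$ (Hopf algebra), $A(\lambda)=F/(\mathcal R\cup\{(\mathrm{ad}_c\,x_i)(x_j)-\lambda_{ij}g_ig_j\}_\Theta)$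 (algebra). The coproduct of $F$ induces coactions $H^0\otimes A(\lambda)\leftarrow A(\lambda)\to A(\lambda)\otimes H^\lambda$ making $A(\lambda)$ an $(H^0,H^\lambda)$-bicomodule algebra. Filtrations. $F$ is graded by tensor degree in $TV$ with $k\Gamma$ in degree $0$; the filtration $F_n=\bigoplus_{i\le n}T^iV\otimes k\Gamma$ induces quotient filtrations on $A(\lambda)$ and $H^\lambda$, giving epimorphisms of graded algebras $F\to\operatorname{gr}A(\lambda)$ and of graded Hopf algebras $F\to\operatorname{gr}H^\lambda$. These factor through the canonical maps $H^0\to\operatorname{gr}A(\lambda)$, $H^0\to\operatorname{gr}H^\lambda$ of the statement. The coactions on $A(\lambda)$ are filtered and induce an $(H^0,\operatorname{gr}H^\lambda)$-bicomodule algebra structure on $\operatorname{gr}A(\lambda)$. *)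

theory Defs
  imports Complex_Main "HOL-Algebra.QuotRing" "HOL-Algebra.Module" "HOL-Library.Poly_Mapping"
begin

abbreviation "keys \<equiv> Poly_Mapping.keys"
abbreviation "lookup \<equiv> Poly_Mapping.lookup"
abbreviation "single \<equiv> Poly_Mapping.single"


section \<open>Algebras over a commutative ring\<close>

text \<open>
  The base ring is a type \<open>'k\<close> of class \<open>comm_ring_1\<close>; this class includes \<open>0 \<noteq> 1\<close>.
  A $k$-module or $k$-algebra is a \<open>('k, 'a) module\<close> record of HOL-Algebra.
\<close>

definition base_ring :: "('k::comm_ring_1, 'k) module" where
  "base_ring = \<lparr>carrier = UNIV, mult = (*), one = 1, zero = 0, add = (+), smult = (*)\<rparr>"

definition k_algebra :: "('k::comm_ring_1, 'a, 'm) module_scheme \<Rightarrow> bool" where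
  "k_algebra A \<longleftrightarrow> ring A \<and> Module.module base_ring A \<and>
     (\<forall>c. \<forall>x\<in>carrier A. \<forall>y\<in>carrier A.
        (c \<odot>\<^bsub>A\<^esub> x) \<otimes>\<^bsub>A\<^esub> y = c \<odot>\<^bsub>A\<^esub> (x \<otimes>\<^bsub>A\<^esub> y) \<and>
        x \<otimes>\<^bsub>A\<^esub> (c \<odot>\<^bsub>A\<^esub> y) = c \<odot>\<^bsub>A\<^esub> (x \<otimes>\<^bsub>A\<^esub> y))"

definition k_linear ::
  "('k::comm_ring_1, 'a, 'm) module_scheme \<Rightarrow> ('k, 'b, 'n) module_scheme \<Rightarrow> ('a \<Rightarrow> 'b) \<Rightarrow> bool" where
  "k_linear M N f \<longleftrightarrow> f \<in> carrier M \<rightarrow> carrier N \<and>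
     (\<forall>x\<in>carrier M. \<forall>y\<in>carrier M. f (x \<oplus>\<^bsub>M\<^esub> y) = f x \<oplus>\<^bsub>N\<^esub> f y) \<and>
     (\<forall>c. \<forall>x\<in>carrier M. f (c \<odot>\<^bsub>M\<^esub> x) = c \<odot>\<^bsub>N\<^esub> f x)"

definition algebra_hom ::
  "('k::comm_ring_1, 'a, 'm) module_scheme \<Rightarrow> ('k, 'b, 'n) module_scheme \<Rightarrow> ('a \<Rightarrow> 'b) \<Rightarrow> bool" where
  "algebra_hom A B f \<longleftrightarrow> f \<in> ring_hom A B \<and> k_linear A B f"

definition quotient_algebra ::
  "('k::comm_ring_1, 'a, 'm) module_scheme \<Rightarrow> 'a set \<Rightarrow> ('k, 'a set) module" where
  "quotient_algebra A J =
     \<lparr>carrier = carrier (A Quot J), mult = mult (A Quot J), one = one (A Quot J),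
      zero = zero (A Quot J), add = add (A Quot J),
      smult = (\<lambda>c X. \<Union>x\<in>X. J +>\<^bsub>A\<^esub> (c \<odot>\<^bsub>A\<^esub> x))\<rparr>"

text \<open>The map on cosets induced by a map \<open>f\<close> that is constant on each of them.\<close>

definition on_cosets :: "('a \<Rightarrow> 'b) \<Rightarrow> 'a set \<Rightarrow> 'b" where
  "on_cosets f X = the_elem (f ` X)"

text \<open>
  The free module on \<open>S\<close>, with the multiplication \<open>s \<cdot> t = \<tau> s t *\<^sub>k m s t\<close> of basis elements.
\<close>

definition twisted_algebra ::
  "'s set \<Rightarrow> ('s \<Rightarrow> 's \<Rightarrow> 's) \<Rightarrow> 's \<Rightarrow> ('s \<Rightarrow> 's \<Rightarrow> 'k) \<Rightarrow> ('k::comm_ring_1, 's \<Rightarrow>\<^sub>0 'k) module" where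
  "twisted_algebra S m e \<tau> =
     \<lparr>carrier = {f. keys f \<subseteq> S},
      mult = (\<lambda>f h. \<Sum>s\<in>keys f. \<Sum>t\<in>keys h.
                single (m s t) (\<tau> s t * lookup f s * lookup h t)),
      one = single e 1, zero = 0, add = (+),
      smult = (\<lambda>c. Poly_Mapping.map ((*) c))\<rparr>"

definition linear_extension ::
  "('k::comm_ring_1, 'a, 'm) module_scheme \<Rightarrow> ('s \<Rightarrow> 'a) \<Rightarrow> ('s \<Rightarrow>\<^sub>0 'k) \<Rightarrow> 'a" where
  "linear_extension M \<phi> f = (\<Oplus>\<^bsub>M\<^esub>s\<in>keys f. lookup f s \<odot>\<^bsub>M\<^esub> \<phi> s)"


section \<open>Tensor products\<close>

text \<open>
  \<open>A \<otimes>\<^sub>k B\<close> is the free module on \<open>A \<times> B\<close> modulo the span of the bilinearity relations. The free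
  module carries the product \<open>(a, b)(a', b') = (a a', b b')\<close>, so that the quotient is the tensor
  product algebra.
\<close>

definition free_on_pairs ::
  "('k::comm_ring_1, 'a, 'm) module_scheme \<Rightarrow> ('k, 'b, 'n) module_scheme \<Rightarrow>
     ('k, 'a \<times> 'b \<Rightarrow>\<^sub>0 'k) module" where
  "free_on_pairs A B =
     twisted_algebra (carrier A \<times> carrier B)
       (\<lambda>(a, b) (a', b'). (a \<otimes>\<^bsub>A\<^esub> a', b \<otimes>\<^bsub>B\<^esub> b')) (\<one>\<^bsub>A\<^esub>, \<one>\<^bsub>B\<^esub>) (\<lambda>_ _. 1)"

definition bilinearity_relations ::
  "('k::comm_ring_1, 'a, 'm) module_scheme \<Rightarrow> ('k, 'b, 'n) module_scheme \<Rightarrow>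
     ('a \<times> 'b \<Rightarrow>\<^sub>0 'k) set" where
  "bilinearity_relations A B =
     {single (a \<oplus>\<^bsub>A\<^esub> a', b) 1 - single (a, b) 1
        - single (a', b) 1 | a a' b. a \<in> carrier A \<and> a' \<in> carrier A \<and> b \<in> carrier B} \<union>
     {single (a, b \<oplus>\<^bsub>B\<^esub> b') 1 - single (a, b) 1
        - single (a, b') 1 | a b b'. a \<in> carrier A \<and> b \<in> carrier B \<and> b' \<in> carrier B} \<union>
     {single (c \<odot>\<^bsub>A\<^esub> a, b) 1 - single (a, b) c
        | c a b. a \<in> carrier A \<and> b \<in> carrier B} \<union>
     {single (a, c \<odot>\<^bsub>B\<^esub> b) 1 - single (a, b) c
        | c a b. a \<in> carrier A \<and> b \<in> carrier B}"

definition tensor_kernel ::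
  "('k::comm_ring_1, 'a, 'm) module_scheme \<Rightarrow> ('k, 'b, 'n) module_scheme \<Rightarrow>
     ('a \<times> 'b \<Rightarrow>\<^sub>0 'k) set" where
  "tensor_kernel A B =
     Modules.module.span (\<lambda>c. Poly_Mapping.map ((*) c)) (bilinearity_relations A B)"

definition tensor ::
  "('k::comm_ring_1, 'a, 'm) module_scheme \<Rightarrow> ('k, 'b, 'n) module_scheme \<Rightarrow>
     ('k, ('a \<times> 'b \<Rightarrow>\<^sub>0 'k) set) module" where
  "tensor A B = quotient_algebra (free_on_pairs A B) (tensor_kernel A B)"

definition pure_tensor ::
  "('k::comm_ring_1, 'a, 'm) module_scheme \<Rightarrow> ('k, 'b, 'n) module_scheme \<Rightarrow>
     'a \<Rightarrow> 'b \<Rightarrow> ('a \<times> 'b \<Rightarrow>\<^sub>0 'k) set" where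
  "pure_tensor A B a b = tensor_kernel A B +>\<^bsub>free_on_pairs A B\<^esub> single (a, b) 1"

text \<open>The linear map on a tensor product that is induced by a bilinear map \<open>\<beta>\<close> into \<open>M\<close>.\<close>

definition tensor_lift ::
  "('k::comm_ring_1, 'c, 'm) module_scheme \<Rightarrow> ('a \<Rightarrow> 'b \<Rightarrow> 'c) \<Rightarrow> ('a \<times> 'b \<Rightarrow>\<^sub>0 'k) set \<Rightarrow> 'c" where
  "tensor_lift M \<beta> = on_cosets (linear_extension M (\<lambda>(a, b). \<beta> a b))"

text \<open>\<open>f \<otimes> h\<close>, where \<open>A\<close> and \<open>B\<close> are the \<^emph>\<open>codomains\<close> of \<open>f\<close> and \<open>h\<close>.\<close>

definition tensor_map ::
  "('k::comm_ring_1, 'c, 'm) module_scheme \<Rightarrow> ('k, 'd, 'n) module_scheme \<Rightarrow>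
     ('a \<Rightarrow> 'c) \<Rightarrow> ('b \<Rightarrow> 'd) \<Rightarrow> ('a \<times> 'b \<Rightarrow>\<^sub>0 'k) set \<Rightarrow> ('c \<times> 'd \<Rightarrow>\<^sub>0 'k) set" where
  "tensor_map A B f h = tensor_lift (tensor A B) (\<lambda>a b. pure_tensor A B (f a) (h b))"

text \<open>\<open>(A \<otimes> B) \<otimes> C \<rightarrow> A \<otimes> (B \<otimes> C)\<close>\<close>

definition tensor_assoc ::
  "('k::comm_ring_1, 'a, 'l) module_scheme \<Rightarrow> ('k, 'b, 'm) module_scheme \<Rightarrow>
     ('k, 'c, 'n) module_scheme \<Rightarrow>
     (('a \<times> 'b \<Rightarrow>\<^sub>0 'k) set \<times> 'c \<Rightarrow>\<^sub>0 'k) set \<Rightarrow> ('a \<times> ('b \<times> 'c \<Rightarrow>\<^sub>0 'k) set \<Rightarrow>\<^sub>0 'k) set" where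
  "tensor_assoc A B C =
     tensor_lift (tensor A (tensor B C))
       (\<lambda>t c. tensor_lift (tensor A (tensor B C))
                (\<lambda>a b. pure_tensor A (tensor B C) a (pure_tensor B C b c)) t)"


section \<open>Hopf algebras and bicleft objects\<close>

record (overloaded) ('k::comm_ring_1, 'h) hopf = "('k, 'h) module" +
  comult :: "'h \<Rightarrow> ('h \<times> 'h \<Rightarrow>\<^sub>0 'k) set"
  counit :: "'h \<Rightarrow> 'k"

definition convolution_inverse ::
  "('k::comm_ring_1, 'h) hopf \<Rightarrow> ('k, 'a, 'm) module_scheme \<Rightarrow> ('h \<Rightarrow> 'a) \<Rightarrow> ('h \<Rightarrow> 'a) \<Rightarrow> bool" where
  "convolution_inverse H A \<phi> \<psi> \<longleftrightarrow>
     (\<forall>h\<in>carrier H.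
        tensor_lift A (\<lambda>a b. \<phi> a \<otimes>\<^bsub>A\<^esub> \<psi> b) (comult H h) = counit H h \<odot>\<^bsub>A\<^esub> \<one>\<^bsub>A\<^esub> \<and>
        tensor_lift A (\<lambda>a b. \<psi> a \<otimes>\<^bsub>A\<^esub> \<phi> b) (comult H h) = counit H h \<odot>\<^bsub>A\<^esub> \<one>\<^bsub>A\<^esub>)"

definition hopf_algebra :: "('k::comm_ring_1, 'h) hopf \<Rightarrow> bool" where
  "hopf_algebra H \<longleftrightarrow>
     k_algebra H \<and>
     algebra_hom H (tensor H H) (comult H) \<and>
     algebra_hom H base_ring (counit H) \<and>
     (\<forall>h\<in>carrier H.
        tensor_assoc H H H (tensor_map (tensor H H) H (comult H) id (comult H h))
          = tensor_map H (tensor H H) id (comult H) (comult H h) \<and>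
        tensor_lift H (\<lambda>a b. counit H a \<odot>\<^bsub>H\<^esub> b) (comult H h) = h \<and>
        tensor_lift H (\<lambda>a b. counit H b \<odot>\<^bsub>H\<^esub> a) (comult H h) = h) \<and>
     (\<exists>S. k_linear H H S \<and> convolution_inverse H H id S)"

definition left_comodule_algebra ::
  "('k::comm_ring_1, 'h) hopf \<Rightarrow> ('k, 'a, 'm) module_scheme \<Rightarrow>
     ('a \<Rightarrow> ('h \<times> 'a \<Rightarrow>\<^sub>0 'k) set) \<Rightarrow> bool" where
  "left_comodule_algebra H A \<rho> \<longleftrightarrow>
     k_algebra A \<and> algebra_hom A (tensor H A) \<rho> \<and>
     (\<forall>a\<in>carrier A.
        tensor_assoc H H A (tensor_map (tensor H H) A (comult H) id (\<rho> a))
          = tensor_map H (tensor H A) id \<rho> (\<rho> a) \<and>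
        tensor_lift A (\<lambda>h b. counit H h \<odot>\<^bsub>A\<^esub> b) (\<rho> a) = a)"

definition right_comodule_algebra ::
  "('k::comm_ring_1, 'h) hopf \<Rightarrow> ('k, 'a, 'm) module_scheme \<Rightarrow>
     ('a \<Rightarrow> ('a \<times> 'h \<Rightarrow>\<^sub>0 'k) set) \<Rightarrow> bool" where
  "right_comodule_algebra H A \<rho> \<longleftrightarrow>
     k_algebra A \<and> algebra_hom A (tensor A H) \<rho> \<and>
     (\<forall>a\<in>carrier A.
        tensor_assoc A H H (tensor_map (tensor A H) H \<rho> id (\<rho> a))
          = tensor_map A (tensor H H) id (comult H) (\<rho> a) \<and>
        tensor_lift A (\<lambda>b h. counit H h \<odot>\<^bsub>A\<^esub> b) (\<rho> a) = a)"

text \<open>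
  That the coinvariants equal $k$ means that \<open>c \<mapsto> c \<cdot> 1\<close> is a bijection from $k$ onto them; over a
  commutative ring this includes the injectivity of \<open>k \<rightarrow> A\<close>.
\<close>

definition left_cleft_object ::
  "('k::comm_ring_1, 'h) hopf \<Rightarrow> ('k, 'a, 'm) module_scheme \<Rightarrow>
     ('a \<Rightarrow> ('h \<times> 'a \<Rightarrow>\<^sub>0 'k) set) \<Rightarrow> bool" where
  "left_cleft_object H A \<rho> \<longleftrightarrow>
     left_comodule_algebra H A \<rho> \<and>
     (\<exists>\<phi> \<psi>. k_linear H A \<phi> \<and> k_linear H A \<psi> \<and> convolution_inverse H A \<phi> \<psi> \<and>
        (\<forall>h\<in>carrier H. \<rho> (\<phi> h) = tensor_map H A id \<phi> (comult H h))) \<and>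
     bij_betw (\<lambda>c. c \<odot>\<^bsub>A\<^esub> \<one>\<^bsub>A\<^esub>) UNIV {a \<in> carrier A. \<rho> a = pure_tensor H A \<one>\<^bsub>H\<^esub> a}"

definition right_cleft_object ::
  "('k::comm_ring_1, 'h) hopf \<Rightarrow> ('k, 'a, 'm) module_scheme \<Rightarrow>
     ('a \<Rightarrow> ('a \<times> 'h \<Rightarrow>\<^sub>0 'k) set) \<Rightarrow> bool" where
  "right_cleft_object H A \<rho> \<longleftrightarrow>
     right_comodule_algebra H A \<rho> \<and>
     (\<exists>\<phi> \<psi>. k_linear H A \<phi> \<and> k_linear H A \<psi> \<and> convolution_inverse H A \<phi> \<psi> \<and>
        (\<forall>h\<in>carrier H. \<rho> (\<phi> h) = tensor_map A H \<phi> id (comult H h))) \<and>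
     bij_betw (\<lambda>c. c \<odot>\<^bsub>A\<^esub> \<one>\<^bsub>A\<^esub>) UNIV {a \<in> carrier A. \<rho> a = pure_tensor A H a \<one>\<^bsub>H\<^esub>}"

definition bicomodule_algebra ::
  "('k::comm_ring_1, 'l) hopf \<Rightarrow> ('k, 'h) hopf \<Rightarrow> ('k, 'a, 'm) module_scheme \<Rightarrow>
     ('a \<Rightarrow> ('l \<times> 'a \<Rightarrow>\<^sub>0 'k) set) \<Rightarrow> ('a \<Rightarrow> ('a \<times> 'h \<Rightarrow>\<^sub>0 'k) set) \<Rightarrow> bool" where
  "bicomodule_algebra L H A \<rho>\<^sub>L \<rho>\<^sub>R \<longleftrightarrow>
     left_comodule_algebra L A \<rho>\<^sub>L \<and> right_comodule_algebra H A \<rho>\<^sub>R \<and>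
     (\<forall>a\<in>carrier A.
        tensor_assoc L A H (tensor_map (tensor L A) H \<rho>\<^sub>L id (\<rho>\<^sub>R a))
          = tensor_map L (tensor A H) id \<rho>\<^sub>R (\<rho>\<^sub>L a))"

definition bicleft_object ::
  "('k::comm_ring_1, 'l) hopf \<Rightarrow> ('k, 'h) hopf \<Rightarrow> ('k, 'a, 'm) module_scheme \<Rightarrow>
     ('a \<Rightarrow> ('l \<times> 'a \<Rightarrow>\<^sub>0 'k) set) \<Rightarrow> ('a \<Rightarrow> ('a \<times> 'h \<Rightarrow>\<^sub>0 'k) set) \<Rightarrow> bool" where
  "bicleft_object L H A \<rho>\<^sub>L \<rho>\<^sub>R \<longleftrightarrow>
     hopf_algebra L \<and> hopf_algebra H \<and> bicomodule_algebra L H A \<rho>\<^sub>L \<rho>\<^sub>R \<and>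
     left_cleft_object L A \<rho>\<^sub>L \<and> right_cleft_object H A \<rho>\<^sub>R"

definition graded_algebra_iso ::
  "('k::comm_ring_1, 'a, 'm) module_scheme \<Rightarrow> (nat \<Rightarrow> 'a set) \<Rightarrow>
     ('k, 'b, 'n) module_scheme \<Rightarrow> (nat \<Rightarrow> 'b set) \<Rightarrow> ('a \<Rightarrow> 'b) \<Rightarrow> bool" where
  "graded_algebra_iso A A_deg B B_deg f \<longleftrightarrow>
     algebra_hom A B f \<and> bij_betw f (carrier A) (carrier B) \<and> (\<forall>n. f ` A_deg n = B_deg n)"

definition graded_hopf_iso ::
  "('k::comm_ring_1, 'a) hopf \<Rightarrow> (nat \<Rightarrow> 'a set) \<Rightarrow>
     ('k, 'b) hopf \<Rightarrow> (nat \<Rightarrow> 'b set) \<Rightarrow> ('a \<Rightarrow> 'b) \<Rightarrow> bool" where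
  "graded_hopf_iso H H_deg K K_deg f \<longleftrightarrow>
     graded_algebra_iso H H_deg K K_deg f \<and>
     (\<forall>h\<in>carrier H. comult K (f h) = tensor_map K K f f (comult H h) \<and> counit K (f h) = counit H h)"


section \<open>Filtrations and associated graded objects\<close>

text \<open>The term below degree \<open>n\<close> of an \<open>\<nat>\<close>-filtration, with zero below degree \<open>0\<close>.\<close>

definition fil_below ::
  "('k::comm_ring_1, 'a, 'm) module_scheme \<Rightarrow> (nat \<Rightarrow> 'a set) \<Rightarrow> nat \<Rightarrow> 'a set" where
  "fil_below A Fil n = (case n of 0 \<Rightarrow> {\<zero>\<^bsub>A\<^esub>} | Suc m \<Rightarrow> Fil m)"

text \<open>
  A bilinear map that is additive on filtration degrees induces one on associated graded modules:
  in degree \<open>n\<close>, the classes of \<open>a\<^sub>i\<close> and \<open>b\<^sub>j\<close> go to the class of \<open>\<Sum>\<^bsub>i + j = n\<^esub> \<beta> a\<^sub>i b\<^sub>j\<close>.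
\<close>

definition gr_bilinear ::
  "('k::comm_ring_1, 'c, 'm) module_scheme \<Rightarrow> (nat \<Rightarrow> 'c set) \<Rightarrow> ('a \<Rightarrow> 'b \<Rightarrow> 'c) \<Rightarrow>
     (nat \<Rightarrow> 'a set) \<Rightarrow> (nat \<Rightarrow> 'b set) \<Rightarrow> nat \<Rightarrow> 'c set" where
  "gr_bilinear C Fil \<beta> y z n =
     \<Union>{fil_below C Fil n +>\<^bsub>C\<^esub> (\<Oplus>\<^bsub>C\<^esub>i\<in>{..n}. \<beta> (a i) (b (n - i)))
        | a b. \<forall>i. a i \<in> y i \<and> b i \<in> z i}"

text \<open>
  \<open>gr A = \<Oplus>\<^sub>n A\<^sub>n / A\<^bsub>n-1\<^esub>\<close>; an element is the finitely supported family of its components, each of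
  which is a coset.
\<close>

definition gr ::
  "('k::comm_ring_1, 'a, 'm) module_scheme \<Rightarrow> (nat \<Rightarrow> 'a set) \<Rightarrow> ('k, nat \<Rightarrow> 'a set) module" where
  "gr A Fil =
     \<lparr>carrier = {y. (\<forall>n. \<exists>a\<in>Fil n. y n = fil_below A Fil n +>\<^bsub>A\<^esub> a) \<and>
                    finite {n. y n \<noteq> fil_below A Fil n}},
      mult = gr_bilinear A Fil (mult A),
      one = (\<lambda>n. if n = 0 then fil_below A Fil 0 +>\<^bsub>A\<^esub> \<one>\<^bsub>A\<^esub> else fil_below A Fil n),
      zero = fil_below A Fil,
      add = (\<lambda>y z n. y n <+>\<^bsub>A\<^esub> z n),
      smult = (\<lambda>c y n. \<Union>a\<in>y n. fil_below A Fil n +>\<^bsub>A\<^esub> (c \<odot>\<^bsub>A\<^esub> a))\<rparr>"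

definition gr_degree ::
  "('k::comm_ring_1, 'a, 'm) module_scheme \<Rightarrow> (nat \<Rightarrow> 'a set) \<Rightarrow> nat \<Rightarrow> (nat \<Rightarrow> 'a set) set" where
  "gr_degree A Fil n = {y \<in> carrier (gr A Fil). \<forall>m. m \<noteq> n \<longrightarrow> y m = fil_below A Fil m}"

definition gr_map ::
  "('k::comm_ring_1, 'b, 'm) module_scheme \<Rightarrow> (nat \<Rightarrow> 'b set) \<Rightarrow> ('a \<Rightarrow> 'b) \<Rightarrow>
     (nat \<Rightarrow> 'a set) \<Rightarrow> nat \<Rightarrow> 'b set" where
  "gr_map B Fil f y n = (\<Union>a\<in>y n. fil_below B Fil n +>\<^bsub>B\<^esub> f a)"

text \<open>\<open>(A \<otimes> B)\<^sub>n\<close> is the sum of the images of the \<open>A\<^sub>i \<otimes> B\<^sub>j\<close>, \<open>i + j = n\<close>.\<close>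

definition tensor_filtration ::
  "('k::comm_ring_1, 'a, 'm) module_scheme \<Rightarrow> (nat \<Rightarrow> 'a set) \<Rightarrow>
     ('k, 'b, 'n) module_scheme \<Rightarrow> (nat \<Rightarrow> 'b set) \<Rightarrow> nat \<Rightarrow> ('a \<times> 'b \<Rightarrow>\<^sub>0 'k) set set" where
  "tensor_filtration A FilA B FilB n =
     {tensor_kernel A B +>\<^bsub>free_on_pairs A B\<^esub> f
        | f. keys f \<subseteq> (\<Union>i\<le>n. FilA i \<times> FilB (n - i))}"

text \<open>The canonical map \<open>gr A \<otimes> gr B \<rightarrow> gr (A \<otimes> B)\<close>.\<close>

definition gr_tensor ::
  "('k::comm_ring_1, 'a, 'm) module_scheme \<Rightarrow> (nat \<Rightarrow> 'a set) \<Rightarrow>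
     ('k, 'b, 'n) module_scheme \<Rightarrow> (nat \<Rightarrow> 'b set) \<Rightarrow>
     ((nat \<Rightarrow> 'a set) \<times> (nat \<Rightarrow> 'b set) \<Rightarrow>\<^sub>0 'k) set \<Rightarrow> nat \<Rightarrow> ('a \<times> 'b \<Rightarrow>\<^sub>0 'k) set set" where
  "gr_tensor A FilA B FilB =
     tensor_lift (gr (tensor A B) (tensor_filtration A FilA B FilB))
       (gr_bilinear (tensor A B) (tensor_filtration A FilA B FilB) (pure_tensor A B))"

text \<open>
  The map \<open>gr X \<rightarrow> gr A \<otimes> gr B\<close> that a filtered map \<open>\<delta> : X \<rightarrow> A \<otimes> B\<close> induces when
  \<open>gr A \<otimes> gr B\<close> is identified with \<open>gr (A \<otimes> B)\<close>.
\<close>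

definition gr_comap ::
  "('k::comm_ring_1, 'a, 'm) module_scheme \<Rightarrow> (nat \<Rightarrow> 'a set) \<Rightarrow>
     ('k, 'b, 'n) module_scheme \<Rightarrow> (nat \<Rightarrow> 'b set) \<Rightarrow> ('x \<Rightarrow> ('a \<times> 'b \<Rightarrow>\<^sub>0 'k) set) \<Rightarrow>
     (nat \<Rightarrow> 'x set) \<Rightarrow> ((nat \<Rightarrow> 'a set) \<times> (nat \<Rightarrow> 'b set) \<Rightarrow>\<^sub>0 'k) set" where
  "gr_comap A FilA B FilB \<delta> y =
     inv_into (carrier (tensor (gr A FilA) (gr B FilB))) (gr_tensor A FilA B FilB)
       (gr_map (tensor A B) (tensor_filtration A FilA B FilB) \<delta> y)"

text \<open>
  \<open>gr k = k\<close> is concentrated in degree \<open>0\<close>, so the induced counit is read off the degree \<open>0\<close>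
  component.
\<close>

definition gr_hopf :: "('k::comm_ring_1, 'h) hopf \<Rightarrow> (nat \<Rightarrow> 'h set) \<Rightarrow> ('k, nat \<Rightarrow> 'h set) hopf" where
  "gr_hopf H Fil =
     module.extend (gr H Fil)
       (hopf.fields (gr_comap H Fil H Fil (comult H)) (\<lambda>y. on_cosets (counit H) (y 0)))"


section \<open>Braid groups\<close>

text \<open>
  \<open>(s, True)\<close> and \<open>(s, False)\<close> stand for the Artin generator which crosses the strands \<open>s\<close> and
  \<open>s + 1\<close> (counted from \<open>0\<close>) and for its inverse; \<open>B\<^sub>l\<close> is the set of words in these, modulo
  the defining relations.
\<close>

definition braid_words :: "nat \<Rightarrow> (nat \<times> bool) list set" where
  "braid_words l = {\<beta>. \<forall>(s, e)\<in>set \<beta>. s + 1 < l}"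

inductive braid_equiv :: "nat \<Rightarrow> (nat \<times> bool) list \<Rightarrow> (nat \<times> bool) list \<Rightarrow> bool" for l where
  refl: "\<beta> \<in> braid_words l \<Longrightarrow> braid_equiv l \<beta> \<beta>"
| sym: "braid_equiv l \<beta> \<gamma> \<Longrightarrow> braid_equiv l \<gamma> \<beta>"
| trans: "braid_equiv l \<alpha> \<beta> \<Longrightarrow> braid_equiv l \<beta> \<gamma> \<Longrightarrow> braid_equiv l \<alpha> \<gamma>"
| mult: "braid_equiv l \<alpha> \<beta> \<Longrightarrow> braid_equiv l \<gamma> \<delta> \<Longrightarrow> braid_equiv l (\<alpha> @ \<gamma>) (\<beta> @ \<delta>)"
| inverse: "s + 1 < l \<Longrightarrow> braid_equiv l [(s, e), (s, \<not> e)] []"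
| far: "s + 2 \<le> t \<Longrightarrow> t + 1 < l \<Longrightarrow>
    braid_equiv l [(s, True), (t, True)] [(t, True), (s, True)]"
| near: "s + 2 < l \<Longrightarrow>
    braid_equiv l [(s, True), (s + 1, True), (s, True)] [(s + 1, True), (s, True), (s + 1, True)]"

definition braid_group :: "nat \<Rightarrow> (nat \<times> bool) list set set" where
  "braid_group l = braid_words l // {(\<beta>, \<gamma>). braid_equiv l \<beta> \<gamma>}"


section \<open>The tensor algebra and its bosonization\<close>

text \<open>
  \<open>\<Gamma>\<close> is a type of class \<open>ab_group_add\<close>, hence written additively; \<open>I\<close> is a finite type \<open>'i\<close>; words
  over \<open>'i\<close> form the basis of $TV$. The partition of \<open>I\<close> is given by the map
  \<open>blk :: 'i \<Rightarrow> nat\<close>, \<open>i \<mapsto> |i|\<close>.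
\<close>

definition character :: "('g::ab_group_add \<Rightarrow> 'k::comm_ring_1) \<Rightarrow> bool" where
  "character \<eta> \<longleftrightarrow> (\<forall>a. \<eta> a dvd 1) \<and> (\<forall>a b. \<eta> (a + b) = \<eta> a * \<eta> b)"

definition word_degree :: "('i \<Rightarrow> 'g::ab_group_add) \<Rightarrow> 'i list \<Rightarrow> 'g" where
  "word_degree g w = sum_list (map g w)"

definition word_char :: "('i \<Rightarrow> 'g \<Rightarrow> 'k::comm_ring_1) \<Rightarrow> 'i list \<Rightarrow> 'g \<Rightarrow> 'k" where
  "word_char \<chi> w a = prod_list (map (\<lambda>i. \<chi> i a) w)"

definition tensor_algebra :: "('k::comm_ring_1, 'i list \<Rightarrow>\<^sub>0 'k) module" where
  "tensor_algebra = twisted_algebra UNIV (@) [] (\<lambda>_ _. 1)"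

text \<open>
  The generator \<open>(s, True)\<close> acts by \<open>c\<close> on the factors \<open>s\<close>, \<open>s + 1\<close>, and \<open>(s, False)\<close> by \<open>c\<^sup>-\<^sup>1\<close>, i.e.
  \<open>x\<^sub>i \<otimes> x\<^sub>j \<mapsto> q\<^sub>j\<^sub>i\<^sup>-\<^sup>1 x\<^sub>j \<otimes> x\<^sub>i\<close>, where the inverse of \<open>q\<^sub>j\<^sub>i = \<chi>\<^sub>i(g\<^sub>j)\<close> is \<open>\<chi>\<^sub>i(- g\<^sub>j)\<close>.
\<close>

definition braid_generator_act ::
  "('i \<Rightarrow> 'g::ab_group_add) \<Rightarrow> ('i \<Rightarrow> 'g \<Rightarrow> 'k::comm_ring_1) \<Rightarrow> nat \<times> bool \<Rightarrow>
     ('i list \<Rightarrow>\<^sub>0 'k) \<Rightarrow> 'i list \<Rightarrow>\<^sub>0 'k" where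
  "braid_generator_act g \<chi> = (\<lambda>(s, e). linear_extension tensor_algebra
     (\<lambda>w. let i = w ! s; j = w ! Suc s in
        single (w[s := j, Suc s := i])
          (if e then \<chi> j (g i) else \<chi> i (- g j))))"

text \<open>The action of \<open>\<xi> \<in> k B\<^sub>l\<close> on \<open>x\<^bsub>i\<^sub>1\<^esub> \<otimes> \<dots> \<otimes> x\<^bsub>i\<^sub>l\<^esub>\<close>, given as the word \<open>w = [i\<^sub>1, \<dots>, i\<^sub>l]\<close>.\<close>

definition braid_algebra_act ::
  "('i \<Rightarrow> 'g::ab_group_add) \<Rightarrow> ('i \<Rightarrow> 'g \<Rightarrow> 'k::comm_ring_1) \<Rightarrow>
     ((nat \<times> bool) list set \<Rightarrow>\<^sub>0 'k) \<Rightarrow> 'i list \<Rightarrow> 'i list \<Rightarrow>\<^sub>0 'k" where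
  "braid_algebra_act g \<chi> \<xi> w =
     linear_extension tensor_algebra
       (on_cosets (\<lambda>\<beta>. foldr (braid_generator_act g \<chi>) \<beta> (single w 1))) \<xi>"

text \<open>
  The braided tensor product algebra \<open>TV \<otimes> TV\<close>, on the basis of pairs of words:
  \<open>(u \<otimes> v)(u' \<otimes> v') = u c(v \<otimes> u') v'\<close>.
\<close>

definition braided_square ::
  "('i \<Rightarrow> 'g::ab_group_add) \<Rightarrow> ('i \<Rightarrow> 'g \<Rightarrow> 'k::comm_ring_1) \<Rightarrow>
     ('k, 'i list \<times> 'i list \<Rightarrow>\<^sub>0 'k) module" where
  "braided_square g \<chi> =
     twisted_algebra UNIV (\<lambda>(u, v) (u', v'). (u @ u', v @ v')) ([], [])
       (\<lambda>(u, v) (u', v'). word_char \<chi> u' (word_degree g v))"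

definition braided_comult ::
  "('i \<Rightarrow> 'g::ab_group_add) \<Rightarrow> ('i \<Rightarrow> 'g \<Rightarrow> 'k::comm_ring_1) \<Rightarrow>
     ('i list \<Rightarrow>\<^sub>0 'k) \<Rightarrow> 'i list \<times> 'i list \<Rightarrow>\<^sub>0 'k" where
  "braided_comult g \<chi> = linear_extension (braided_square g \<chi>)
     (\<lambda>w. foldr (\<lambda>i t. (single ([i], []) 1 + single ([], [i]) 1)
                        \<otimes>\<^bsub>braided_square g \<chi>\<^esub> t) w \<one>\<^bsub>braided_square g \<chi>\<^esub>)"

definition primitive_modulo ::
  "('i \<Rightarrow> 'g::ab_group_add) \<Rightarrow> ('i \<Rightarrow> 'g \<Rightarrow> 'k::comm_ring_1) \<Rightarrow>
     ('i list \<Rightarrow>\<^sub>0 'k) set \<Rightarrow> ('i list \<Rightarrow>\<^sub>0 'k) \<Rightarrow> bool" where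
  "primitive_modulo g \<chi> J r \<longleftrightarrow>
     (let Q = quotient_algebra tensor_algebra J; \<pi> = (\<lambda>f. J +>\<^bsub>tensor_algebra\<^esub> f)
      in linear_extension (tensor Q Q)
           (\<lambda>(u, v). pure_tensor Q Q (\<pi> (single u 1)) (\<pi> (single v 1)))
           (braided_comult g \<chi> r)
         = pure_tensor Q Q (\<pi> r) \<one>\<^bsub>Q\<^esub> \<oplus>\<^bsub>tensor Q Q\<^esub> pure_tensor Q Q \<one>\<^bsub>Q\<^esub> (\<pi> r))"

text \<open>\<open>F = TV \<rtimes> \<Gamma>\<close>; the basis element \<open>(w, a)\<close> is \<open>w \<otimes> a\<close>.\<close>

definition bosonization ::
  "('i \<Rightarrow> 'g::ab_group_add \<Rightarrow> 'k::comm_ring_1) \<Rightarrow> ('k, 'i list \<times> 'g \<Rightarrow>\<^sub>0 'k) module" where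
  "bosonization \<chi> =
     twisted_algebra UNIV (\<lambda>(u, a) (v, b). (u @ v, a + b)) ([], 0) (\<lambda>(u, a) (v, b). word_char \<chi> v a)"

definition var :: "'i \<Rightarrow> 'i list \<times> 'g::ab_group_add \<Rightarrow>\<^sub>0 'k::comm_ring_1" where
  "var i = single ([i], 0) 1"

definition grouplike :: "'g \<Rightarrow> 'i list \<times> 'g::ab_group_add \<Rightarrow>\<^sub>0 'k::comm_ring_1" where
  "grouplike a = single ([], a) 1"

definition TV_incl ::
  "('i list \<Rightarrow>\<^sub>0 'k::comm_ring_1) \<Rightarrow> 'i list \<times> 'g::ab_group_add \<Rightarrow>\<^sub>0 'k" where
  "TV_incl f = (\<Sum>w\<in>keys f. single (w, 0) (lookup f w))"

definition F_comult ::
  "('i \<Rightarrow> 'g::ab_group_add) \<Rightarrow> ('i \<Rightarrow> 'g \<Rightarrow> 'k::comm_ring_1) \<Rightarrow>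
     ('i list \<times> 'g \<Rightarrow>\<^sub>0 'k) \<Rightarrow>
     (('i list \<times> 'g \<Rightarrow>\<^sub>0 'k) \<times> ('i list \<times> 'g \<Rightarrow>\<^sub>0 'k) \<Rightarrow>\<^sub>0 'k) set" where
  "F_comult g \<chi> =
     (let F = bosonization \<chi>; FF = tensor F F in
      linear_extension FF
        (\<lambda>(w, a). foldr (\<lambda>i t. (pure_tensor F F (var i) \<one>\<^bsub>F\<^esub>
                                 \<oplus>\<^bsub>FF\<^esub> pure_tensor F F (grouplike (g i)) (var i)) \<otimes>\<^bsub>FF\<^esub> t)
                    w (pure_tensor F F (grouplike a) (grouplike a))))"

definition F_counit :: "('i list \<times> 'g \<Rightarrow>\<^sub>0 'k::comm_ring_1) \<Rightarrow> 'k" where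
  "F_counit f = (\<Sum>p\<in>{p \<in> keys f. fst p = []}. lookup f p)"

definition F_degree :: "nat \<Rightarrow> ('i list \<times> 'g \<Rightarrow>\<^sub>0 'k::comm_ring_1) set" where
  "F_degree n = {f. \<forall>p\<in>keys f. length (fst p) = n}"

definition F_filtration :: "nat \<Rightarrow> ('i list \<times> 'g \<Rightarrow>\<^sub>0 'k::comm_ring_1) set" where
  "F_filtration n = {f. \<forall>p\<in>keys f. length (fst p) \<le> n}"

definition F_component ::
  "nat \<Rightarrow> ('i list \<times> 'g \<Rightarrow>\<^sub>0 'k::comm_ring_1) \<Rightarrow> 'i list \<times> 'g \<Rightarrow>\<^sub>0 'k" where
  "F_component n f = (\<Sum>p\<in>{p \<in> keys f. length (fst p) = n}. single p (lookup f p))"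


section \<open>The quotients of the bosonization\<close>

definition Theta :: "('i \<Rightarrow> nat) \<Rightarrow> ('i \<times> 'i) set" where
  "Theta blk = {(i, j). blk i > blk j}"

definition Xi :: "('i \<Rightarrow> 'g \<Rightarrow> 'k::comm_ring_1) \<Rightarrow> ('i \<Rightarrow> nat) \<Rightarrow> ('i \<times> 'i) set" where
  "Xi \<chi> blk = {(i, j) \<in> Theta blk. \<forall>a. \<chi> i a * \<chi> j a = 1}"

text \<open>
  An element of \<open>k\<^sup>\<Xi>\<close> is given by a function on all pairs of which only the values on
  \<open>\<Xi>\<close> are used.
\<close>

definition extend_by_zero ::
  "('i \<Rightarrow> 'g \<Rightarrow> 'k::comm_ring_1) \<Rightarrow> ('i \<Rightarrow> nat) \<Rightarrow> ('i \<times> 'i \<Rightarrow> 'k) \<Rightarrow> 'i \<times> 'i \<Rightarrow> 'k" where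
  "extend_by_zero \<chi> blk lam p = (if p \<in> Xi \<chi> blk then lam p else 0)"

definition braided_commutator ::
  "('i \<Rightarrow> 'g::ab_group_add) \<Rightarrow> ('i \<Rightarrow> 'g \<Rightarrow> 'k::comm_ring_1) \<Rightarrow> 'i \<Rightarrow> 'i \<Rightarrow> 'i list \<Rightarrow>\<^sub>0 'k" where
  "braided_commutator g \<chi> i j =
     single [i, j] 1 - single [j, i] (\<chi> j (g i))"

text \<open>The ideal of \<open>F\<close> generated by \<open>\<R>\<close> and the \<open>(ad\<^sub>c x\<^sub>i)(x\<^sub>j) - r (i, j)\<close>, \<open>(i, j) \<in> \<Theta>\<close>.\<close>

definition defining_ideal ::
  "('i \<Rightarrow> 'g::ab_group_add) \<Rightarrow> ('i \<Rightarrow> 'g \<Rightarrow> 'k::comm_ring_1) \<Rightarrow> ('i \<Rightarrow> nat) \<Rightarrow>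
     ('i list \<Rightarrow>\<^sub>0 'k) set \<Rightarrow> ('i \<times> 'i \<Rightarrow> 'i list \<times> 'g \<Rightarrow>\<^sub>0 'k) \<Rightarrow> ('i list \<times> 'g \<Rightarrow>\<^sub>0 'k) set" where
  "defining_ideal g \<chi> blk R r =
     Idl\<^bsub>bosonization \<chi>\<^esub>
       (TV_incl ` R \<union>
        {TV_incl (braided_commutator g \<chi> i j) - r (i, j) | i j. (i, j) \<in> Theta blk})"

definition H0_ideal where
  "H0_ideal g \<chi> blk R = defining_ideal g \<chi> blk R (\<lambda>_. 0)"

definition H_ideal where
  "H_ideal g \<chi> blk R lam = defining_ideal g \<chi> blk R
     (\<lambda>(i, j). extend_by_zero \<chi> blk lam (i, j) \<odot>\<^bsub>bosonization \<chi>\<^esub>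
        (grouplike (g i + g j) - \<one>\<^bsub>bosonization \<chi>\<^esub>))"

definition A_ideal where
  "A_ideal g \<chi> blk R lam = defining_ideal g \<chi> blk R
     (\<lambda>(i, j). extend_by_zero \<chi> blk lam (i, j) \<odot>\<^bsub>bosonization \<chi>\<^esub> grouplike (g i + g j))"

definition F_proj where
  "F_proj \<chi> J f = J +>\<^bsub>bosonization \<chi>\<^esub> f"

definition F_quotient where
  "F_quotient \<chi> J = quotient_algebra (bosonization \<chi>) J"

definition quotient_filtration where
  "quotient_filtration \<chi> J n = F_proj \<chi> J ` F_filtration n"

text \<open>The map \<open>F/I \<rightarrow> F/J \<otimes> F/K\<close> induced by the coproduct of \<open>F\<close>, on cosets of \<open>I\<close>.\<close>

definition induced_comult where
  "induced_comult g \<chi> J K =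
     on_cosets (\<lambda>f. tensor_map (F_quotient \<chi> J) (F_quotient \<chi> K) (F_proj \<chi> J) (F_proj \<chi> K)
                      (F_comult g \<chi> f))"

definition F_quotient_hopf ::
  "('i \<Rightarrow> 'g::ab_group_add) \<Rightarrow> ('i \<Rightarrow> 'g \<Rightarrow> 'k::comm_ring_1) \<Rightarrow>
     ('i list \<times> 'g \<Rightarrow>\<^sub>0 'k) set \<Rightarrow> ('k, ('i list \<times> 'g \<Rightarrow>\<^sub>0 'k) set) hopf" where
  "F_quotient_hopf g \<chi> J =
     module.extend (F_quotient \<chi> J) (hopf.fields (induced_comult g \<chi> J J) (on_cosets F_counit))"

definition H0 where
  "H0 g \<chi> blk R = F_quotient_hopf g \<chi> (H0_ideal g \<chi> blk R)"

definition H_lam where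
  "H_lam g \<chi> blk R lam = F_quotient_hopf g \<chi> (H_ideal g \<chi> blk R lam)"

definition A_lam where
  "A_lam g \<chi> blk R lam = F_quotient \<chi> (A_ideal g \<chi> blk R lam)"

definition A_left_coaction where
  "A_left_coaction g \<chi> blk R lam = induced_comult g \<chi> (H0_ideal g \<chi> blk R) (A_ideal g \<chi> blk R lam)"

definition A_right_coaction where
  "A_right_coaction g \<chi> blk R lam =
     induced_comult g \<chi> (A_ideal g \<chi> blk R lam) (H_ideal g \<chi> blk R lam)"

definition H0_degree where
  "H0_degree g \<chi> blk R n = F_proj \<chi> (H0_ideal g \<chi> blk R) ` F_degree n"

definition H0_filtration where
  "H0_filtration g \<chi> blk R = quotient_filtration \<chi> (H0_ideal g \<chi> blk R)"

definition H_filtration where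
  "H_filtration g \<chi> blk R lam = quotient_filtration \<chi> (H_ideal g \<chi> blk R lam)"

definition A_filtration where
  "A_filtration g \<chi> blk R lam = quotient_filtration \<chi> (A_ideal g \<chi> blk R lam)"

definition gr_H where
  "gr_H g \<chi> blk R lam = gr_hopf (H_lam g \<chi> blk R lam) (H_filtration g \<chi> blk R lam)"

definition gr_A where
  "gr_A g \<chi> blk R lam = gr (A_lam g \<chi> blk R lam) (A_filtration g \<chi> blk R lam)"

text \<open>
  The epimorphism \<open>F \<rightarrow> gr (F/J)\<close>, and the map \<open>H\<^sup>0 \<rightarrow> gr (F/J)\<close> through which it factors.
\<close>

definition symbol_map where
  "symbol_map \<chi> J f =
     (\<lambda>n. fil_below (F_quotient \<chi> J) (quotient_filtration \<chi> J) n
            +>\<^bsub>F_quotient \<chi> J\<^esub> F_proj \<chi> J (F_component n f))"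

definition H0_to_gr where
  "H0_to_gr \<chi> J = on_cosets (symbol_map \<chi> J)"

text \<open>
  The coactions on \<open>gr A(\<lambda>)\<close> are induced from those on \<open>A(\<lambda>)\<close>. For the left one, the graded Hopf
  algebra \<open>H\<^sup>0\<close> is identified with its associated graded by \<open>H0_to_gr\<close> for the ideal of \<open>H\<^sup>0\<close>.
\<close>

definition gr_A_left_coaction where
  "gr_A_left_coaction g \<chi> blk R lam y =
     (let Hz = H0 g \<chi> blk R; Hz_fil = H0_filtration g \<chi> blk R;
          B = A_lam g \<chi> blk R lam; B_fil = A_filtration g \<chi> blk R lam
      in inv_into (carrier (tensor Hz (gr B B_fil)))
           (gr_tensor Hz Hz_fil B B_fil \<circ>
            tensor_map (gr Hz Hz_fil) (gr B B_fil) (H0_to_gr \<chi> (H0_ideal g \<chi> blk R)) id)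
           (gr_map (tensor Hz B) (tensor_filtration Hz Hz_fil B B_fil)
              (A_left_coaction g \<chi> blk R lam) y))"

definition gr_A_right_coaction where
  "gr_A_right_coaction g \<chi> blk R lam =
     gr_comap (A_lam g \<chi> blk R lam) (A_filtration g \<chi> blk R lam)
       (H_lam g \<chi> blk R lam) (H_filtration g \<chi> blk R lam) (A_right_coaction g \<chi> blk R lam)"

text \<open>The elements \<open>\<xi>(x\<^bsub>i\<^sub>1\<^esub> \<otimes> \<dots> \<otimes> x\<^bsub>i\<^sub>l\<^esub>)\<close> with \<open>\<xi> \<in> k B\<^sub>l\<close>, \<open>l \<ge> 2\<close> and \<open>|i\<^sub>1| = \<dots> = |i\<^sub>l|\<close>.\<close>

definition braid_relators ::
  "('i \<Rightarrow> 'g::ab_group_add) \<Rightarrow> ('i \<Rightarrow> 'g \<Rightarrow> 'k::comm_ring_1) \<Rightarrow> ('i \<Rightarrow> nat) \<Rightarrow>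
     ('i list \<Rightarrow>\<^sub>0 'k) set" where
  "braid_relators g \<chi> blk =
     {braid_algebra_act g \<chi> \<xi> w | \<xi> w.
        length w \<ge> 2 \<and> keys \<xi> \<subseteq> braid_group (length w) \<and>
        (\<forall>i\<in>set w. \<forall>j\<in>set w. blk i = blk j)}"

end

theory Submission
  imports Defs "HOL-Library.Multiset"
begin

text \<open>
  Let \<open>I m n\<close> be the ideal of \<open>F\<close> generated by \<open>R\<close> and the \<open>ad i j - (m i j g\<^sub>i g\<^sub>j + n i j)\<close>; the
  ideals of \<open>H\<^sup>0\<close>, \<open>A(\<lambda>)\<close> and \<open>H\<^sup>\<lambda>\<close> are \<open>I 0 0\<close>, \<open>I \<lambda> 0\<close> and \<open>I \<lambda> (-\<lambda>)\<close>. The point is that the leading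
  forms of elements of \<open>I m n\<close> lie in \<open>I 0 0\<close>. To see this, \<open>x\<^sub>i\<close> is made to act on \<open>F\<close> by
  \<open>X\<^sub>i = x\<^sub>i + M\<^sub>i + N\<^sub>i\<close> with skew derivations \<open>M\<^sub>i : x\<^sub>k \<mapsto> m i k g\<^sub>i g\<^sub>k\<close> and \<open>N\<^sub>i : x\<^sub>k \<mapsto> n i k\<close> of degree \<open>-1\<close>.
  These preserve \<open>I 0 0\<close>, and modulo \<open>I 0 0\<close> the \<open>X\<^sub>i\<close> satisfy the relations of \<open>I m n\<close>: for the
  linking relations this is a computation of commutators, and for a relation \<open>r \<in> R\<close> the primitivity
  of \<open>r\<close> modulo earlier relations gives \<open>r(X) = r(x) + r(M) + r(N)\<close>, where \<open>r(M) = r(N) = 0\<close> by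
  induction along the chain. Applying the operators to \<open>1\<close> yields a linear map \<open>Phi\<close> that is
  unitriangular for the filtration and sends \<open>I m n\<close> into \<open>I 0 0\<close>.

  Hence the symbol maps \<open>F \<rightarrow> gr (F / I m n)\<close> all have kernel \<open>I 0 0\<close>, and the components of \<open>Phi\<close>
  show that \<open>gr A \<otimes> gr B \<rightarrow> gr (A \<otimes> B)\<close> is injective on these quotients. So all structure maps are
  induced from the coproduct of \<open>F\<close>, and cleftness follows from the antipode of \<open>F\<close>.
\<close>

section \<open>Modules and algebras\<close>

text \<open>No basis of \<open>F / I m n\<close> is at hand: \<open>k\<close> is an arbitrary
  commutative ring and nothing makes the relations confluent, so neither rewriting nor dimensions
  nor flatness can compare the quotients. An action on the known quotient \<open>H^0\<close> takes
  their place. The operators are split into \<open>x_i\<close>, \<open>M_i\<close>,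
  \<open>N_i\<close> because, within a block, two summands have to q-commute with the same factors
  as the two legs of the braided coproduct. A word evaluated at their sum is then its braided
  coproduct evaluated at the pair, and primitivity of a relator becomes additivity. This fixes the
  twists of \<open>M_i\<close> and \<open>N_i\<close>, which agree on letters of other blocks and
  differ on letters of the own block. A skew derivation \<open>x_k \<mapsto> c_k \<gamma>_k\<close>
  with values in \<open>k\<Gamma>\<close> respects \<open>a x_k = \<chi>_k(a) x_k a\<close> if its
  group twist is \<open>\<chi>_k\<close> wherever \<open>c_k \<noteq> 0\<close>. The group twist of
  index \<open>i\<close> is the inverse of \<open>\<chi>_i\<close>; this is the role of the
  condition \<open>\<chi>_i \<chi>_k = 1\<close> on \<open>\<Xi>\<close>. Without flatness,
  injectivity does not pass to tensor products, but linear maps do. This is why components of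
  \<open>Phi\<close>, defined on all of \<open>F / I m n\<close>, are used for the
  coactions.\<close>

locale kmod = abelian_group M for M :: "('k::comm_ring_1, 'a, 'm) module_scheme" (structure) +
  assumes smult_closed [simp, intro]: "x \<in> carrier M \<Longrightarrow> c \<odot> x \<in> carrier M"
    and smult_l_distr: "x \<in> carrier M \<Longrightarrow> (c + d) \<odot> x = c \<odot> x \<oplus> d \<odot> x"
    and smult_r_distr: "x \<in> carrier M \<Longrightarrow> y \<in> carrier M \<Longrightarrow> c \<odot> (x \<oplus> y) = c \<odot> x \<oplus> c \<odot> y"
    and smult_smult: "x \<in> carrier M \<Longrightarrow> c \<odot> (d \<odot> x) = (c * d) \<odot> x"
    and smult_one [simp]: "x \<in> carrier M \<Longrightarrow> 1 \<odot> x = x"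

lemma base_ring_simps [simp]:
  "carrier base_ring = UNIV" "monoid.mult base_ring = (*)" "one base_ring = 1" "zero base_ring = 0"
  "add base_ring = (+)" "smult base_ring = (*)"
  by (auto simp: base_ring_def)

lemma cring_base_ring: "cring (base_ring :: ('k::comm_ring_1, 'k) module)"
proof (rule cringI)
  show "abelian_group (base_ring :: ('k, 'k) module)"
    by (rule abelian_groupI) (auto simp: algebra_simps intro: exI[of _ "- _"])
  show "comm_monoid (base_ring :: ('k, 'k) module)"
    by (rule comm_monoidI) (auto simp: algebra_simps)
qed (auto simp: algebra_simps)

text \<open>The base ring is a type, so its ring axioms are discharged once; afterwards a module is
  a single structure with scalars of type \<open>'k\<close>.\<close>

lemma module_iff_kmod: "Module.module base_ring M \<longleftrightarrow> kmod M"
proof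
  assume "Module.module base_ring M"
  then interpret Module.module base_ring M .
  show "kmod M"
    using smult_closed smult_l_distr smult_r_distr smult_assoc1 smult_one
    by unfold_locales auto
next
  assume "kmod M"
  then interpret kmod M .
  show "Module.module base_ring M"
    by (rule moduleI[OF cring_base_ring abelian_group_axioms])
      (auto simp: smult_l_distr smult_r_distr smult_smult)
qed

context kmod
begin

lemma smult_zero_left [simp]: "x \<in> carrier M \<Longrightarrow> 0 \<odot> x = \<zero>"
  using smult_l_distr[of x 0 0] by (simp add: add.r_cancel_one')

lemma smult_zero_right [simp]: "c \<odot> \<zero> = \<zero>"
  using smult_r_distr[of \<zero> \<zero> c] by (simp add: add.r_cancel_one')

lemma minus_eq_smult: "x \<in> carrier M \<Longrightarrow> \<ominus> x = (-1) \<odot> x"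
  using smult_l_distr[of x "-1" 1] by (simp add: minus_equality)

lemma a_inv_zero [simp]: "\<ominus> \<zero> = \<zero>"
  by (rule minus_equality) auto

lemma smult_uminus: "x \<in> carrier M \<Longrightarrow> (- c) \<odot> x = \<ominus> (c \<odot> x)"
  by (simp add: minus_eq_smult smult_smult)

lemma smult_a_inv: "x \<in> carrier M \<Longrightarrow> c \<odot> (\<ominus> x) = \<ominus> (c \<odot> x)"
  by (simp add: minus_eq_smult smult_smult)

lemma smult_finsum: "f \<in> A \<rightarrow> carrier M \<Longrightarrow> c \<odot> (\<Oplus>i\<in>A. f i) = (\<Oplus>i\<in>A. c \<odot> f i)"
  by (induction A rule: infinite_finite_induct) (auto simp: smult_r_distr Pi_def)

lemma eq_iff_minus: "x \<in> carrier M \<Longrightarrow> y \<in> carrier M \<Longrightarrow> x = y \<longleftrightarrow> x \<oplus> \<ominus> y = \<zero>"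
  using minus_equality[of x "\<ominus> y"] by (auto simp: r_neg)

end

locale kalg = ring A + kmod A for A :: "('k::comm_ring_1, 'a, 'm) module_scheme" (structure) +
  assumes smult_mult_left: "x \<in> carrier A \<Longrightarrow> y \<in> carrier A \<Longrightarrow> (c \<odot> x) \<otimes> y = c \<odot> (x \<otimes> y)"
    and smult_mult_right: "x \<in> carrier A \<Longrightarrow> y \<in> carrier A \<Longrightarrow> x \<otimes> (c \<odot> y) = c \<odot> (x \<otimes> y)"

lemma k_algebra_iff_kalg: "k_algebra A \<longleftrightarrow> kalg A"
  unfolding k_algebra_def module_iff_kmod kalg_def kalg_axioms_def by blast

lemma kalg_kmod: "kalg A \<Longrightarrow> kmod A"
  by (rule kalg.axioms(2))

lemma kmod_base_ring: "kmod (base_ring :: ('k::comm_ring_1, 'k) module)"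
  unfolding module_iff_kmod[symmetric]
  by (rule moduleI[OF cring_base_ring ring.axioms(1)[OF cring.axioms(1)[OF cring_base_ring]]])
    (auto simp: algebra_simps)

lemma kalg_base_ring: "kalg (base_ring :: ('k::comm_ring_1, 'k) module)"
  using kmod_base_ring cring.axioms(1)[OF cring_base_ring]
  by (auto simp: kalg_def kalg_axioms_def algebra_simps)


lemma k_linearI:
  "(\<And>x. x \<in> carrier M \<Longrightarrow> f x \<in> carrier N) \<Longrightarrow>
   (\<And>x y. x \<in> carrier M \<Longrightarrow> y \<in> carrier M \<Longrightarrow> f (x \<oplus>\<^bsub>M\<^esub> y) = f x \<oplus>\<^bsub>N\<^esub> f y) \<Longrightarrow>
   (\<And>c x. x \<in> carrier M \<Longrightarrow> f (c \<odot>\<^bsub>M\<^esub> x) = c \<odot>\<^bsub>N\<^esub> f x) \<Longrightarrow> k_linear M N f"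
  by (auto simp: k_linear_def)

lemma k_linear_closed: "k_linear M N f \<Longrightarrow> x \<in> carrier M \<Longrightarrow> f x \<in> carrier N"
  and k_linear_add:
    "k_linear M N f \<Longrightarrow> x \<in> carrier M \<Longrightarrow> y \<in> carrier M \<Longrightarrow> f (x \<oplus>\<^bsub>M\<^esub> y) = f x \<oplus>\<^bsub>N\<^esub> f y"
  and k_linear_smult: "k_linear M N f \<Longrightarrow> x \<in> carrier M \<Longrightarrow> f (c \<odot>\<^bsub>M\<^esub> x) = c \<odot>\<^bsub>N\<^esub> f x"
  by (auto simp: k_linear_def)

lemma k_linear_zero:
  assumes "kmod M" "kmod N" "k_linear M N f" shows "f \<zero>\<^bsub>M\<^esub> = \<zero>\<^bsub>N\<^esub>"
proof -
  interpret M: kmod M by fact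
  interpret N: kmod N by fact
  have "f (0 \<odot>\<^bsub>M\<^esub> \<zero>\<^bsub>M\<^esub>) = 0 \<odot>\<^bsub>N\<^esub> f \<zero>\<^bsub>M\<^esub>"
    by (rule k_linear_smult[OF assms(3)]) simp
  thus ?thesis using k_linear_closed[OF assms(3), of "\<zero>\<^bsub>M\<^esub>"] by simp
qed

lemma k_linear_minus:
  assumes "kmod M" "kmod N" "k_linear M N f" "x \<in> carrier M" shows "f (\<ominus>\<^bsub>M\<^esub> x) = \<ominus>\<^bsub>N\<^esub> f x"
  using assms k_linear_closed[OF assms(3,4)]
  by (simp add: kmod.minus_eq_smult k_linear_smult)

lemma k_linear_finsum:
  assumes "kmod M" "kmod N" "k_linear M N f" "h \<in> A \<rightarrow> carrier M"
  shows "f (\<Oplus>\<^bsub>M\<^esub>i\<in>A. h i) = (\<Oplus>\<^bsub>N\<^esub>i\<in>A. f (h i))"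
proof -
  interpret M: kmod M by fact
  interpret N: kmod N by fact
  have "h \<in> A \<rightarrow> carrier M \<Longrightarrow> ?thesis"
  proof (induction A rule: infinite_finite_induct)
    case (insert x F)
    then show ?case
      by (auto simp: k_linear_add[OF assms(3)] k_linear_closed[OF assms(3)] Pi_def)
  qed (auto simp: k_linear_zero[OF assms(1-3)])
  thus ?thesis using assms by simp
qed

lemma k_linear_comp:
  "k_linear M N f \<Longrightarrow> k_linear N P h \<Longrightarrow> k_linear M P (\<lambda>x. h (f x))"
  by (auto simp: k_linear_def Pi_def)

lemma k_linear_id: "k_linear M M id" "k_linear M M (\<lambda>x. x)"
  by (auto simp: k_linear_def)

lemma algebra_homI:
  "k_linear A B f \<Longrightarrow> f \<one>\<^bsub>A\<^esub> = \<one>\<^bsub>B\<^esub> \<Longrightarrow>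
   (\<And>x y. x \<in> carrier A \<Longrightarrow> y \<in> carrier A \<Longrightarrow> f (x \<otimes>\<^bsub>A\<^esub> y) = f x \<otimes>\<^bsub>B\<^esub> f y) \<Longrightarrow> algebra_hom A B f"
  by (auto simp: algebra_hom_def ring_hom_def k_linear_def)

lemma algebra_hom_linear: "algebra_hom A B f \<Longrightarrow> k_linear A B f"
  and algebra_hom_mult: "algebra_hom A B f \<Longrightarrow> x \<in> carrier A \<Longrightarrow> y \<in> carrier A \<Longrightarrow>
     f (x \<otimes>\<^bsub>A\<^esub> y) = f x \<otimes>\<^bsub>B\<^esub> f y"
  and algebra_hom_one: "algebra_hom A B f \<Longrightarrow> f \<one>\<^bsub>A\<^esub> = \<one>\<^bsub>B\<^esub>"
  by (auto simp: algebra_hom_def ring_hom_def)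

lemma algebra_hom_comp:
  assumes "algebra_hom A B f" "algebra_hom B C h" shows "algebra_hom A C (\<lambda>x. h (f x))"
  by (rule algebra_homI)
    (use assms in \<open>auto simp: algebra_hom_linear[THEN k_linear_closed] algebra_hom_mult
      algebra_hom_one intro: k_linear_comp algebra_hom_linear\<close>)

lemma algebra_hom_id: "algebra_hom A A id" "algebra_hom A A (\<lambda>x. x)"
  by (auto intro!: algebra_homI k_linear_id)

text \<open>Transport of structure along a surjection that respects the operations. Quotients,
  associated graded modules and records extended by coalgebra fields all arise in this way, so the
  axioms are not verified on cosets directly.\<close>

lemma kmod_surj_image:
  assumes "kmod A" and surj: "carrier B = f ` carrier A"
    and add: "\<And>x y. x \<in> carrier A \<Longrightarrow> y \<in> carrier A \<Longrightarrow> f x \<oplus>\<^bsub>B\<^esub> f y = f (x \<oplus>\<^bsub>A\<^esub> y)"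
    and zero: "\<zero>\<^bsub>B\<^esub> = f \<zero>\<^bsub>A\<^esub>"
    and smult: "\<And>c x. x \<in> carrier A \<Longrightarrow> c \<odot>\<^bsub>B\<^esub> f x = f (c \<odot>\<^bsub>A\<^esub> x)"
  shows "kmod B" and "k_linear A B f"
proof -
  interpret A: kmod A by fact
  interpret B: abelian_group B
  proof (rule abelian_groupI)
    fix x assume "x \<in> carrier B"
    then obtain x' where "x' \<in> carrier A" "x = f x'" by (auto simp: surj)
    then have "f (\<ominus>\<^bsub>A\<^esub> x') \<in> carrier B" "f (\<ominus>\<^bsub>A\<^esub> x') \<oplus>\<^bsub>B\<^esub> x = \<zero>\<^bsub>B\<^esub>"
      by (auto simp: surj add zero A.l_neg)
    then show "\<exists>y\<in>carrier B. y \<oplus>\<^bsub>B\<^esub> x = \<zero>\<^bsub>B\<^esub>" by blast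
  qed (auto simp: surj add zero A.a_ac)
  show "kmod B"
    by unfold_locales
      (auto simp: surj smult add A.smult_l_distr A.smult_r_distr A.smult_smult)
  show "k_linear A B f"
    by (rule k_linearI) (auto simp: surj add smult)
qed

lemma kalg_surj_image:
  assumes "kalg A" and surj: "carrier B = f ` carrier A"
    and add: "\<And>x y. x \<in> carrier A \<Longrightarrow> y \<in> carrier A \<Longrightarrow> f x \<oplus>\<^bsub>B\<^esub> f y = f (x \<oplus>\<^bsub>A\<^esub> y)"
    and zero: "\<zero>\<^bsub>B\<^esub> = f \<zero>\<^bsub>A\<^esub>"
    and smult: "\<And>c x. x \<in> carrier A \<Longrightarrow> c \<odot>\<^bsub>B\<^esub> f x = f (c \<odot>\<^bsub>A\<^esub> x)"
    and mult: "\<And>x y. x \<in> carrier A \<Longrightarrow> y \<in> carrier A \<Longrightarrow> f x \<otimes>\<^bsub>B\<^esub> f y = f (x \<otimes>\<^bsub>A\<^esub> y)"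
    and one: "\<one>\<^bsub>B\<^esub> = f \<one>\<^bsub>A\<^esub>"
  shows "kalg B" and "algebra_hom A B f"
proof -
  interpret A: kalg A by fact
  interpret B: kmod B using kmod_surj_image(1)[OF A.kmod_axioms surj add zero smult] .
  interpret B: ring B
  proof (rule ringI)
    show "abelian_group B" by (rule B.abelian_group_axioms)
    show "Group.monoid B"
      by (rule monoidI) (auto simp: surj mult one A.m_assoc)
  qed (auto simp: surj mult add A.l_distr A.r_distr)
  show "kalg B"
    by unfold_locales (auto simp: surj mult smult A.smult_mult_left A.smult_mult_right)
  show "algebra_hom A B f"
    using kmod_surj_image(2)[OF A.kmod_axioms surj add zero smult] mult one
    by (auto intro!: algebra_homI)
qed

section \<open>Linear extension\<close>

lemma lookup_pscale [simp]: "lookup (Poly_Mapping.map ((*) (c::'k::comm_ring_1)) f) x = c * lookup f x"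
  by transfer (simp add: when_def)

global_interpretation pm: Modules.module "\<lambda>c::'k::comm_ring_1. Poly_Mapping.map ((*) c)"
  by standard (rule poly_mapping_eqI; simp add: lookup_add algebra_simps)+

lemma pscale_single [simp]: "Poly_Mapping.map ((*) (c::'k::comm_ring_1)) (single s d) = single s (c * d)"
  by (rule poly_mapping_eqI) (simp add: lookup_single when_def)

lemma keys_pscale: "keys (Poly_Mapping.map ((*) (c::'k::comm_ring_1)) f) \<subseteq> keys f"
  by (auto simp: in_keys_iff)

lemma poly_mapping_eq_sum: "(f :: 'a \<Rightarrow>\<^sub>0 'b::comm_monoid_add) = (\<Sum>s\<in>keys f. single s (lookup f s))"
  by (rule poly_mapping_eqI) (auto simp: lookup_sum lookup_single when_def in_keys_iff)

lemma pm_induct [consumes 1, case_names zero add]: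
  fixes f :: "'a \<Rightarrow>\<^sub>0 'b::comm_monoid_add"
  assumes "keys f \<subseteq> S" and "P 0"
    and add: "\<And>s c h. s \<in> S \<Longrightarrow> keys h \<subseteq> S \<Longrightarrow> P h \<Longrightarrow> P (single s c + h)"
  shows "P f"
proof -
  have "finite K \<Longrightarrow> K \<subseteq> S \<Longrightarrow> P (\<Sum>s\<in>K. single s (lookup f s))" for K
  proof (induction K rule: finite_induct)
    case (insert s K)
    moreover have "keys (\<Sum>s\<in>K. single s (lookup f s)) \<subseteq> S"
      using insert.prems keys_sum[of "\<lambda>s. single s (lookup f s)" K] by (auto split: if_splits)
    ultimately show ?case by (simp add: add)
  qed (use assms in simp)
  from this[of "keys f"] show ?thesis using assms(1) by (simp flip: poly_mapping_eq_sum)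
qed

context kmod
begin

text \<open>\<open>linear_extension\<close> sums over the support, and supports change under
  addition and scaling; a fixed finite index set containing them makes the sums comparable.\<close>

lemma lin_ext_superset:
  assumes "finite K" "keys f \<subseteq> K" "\<phi> \<in> K \<rightarrow> carrier M"
  shows "linear_extension M \<phi> f = (\<Oplus>s\<in>K. lookup f s \<odot> \<phi> s)"
  unfolding linear_extension_def
  by (rule add.finprod_mono_neutral_cong_left)
     (use assms in \<open>auto simp: Pi_def not_in_keys_iff_lookup_eq_zero\<close>)

lemma lin_ext_closed: "\<phi> \<in> keys f \<rightarrow> carrier M \<Longrightarrow> linear_extension M \<phi> f \<in> carrier M"
  unfolding linear_extension_def by (rule finsum_closed) auto

lemma lin_ext_zero [simp]: "linear_extension M \<phi> 0 = \<zero>"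
  by (simp add: linear_extension_def)

lemma lin_ext_single: "\<phi> s \<in> carrier M \<Longrightarrow> linear_extension M \<phi> (single s c) = c \<odot> \<phi> s"
  by (subst lin_ext_superset[of "{s}"]) auto

lemma lin_ext_add:
  assumes "\<phi> \<in> keys f \<rightarrow> carrier M" "\<phi> \<in> keys h \<rightarrow> carrier M"
  shows "linear_extension M \<phi> (f + h) = linear_extension M \<phi> f \<oplus> linear_extension M \<phi> h"
proof -
  have *: "\<phi> \<in> keys f \<union> keys h \<rightarrow> carrier M" using assms by auto
  have "linear_extension M \<phi> (f + h)
      = (\<Oplus>s\<in>keys f \<union> keys h. lookup f s \<odot> \<phi> s \<oplus> lookup h s \<odot> \<phi> s)"
    using * keys_add[of f h]
    by (subst lin_ext_superset[of "keys f \<union> keys h"])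
      (auto simp: lookup_add smult_l_distr Pi_def simp del: finsum_addf intro!: finsum_cong')
  also have "\<dots> = linear_extension M \<phi> f \<oplus> linear_extension M \<phi> h"
    using * by (subst finsum_addf) (auto simp: lin_ext_superset[of "keys f \<union> keys h"])
  finally show ?thesis .
qed

lemma lin_ext_smult:
  assumes "\<phi> \<in> keys f \<rightarrow> carrier M"
  shows "linear_extension M \<phi> (Poly_Mapping.map ((*) c) f) = c \<odot> linear_extension M \<phi> f"
  using assms keys_pscale[of c f]
  by (auto simp: lin_ext_superset[of "keys f"] smult_finsum smult_smult Pi_def intro!: finsum_cong')

lemma lin_ext_cong:
  assumes "\<And>s. s \<in> keys f \<Longrightarrow> \<phi> s = \<psi> s" "\<psi> \<in> keys f \<rightarrow> carrier M"
  shows "linear_extension M \<phi> f = linear_extension M \<psi> f"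
  unfolding linear_extension_def by (rule finsum_cong') (use assms in auto)

lemma lin_ext_uminus:
  assumes "\<phi> \<in> keys f \<rightarrow> carrier M"
  shows "linear_extension M \<phi> (- f) = \<ominus> linear_extension M \<phi> f"
  using lin_ext_smult[OF assms, of "-1"] lin_ext_closed[OF assms]
  by (simp add: minus_eq_smult)

lemma lin_ext_diff:
  assumes "\<phi> \<in> keys f \<rightarrow> carrier M" "\<phi> \<in> keys h \<rightarrow> carrier M"
  shows "linear_extension M \<phi> (f - h) = linear_extension M \<phi> f \<oplus> \<ominus> linear_extension M \<phi> h"
  using lin_ext_add[of \<phi> f "- h"] lin_ext_uminus[OF assms(2)] assms by simp

lemma lin_ext_const_zero: "(\<And>s. s \<in> keys f \<Longrightarrow> \<phi> s = \<zero>) \<Longrightarrow> linear_extension M \<phi> f = \<zero>"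
  unfolding linear_extension_def by (rule add.finprod_one_eqI) auto

lemma lin_ext_fun_add:
  assumes "\<phi> \<in> keys f \<rightarrow> carrier M" "\<psi> \<in> keys f \<rightarrow> carrier M"
  shows "linear_extension M (\<lambda>s. \<phi> s \<oplus> \<psi> s) f = linear_extension M \<phi> f \<oplus> linear_extension M \<psi> f"
  using assms unfolding linear_extension_def
  by (subst finsum_addf[symmetric]) (auto simp: smult_r_distr Pi_def simp del: finsum_addf intro!: finsum_cong')

lemma lin_ext_fun_smult:
  assumes "\<phi> \<in> keys f \<rightarrow> carrier M"
  shows "linear_extension M (\<lambda>s. c \<odot> \<phi> s) f = c \<odot> linear_extension M \<phi> f"
  using assms unfolding linear_extension_def
  by (auto simp: smult_finsum Pi_def smult_smult mult.commute intro!: finsum_cong')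

end

lemma k_linear_lin_ext:
  assumes "kmod M" "kmod N" "k_linear M N f" "\<phi> \<in> keys h \<rightarrow> carrier M"
  shows "f (linear_extension M \<phi> h) = linear_extension N (\<lambda>s. f (\<phi> s)) h"
proof -
  interpret M: kmod M by fact
  interpret N: kmod N by fact
  show ?thesis
    using assms(4) unfolding linear_extension_def
    by (subst k_linear_finsum[OF assms(1-3)])
       (auto simp: k_linear_smult[OF assms(3)] Pi_def k_linear_closed[OF assms(3)] intro!: N.finsum_cong')
qed

section \<open>Quotients\<close>

locale submod = kmod M for M :: "('k::comm_ring_1, 'a, 'm) module_scheme" (structure) +
  fixes J
  assumes sub: "J \<subseteq> carrier M" and zero_mem [simp]: "\<zero> \<in> J"
    and add_mem: "x \<in> J \<Longrightarrow> y \<in> J \<Longrightarrow> x \<oplus> y \<in> J"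
    and smult_mem: "x \<in> J \<Longrightarrow> c \<odot> x \<in> J"
begin

lemma mem_carrier [intro]: "x \<in> J \<Longrightarrow> x \<in> carrier M"
  using sub by blast

lemma minus_mem: "x \<in> J \<Longrightarrow> \<ominus> x \<in> J"
  using smult_mem[of x "-1"] sub by (auto simp: minus_eq_smult)

lemma coset_def: "J +> x = (\<lambda>j. j \<oplus> x) ` J"
  by (auto simp: a_r_coset_def r_coset_def)

lemma coset_zero [simp]: "J +> \<zero> = J"
  unfolding coset_def using sub by force

lemma coset_self: "x \<in> carrier M \<Longrightarrow> x \<in> J +> x"
  unfolding coset_def using zero_mem by (metis image_eqI l_zero)

lemma coset_memD: "y \<in> J +> x \<Longrightarrow> x \<in> carrier M \<Longrightarrow> y \<in> carrier M \<and> y \<oplus> \<ominus> x \<in> J"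
  unfolding coset_def using sub by (auto simp: a_assoc r_neg)

lemma coset_subset:
  assumes "x \<in> carrier M" "y \<in> carrier M" "x \<oplus> \<ominus> y \<in> J" shows "J +> x \<subseteq> J +> y"
proof
  fix z assume "z \<in> J +> x"
  then obtain j where "j \<in> J" "z = j \<oplus> x" by (auto simp: coset_def)
  then have "z = (j \<oplus> (x \<oplus> \<ominus> y)) \<oplus> y" "j \<oplus> (x \<oplus> \<ominus> y) \<in> J"
    using assms sub by (auto simp: a_assoc l_neg add_mem)
  then show "z \<in> J +> y" by (auto simp: coset_def)
qed

lemma coset_eq_iff:
  assumes "x \<in> carrier M" "y \<in> carrier M"
  shows "J +> x = J +> y \<longleftrightarrow> x \<oplus> \<ominus> y \<in> J"
proof
  assume "J +> x = J +> y"
  with coset_self[OF assms(1)] coset_memD[OF _ assms(2)] show "x \<oplus> \<ominus> y \<in> J" by blast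
next
  assume *: "x \<oplus> \<ominus> y \<in> J"
  then have "y \<oplus> \<ominus> x \<in> J"
    using minus_mem[OF *] assms by (simp add: minus_add a_comm)
  with * assms show "J +> x = J +> y" by (intro equalityI coset_subset)
qed

lemma coset_eq_self_iff: "x \<in> carrier M \<Longrightarrow> J +> x = J \<longleftrightarrow> x \<in> J"
  using coset_eq_iff[of x \<zero>] by simp

lemma coset_sum:
  assumes "x \<in> carrier M" "y \<in> carrier M"
  shows "(J +> x) <+>\<^bsub>M\<^esub> (J +> y) = J +> (x \<oplus> y)"
proof -
  have 1: "(i \<oplus> x) \<oplus> (j \<oplus> y) = (i \<oplus> j) \<oplus> (x \<oplus> y)" if "i \<in> J" "j \<in> J" for i j
    using that assms mem_carrier by (simp add: a_ac)
  have 2: "j \<oplus> (x \<oplus> y) = (j \<oplus> x) \<oplus> (\<zero> \<oplus> y)" if "j \<in> J" for j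
    using that assms mem_carrier by (simp add: a_ac)
  show ?thesis
  proof (intro equalityI subsetI)
    fix z assume "z \<in> (J +> x) <+>\<^bsub>M\<^esub> (J +> y)"
    then obtain i j where "i \<in> J" "j \<in> J" "z = (i \<oplus> x) \<oplus> (j \<oplus> y)"
      by (auto simp: set_add_def' coset_def)
    then show "z \<in> J +> (x \<oplus> y)"
      by (simp add: 1 add_mem coset_def)
  next
    fix z assume "z \<in> J +> (x \<oplus> y)"
    then obtain j where "j \<in> J" "z = (j \<oplus> x) \<oplus> (\<zero> \<oplus> y)"
      by (auto simp: coset_def 2)
    then show "z \<in> (J +> x) <+>\<^bsub>M\<^esub> (J +> y)"
      using zero_mem unfolding set_add_def' coset_def by blast
  qed
qed

lemma coset_union:
  assumes "x \<in> carrier M" "\<And>y. y \<in> J +> x \<Longrightarrow> h y = h x"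
  shows "(\<Union>y\<in>J +> x. h y) = h x"
proof -
  have "(\<Union>y\<in>J +> x. h y) = (\<Union>y\<in>J +> x. h x)" by (rule SUP_cong[OF HOL.refl assms(2)])
  then show ?thesis using coset_self[OF assms(1)] by auto
qed

lemma on_cosets_coset:
  assumes "x \<in> carrier M" "\<And>y. y \<in> J +> x \<Longrightarrow> f y = f x"
  shows "on_cosets f (J +> x) = f x"
proof -
  have "f ` (J +> x) = (\<lambda>_. f x) ` (J +> x)" by (rule image_cong[OF HOL.refl assms(2)])
  also have "\<dots> = {f x}" using coset_self[OF assms(1)] by auto
  finally have "f ` (J +> x) = {f x}" .
  then show ?thesis by (simp add: on_cosets_def)
qed

lemma coset_smult:
  assumes "x \<in> carrier M" shows "(\<Union>y\<in>J +> x. J +> (c \<odot> y)) = J +> (c \<odot> x)"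
proof (rule coset_union[OF assms])
  fix y assume "y \<in> J +> x"
  then have y: "y \<in> carrier M" "y \<oplus> \<ominus> x \<in> J" using coset_memD assms by auto
  then have "c \<odot> y \<oplus> \<ominus> (c \<odot> x) = c \<odot> (y \<oplus> \<ominus> x)"
    using assms by (simp add: smult_r_distr smult_a_inv)
  then show "J +> (c \<odot> y) = J +> (c \<odot> x)"
    using y assms by (simp add: coset_eq_iff smult_mem)
qed

lemma quotient_carrier: "carrier (quotient_algebra M J) = (\<lambda>x. J +> x) ` carrier M"
  by (auto simp: quotient_algebra_def FactRing_def A_RCOSETS_def RCOSETS_def a_r_coset_def)

lemma quotient_zero [simp]: "zero (quotient_algebra M J) = J"
  and quotient_add: "x \<in> carrier M \<Longrightarrow> y \<in> carrier M \<Longrightarrow>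
    (J +> x) \<oplus>\<^bsub>quotient_algebra M J\<^esub> (J +> y) = J +> (x \<oplus> y)"
  and quotient_smult: "x \<in> carrier M \<Longrightarrow> c \<odot>\<^bsub>quotient_algebra M J\<^esub> (J +> x) = J +> (c \<odot> x)"
  by (auto simp: quotient_algebra_def FactRing_def coset_sum coset_smult)

lemma kmod_quotient: "kmod (quotient_algebra M J)"
  and k_linear_proj: "k_linear M (quotient_algebra M J) (\<lambda>x. J +> x)"
  by (rule kmod_surj_image[OF kmod_axioms, of _ "\<lambda>x. J +> x"];
      simp add: quotient_carrier quotient_add quotient_smult)+

text \<open>\<open>on_cosets\<close> picks the only value that a map takes on a coset; vanishing on
  \<open>J\<close> makes that value unique. Induced coproducts, counits and \<open>H0_to_gr\<close>
  are all evaluated through this lemma.\<close>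

lemma on_cosets_linear:
  assumes N: "kmod N" and f: "k_linear M N f" and ker: "\<And>j. j \<in> J \<Longrightarrow> f j = \<zero>\<^bsub>N\<^esub>"
  shows "x \<in> carrier M \<Longrightarrow> on_cosets f (J +> x) = f x"
    and "k_linear (quotient_algebra M J) N (on_cosets f)"
proof -
  interpret N: kmod N by fact
  show *: "on_cosets f (J +> x) = f x" if "x \<in> carrier M" for x
  proof (rule on_cosets_coset[OF that])
    fix y assume "y \<in> J +> x"
    then obtain j where "j \<in> J" "y = j \<oplus> x" by (auto simp: coset_def)
    with that sub show "f y = f x"
      by (auto simp: k_linear_add[OF f] ker k_linear_closed[OF f])
  qed
  show "k_linear (quotient_algebra M J) N (on_cosets f)"
    by (rule k_linearI)
       (auto simp: quotient_carrier quotient_add quotient_smult * k_linear_add[OF f]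
          k_linear_smult[OF f] k_linear_closed[OF f])
qed

end

lemma ideal_submod:
  assumes "kalg A" "ideal J A" shows "submod A J"
proof -
  interpret A: kalg A by fact
  interpret ideal J A by fact
  show ?thesis
  proof (rule submod.intro[OF A.kmod_axioms], unfold_locales)
    fix x c assume "x \<in> J"
    then have "(c \<odot>\<^bsub>A\<^esub> \<one>\<^bsub>A\<^esub>) \<otimes>\<^bsub>A\<^esub> x \<in> J" by (intro I_l_closed) auto
    then show "c \<odot>\<^bsub>A\<^esub> x \<in> J" using \<open>x \<in> J\<close> by (simp add: A.smult_mult_left)
  qed (auto simp: a_subset)
qed

lemma quotient_mult:
  assumes "ideal J A" "x \<in> carrier A" "y \<in> carrier A"
  shows "(J +>\<^bsub>A\<^esub> x) \<otimes>\<^bsub>quotient_algebra A J\<^esub> (J +>\<^bsub>A\<^esub> y) = J +>\<^bsub>A\<^esub> (x \<otimes>\<^bsub>A\<^esub> y)"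
  using ideal.rcoset_mult_add[OF assms] by (simp add: quotient_algebra_def FactRing_def)

lemma quotient_one: "\<one>\<^bsub>quotient_algebra A J\<^esub> = J +>\<^bsub>A\<^esub> \<one>\<^bsub>A\<^esub>"
  by (simp add: quotient_algebra_def FactRing_def)

lemma kalg_quotient:
  assumes "kalg A" "ideal J A"
  shows "kalg (quotient_algebra A J)" "algebra_hom A (quotient_algebra A J) (\<lambda>x. J +>\<^bsub>A\<^esub> x)"
proof -
  interpret submod A J using assms by (rule ideal_submod)
  show "kalg (quotient_algebra A J)" "algebra_hom A (quotient_algebra A J) (\<lambda>x. J +>\<^bsub>A\<^esub> x)"
    by (rule kalg_surj_image[OF assms(1), of _ "\<lambda>x. J +>\<^bsub>A\<^esub> x"];
      simp add: quotient_carrier quotient_add quotient_smult quotient_mult[OF assms(2)] quotient_one)+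
qed

lemma kernel_ideal:
  assumes "kalg A" "kalg B" "algebra_hom A B f"
  shows "ideal {x \<in> carrier A. f x = \<zero>\<^bsub>B\<^esub>} A"
proof -
  interpret A: kalg A by fact
  interpret B: kalg B by fact
  have "ring_hom_ring A B f"
    using assms(3) by (intro ring_hom_ringI2 A.ring_axioms B.ring_axioms) (auto simp: algebra_hom_def)
  then show ?thesis
    using ring_hom_ring.kernel_is_ideal[of A B f] by (simp add: a_kernel_def' )
qed

section \<open>Twisted algebras\<close>

lemma twisted_algebra_simps [simp]:
  "carrier (twisted_algebra S m e \<tau>) = {f. keys f \<subseteq> S}"
  "one (twisted_algebra S m e \<tau>) = single e 1" "zero (twisted_algebra S m e \<tau>) = 0"
  "add (twisted_algebra S m e \<tau>) = (+)"
  "smult (twisted_algebra S m e \<tau>) = (\<lambda>c. Poly_Mapping.map ((*) c))"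
  by (auto simp: twisted_algebra_def)

lemma keys_add_subset [simp]: "keys f \<subseteq> S \<Longrightarrow> keys h \<subseteq> S \<Longrightarrow> keys (f + h) \<subseteq> S"
  using keys_add[of f h] by auto

lemma keys_diff_subset [simp]:
  fixes f h :: "'s \<Rightarrow>\<^sub>0 'k::ab_group_add"
  shows "keys f \<subseteq> S \<Longrightarrow> keys h \<subseteq> S \<Longrightarrow> keys (f - h) \<subseteq> S"
  by (auto simp: in_keys_iff lookup_minus subset_iff) (metis diff_self)

lemma keys_pscale_subset [simp]:
  "keys f \<subseteq> S \<Longrightarrow> keys (Poly_Mapping.map ((*) (c::'k::comm_ring_1)) f) \<subseteq> S"
  using keys_pscale[of c f] by auto

lemma keys_uminus_subset [simp]:
  fixes f :: "'s \<Rightarrow>\<^sub>0 'k::ab_group_add"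
  shows "keys f \<subseteq> S \<Longrightarrow> keys (- f) \<subseteq> S"
  by (auto simp: in_keys_iff)

lemma k_linear_cong:
  "kmod M \<Longrightarrow> (\<And>x. x \<in> carrier M \<Longrightarrow> f x = h x) \<Longrightarrow> k_linear M N h \<Longrightarrow> k_linear M N f"
  by (rule k_linearI) (auto simp: k_linear_closed k_linear_add k_linear_smult kmod.smult_closed
      abelian_monoid.a_closed kmod.axioms(1)[THEN abelian_group.axioms(1)])

lemma abelian_group_twisted: "abelian_group (twisted_algebra S m e \<tau>)"
proof (rule abelian_groupI)
  fix f assume "f \<in> carrier (twisted_algebra S m e \<tau>)"
  then show "\<exists>h\<in>carrier (twisted_algebra S m e \<tau>).
      h \<oplus>\<^bsub>twisted_algebra S m e \<tau>\<^esub> f = \<zero>\<^bsub>twisted_algebra S m e \<tau>\<^esub>"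
    by (intro bexI[of _ "- f"]) (auto simp: in_keys_iff)
qed (simp_all add: algebra_simps)

lemma kmod_twisted: "kmod (twisted_algebra S m e \<tau>)"
proof -
  interpret abelian_group "twisted_algebra S m e \<tau>" by (rule abelian_group_twisted)
  show ?thesis
    by unfold_locales (simp_all add: pm.scale_left_distrib pm.scale_right_distrib)
qed

lemma twisted_a_inv: "keys f \<subseteq> S \<Longrightarrow> \<ominus>\<^bsub>twisted_algebra S m e \<tau>\<^esub> f = - f"
proof -
  interpret kmod "twisted_algebra S m e \<tau>" by (rule kmod_twisted)
  assume "keys f \<subseteq> S"
  then show ?thesis by (intro minus_equality) (auto simp: in_keys_iff)
qed

lemma finsum_twisted:
  assumes "\<And>x. x \<in> A \<Longrightarrow> keys (f x) \<subseteq> S"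
  shows "finsum (twisted_algebra S m e \<tau>) f A = sum f A"
proof -
  interpret kmod "twisted_algebra S m e \<tau>" by (rule kmod_twisted)
  from assms show ?thesis
    by (induction A rule: infinite_finite_induct) (auto simp: Pi_def)
qed

lemma lin_ext_twisted:
  assumes "\<And>x. x \<in> keys h \<Longrightarrow> keys (f x) \<subseteq> S"
  shows "linear_extension (twisted_algebra S m e \<tau>) f h
    = (\<Sum>s\<in>keys h. Poly_Mapping.map ((*) (lookup h s)) (f s))"
  unfolding linear_extension_def twisted_algebra_simps
  by (rule finsum_twisted) (meson assms keys_pscale order_trans)

lemma twisted_mult_superset:
  assumes "finite K" "finite L" "keys f \<subseteq> K" "keys h \<subseteq> L"
  shows "f \<otimes>\<^bsub>twisted_algebra S m e \<tau>\<^esub> h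
    = (\<Sum>s\<in>K. \<Sum>t\<in>L. single (m s t) (\<tau> s t * lookup f s * lookup h t))"
proof -
  have "f \<otimes>\<^bsub>twisted_algebra S m e \<tau>\<^esub> h
    = (\<Sum>s\<in>keys f. \<Sum>t\<in>L. single (m s t) (\<tau> s t * lookup f s * lookup h t))"
    unfolding twisted_algebra_def using assms
    by (simp, intro sum.cong[OF HOL.refl] sum.mono_neutral_left) (auto simp: in_keys_iff)
  also have "\<dots> = (\<Sum>s\<in>K. \<Sum>t\<in>L. single (m s t) (\<tau> s t * lookup f s * lookup h t))"
    using assms by (auto intro!: sum.mono_neutral_left simp: in_keys_iff)
  finally show ?thesis .
qed

lemma twisted_mult_add_left:
  "(f + f') \<otimes>\<^bsub>twisted_algebra S m e \<tau>\<^esub> h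
    = f \<otimes>\<^bsub>twisted_algebra S m e \<tau>\<^esub> h + f' \<otimes>\<^bsub>twisted_algebra S m e \<tau>\<^esub> h"
  using keys_add[of f f']
  by (simp add: twisted_mult_superset[of "keys f \<union> keys f'" "keys h"] lookup_add algebra_simps
      single_add sum.distrib)

lemma twisted_mult_add_right:
  "h \<otimes>\<^bsub>twisted_algebra S m e \<tau>\<^esub> (f + f')
    = h \<otimes>\<^bsub>twisted_algebra S m e \<tau>\<^esub> f + h \<otimes>\<^bsub>twisted_algebra S m e \<tau>\<^esub> f'"
  using keys_add[of f f']
  by (simp add: twisted_mult_superset[of "keys h" "keys f \<union> keys f'"] lookup_add algebra_simps
      single_add sum.distrib)

lemma twisted_mult_zero [simp]:
  "0 \<otimes>\<^bsub>twisted_algebra S m e \<tau>\<^esub> h = 0" "h \<otimes>\<^bsub>twisted_algebra S m e \<tau>\<^esub> 0 = 0"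
  by (simp_all add: twisted_algebra_def)

lemma twisted_mult_diff_left:
  "(f - f') \<otimes>\<^bsub>twisted_algebra S m e \<tau>\<^esub> h
    = f \<otimes>\<^bsub>twisted_algebra S m e \<tau>\<^esub> h - f' \<otimes>\<^bsub>twisted_algebra S m e \<tau>\<^esub> h"
  using twisted_mult_add_left[where f="f - f'" and f'=f' and S=S and m=m and e=e and \<tau>=\<tau> and h=h] by simp

lemma twisted_mult_diff_right:
  "h \<otimes>\<^bsub>twisted_algebra S m e \<tau>\<^esub> (f - f')
    = h \<otimes>\<^bsub>twisted_algebra S m e \<tau>\<^esub> f - h \<otimes>\<^bsub>twisted_algebra S m e \<tau>\<^esub> f'"
  using twisted_mult_add_right[where f="f - f'" and f'=f' and S=S and m=m and e=e and \<tau>=\<tau> and h=h] by simp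

lemma twisted_mult_single [simp]:
  "single s a \<otimes>\<^bsub>twisted_algebra S m e \<tau>\<^esub> single t b = single (m s t) (\<tau> s t * a * b)"
  by (subst twisted_mult_superset[of "{s}" "{t}"]) auto

lemma pscale_sum:
  "Poly_Mapping.map ((*) (c::'k::comm_ring_1)) (\<Sum>i\<in>I. f i) = (\<Sum>i\<in>I. Poly_Mapping.map ((*) c) (f i))"
  by (rule pm.scale_sum_right)

lemma twisted_mult_scale_left:
  "Poly_Mapping.map ((*) c) f \<otimes>\<^bsub>twisted_algebra S m e \<tau>\<^esub> h
    = Poly_Mapping.map ((*) c) (f \<otimes>\<^bsub>twisted_algebra S m e \<tau>\<^esub> h)"
  using keys_pscale[of c f]
  by (simp add: twisted_mult_superset[of "keys f" "keys h"] pscale_sum algebra_simps)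

lemma twisted_mult_scale_right:
  "h \<otimes>\<^bsub>twisted_algebra S m e \<tau>\<^esub> Poly_Mapping.map ((*) c) f
    = Poly_Mapping.map ((*) c) (h \<otimes>\<^bsub>twisted_algebra S m e \<tau>\<^esub> f)"
  using keys_pscale[of c f]
  by (simp add: twisted_mult_superset[of "keys h" "keys f"] pscale_sum algebra_simps)

text \<open>The conditions make \<open>\<tau>\<close> a normalized 2-cocycle on the monoid
  \<open>S\<close>, which yields associativity and the unit law of the twisted product. The free
  algebra on pairs and \<open>TV\<close> have the trivial cocycle; the bosonization has the cocycle
  \<open>word_char \<chi> v a\<close>.\<close>

locale twist =
  fixes S :: "'s set" and m e and \<tau> :: "'s \<Rightarrow> 's \<Rightarrow> 'k::comm_ring_1"
  assumes e: "e \<in> S" and m_closed: "s \<in> S \<Longrightarrow> t \<in> S \<Longrightarrow> m s t \<in> S"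
    and m_assoc: "s \<in> S \<Longrightarrow> t \<in> S \<Longrightarrow> u \<in> S \<Longrightarrow> m (m s t) u = m s (m t u)"
    and m_e: "s \<in> S \<Longrightarrow> m e s = s" "s \<in> S \<Longrightarrow> m s e = s"
    and \<tau>_e: "s \<in> S \<Longrightarrow> \<tau> e s = 1" "s \<in> S \<Longrightarrow> \<tau> s e = 1"
    and cocycle: "s \<in> S \<Longrightarrow> t \<in> S \<Longrightarrow> u \<in> S \<Longrightarrow> \<tau> s t * \<tau> (m s t) u = \<tau> t u * \<tau> s (m t u)"
begin

abbreviation "T \<equiv> twisted_algebra S m e \<tau>"

lemma mult_closed:
  assumes "keys f \<subseteq> S" "keys h \<subseteq> S" shows "keys (f \<otimes>\<^bsub>T\<^esub> h) \<subseteq> S"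
proof -
  have *: "keys (\<Sum>t\<in>keys h. single (m s t) (\<tau> s t * lookup f s * lookup h t)) \<subseteq> S" if "s \<in> keys f" for s
    by (rule order_trans[OF keys_sum]) (use that assms m_closed in auto)
  have "keys (\<Sum>s\<in>keys f. \<Sum>t\<in>keys h. single (m s t) (\<tau> s t * lookup f s * lookup h t)) \<subseteq> S"
    by (rule order_trans[OF keys_sum UN_least[OF *]])
  then show ?thesis by (simp add: twisted_algebra_def)
qed

lemma mult_assoc:
  assumes "keys f \<subseteq> S" "keys h \<subseteq> S" "keys p \<subseteq> S"
  shows "(f \<otimes>\<^bsub>T\<^esub> h) \<otimes>\<^bsub>T\<^esub> p = f \<otimes>\<^bsub>T\<^esub> (h \<otimes>\<^bsub>T\<^esub> p)"
  using assms(1)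
proof (induction f rule: pm_induct)
  case (add s a f)
  from assms(2) have "(single s a \<otimes>\<^bsub>T\<^esub> h) \<otimes>\<^bsub>T\<^esub> p = single s a \<otimes>\<^bsub>T\<^esub> (h \<otimes>\<^bsub>T\<^esub> p)"
  proof (induction h rule: pm_induct)
    case (add t b h)
    from assms(3)
    have "(single s a \<otimes>\<^bsub>T\<^esub> single t b) \<otimes>\<^bsub>T\<^esub> p = single s a \<otimes>\<^bsub>T\<^esub> (single t b \<otimes>\<^bsub>T\<^esub> p)"
    proof (induction p rule: pm_induct)
      case (add u c p)
      have "\<tau> (m s t) u * (\<tau> s t * a * b) * c = \<tau> s (m t u) * a * (\<tau> t u * b * c)"
        using cocycle[OF \<open>s \<in> S\<close> \<open>t \<in> S\<close> \<open>u \<in> S\<close>]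
        by (metis (no_types, opaque_lifting) mult.assoc mult.commute)
      with add show ?case
        using \<open>s \<in> S\<close> \<open>t \<in> S\<close> m_assoc by (simp add: twisted_mult_add_right)
    qed simp
    with add show ?case by (simp add: twisted_mult_add_left twisted_mult_add_right)
  qed simp
  with add show ?case by (simp add: twisted_mult_add_left)
qed simp

lemma mult_one:
  assumes "keys f \<subseteq> S" shows "single e 1 \<otimes>\<^bsub>T\<^esub> f = f" "f \<otimes>\<^bsub>T\<^esub> single e 1 = f"
  using assms
  by (induction f rule: pm_induct)
    (simp_all add: twisted_mult_add_left twisted_mult_add_right m_e \<tau>_e)

lemma kalg_T: "kalg T"
proof -
  interpret kmod T by (rule kmod_twisted)
  interpret ring T
  proof (rule ringI)
    show "abelian_group T" by (rule abelian_group_twisted)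
    show "Group.monoid T" using e
      by (intro monoidI) (auto simp: mult_closed mult_assoc mult_one split: if_splits)
  qed (auto simp: twisted_mult_add_left twisted_mult_add_right)
  show ?thesis
    by unfold_locales (auto simp: twisted_mult_scale_left twisted_mult_scale_right)
qed

end

section \<open>Tensor products\<close>

definition bilin where
  "bilin A B M \<beta> \<longleftrightarrow> (\<forall>a\<in>carrier A. k_linear B M (\<beta> a)) \<and> (\<forall>b\<in>carrier B. k_linear A M (\<lambda>a. \<beta> a b))"

lemma bilinI:
  "(\<And>a. a \<in> carrier A \<Longrightarrow> k_linear B M (\<beta> a)) \<Longrightarrow>
   (\<And>b. b \<in> carrier B \<Longrightarrow> k_linear A M (\<lambda>a. \<beta> a b)) \<Longrightarrow> bilin A B M \<beta>"
  by (simp add: bilin_def)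

lemma bilin_right: "bilin A B M \<beta> \<Longrightarrow> a \<in> carrier A \<Longrightarrow> k_linear B M (\<beta> a)"
  and bilin_left: "bilin A B M \<beta> \<Longrightarrow> b \<in> carrier B \<Longrightarrow> k_linear A M (\<lambda>a. \<beta> a b)"
  by (simp_all add: bilin_def)

lemma bilin_closed: "bilin A B M \<beta> \<Longrightarrow> a \<in> carrier A \<Longrightarrow> b \<in> carrier B \<Longrightarrow> \<beta> a b \<in> carrier M"
  by (rule k_linear_closed[OF bilin_right])

lemma bilin_comp:
  assumes "bilin A B M \<beta>" "k_linear A' A f" "k_linear B' B h"
  shows "bilin A' B' M (\<lambda>a b. \<beta> (f a) (h b))"
proof (rule bilinI)
  fix a assume "a \<in> carrier A'"
  then show "k_linear B' M (\<lambda>b. \<beta> (f a) (h b))"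
    by (intro k_linear_comp[OF assms(3) bilin_right[OF assms(1)]] k_linear_closed[OF assms(2)])
next
  fix b assume "b \<in> carrier B'"
  then show "k_linear A' M (\<lambda>a. \<beta> (f a) (h b))"
    by (intro k_linear_comp[OF assms(2) bilin_left[OF assms(1)]] k_linear_closed[OF assms(3)])
qed

lemma bilin_linear:
  assumes "bilin A B M \<beta>" "k_linear M N f" shows "bilin A B N (\<lambda>a b. f (\<beta> a b))"
  by (rule bilinI[OF k_linear_comp[OF bilin_right[OF assms(1)] assms(2)]
        k_linear_comp[OF bilin_left[OF assms(1)] assms(2)]])

lemma kalg_bilin_mult: "kalg A \<Longrightarrow> bilin A A A (monoid.mult A)"
proof -
  assume "kalg A"
  then interpret kalg A .
  show ?thesis
    by (intro bilinI k_linearI) (auto simp: r_distr l_distr smult_mult_left smult_mult_right)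
qed

lemma free_on_pairs_simps [simp]:
  "carrier (free_on_pairs A B) = {f. keys f \<subseteq> carrier A \<times> carrier B}"
  "one (free_on_pairs A B) = single (\<one>\<^bsub>A\<^esub>, \<one>\<^bsub>B\<^esub>) 1" "zero (free_on_pairs A B) = 0"
  "add (free_on_pairs A B) = (+)"
  "smult (free_on_pairs A B) = (\<lambda>c. Poly_Mapping.map ((*) c))"
  by (auto simp: free_on_pairs_def)

locale kmod_pair = A: kmod A + B: kmod B
  for A :: "('k::comm_ring_1, 'a, 'm) module_scheme" and B :: "('k, 'b, 'n) module_scheme"
begin

abbreviation "K \<equiv> tensor_kernel A B"
abbreviation "FP \<equiv> free_on_pairs A B"
abbreviation "T \<equiv> tensor A B"

lemma relations_carrier: "bilinearity_relations A B \<subseteq> carrier FP"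
proof -
  have "keys (single p c) \<subseteq> carrier A \<times> carrier B" if "p \<in> carrier A \<times> carrier B" for p and c :: 'k
    using that by simp
  then show ?thesis
    unfolding bilinearity_relations_def free_on_pairs_simps
    by (intro subsetI) (elim UnE CollectE exE conjE; simp)
qed

lemma K_carrier: "K \<subseteq> carrier FP"
proof -
  have "pm.subspace (carrier FP)"
    unfolding pm.subspace_def using keys_add keys_pscale by fastforce
  then show ?thesis
    unfolding tensor_kernel_def using relations_carrier by (intro pm.span_minimal)
qed

lemma submod_K: "submod FP K"
proof -
  interpret kmod FP unfolding free_on_pairs_def by (rule kmod_twisted)
  show ?thesis
    by unfold_locales
      (use K_carrier in \<open>auto simp: tensor_kernel_def pm.span_zero pm.span_add pm.span_scale\<close>)
qed

sublocale FP: submod FP K by (rule submod_K)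

lemma FP_a_inv [simp]: "keys f \<subseteq> carrier A \<times> carrier B \<Longrightarrow> \<ominus>\<^bsub>FP\<^esub> f = - f"
  unfolding free_on_pairs_def by (rule twisted_a_inv)

lemma K_zero: "0 \<in> K"
  by (simp add: tensor_kernel_def pm.span_zero)

lemma K_scale: "x \<in> K \<Longrightarrow> Poly_Mapping.map ((*) c) x \<in> K"
  and K_add: "x \<in> K \<Longrightarrow> y \<in> K \<Longrightarrow> x + y \<in> K"
  by (auto simp: tensor_kernel_def pm.span_scale pm.span_add)

text \<open>The relations with a coefficient \<open>c\<close>: multiplying a generator of the kernel
  by a monomial of the free algebra produces such multiples.\<close>

lemma K_add_left:
  assumes "a \<in> carrier A" "a' \<in> carrier A" "b \<in> carrier B"
  shows "single (a \<oplus>\<^bsub>A\<^esub> a', b) c - single (a, b) c - single (a', b) c \<in> K"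
proof -
  have "single (a \<oplus>\<^bsub>A\<^esub> a', b) 1 - single (a, b) 1 - single (a', b) 1 \<in> K"
    unfolding tensor_kernel_def
    by (rule pm.span_base) (use assms in \<open>auto simp: bilinearity_relations_def\<close>)
  from K_scale[OF this, of c] show ?thesis by (simp add: pm.scale_right_diff_distrib)
qed

lemma K_add_right:
  assumes "a \<in> carrier A" "b \<in> carrier B" "b' \<in> carrier B"
  shows "single (a, b \<oplus>\<^bsub>B\<^esub> b') c - single (a, b) c - single (a, b') c \<in> K"
proof -
  have "single (a, b \<oplus>\<^bsub>B\<^esub> b') 1 - single (a, b) 1 - single (a, b') 1 \<in> K"
    unfolding tensor_kernel_def
    by (rule pm.span_base) (use assms in \<open>auto simp: bilinearity_relations_def\<close>)
  from K_scale[OF this, of c] show ?thesis by (simp add: pm.scale_right_diff_distrib)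
qed

lemma K_smult_left:
  assumes "a \<in> carrier A" "b \<in> carrier B"
  shows "single (d \<odot>\<^bsub>A\<^esub> a, b) c - single (a, b) (c * d) \<in> K"
proof -
  have "single (d \<odot>\<^bsub>A\<^esub> a, b) 1 - single (a, b) d \<in> K"
    unfolding tensor_kernel_def
    by (rule pm.span_base) (use assms in \<open>auto simp: bilinearity_relations_def\<close>)
  from K_scale[OF this, of c] show ?thesis by (simp add: pm.scale_right_diff_distrib)
qed

lemma K_smult_right:
  assumes "a \<in> carrier A" "b \<in> carrier B"
  shows "single (a, d \<odot>\<^bsub>B\<^esub> b) c - single (a, b) (c * d) \<in> K"
proof -
  have "single (a, d \<odot>\<^bsub>B\<^esub> b) 1 - single (a, b) d \<in> K"
    unfolding tensor_kernel_def
    by (rule pm.span_base) (use assms in \<open>auto simp: bilinearity_relations_def\<close>)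
  from K_scale[OF this, of c] show ?thesis by (simp add: pm.scale_right_diff_distrib)
qed

lemma kmod_tensor: "kmod T"
  unfolding tensor_def by (rule FP.kmod_quotient)

lemma pure_closed [simp]: "a \<in> carrier A \<Longrightarrow> b \<in> carrier B \<Longrightarrow> pure_tensor A B a b \<in> carrier T"
  unfolding tensor_def pure_tensor_def by (auto simp: FP.quotient_carrier)

lemma bilin_pure: "bilin A B T (pure_tensor A B)"
proof (intro bilinI k_linearI)
  fix a b b' assume ab: "a \<in> carrier A" "b \<in> carrier B" "b' \<in> carrier B"
  show "pure_tensor A B a (b \<oplus>\<^bsub>B\<^esub> b') = pure_tensor A B a b \<oplus>\<^bsub>T\<^esub> pure_tensor A B a b'"
    using K_add_right[OF ab, of 1] ab keys_add[of "single (a, b) 1" "single (a, b') 1"]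
    unfolding tensor_def pure_tensor_def
    by (simp add: FP.quotient_add FP.coset_eq_iff algebra_simps)
next
  fix a a' b assume ab: "a \<in> carrier A" "a' \<in> carrier A" "b \<in> carrier B"
  show "pure_tensor A B (a \<oplus>\<^bsub>A\<^esub> a') b = pure_tensor A B a b \<oplus>\<^bsub>T\<^esub> pure_tensor A B a' b"
    using K_add_left[OF ab, of 1] ab keys_add[of "single (a, b) 1" "single (a', b) 1"]
    unfolding tensor_def pure_tensor_def
    by (simp add: FP.quotient_add FP.coset_eq_iff algebra_simps)
next
  fix a b d assume ab: "a \<in> carrier A" "b \<in> carrier B"
  show "pure_tensor A B a (d \<odot>\<^bsub>B\<^esub> b) = d \<odot>\<^bsub>T\<^esub> pure_tensor A B a b"
    using K_smult_right[OF ab, of d 1] ab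
    unfolding tensor_def pure_tensor_def
    by (simp add: FP.quotient_smult FP.coset_eq_iff)
next
  fix a b d assume ab: "b \<in> carrier B" "a \<in> carrier A"
  show "pure_tensor A B (d \<odot>\<^bsub>A\<^esub> a) b = d \<odot>\<^bsub>T\<^esub> pure_tensor A B a b"
    using K_smult_left[OF ab(2,1), of d 1] ab
    unfolding tensor_def pure_tensor_def
    by (simp add: FP.quotient_smult FP.coset_eq_iff)
qed simp_all

text \<open>Scalars are absorbed into the left factor of a pure tensor, and zero is the pure tensor
  of two zeros, so sums are the only closure condition.\<close>

lemma tensor_induct [consumes 1, case_names pure add]:
  assumes t: "t \<in> carrier T"
    and pure: "\<And>a b. a \<in> carrier A \<Longrightarrow> b \<in> carrier B \<Longrightarrow> P (pure_tensor A B a b)"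
    and add: "\<And>s t. s \<in> carrier T \<Longrightarrow> t \<in> carrier T \<Longrightarrow> P s \<Longrightarrow> P t \<Longrightarrow> P (s \<oplus>\<^bsub>T\<^esub> t)"
  shows "P t"
proof -
  interpret T: kmod T by (rule kmod_tensor)
  have pz: "pure_tensor A B \<zero>\<^bsub>A\<^esub> \<zero>\<^bsub>B\<^esub> = \<zero>\<^bsub>T\<^esub>"
    by (rule k_linear_zero[OF _ kmod_tensor bilin_right[OF bilin_pure]]) (auto intro: B.kmod_axioms)
  from t obtain f where f: "keys f \<subseteq> carrier A \<times> carrier B" "t = K +>\<^bsub>FP\<^esub> f"
    by (auto simp: tensor_def FP.quotient_carrier)
  from f(1) have "P (K +>\<^bsub>FP\<^esub> f)"
  proof (induction f rule: pm_induct)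
    case zero
    then show ?case
      using pure[of "\<zero>\<^bsub>A\<^esub>" "\<zero>\<^bsub>B\<^esub>"] pz FP.coset_zero by (simp add: tensor_def)
  next
    case (add s c h)
    obtain a b where s: "s = (a, b)" "a \<in> carrier A" "b \<in> carrier B" using add.hyps by auto
    have "K +>\<^bsub>FP\<^esub> single s c = c \<odot>\<^bsub>T\<^esub> pure_tensor A B a b"
      using s by (simp add: tensor_def pure_tensor_def FP.quotient_smult)
    also have "\<dots> = pure_tensor A B (c \<odot>\<^bsub>A\<^esub> a) b"
      using k_linear_smult[OF bilin_left[OF bilin_pure]] s by simp
    finally have 1: "K +>\<^bsub>FP\<^esub> single s c = pure_tensor A B (c \<odot>\<^bsub>A\<^esub> a) b" .
    have 2: "K +>\<^bsub>FP\<^esub> (single s c + h) = (K +>\<^bsub>FP\<^esub> single s c) \<oplus>\<^bsub>T\<^esub> (K +>\<^bsub>FP\<^esub> h)"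
      using s add.hyps by (simp add: tensor_def FP.quotient_add)
    show ?case
      unfolding 2 unfolding 1
      by (rule assms(3)) (use s add pure in \<open>auto simp: tensor_def[of A B] FP.quotient_carrier\<close>,
          auto simp: pure_tensor_def)
  qed
  then show ?thesis using f(2) by simp
qed

lemma tensor_lift:
  assumes "kmod M" "bilin A B M \<beta>"
  shows tensor_lift_pure:
      "a \<in> carrier A \<Longrightarrow> b \<in> carrier B \<Longrightarrow> tensor_lift M \<beta> (pure_tensor A B a b) = \<beta> a b"
    and tensor_lift_linear: "k_linear T M (tensor_lift M \<beta>)"
proof -
  interpret M: kmod M by fact
  let ?L = "linear_extension M (\<lambda>(a, b). \<beta> a b)"
  have cl: "(\<lambda>(a, b). \<beta> a b) \<in> keys f \<rightarrow> carrier M" if "keys f \<subseteq> carrier A \<times> carrier B" for f :: "'a \<times> 'b \<Rightarrow>\<^sub>0 'k"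
    using that bilin_closed[OF assms(2)] by auto
  have lin: "k_linear FP M ?L"
    by (rule k_linearI) (auto simp: M.lin_ext_closed M.lin_ext_add M.lin_ext_smult cl)
  have sing: "?L (single (a, b) c) = c \<odot>\<^bsub>M\<^esub> \<beta> a b" if "a \<in> carrier A" "b \<in> carrier B" for a b c
    using that bilin_closed[OF assms(2)] by (subst M.lin_ext_single) auto
  have diff: "?L (f - h) = ?L f \<oplus>\<^bsub>M\<^esub> \<ominus>\<^bsub>M\<^esub> ?L h"
    if "keys f \<subseteq> carrier A \<times> carrier B" "keys h \<subseteq> carrier A \<times> carrier B" for f h
    using cl[OF that(1)] cl[OF that(2)] by (rule M.lin_ext_diff)
  have ker: "?L j = \<zero>\<^bsub>M\<^esub>" if "j \<in> K" for j
  proof -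
    let ?U = "{f \<in> carrier FP. ?L f = \<zero>\<^bsub>M\<^esub>}"
    have "pm.subspace ?U"
    proof (rule pm.subspaceI)
      show "x + y \<in> ?U" if "x \<in> ?U" "y \<in> ?U" for x y
        using that k_linear_add[OF lin] keys_add[of x y] by auto
      show "Poly_Mapping.map ((*) c) x \<in> ?U" if "x \<in> ?U" for c x
        using that k_linear_smult[OF lin, of x c] keys_pscale[of c x] by auto
    qed simp
    moreover have "bilinearity_relations A B \<subseteq> ?U"
    proof
      fix r assume r: "r \<in> bilinearity_relations A B"
      have "?L r = \<zero>\<^bsub>M\<^esub>"
        using r unfolding bilinearity_relations_def
      proof (elim UnE CollectE exE conjE, goal_cases)
        case (1 a a' b)
        then show ?case
          using k_linear_add[OF bilin_left[OF assms(2)], of b a a'] bilin_closed[OF assms(2)]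
          by (simp add: diff sing M.minus_add M.a_ac M.r_neg M.r_neg1)
      next
        case (2 a b b')
        then show ?case
          using k_linear_add[OF bilin_right[OF assms(2)], of a b b'] bilin_closed[OF assms(2)]
          by (simp add: diff sing M.minus_add M.a_ac M.r_neg M.r_neg1)
      next
        case (3 c a b)
        then show ?case
          using k_linear_smult[OF bilin_left[OF assms(2)], of b a c] bilin_closed[OF assms(2)]
          by (simp add: diff sing M.r_neg)
      next
        case (4 c a b)
        then show ?case
          using k_linear_smult[OF bilin_right[OF assms(2)], of a b c] bilin_closed[OF assms(2)]
          by (simp add: diff sing M.r_neg)
      qed
      then show "r \<in> ?U" using r relations_carrier by auto
    qed
    ultimately have "K \<subseteq> ?U" unfolding tensor_kernel_def by (rule pm.span_minimal[rotated])
    then show ?thesis using that by auto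
  qed
  show "tensor_lift M \<beta> (pure_tensor A B a b) = \<beta> a b" if "a \<in> carrier A" "b \<in> carrier B"
    unfolding tensor_lift_def pure_tensor_def
    using that bilin_closed[OF assms(2) that]
    by (subst FP.on_cosets_linear(1)[OF assms(1) lin ker]) (auto simp: sing)
  show "k_linear T M (tensor_lift M \<beta>)"
    unfolding tensor_lift_def tensor_def
    by (rule FP.on_cosets_linear(2)[OF assms(1) lin ker])
qed

lemma tensor_linear_eq:
  assumes "k_linear T N f" "k_linear T N h" "t \<in> carrier T"
    and "\<And>a b. a \<in> carrier A \<Longrightarrow> b \<in> carrier B \<Longrightarrow> f (pure_tensor A B a b) = h (pure_tensor A B a b)"
  shows "f t = h t"
  using assms(3)
  by (induction t rule: tensor_induct)
    (auto simp: assms(4) k_linear_add[OF assms(1)] k_linear_add[OF assms(2)])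

end

lemma kmod_tensor: "kmod A \<Longrightarrow> kmod B \<Longrightarrow> kmod (tensor A B)"
  by (rule kmod_pair.kmod_tensor) (rule kmod_pair.intro)

lemma tensor_map:
  assumes "kmod A" "kmod B" "kmod C" "kmod D" "k_linear A C f" "k_linear B D h"
  shows tensor_map_pure: "a \<in> carrier A \<Longrightarrow> b \<in> carrier B \<Longrightarrow>
      tensor_map C D f h (pure_tensor A B a b) = pure_tensor C D (f a) (h b)"
    and tensor_map_linear: "k_linear (tensor A B) (tensor C D) (tensor_map C D f h)"
proof -
  interpret AB: kmod_pair A B using assms by (simp add: kmod_pair.intro)
  interpret CD: kmod_pair C D using assms by (simp add: kmod_pair.intro)
  have *: "bilin A B (tensor C D) (\<lambda>a b. pure_tensor C D (f a) (h b))"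
    by (rule bilin_comp[OF CD.bilin_pure assms(5,6)])
  show "a \<in> carrier A \<Longrightarrow> b \<in> carrier B \<Longrightarrow>
      tensor_map C D f h (pure_tensor A B a b) = pure_tensor C D (f a) (h b)"
    "k_linear (tensor A B) (tensor C D) (tensor_map C D f h)"
    unfolding tensor_map_def
    using AB.tensor_lift[OF CD.kmod_tensor *] by auto
qed

lemma tensor_map_comp:
  assumes "kmod A" "kmod B" "kmod C" "kmod D" "kmod C'" "kmod D'"
    "k_linear A C f" "k_linear B D h" "k_linear C C' f'" "k_linear D D' h'" "t \<in> carrier (tensor A B)"
  shows "tensor_map C' D' f' h' (tensor_map C D f h t) = tensor_map C' D' (\<lambda>x. f' (f x)) (\<lambda>x. h' (h x)) t"
proof -
  interpret AB: kmod_pair A B using assms by (simp add: kmod_pair.intro)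
  note 1 = k_linear_comp[OF assms(7,9)] and 2 = k_linear_comp[OF assms(8,10)]
  show ?thesis
    by (rule AB.tensor_linear_eq[OF k_linear_comp[OF tensor_map_linear tensor_map_linear]
          tensor_map_linear, OF assms(1-4,7,8) assms(3-6,9,10) assms(1,2,5,6) 1 2 assms(11)])
      (use assms in \<open>auto simp: tensor_map_pure[OF assms(1-4,7,8)] tensor_map_pure[OF assms(3-6,9,10)]
        tensor_map_pure[OF assms(1,2,5,6) 1 2] k_linear_closed\<close>)
qed

lemma tensor_map_lift:
  assumes "kmod A" "kmod B" "kmod C" "kmod D" "kmod M"
    "k_linear A C f" "k_linear B D h" "bilin C D M \<beta>" "t \<in> carrier (tensor A B)"
  shows "tensor_lift M \<beta> (tensor_map C D f h t) = tensor_lift M (\<lambda>a b. \<beta> (f a) (h b)) t"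
proof -
  interpret AB: kmod_pair A B using assms by (simp add: kmod_pair.intro)
  interpret CD: kmod_pair C D using assms by (simp add: kmod_pair.intro)
  note b = bilin_comp[OF assms(8,6,7)]
  show ?thesis
    by (rule AB.tensor_linear_eq[OF k_linear_comp[OF tensor_map_linear CD.tensor_lift_linear]
          AB.tensor_lift_linear, OF assms(1-4,6,7) assms(5,8) assms(5) b assms(9)])
      (use assms in \<open>auto simp: tensor_map_pure[OF assms(1-4,6,7)] AB.tensor_lift_pure[OF assms(5) b]
        CD.tensor_lift_pure[OF assms(5,8)] k_linear_closed\<close>)
qed

text \<open>Surjectivity passes to tensor products over any \<open>k\<close>. Injectivity does not,
  and where the coactions on \<open>gr\<close> require it, the projections \<open>pr\<close> below
  have to supply it.\<close>

lemma tensor_map_surj: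
  assumes "kmod A" "kmod B" "kmod C" "kmod D" "k_linear A C f" "k_linear B D h"
    "f ` carrier A = carrier C" "h ` carrier B = carrier D"
  shows "tensor_map C D f h ` carrier (tensor A B) = carrier (tensor C D)"
proof -
  interpret AB: kmod_pair A B using assms by (simp add: kmod_pair.intro)
  interpret CD: kmod_pair C D using assms by (simp add: kmod_pair.intro)
  interpret T: kmod "tensor A B" by (rule AB.kmod_tensor)
  note tm = tensor_map[OF assms(1-6)]
  have "t \<in> tensor_map C D f h ` carrier (tensor A B)" if "t \<in> carrier (tensor C D)" for t
    using that
  proof (induction t rule: CD.tensor_induct)
    case (pure c d)
    then have "c \<in> f ` carrier A" "d \<in> h ` carrier B" by (simp_all only: assms(7,8))
    then obtain a b where ab: "a \<in> carrier A" "c = f a" "b \<in> carrier B" "d = h b"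
      by (elim imageE)
    then show ?case using tm(1)[of a b] AB.pure_closed[of a b]
      by (intro image_eqI[of _ _ "pure_tensor A B a b"]) simp_all
  next
    case (add s t)
    then obtain x y where "s = tensor_map C D f h x" "x \<in> carrier (tensor A B)"
      "t = tensor_map C D f h y" "y \<in> carrier (tensor A B)" by (elim imageE)
    then show ?case
      using k_linear_add[OF tm(2), of x y] T.a_closed[of x y]
      by (intro image_eqI[of _ _ "x \<oplus>\<^bsub>tensor A B\<^esub> y"]) simp_all
  qed
  then show ?thesis using k_linear_closed[OF tm(2)] by blast
qed

section \<open>Tensor products of algebras\<close>

locale kalg_pair = A: kalg A + B: kalg B
  for A :: "('k::comm_ring_1, 'a, 'm) module_scheme" and B :: "('k, 'b, 'n) module_scheme"
begin

sublocale kmod_pair A B ..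

lemma kalg_FP: "kalg FP"
  unfolding free_on_pairs_def
  by (rule twist.kalg_T, unfold_locales) (auto simp: A.m_assoc B.m_assoc)

lemma FP_mult_single: "single (a, b) c \<otimes>\<^bsub>FP\<^esub> single (a', b') d = single (a \<otimes>\<^bsub>A\<^esub> a', b \<otimes>\<^bsub>B\<^esub> b') (c * d)"
  by (simp add: free_on_pairs_def)

lemma FP_mult_diff:
  "x \<otimes>\<^bsub>FP\<^esub> (y - z) = x \<otimes>\<^bsub>FP\<^esub> y - x \<otimes>\<^bsub>FP\<^esub> z" "(y - z) \<otimes>\<^bsub>FP\<^esub> x = y \<otimes>\<^bsub>FP\<^esub> x - z \<otimes>\<^bsub>FP\<^esub> x"
  by (simp_all add: free_on_pairs_def twisted_mult_diff_left twisted_mult_diff_right)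

lemma relation_mult:
  assumes "r \<in> bilinearity_relations A B" "a \<in> carrier A" "b \<in> carrier B"
  shows "single (a, b) c \<otimes>\<^bsub>FP\<^esub> r \<in> K" "r \<otimes>\<^bsub>FP\<^esub> single (a, b) c \<in> K"
  using assms unfolding bilinearity_relations_def
  by (auto simp: FP_mult_single FP_mult_diff A.r_distr A.l_distr B.r_distr B.l_distr
      A.smult_mult_left A.smult_mult_right B.smult_mult_left B.smult_mult_right
      K_add_left K_add_right K_smult_left K_smult_right mult.commute[of _ c])

lemma ideal_K: "ideal K FP"
proof -
  interpret R: kalg FP by (rule kalg_FP)
  \<comment> \<open>The elements whose products with everything, from both sides, fall into
    \<open>K\<close>. Being a subspace, this set contains \<open>K\<close> as soon as it contains
    the bilinearity relations.\<close>
  let ?U = "{r \<in> carrier FP. \<forall>x\<in>carrier FP. x \<otimes>\<^bsub>FP\<^esub> r \<in> K \<and> r \<otimes>\<^bsub>FP\<^esub> x \<in> K}"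
  have "pm.subspace ?U"
  proof (rule pm.subspaceI)
    show "x + y \<in> ?U" if "x \<in> ?U" "y \<in> ?U" for x y
      using that FP.add.m_closed[of x y] R.r_distr[of x y] R.l_distr[of x y] K_add by auto
    show "Poly_Mapping.map ((*) c) x \<in> ?U" if "x \<in> ?U" for c x
      using that FP.smult_closed[of x c] R.smult_mult_left[of x _ c] R.smult_mult_right[of _ x c]
        K_scale by auto
  qed (use FP.zero_mem in \<open>auto simp: free_on_pairs_def\<close>)
  moreover have "bilinearity_relations A B \<subseteq> ?U"
  proof
    fix r assume r: "r \<in> bilinearity_relations A B"
    have "x \<otimes>\<^bsub>FP\<^esub> r \<in> K \<and> r \<otimes>\<^bsub>FP\<^esub> x \<in> K" if "keys x \<subseteq> carrier A \<times> carrier B" for x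
      using that
    proof (induction x rule: pm_induct)
      case zero
      then show ?case using FP.zero_mem by (simp add: free_on_pairs_def)
    next
      case (add s c h)
      then show ?case
        using relation_mult[OF r, of "fst s" "snd s" c] K_add
        by (auto simp: free_on_pairs_def twisted_mult_add_left twisted_mult_add_right)
    qed
    then show "r \<in> ?U" using r relations_carrier by auto
  qed
  ultimately have "K \<subseteq> ?U" unfolding tensor_kernel_def by (rule pm.span_minimal[rotated])
  moreover have "additive_subgroup K FP"
    by (intro additive_subgroup.intro subgroup.intro)
      (use K_carrier K_zero K_add FP.minus_mem in \<open>auto simp: a_inv_def\<close>)
  ultimately show ?thesis
    by (intro ideal.intro ideal_axioms.intro R.ring_axioms) auto
qed

lemma kalg_tensor: "kalg T"
  unfolding tensor_def by (rule kalg_quotient[OF kalg_FP ideal_K])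

lemma pure_mult:
  assumes "a \<in> carrier A" "b \<in> carrier B" "a' \<in> carrier A" "b' \<in> carrier B"
  shows "pure_tensor A B a b \<otimes>\<^bsub>T\<^esub> pure_tensor A B a' b' = pure_tensor A B (a \<otimes>\<^bsub>A\<^esub> a') (b \<otimes>\<^bsub>B\<^esub> b')"
  unfolding tensor_def pure_tensor_def
  using assms by (subst quotient_mult[OF ideal_K]) (auto simp: FP_mult_single)

lemma tensor_one: "\<one>\<^bsub>T\<^esub> = pure_tensor A B \<one>\<^bsub>A\<^esub> \<one>\<^bsub>B\<^esub>"
  by (simp add: tensor_def pure_tensor_def quotient_one)

lemma tensor_algebra_homI:
  assumes "kalg M" and f: "k_linear T M f"
    and one: "f (pure_tensor A B \<one>\<^bsub>A\<^esub> \<one>\<^bsub>B\<^esub>) = \<one>\<^bsub>M\<^esub>"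
    and mult: "\<And>a b a' b'. a \<in> carrier A \<Longrightarrow> b \<in> carrier B \<Longrightarrow> a' \<in> carrier A \<Longrightarrow> b' \<in> carrier B \<Longrightarrow>
      f (pure_tensor A B (a \<otimes>\<^bsub>A\<^esub> a') (b \<otimes>\<^bsub>B\<^esub> b'))
        = f (pure_tensor A B a b) \<otimes>\<^bsub>M\<^esub> f (pure_tensor A B a' b')"
  shows "algebra_hom T M f"
proof (rule algebra_homI[OF f])
  interpret T: kalg T by (rule kalg_tensor)
  interpret M: kalg M by fact
  show "f \<one>\<^bsub>T\<^esub> = \<one>\<^bsub>M\<^esub>" by (simp add: tensor_one one)
  fix s t assume "s \<in> carrier T" and t: "t \<in> carrier T"
  then show "f (s \<otimes>\<^bsub>T\<^esub> t) = f s \<otimes>\<^bsub>M\<^esub> f t"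
  proof (induction s rule: tensor_induct)
    case (pure a b)
    from t show ?case
    proof (induction t rule: tensor_induct)
      case (pure a' b')
      then show ?case using \<open>a \<in> carrier A\<close> \<open>b \<in> carrier B\<close> by (simp add: pure_mult mult)
    next
      case (add u v)
      then show ?case using \<open>a \<in> carrier A\<close> \<open>b \<in> carrier B\<close>
        by (simp add: k_linear_add[OF f] T.r_distr M.r_distr k_linear_closed[OF f])
    qed
  next
    case (add u v)
    then show ?case using t
      by (simp add: k_linear_add[OF f] T.l_distr M.l_distr k_linear_closed[OF f])
  qed
qed

end

lemma kalg_tensor: "kalg A \<Longrightarrow> kalg B \<Longrightarrow> kalg (tensor A B)"
  by (rule kalg_pair.kalg_tensor) (rule kalg_pair.intro)

lemma tensor_map_algebra_hom:
  assumes "kalg A" "kalg B" "kalg C" "kalg D" "algebra_hom A C f" "algebra_hom B D h"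
  shows "algebra_hom (tensor A B) (tensor C D) (tensor_map C D f h)"
proof -
  interpret AB: kalg_pair A B using assms by (simp add: kalg_pair.intro)
  interpret CD: kalg_pair C D using assms by (simp add: kalg_pair.intro)
  note m = AB.A.kmod_axioms AB.B.kmod_axioms CD.A.kmod_axioms CD.B.kmod_axioms
    algebra_hom_linear[OF assms(5)] algebra_hom_linear[OF assms(6)]
  show ?thesis
    by (rule AB.tensor_algebra_homI[OF CD.kalg_tensor tensor_map_linear[OF m]])
       (auto simp: tensor_map_pure[OF m] CD.tensor_one algebra_hom_one[OF assms(5)]
         algebra_hom_one[OF assms(6)] algebra_hom_mult[OF assms(5)] algebra_hom_mult[OF assms(6)]
         CD.pure_mult k_linear_closed[OF m(5)] k_linear_closed[OF m(6)])
qed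

lemma k_linear_fun_add:
  assumes "kmod N" "k_linear M N f" "k_linear M N h" shows "k_linear M N (\<lambda>x. f x \<oplus>\<^bsub>N\<^esub> h x)"
proof -
  interpret kmod N by fact
  show ?thesis
    by (rule k_linearI)
      (auto simp: k_linear_closed[OF assms(2)] k_linear_closed[OF assms(3)] k_linear_add[OF assms(2)]
        k_linear_add[OF assms(3)] k_linear_smult[OF assms(2)] k_linear_smult[OF assms(3)]
        smult_r_distr a_ac)
qed

section \<open>Associativity of the tensor product\<close>

locale kmod_triple = A: kmod A + B: kmod B + C: kmod C
  for A :: "('k::comm_ring_1, 'a, 'm) module_scheme" and B :: "('k, 'b, 'n) module_scheme"
    and C :: "('k, 'c, 'o) module_scheme"
begin

sublocale AB: kmod_pair A B ..
sublocale BC: kmod_pair B C ..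
sublocale AB_C: kmod_pair "tensor A B" C
  by (intro kmod_pair.intro AB.kmod_tensor C.kmod_axioms)
sublocale A_BC: kmod_pair A "tensor B C"
  by (intro kmod_pair.intro BC.kmod_tensor A.kmod_axioms)

lemma tensor_induct3 [consumes 1, case_names pure add]:
  assumes "t \<in> carrier (tensor (tensor A B) C)"
    and "\<And>a b c. a \<in> carrier A \<Longrightarrow> b \<in> carrier B \<Longrightarrow> c \<in> carrier C \<Longrightarrow>
      P (pure_tensor (tensor A B) C (pure_tensor A B a b) c)"
    and "\<And>s t. s \<in> carrier (tensor (tensor A B) C) \<Longrightarrow> t \<in> carrier (tensor (tensor A B) C) \<Longrightarrow>
      P s \<Longrightarrow> P t \<Longrightarrow> P (s \<oplus>\<^bsub>tensor (tensor A B) C\<^esub> t)"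
  shows "P t"
  using assms(1)
proof (induction t rule: AB_C.tensor_induct)
  case (pure s c)
  then show ?case
  proof (induction s rule: AB.tensor_induct)
    case (add s t)
    then show ?case
      by (simp add: k_linear_add[OF bilin_left[OF AB_C.bilin_pure]] assms(3))
  qed (rule assms(2))
qed (rule assms(3))

lemma tensor_linear_eq3:
  assumes "k_linear (tensor (tensor A B) C) N f" "k_linear (tensor (tensor A B) C) N h"
    "t \<in> carrier (tensor (tensor A B) C)"
    and "\<And>a b c. a \<in> carrier A \<Longrightarrow> b \<in> carrier B \<Longrightarrow> c \<in> carrier C \<Longrightarrow>
      f (pure_tensor (tensor A B) C (pure_tensor A B a b) c)
      = h (pure_tensor (tensor A B) C (pure_tensor A B a b) c)"
  shows "f t = h t"
  using assms(3)
  by (induction t rule: tensor_induct3)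
    (auto simp: assms(4) k_linear_add[OF assms(1)] k_linear_add[OF assms(2)])

lemma tensor_assoc_pure: "a \<in> carrier A \<Longrightarrow> b \<in> carrier B \<Longrightarrow> c \<in> carrier C \<Longrightarrow>
    tensor_assoc A B C (pure_tensor (tensor A B) C (pure_tensor A B a b) c)
      = pure_tensor A (tensor B C) a (pure_tensor B C b c)"
  and tensor_assoc_linear:
    "k_linear (tensor (tensor A B) C) (tensor A (tensor B C)) (tensor_assoc A B C)"
proof -
  let ?M = "tensor A (tensor B C)"
  let ?\<beta> = "\<lambda>c a b. pure_tensor A (tensor B C) a (pure_tensor B C b c)"
  let ?\<gamma> = "\<lambda>t c. tensor_lift ?M (?\<beta> c) t"
  have 1: "bilin A B ?M (?\<beta> c)" if "c \<in> carrier C" for c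
    by (rule bilin_comp[OF A_BC.bilin_pure k_linear_id(2) bilin_left[OF BC.bilin_pure that]])
  \<comment> \<open>The third argument sits inside the bilinear map that is lifted, so linearity in
    it cannot be read off the lift; it is proved by induction on the tensor.\<close>
  have 2: "k_linear C ?M (?\<gamma> t)" if "t \<in> carrier (tensor A B)" for t
    using that
  proof (induction t rule: AB.tensor_induct)
    case (pure a b)
    have l: "k_linear C ?M (\<lambda>c. ?\<beta> c a b)"
      by (rule k_linear_comp[OF bilin_right[OF BC.bilin_pure] bilin_right[OF A_BC.bilin_pure]]) (fact pure)+
    show ?case
      by (rule k_linear_cong[OF C.kmod_axioms _ l]) (use pure in \<open>simp add: AB.tensor_lift_pure[OF A_BC.kmod_tensor 1]\<close>)
  next
    case (add s t)
    have "?\<gamma> (s \<oplus>\<^bsub>tensor A B\<^esub> t) c = ?\<gamma> s c \<oplus>\<^bsub>?M\<^esub> ?\<gamma> t c" if "c \<in> carrier C" for c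
      by (rule k_linear_add[OF AB.tensor_lift_linear[OF A_BC.kmod_tensor 1]]) (fact that add)+
    then show ?case
      by (rule k_linear_cong[OF C.kmod_axioms _ k_linear_fun_add[OF A_BC.kmod_tensor add(3,4)]])
  qed
  have 3: "bilin (tensor A B) C ?M ?\<gamma>"
    by (rule bilinI[OF 2 AB.tensor_lift_linear[OF A_BC.kmod_tensor 1]])
  show "k_linear (tensor (tensor A B) C) (tensor A (tensor B C)) (tensor_assoc A B C)"
    unfolding tensor_assoc_def by (rule AB_C.tensor_lift_linear[OF A_BC.kmod_tensor 3])
  show "tensor_assoc A B C (pure_tensor (tensor A B) C (pure_tensor A B a b) c)
      = pure_tensor A (tensor B C) a (pure_tensor B C b c)"
    if "a \<in> carrier A" "b \<in> carrier B" "c \<in> carrier C"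
    unfolding tensor_assoc_def using that
    by (simp add: AB_C.tensor_lift_pure[OF A_BC.kmod_tensor 3] AB.tensor_lift_pure[OF A_BC.kmod_tensor 1])
qed

end

lemma tensor_assoc_algebra_hom:
  assumes "kalg A" "kalg B" "kalg C"
  shows "algebra_hom (tensor (tensor A B) C) (tensor A (tensor B C)) (tensor_assoc A B C)"
proof -
  interpret A: kalg A by fact
  interpret B: kalg B by fact
  interpret C: kalg C by fact
  interpret AB: kalg_pair A B ..
  interpret BC: kalg_pair B C ..
  interpret AB_C: kalg_pair "tensor A B" C by (intro kalg_pair.intro AB.kalg_tensor assms)
  interpret A_BC: kalg_pair A "tensor B C" by (intro kalg_pair.intro BC.kalg_tensor assms)
  interpret kmod_triple A B C ..
  interpret L: kalg "tensor (tensor A B) C" by (rule AB_C.kalg_tensor)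
  interpret R: kalg "tensor A (tensor B C)" by (rule A_BC.kalg_tensor)
  note cl = k_linear_closed[OF tensor_assoc_linear] and ad = k_linear_add[OF tensor_assoc_linear]
  show ?thesis
  proof (rule algebra_homI[OF tensor_assoc_linear])
    show "tensor_assoc A B C \<one>\<^bsub>tensor (tensor A B) C\<^esub> = \<one>\<^bsub>tensor A (tensor B C)\<^esub>"
      by (simp add: AB_C.tensor_one AB.tensor_one A_BC.tensor_one BC.tensor_one tensor_assoc_pure)
    fix s t assume "s \<in> carrier (tensor (tensor A B) C)" and t: "t \<in> carrier (tensor (tensor A B) C)"
    then show "tensor_assoc A B C (s \<otimes>\<^bsub>tensor (tensor A B) C\<^esub> t)
      = tensor_assoc A B C s \<otimes>\<^bsub>tensor A (tensor B C)\<^esub> tensor_assoc A B C t"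
    proof (induction s rule: tensor_induct3)
      case (pure a b c)
      note abc = this
      from t show ?case
      proof (induction t rule: tensor_induct3)
        case (pure a' b' c')
        then show ?case using abc
          by (simp add: AB_C.pure_mult AB.pure_mult A_BC.pure_mult BC.pure_mult tensor_assoc_pure)
      next
        case (add u v)
        then show ?case using abc by (simp add: L.r_distr R.r_distr ad cl)
      qed
    next
      case (add u v)
      then show ?case using t by (simp add: L.l_distr R.l_distr ad cl)
    qed
  qed
qed

section \<open>Quotients of a Hopf algebra\<close>

context kmod_pair
begin

lemma tensor_lift_cong:
  assumes "kmod M" "bilin A B M \<beta>" "t \<in> carrier T"
    and "\<And>a b. a \<in> carrier A \<Longrightarrow> b \<in> carrier B \<Longrightarrow> \<beta>' a b = \<beta> a b"
  shows "tensor_lift M \<beta>' t = tensor_lift M \<beta> t"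
proof -
  have "bilin A B M \<beta>'"
    by (intro bilinI k_linear_cong[OF B.kmod_axioms _ bilin_right[OF assms(2)]]
        k_linear_cong[OF A.kmod_axioms _ bilin_left[OF assms(2)]]) (auto simp: assms(4))
  note l = tensor_lift[OF assms(1) this] and l' = tensor_lift[OF assms(1,2)]
  show ?thesis
    by (rule tensor_linear_eq[OF l(2) l'(2) assms(3)]) (simp add: l(1) l'(1) assms(4))
qed

lemma linear_tensor_lift:
  assumes "kmod M" "kmod N" "bilin A B M \<beta>" "k_linear M N f" "t \<in> carrier T"
  shows "f (tensor_lift M \<beta> t) = tensor_lift N (\<lambda>a b. f (\<beta> a b)) t"
proof -
  note l = tensor_lift[OF assms(1,3)] and l' = tensor_lift[OF assms(2) bilin_linear[OF assms(3,4)]]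
  show ?thesis
    by (rule tensor_linear_eq[OF k_linear_comp[OF l(2) assms(4)] l'(2) assms(5)]) (simp add: l(1) l'(1))
qed

lemma tensor_map_cong:
  assumes "kmod C" "kmod D" "k_linear A C f" "k_linear B D h" "t \<in> carrier T"
    and "\<And>a. a \<in> carrier A \<Longrightarrow> f' a = f a" "\<And>b. b \<in> carrier B \<Longrightarrow> h' b = h b"
  shows "tensor_map C D f' h' t = tensor_map C D f h t"
  unfolding tensor_map_def
proof (rule tensor_lift_cong)
  interpret CD: kmod_pair C D using assms by (simp add: kmod_pair.intro)
  show "kmod (tensor C D)" by (rule CD.kmod_tensor)
  show "bilin A B (tensor C D) (\<lambda>a b. pure_tensor C D (f a) (h b))"
    by (rule bilin_comp[OF CD.bilin_pure assms(3,4)])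
qed (use assms in auto)

end

text \<open>The homomorphism theorem for an arbitrary epimorphism \<open>t\<close> in place of a
  coset projection: values are defined by choosing preimages, and \<open>ker\<close> removes the
  dependence on the choice. It produces the cleaving maps, their convolution inverses and the counit
  of \<open>A\<close>.\<close>

lemma surj_factor:
  assumes "kmod F" "kmod H" "kmod A" "k_linear F H t" "t ` carrier F = carrier H" "k_linear F A s"
    and ker: "\<And>f. f \<in> carrier F \<Longrightarrow> t f = \<zero>\<^bsub>H\<^esub> \<Longrightarrow> s f = \<zero>\<^bsub>A\<^esub>"
  obtains \<phi> where "k_linear H A \<phi>" "\<And>f. f \<in> carrier F \<Longrightarrow> \<phi> (t f) = s f"
proof -
  interpret F: kmod F by fact
  interpret H: kmod H by fact
  interpret A: kmod A by fact
  define \<phi> where "\<phi> x = s (SOME f. f \<in> carrier F \<and> t f = x)" for x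
  have \<phi>: "\<phi> (t f) = s f" if f: "f \<in> carrier F" for f
  proof -
    define f' where "f' = (SOME f'. f' \<in> carrier F \<and> t f' = t f)"
    have f': "f' \<in> carrier F" "t f' = t f"
      using someI[of "\<lambda>f'. f' \<in> carrier F \<and> t f' = t f" f] f by (auto simp: f'_def)
    have "t (f' \<oplus>\<^bsub>F\<^esub> \<ominus>\<^bsub>F\<^esub> f) = \<zero>\<^bsub>H\<^esub>"
      using f f' k_linear_closed[OF assms(4)]
      by (simp add: k_linear_add[OF assms(4)] k_linear_minus[OF assms(1,2,4)] H.r_neg)
    moreover have "f' \<oplus>\<^bsub>F\<^esub> \<ominus>\<^bsub>F\<^esub> f \<in> carrier F" using f f'(1) by simp
    ultimately have "s (f' \<oplus>\<^bsub>F\<^esub> \<ominus>\<^bsub>F\<^esub> f) = \<zero>\<^bsub>A\<^esub>" by (intro ker)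
    then have "s f' = s f"
      using f f'(1) k_linear_closed[OF assms(6)] A.eq_iff_minus[of "s f'" "s f"]
      by (simp add: k_linear_add[OF assms(6)] k_linear_minus[OF assms(1,3,6)])
    then show ?thesis by (simp add: \<phi>_def f'_def)
  qed
  have "k_linear H A \<phi>"
  proof (rule k_linearI)
    fix x assume "x \<in> carrier H"
    then have "x \<in> t ` carrier F" by (simp only: assms(5))
    then obtain f where f: "x = t f" "f \<in> carrier F" by (elim imageE)
    then show "\<phi> x \<in> carrier A" using k_linear_closed[OF assms(6)] by (simp add: \<phi>)
    show "\<phi> (c \<odot>\<^bsub>H\<^esub> x) = c \<odot>\<^bsub>A\<^esub> \<phi> x" for c
      using f by (simp add: k_linear_smult[OF assms(4), symmetric] \<phi> k_linear_smult[OF assms(6)])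
    fix y assume "y \<in> carrier H"
    then have "y \<in> t ` carrier F" by (simp only: assms(5))
    then obtain h where h: "y = t h" "h \<in> carrier F" by (elim imageE)
    then show "\<phi> (x \<oplus>\<^bsub>H\<^esub> y) = \<phi> x \<oplus>\<^bsub>A\<^esub> \<phi> y"
      using f by (simp add: k_linear_add[OF assms(4), symmetric] \<phi> k_linear_add[OF assms(6)])
  qed
  with \<phi> show thesis using that by blast
qed

text \<open>The record of \<open>F\<close> has no coalgebra fields, so its Hopf structure enters as
  separate functions. Each axiom of a quotient is then an identity of \<open>F\<close> pushed
  forward along an epimorphism.\<close>

locale hopf_data = F: kalg F for F :: "('k::comm_ring_1, 'f, 'm) module_scheme" +
  fixes \<Delta> :: "'f \<Rightarrow> ('f \<times> 'f \<Rightarrow>\<^sub>0 'k) set" and \<epsilon> :: "'f \<Rightarrow> 'k" and S :: "'f \<Rightarrow> 'f"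
  assumes \<Delta>: "algebra_hom F (tensor F F) \<Delta>" and \<epsilon>: "algebra_hom F base_ring \<epsilon>"
    and coassoc: "h \<in> carrier F \<Longrightarrow>
      tensor_assoc F F F (tensor_map (tensor F F) F \<Delta> id (\<Delta> h)) = tensor_map F (tensor F F) id \<Delta> (\<Delta> h)"
    and counit_left: "h \<in> carrier F \<Longrightarrow> tensor_lift F (\<lambda>a b. \<epsilon> a \<odot>\<^bsub>F\<^esub> b) (\<Delta> h) = h"
    and counit_right: "h \<in> carrier F \<Longrightarrow> tensor_lift F (\<lambda>a b. \<epsilon> b \<odot>\<^bsub>F\<^esub> a) (\<Delta> h) = h"
    and S: "k_linear F F S"
    and antipode_right: "h \<in> carrier F \<Longrightarrow>
      tensor_lift F (\<lambda>a b. a \<otimes>\<^bsub>F\<^esub> S b) (\<Delta> h) = \<epsilon> h \<odot>\<^bsub>F\<^esub> \<one>\<^bsub>F\<^esub>"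
    and antipode_left: "h \<in> carrier F \<Longrightarrow>
      tensor_lift F (\<lambda>a b. S a \<otimes>\<^bsub>F\<^esub> b) (\<Delta> h) = \<epsilon> h \<odot>\<^bsub>F\<^esub> \<one>\<^bsub>F\<^esub>"
begin

sublocale FF: kalg_pair F F ..

lemma \<Delta>_closed: "f \<in> carrier F \<Longrightarrow> \<Delta> f \<in> carrier (tensor F F)"
  by (rule k_linear_closed[OF algebra_hom_linear[OF \<Delta>]])

definition epi where
  "epi A s \<longleftrightarrow> kalg A \<and> algebra_hom F A s \<and> s ` carrier F = carrier A"

lemma epiD:
  assumes "epi A s"
  shows "kalg A" "kmod A" "algebra_hom F A s" "k_linear F A s" "s ` carrier F = carrier A"
  using assms by (auto simp: epi_def kalg_kmod algebra_hom_linear)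

lemma epi_cases:
  assumes "epi A s" "x \<in> carrier A" obtains f where "f \<in> carrier F" "x = s f"
proof -
  have "x \<in> s ` carrier F" using assms(2) by (simp only: epiD(5)[OF assms(1)])
  then show thesis using that by (elim imageE)
qed

lemma coaction_algebra_hom:
  assumes X: "epi X s" and A: "epi A a" and B: "epi B b"
    and \<delta>: "\<And>f. f \<in> carrier F \<Longrightarrow> \<delta> (s f) = tensor_map A B a b (\<Delta> f)"
  shows "algebra_hom X (tensor A B) \<delta>"
proof -
  note h = algebra_hom_comp[OF \<Delta> tensor_map_algebra_hom[OF F.kalg_axioms F.kalg_axioms epiD(1)[OF A]
        epiD(1)[OF B] epiD(3)[OF A] epiD(3)[OF B]]]
  note hl = algebra_hom_linear[OF h]
  note s = epiD(3)[OF X] epiD(4)[OF X]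
  show ?thesis
  proof (rule algebra_homI[OF k_linearI])
    show "\<delta> x \<in> carrier (tensor A B)" if "x \<in> carrier X" for x
      using X that by (rule epi_cases) (simp add: \<delta> k_linear_closed[OF hl])
    show "\<delta> (c \<odot>\<^bsub>X\<^esub> x) = c \<odot>\<^bsub>tensor A B\<^esub> \<delta> x" if "x \<in> carrier X" for c x
      using X that by (rule epi_cases)
        (simp add: \<delta> k_linear_smult[OF s(2), symmetric] k_linear_smult[OF hl])
    show "\<delta> \<one>\<^bsub>X\<^esub> = \<one>\<^bsub>tensor A B\<^esub>"
      using algebra_hom_one[OF h] \<delta>[of "\<one>\<^bsub>F\<^esub>"] by (simp add: algebra_hom_one[OF s(1)])
    fix x y assume x: "x \<in> carrier X" and y: "y \<in> carrier X"
    from X x obtain f where f: "f \<in> carrier F" "x = s f" by (rule epi_cases)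
    from X y obtain f' where f': "f' \<in> carrier F" "y = s f'" by (rule epi_cases)
    show "\<delta> (x \<oplus>\<^bsub>X\<^esub> y) = \<delta> x \<oplus>\<^bsub>tensor A B\<^esub> \<delta> y"
      using f f' by (simp add: \<delta> k_linear_add[OF s(2), symmetric] k_linear_add[OF hl])
    show "\<delta> (x \<otimes>\<^bsub>X\<^esub> y) = \<delta> x \<otimes>\<^bsub>tensor A B\<^esub> \<delta> y"
      using f f' by (simp add: \<delta> algebra_hom_mult[OF s(1), symmetric] algebra_hom_mult[OF h])
  qed
qed

text \<open>With \<open>A\<close>, \<open>B\<close>, \<open>C\<close>, \<open>P\<close>,
  \<open>Q\<close> chosen among the quotients, this single statement is coassociativity of either
  Hopf algebra, either comodule axiom, and the compatibility of the two coactions.\<close>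

lemma coassoc_transfer:
  assumes A: "epi A a" and B: "epi B b" and C: "epi C c" and P: "epi P p" and Q: "epi Q q"
    and \<delta>P: "\<And>f. f \<in> carrier F \<Longrightarrow> \<delta>P (p f) = tensor_map A B a b (\<Delta> f)"
    and \<delta>Q: "\<And>f. f \<in> carrier F \<Longrightarrow> \<delta>Q (q f) = tensor_map B C b c (\<Delta> f)"
    and f: "f \<in> carrier F"
  shows "tensor_assoc A B C (tensor_map (tensor A B) C \<delta>P id (tensor_map P C p c (\<Delta> f)))
    = tensor_map A (tensor B C) id \<delta>Q (tensor_map A Q a q (\<Delta> f))"
proof -
  interpret A: kmod A by (rule epiD(2)[OF A])
  interpret B: kmod B by (rule epiD(2)[OF B])
  interpret C: kmod C by (rule epiD(2)[OF C])
  interpret P: kmod P by (rule epiD(2)[OF P])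
  interpret Q: kmod Q by (rule epiD(2)[OF Q])
  interpret FFF: kmod_triple F F F ..
  interpret ABC: kmod_triple A B C ..
  note F = F.kmod_axioms and FF = FF.kmod_tensor
  note AB = ABC.AB.kmod_tensor and BC = ABC.BC.kmod_tensor
  note l\<Delta> = algebra_hom_linear[OF \<Delta>]
  note lP = algebra_hom_linear[OF coaction_algebra_hom[OF P A B \<delta>P]]
  note lQ = algebra_hom_linear[OF coaction_algebra_hom[OF Q B C \<delta>Q]]
  note la = epiD(4)[OF A] and lb = epiD(4)[OF B] and lc = epiD(4)[OF C]
    and lp = epiD(4)[OF P] and lq = epiD(4)[OF Q]
  note lab = tensor_map_linear[OF F F A.kmod_axioms B.kmod_axioms la lb]
  note lbc = tensor_map_linear[OF F F B.kmod_axioms C.kmod_axioms lb lc]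
  let ?t = "\<Delta> f"
  have t: "?t \<in> carrier (tensor F F)" by (rule \<Delta>_closed[OF f])
  \<comment> \<open>Naturality of the associativity map; it reduces the claim to coassociativity in
    \<open>F\<close>.\<close>
  have nat: "tensor_assoc A B C (tensor_map (tensor A B) C (tensor_map A B a b) c u)
    = tensor_map A (tensor B C) a (tensor_map B C b c) (tensor_assoc F F F u)"
    if "u \<in> carrier (tensor (tensor F F) F)" for u
    by (rule FFF.tensor_linear_eq3[OF
          k_linear_comp[OF tensor_map_linear[OF FF F AB C.kmod_axioms lab lc] ABC.tensor_assoc_linear]
          k_linear_comp[OF FFF.tensor_assoc_linear tensor_map_linear[OF F FF A.kmod_axioms BC la lbc]] that])
      (simp add: tensor_map_pure[OF FF F AB C.kmod_axioms lab lc] tensor_map_pure[OF F F A.kmod_axioms B.kmod_axioms la lb]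
        FFF.tensor_assoc_pure ABC.tensor_assoc_pure tensor_map_pure[OF F FF A.kmod_axioms BC la lbc]
        tensor_map_pure[OF F F B.kmod_axioms C.kmod_axioms lb lc] k_linear_closed[OF la] k_linear_closed[OF lb]
        k_linear_closed[OF lc])
  have "tensor_map (tensor A B) C \<delta>P id (tensor_map P C p c ?t)
      = tensor_map (tensor A B) C (\<lambda>x. \<delta>P (p x)) (\<lambda>x. id (c x)) ?t"
    by (rule tensor_map_comp[OF F F P.kmod_axioms C.kmod_axioms AB C.kmod_axioms lp lc lP k_linear_id(1) t])
  also have "\<dots> = tensor_map (tensor A B) C (\<lambda>x. tensor_map A B a b (\<Delta> x)) (\<lambda>x. c (id x)) ?t"
    by (rule FF.tensor_map_cong[OF AB C.kmod_axioms k_linear_comp[OF l\<Delta> lab] k_linear_comp[OF k_linear_id(1) lc] t])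
      (simp_all add: \<delta>P)
  also have "\<dots> = tensor_map (tensor A B) C (tensor_map A B a b) c (tensor_map (tensor F F) F \<Delta> id ?t)"
    by (rule tensor_map_comp[OF F F FF F AB C.kmod_axioms l\<Delta> k_linear_id(1) lab lc t, symmetric])
  also have "tensor_assoc A B C \<dots>
      = tensor_map A (tensor B C) a (tensor_map B C b c) (tensor_map F (tensor F F) id \<Delta> ?t)"
    by (subst nat) (simp_all add: coassoc[OF f] k_linear_closed[OF tensor_map_linear[OF F F FF F l\<Delta> k_linear_id(1)] t])
  also have "\<dots> = tensor_map A (tensor B C) (\<lambda>x. a (id x)) (\<lambda>x. tensor_map B C b c (\<Delta> x)) ?t"
    by (rule tensor_map_comp[OF F F F FF A.kmod_axioms BC k_linear_id(1) l\<Delta> la lbc t])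
  also have "\<dots> = tensor_map A (tensor B C) (\<lambda>x. id (a x)) (\<lambda>x. \<delta>Q (q x)) ?t"
    by (rule FF.tensor_map_cong[OF A.kmod_axioms BC k_linear_comp[OF la k_linear_id(1)] k_linear_comp[OF lq lQ] t])
      (simp_all add: \<delta>Q)
  also have "\<dots> = tensor_map A (tensor B C) id \<delta>Q (tensor_map A Q a q ?t)"
    by (rule tensor_map_comp[OF F F A.kmod_axioms Q.kmod_axioms A.kmod_axioms BC la lq k_linear_id(1) lQ t, symmetric])
  finally show ?thesis .
qed

lemma bilin_counit_left: "kmod A \<Longrightarrow> k_linear H base_ring e \<Longrightarrow> kmod H \<Longrightarrow> bilin H A A (\<lambda>h b. e h \<odot>\<^bsub>A\<^esub> b)"
  by (intro bilinI k_linearI)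
    (auto simp: k_linear_add k_linear_smult kmod.smult_closed kmod.smult_l_distr kmod.smult_r_distr
      kmod.smult_smult mult.commute)

lemma bilin_counit_right: "kmod A \<Longrightarrow> k_linear H base_ring e \<Longrightarrow> kmod H \<Longrightarrow> bilin A H A (\<lambda>b h. e h \<odot>\<^bsub>A\<^esub> b)"
  by (intro bilinI k_linearI)
    (auto simp: k_linear_add k_linear_smult kmod.smult_closed kmod.smult_l_distr kmod.smult_r_distr
      kmod.smult_smult mult.commute)

lemma counit_linear:
  assumes "epi H t" "\<And>f. f \<in> carrier F \<Longrightarrow> e (t f) = \<epsilon> f"
  shows "algebra_hom H base_ring e"
proof -
  note t = epiD(3,4)[OF assms(1)] and l = algebra_hom_linear[OF \<epsilon>]
  show ?thesis
  proof (rule algebra_homI[OF k_linearI])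
    show "e (c \<odot>\<^bsub>H\<^esub> x) = c \<odot>\<^bsub>base_ring\<^esub> e x" if "x \<in> carrier H" for c x
      using assms(1) that by (rule epi_cases)
        (simp add: assms(2) k_linear_smult[OF t(2), symmetric] k_linear_smult[OF l])
    show "e \<one>\<^bsub>H\<^esub> = \<one>\<^bsub>base_ring\<^esub>"
      using algebra_hom_one[OF \<epsilon>] assms(2)[of "\<one>\<^bsub>F\<^esub>"] by (simp add: algebra_hom_one[OF t(1)])
    fix x y assume x: "x \<in> carrier H" and y: "y \<in> carrier H"
    from assms(1) x obtain f where f: "f \<in> carrier F" "x = t f" by (rule epi_cases)
    from assms(1) y obtain f' where f': "f' \<in> carrier F" "y = t f'" by (rule epi_cases)
    show "e (x \<oplus>\<^bsub>H\<^esub> y) = e x \<oplus>\<^bsub>base_ring\<^esub> e y" "e (x \<otimes>\<^bsub>H\<^esub> y) = e x \<otimes>\<^bsub>base_ring\<^esub> e y"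
      using f f' by (simp_all add: assms(2) k_linear_add[OF t(2), symmetric] k_linear_add[OF l]
          algebra_hom_mult[OF t(1), symmetric] algebra_hom_mult[OF \<epsilon>])
  qed simp
qed

lemma counit_left_transfer:
  assumes A: "epi A s" and H: "epi H t" and e: "\<And>f. f \<in> carrier F \<Longrightarrow> e (t f) = \<epsilon> f"
    and f: "f \<in> carrier F"
  shows "tensor_lift A (\<lambda>h b. e h \<odot>\<^bsub>A\<^esub> b) (tensor_map H A t s (\<Delta> f)) = s f"
proof -
  note k = F.kmod_axioms epiD(2)[OF H] epiD(2)[OF A]
  note b = bilin_counit_left[OF k(3) algebra_hom_linear[OF counit_linear[OF H e]] k(2)]
  note bF = bilin_counit_left[OF k(1) algebra_hom_linear[OF \<epsilon>] k(1)]
  have "tensor_lift A (\<lambda>h b. e h \<odot>\<^bsub>A\<^esub> b) (tensor_map H A t s (\<Delta> f))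
      = tensor_lift A (\<lambda>h b. e (t h) \<odot>\<^bsub>A\<^esub> s b) (\<Delta> f)"
    by (rule tensor_map_lift[OF k(1,1,2,3,3) epiD(4)[OF H] epiD(4)[OF A] b \<Delta>_closed[OF f]])
  also have "\<dots> = tensor_lift A (\<lambda>h b. s (\<epsilon> h \<odot>\<^bsub>F\<^esub> b)) (\<Delta> f)"
    by (rule FF.tensor_lift_cong[OF k(3) bilin_linear[OF bF epiD(4)[OF A]] \<Delta>_closed[OF f]])
      (simp add: e k_linear_smult[OF epiD(4)[OF A]])
  also have "\<dots> = s (tensor_lift F (\<lambda>h b. \<epsilon> h \<odot>\<^bsub>F\<^esub> b) (\<Delta> f))"
    by (rule FF.linear_tensor_lift[OF k(1,3) bF epiD(4)[OF A] \<Delta>_closed[OF f], symmetric])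
  finally show ?thesis by (simp add: counit_left[OF f])
qed

lemma counit_right_transfer:
  assumes A: "epi A s" and H: "epi H t" and e: "\<And>f. f \<in> carrier F \<Longrightarrow> e (t f) = \<epsilon> f"
    and f: "f \<in> carrier F"
  shows "tensor_lift A (\<lambda>b h. e h \<odot>\<^bsub>A\<^esub> b) (tensor_map A H s t (\<Delta> f)) = s f"
proof -
  note k = F.kmod_axioms epiD(2)[OF H] epiD(2)[OF A]
  note b = bilin_counit_right[OF k(3) algebra_hom_linear[OF counit_linear[OF H e]] k(2)]
  note bF = bilin_counit_right[OF k(1) algebra_hom_linear[OF \<epsilon>] k(1)]
  have "tensor_lift A (\<lambda>b h. e h \<odot>\<^bsub>A\<^esub> b) (tensor_map A H s t (\<Delta> f))
      = tensor_lift A (\<lambda>b h. e (t h) \<odot>\<^bsub>A\<^esub> s b) (\<Delta> f)"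
    by (rule tensor_map_lift[OF k(1,1,3,2,3) epiD(4)[OF A] epiD(4)[OF H] b \<Delta>_closed[OF f]])
  also have "\<dots> = tensor_lift A (\<lambda>b h. s (\<epsilon> h \<odot>\<^bsub>F\<^esub> b)) (\<Delta> f)"
    by (rule FF.tensor_lift_cong[OF k(3) bilin_linear[OF bF epiD(4)[OF A]] \<Delta>_closed[OF f]])
      (simp add: e k_linear_smult[OF epiD(4)[OF A]])
  also have "\<dots> = s (tensor_lift F (\<lambda>b h. \<epsilon> h \<odot>\<^bsub>F\<^esub> b) (\<Delta> f))"
    by (rule FF.linear_tensor_lift[OF k(1,3) bF epiD(4)[OF A] \<Delta>_closed[OF f], symmetric])
  finally show ?thesis by (simp add: counit_right[OF f])
qed

text \<open>\<open>U\<close> and \<open>V\<close> stand for the identity and the antipode in either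
  order, so one statement serves both sides of a convolution inverse.\<close>

lemma convolution_transfer:
  assumes A: "epi A s" and H: "epi H t" and lin: "k_linear H A \<phi>" "k_linear H A \<psi>" "k_linear F F U" "k_linear F F V"
    and \<phi>: "\<And>f. f \<in> carrier F \<Longrightarrow> \<phi> (t f) = s (U f)" and \<psi>: "\<And>f. f \<in> carrier F \<Longrightarrow> \<psi> (t f) = s (V f)"
    and f: "f \<in> carrier F" and UV: "tensor_lift F (\<lambda>a b. U a \<otimes>\<^bsub>F\<^esub> V b) (\<Delta> f) = \<epsilon> f \<odot>\<^bsub>F\<^esub> \<one>\<^bsub>F\<^esub>"
  shows "tensor_lift A (\<lambda>a b. \<phi> a \<otimes>\<^bsub>A\<^esub> \<psi> b) (tensor_map H H t t (\<Delta> f)) = \<epsilon> f \<odot>\<^bsub>A\<^esub> \<one>\<^bsub>A\<^esub>"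
proof -
  note k = F.kmod_axioms epiD(2)[OF H] epiD(2)[OF A]
  note b = bilin_comp[OF kalg_bilin_mult[OF epiD(1)[OF A]] lin(1,2)]
  note bF = bilin_comp[OF kalg_bilin_mult[OF F.kalg_axioms] lin(3,4)]
  have "tensor_lift A (\<lambda>a b. \<phi> a \<otimes>\<^bsub>A\<^esub> \<psi> b) (tensor_map H H t t (\<Delta> f))
      = tensor_lift A (\<lambda>a b. \<phi> (t a) \<otimes>\<^bsub>A\<^esub> \<psi> (t b)) (\<Delta> f)"
    by (rule tensor_map_lift[OF k(1,1,2,2,3) epiD(4)[OF H] epiD(4)[OF H] b \<Delta>_closed[OF f]])
  also have "\<dots> = tensor_lift A (\<lambda>a b. s (U a \<otimes>\<^bsub>F\<^esub> V b)) (\<Delta> f)"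
    by (rule FF.tensor_lift_cong[OF k(3) bilin_linear[OF bF epiD(4)[OF A]] \<Delta>_closed[OF f]])
      (simp add: \<phi> \<psi> algebra_hom_mult[OF epiD(3)[OF A]] k_linear_closed[OF lin(3)] k_linear_closed[OF lin(4)])
  also have "\<dots> = s (tensor_lift F (\<lambda>a b. U a \<otimes>\<^bsub>F\<^esub> V b) (\<Delta> f))"
    by (rule FF.linear_tensor_lift[OF k(1,3) bF epiD(4)[OF A] \<Delta>_closed[OF f], symmetric])
  also have "\<dots> = \<epsilon> f \<odot>\<^bsub>A\<^esub> \<one>\<^bsub>A\<^esub>"
    unfolding UV by (simp add: k_linear_smult[OF epiD(4)[OF A]] algebra_hom_one[OF epiD(3)[OF A]])
  finally show ?thesis .
qed

text \<open>The cleaving map comes from the identity of \<open>F\<close> and its inverse from the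
  antipode of \<open>F\<close>, both factored through \<open>t\<close>. The two kernel conditions
  are exactly what these factorizations ask for.\<close>

lemma convolution_inverse_transfer:
  fixes H :: "('k, 'h) hopf"
  assumes A: "epi A s" and H: "epi H t"
    and comult: "\<And>f. f \<in> carrier F \<Longrightarrow> comult H (t f) = tensor_map H H t t (\<Delta> f)"
    and counit: "\<And>f. f \<in> carrier F \<Longrightarrow> counit H (t f) = \<epsilon> f"
    and ker: "\<And>f. f \<in> carrier F \<Longrightarrow> t f = \<zero>\<^bsub>H\<^esub> \<Longrightarrow> s f = \<zero>\<^bsub>A\<^esub>"
    and ker_S: "\<And>f. f \<in> carrier F \<Longrightarrow> t f = \<zero>\<^bsub>H\<^esub> \<Longrightarrow> s (S f) = \<zero>\<^bsub>A\<^esub>"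
  obtains \<phi> \<psi> where "k_linear H A \<phi>" "k_linear H A \<psi>" "\<And>f. f \<in> carrier F \<Longrightarrow> \<phi> (t f) = s f"
    "convolution_inverse H A \<phi> \<psi>"
proof -
  obtain \<phi> where \<phi>: "k_linear H A \<phi>" "\<And>f. f \<in> carrier F \<Longrightarrow> \<phi> (t f) = s f"
    using surj_factor[OF F.kmod_axioms epiD(2)[OF H] epiD(2)[OF A] epiD(4)[OF H] epiD(5)[OF H]
        epiD(4)[OF A] ker] by blast
  obtain \<psi> where \<psi>: "k_linear H A \<psi>" "\<And>f. f \<in> carrier F \<Longrightarrow> \<psi> (t f) = s (S f)"
    using surj_factor[OF F.kmod_axioms epiD(2)[OF H] epiD(2)[OF A] epiD(4)[OF H] epiD(5)[OF H]
        k_linear_comp[OF S epiD(4)[OF A]] ker_S] by blast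
  have "convolution_inverse H A \<phi> \<psi>"
    unfolding convolution_inverse_def
  proof
    fix h assume "h \<in> carrier H"
    with H obtain f where f: "f \<in> carrier F" "h = t f" by (rule epi_cases)
    have id: "k_linear F F (\<lambda>x. x)" by (rule k_linear_id)
    show "tensor_lift A (\<lambda>a b. \<phi> a \<otimes>\<^bsub>A\<^esub> \<psi> b) (comult H h) = counit H h \<odot>\<^bsub>A\<^esub> \<one>\<^bsub>A\<^esub> \<and>
        tensor_lift A (\<lambda>a b. \<psi> a \<otimes>\<^bsub>A\<^esub> \<phi> b) (comult H h) = counit H h \<odot>\<^bsub>A\<^esub> \<one>\<^bsub>A\<^esub>"
      using convolution_transfer[OF A H \<phi>(1) \<psi>(1) id S \<phi>(2) \<psi>(2) f(1) antipode_right[OF f(1)]]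
        convolution_transfer[OF A H \<psi>(1) \<phi>(1) S id \<psi>(2) \<phi>(2) f(1) antipode_left[OF f(1)]]
      by (simp add: f comult counit)
  qed
  with \<phi> \<psi>(1) show thesis using that by blast
qed

lemma hopf_algebra_epi:
  fixes H :: "('k, 'h) hopf"
  assumes H: "epi H t"
    and comult: "\<And>f. f \<in> carrier F \<Longrightarrow> comult H (t f) = tensor_map H H t t (\<Delta> f)"
    and counit: "\<And>f. f \<in> carrier F \<Longrightarrow> counit H (t f) = \<epsilon> f"
    and ker_S: "\<And>f. f \<in> carrier F \<Longrightarrow> t f = \<zero>\<^bsub>H\<^esub> \<Longrightarrow> t (S f) = \<zero>\<^bsub>H\<^esub>"
  shows "hopf_algebra H"
proof -
  obtain \<phi> \<psi> where 1: "k_linear H H \<phi>" "k_linear H H \<psi>" "\<And>f. f \<in> carrier F \<Longrightarrow> \<phi> (t f) = t f"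
    "convolution_inverse H H \<phi> \<psi>"
    using convolution_inverse_transfer[OF H H comult counit _ ker_S] by blast
  interpret H: kalg H by (rule epiD(1)[OF H])
  interpret HH: kalg_pair H H ..
  have c: "comult H h \<in> carrier (tensor H H)" if "h \<in> carrier H" for h
    by (rule k_linear_closed[OF algebra_hom_linear[OF coaction_algebra_hom[OF H H H comult]] that])
  have \<phi>: "\<phi> h = id h" if "h \<in> carrier H" for h
    using H that by (rule epi_cases) (simp add: 1)
  have "tensor_lift H (\<lambda>a b. id a \<otimes>\<^bsub>H\<^esub> \<psi> b) (comult H h) = tensor_lift H (\<lambda>a b. \<phi> a \<otimes>\<^bsub>H\<^esub> \<psi> b) (comult H h)"
    if "h \<in> carrier H" for h
    by (rule HH.tensor_lift_cong[OF H.kmod_axioms bilin_comp[OF kalg_bilin_mult[OF H.kalg_axioms] 1(1,2)] c[OF that]])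
      (simp add: \<phi>)
  moreover have "tensor_lift H (\<lambda>a b. \<psi> a \<otimes>\<^bsub>H\<^esub> id b) (comult H h) = tensor_lift H (\<lambda>a b. \<psi> a \<otimes>\<^bsub>H\<^esub> \<phi> b) (comult H h)"
    if "h \<in> carrier H" for h
    by (rule HH.tensor_lift_cong[OF H.kmod_axioms bilin_comp[OF kalg_bilin_mult[OF H.kalg_axioms] 1(2,1)] c[OF that]])
      (simp add: \<phi>)
  ultimately have "convolution_inverse H H id \<psi>"
    using 1(4) unfolding convolution_inverse_def by simp
  then have S: "\<exists>S. k_linear H H S \<and> convolution_inverse H H id S" using 1(2) by blast
  show ?thesis
    unfolding hopf_algebra_def k_algebra_iff_kalg
  proof (intro conjI ballI S epiD(1)[OF H] coaction_algebra_hom[OF H H H comult] counit_linear[OF H counit])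
    fix h assume "h \<in> carrier H"
    with H obtain f where f: "f \<in> carrier F" "h = t f" by (rule epi_cases)
    show "tensor_assoc H H H (tensor_map (tensor H H) H (comult H) id (comult H h))
        = tensor_map H (tensor H H) id (comult H) (comult H h)"
      using coassoc_transfer[OF H H H H H comult comult f(1)] f by (simp add: comult)
    show "tensor_lift H (\<lambda>a b. counit H a \<odot>\<^bsub>H\<^esub> b) (comult H h) = h"
      using counit_left_transfer[OF H H counit f(1)] f by (simp add: comult)
    show "tensor_lift H (\<lambda>a b. counit H b \<odot>\<^bsub>H\<^esub> a) (comult H h) = h"
      using counit_right_transfer[OF H H counit f(1)] f by (simp add: comult)
  qed
qed

text \<open>\<open>I\<close> is the coinvariance condition of either side. Hypothesis
  \<open>inv\<close> determines \<open>t f\<close> in \<open>H\<close>, and equality of the kernels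
  carries this back to \<open>A\<close>. Vanishing of \<open>\<epsilon>\<close> on the kernel makes
  \<open>c \<mapsto> c 1\<close> injective, which is not automatic over a ring.\<close>

lemma coinvariants:
  assumes A: "epi A s" and H: "epi H t"
    and ker: "\<And>f. f \<in> carrier F \<Longrightarrow> t f = \<zero>\<^bsub>H\<^esub> \<longleftrightarrow> s f = \<zero>\<^bsub>A\<^esub>"
    and ker_\<epsilon>: "\<And>f. f \<in> carrier F \<Longrightarrow> t f = \<zero>\<^bsub>H\<^esub> \<Longrightarrow> \<epsilon> f = 0"
    and inv: "\<And>f. f \<in> carrier F \<Longrightarrow> I (s f) \<Longrightarrow> t f = \<epsilon> f \<odot>\<^bsub>H\<^esub> \<one>\<^bsub>H\<^esub>"
    and k: "\<And>c. I (c \<odot>\<^bsub>A\<^esub> \<one>\<^bsub>A\<^esub>)"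
  shows "bij_betw (\<lambda>c. c \<odot>\<^bsub>A\<^esub> \<one>\<^bsub>A\<^esub>) UNIV {a \<in> carrier A. I a}"
proof (rule bij_betwI')
  interpret A: kalg A by (rule epiD(1)[OF A])
  interpret H: kalg H by (rule epiD(1)[OF H])
  have s1: "s (c \<odot>\<^bsub>F\<^esub> \<one>\<^bsub>F\<^esub>) = c \<odot>\<^bsub>A\<^esub> \<one>\<^bsub>A\<^esub>" for c
    by (simp add: k_linear_smult[OF epiD(4)[OF A]] algebra_hom_one[OF epiD(3)[OF A]])
  have t1: "t (c \<odot>\<^bsub>F\<^esub> \<one>\<^bsub>F\<^esub>) = c \<odot>\<^bsub>H\<^esub> \<one>\<^bsub>H\<^esub>" for c
    by (simp add: k_linear_smult[OF epiD(4)[OF H]] algebra_hom_one[OF epiD(3)[OF H]])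
  have \<epsilon>1: "\<epsilon> (c \<odot>\<^bsub>F\<^esub> \<one>\<^bsub>F\<^esub>) = c" for c
    by (simp add: k_linear_smult[OF algebra_hom_linear[OF \<epsilon>]] algebra_hom_one[OF \<epsilon>])
  show "c \<odot>\<^bsub>A\<^esub> \<one>\<^bsub>A\<^esub> = d \<odot>\<^bsub>A\<^esub> \<one>\<^bsub>A\<^esub> \<longleftrightarrow> c = d" for c d
  proof
    assume "c \<odot>\<^bsub>A\<^esub> \<one>\<^bsub>A\<^esub> = d \<odot>\<^bsub>A\<^esub> \<one>\<^bsub>A\<^esub>"
    then have "c \<odot>\<^bsub>A\<^esub> \<one>\<^bsub>A\<^esub> \<oplus>\<^bsub>A\<^esub> \<ominus>\<^bsub>A\<^esub> (d \<odot>\<^bsub>A\<^esub> \<one>\<^bsub>A\<^esub>) = \<zero>\<^bsub>A\<^esub>" by (simp add: A.r_neg)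
    then have "(c - d) \<odot>\<^bsub>A\<^esub> \<one>\<^bsub>A\<^esub> = \<zero>\<^bsub>A\<^esub>"
      using A.smult_l_distr[of "\<one>\<^bsub>A\<^esub>" c "- d"] by (simp add: A.smult_uminus)
    then have "s ((c - d) \<odot>\<^bsub>F\<^esub> \<one>\<^bsub>F\<^esub>) = \<zero>\<^bsub>A\<^esub>" by (simp add: s1)
    then have "\<epsilon> ((c - d) \<odot>\<^bsub>F\<^esub> \<one>\<^bsub>F\<^esub>) = 0" using ker ker_\<epsilon> by simp
    then show "c = d" by (simp add: \<epsilon>1)
  qed simp
  show "c \<odot>\<^bsub>A\<^esub> \<one>\<^bsub>A\<^esub> \<in> {a \<in> carrier A. I a}" for c using k by simp
  fix a assume "a \<in> {a \<in> carrier A. I a}"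
  then have a: "a \<in> carrier A" "I a" by auto
  from A a(1) obtain f where f: "f \<in> carrier F" "a = s f" by (rule epi_cases)
  have "t (f \<oplus>\<^bsub>F\<^esub> \<ominus>\<^bsub>F\<^esub> (\<epsilon> f \<odot>\<^bsub>F\<^esub> \<one>\<^bsub>F\<^esub>)) = \<zero>\<^bsub>H\<^esub>"
    using f a(2) inv[of f]
    by (simp add: k_linear_add[OF epiD(4)[OF H]] k_linear_minus[OF F.kmod_axioms H.kmod_axioms epiD(4)[OF H]] t1 H.r_neg)
  then have "s (f \<oplus>\<^bsub>F\<^esub> \<ominus>\<^bsub>F\<^esub> (\<epsilon> f \<odot>\<^bsub>F\<^esub> \<one>\<^bsub>F\<^esub>)) = \<zero>\<^bsub>A\<^esub>" using f(1) by (subst ker[symmetric]) auto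
  then have "s f = \<epsilon> f \<odot>\<^bsub>A\<^esub> \<one>\<^bsub>A\<^esub>"
    using f k_linear_closed[OF epiD(4)[OF A]] A.eq_iff_minus[of "s f" "\<epsilon> f \<odot>\<^bsub>A\<^esub> \<one>\<^bsub>A\<^esub>"]
    by (simp add: k_linear_add[OF epiD(4)[OF A]] k_linear_minus[OF F.kmod_axioms A.kmod_axioms epiD(4)[OF A]] s1)
  then show "\<exists>c\<in>UNIV. a = c \<odot>\<^bsub>A\<^esub> \<one>\<^bsub>A\<^esub>" using f by auto
qed

text \<open>The three quotients of \<open>F\<close> share one kernel, so each of
  \<open>\<pi>\<close>, \<open>t\<close>, \<open>s\<close> factors linearly through the others.
  Bicleftness then costs only two properties of that kernel: stability under the antipode and
  vanishing of the counit on it.\<close>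

theorem bicleft_object_epi:
  fixes L :: "('k, 'l) hopf" and H :: "('k, 'h) hopf"
  assumes L: "epi L \<pi>" and H: "epi H t" and A: "epi A s"
    and L_comult: "\<And>f. f \<in> carrier F \<Longrightarrow> comult L (\<pi> f) = tensor_map L L \<pi> \<pi> (\<Delta> f)"
    and L_counit: "\<And>f. f \<in> carrier F \<Longrightarrow> counit L (\<pi> f) = \<epsilon> f"
    and H_comult: "\<And>f. f \<in> carrier F \<Longrightarrow> comult H (t f) = tensor_map H H t t (\<Delta> f)"
    and H_counit: "\<And>f. f \<in> carrier F \<Longrightarrow> counit H (t f) = \<epsilon> f"
    and \<rho>L: "\<And>f. f \<in> carrier F \<Longrightarrow> \<rho>L (s f) = tensor_map L A \<pi> s (\<Delta> f)"
    and \<rho>R: "\<And>f. f \<in> carrier F \<Longrightarrow> \<rho>R (s f) = tensor_map A H s t (\<Delta> f)"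
    and kerL: "\<And>f. f \<in> carrier F \<Longrightarrow> s f = \<zero>\<^bsub>A\<^esub> \<longleftrightarrow> \<pi> f = \<zero>\<^bsub>L\<^esub>"
    and kerH: "\<And>f. f \<in> carrier F \<Longrightarrow> t f = \<zero>\<^bsub>H\<^esub> \<longleftrightarrow> \<pi> f = \<zero>\<^bsub>L\<^esub>"
    and ker_S: "\<And>f. f \<in> carrier F \<Longrightarrow> \<pi> f = \<zero>\<^bsub>L\<^esub> \<Longrightarrow> \<pi> (S f) = \<zero>\<^bsub>L\<^esub>"
    and ker_\<epsilon>: "\<And>f. f \<in> carrier F \<Longrightarrow> \<pi> f = \<zero>\<^bsub>L\<^esub> \<Longrightarrow> \<epsilon> f = 0"
  shows "bicleft_object L H A \<rho>L \<rho>R"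
proof -
  interpret A: kalg A by (rule epiD(1)[OF A])
  interpret L: kalg L by (rule epiD(1)[OF L])
  interpret H: kalg H by (rule epiD(1)[OF H])
  interpret LA: kalg_pair L A ..
  interpret AH: kalg_pair A H ..
  note S_closed = k_linear_closed[OF S]
  have hopf_L: "hopf_algebra L" by (rule hopf_algebra_epi[OF L L_comult L_counit ker_S])
  have hopf_H: "hopf_algebra H"
    by (rule hopf_algebra_epi[OF H H_comult H_counit]) (auto simp: kerH S_closed ker_S)
  note ahL = coaction_algebra_hom[OF A L A \<rho>L] and ahR = coaction_algebra_hom[OF A A H \<rho>R]
  have left: "left_comodule_algebra L A \<rho>L"
    unfolding left_comodule_algebra_def k_algebra_iff_kalg
  proof (intro conjI ballI ahL A.kalg_axioms)
    fix a assume "a \<in> carrier A"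
    with A obtain f where f: "f \<in> carrier F" "a = s f" by (rule epi_cases)
    show "tensor_assoc L L A (tensor_map (tensor L L) A (comult L) id (\<rho>L a))
          = tensor_map L (tensor L A) id \<rho>L (\<rho>L a)"
      using coassoc_transfer[OF L L A L A L_comult \<rho>L f(1)] f by (simp add: \<rho>L)
    show "tensor_lift A (\<lambda>h b. counit L h \<odot>\<^bsub>A\<^esub> b) (\<rho>L a) = a"
      using counit_left_transfer[OF A L L_counit f(1)] f by (simp add: \<rho>L)
  qed
  have right: "right_comodule_algebra H A \<rho>R"
    unfolding right_comodule_algebra_def k_algebra_iff_kalg
  proof (intro conjI ballI ahR A.kalg_axioms)
    fix a assume "a \<in> carrier A"
    with A obtain f where f: "f \<in> carrier F" "a = s f" by (rule epi_cases)
    show "tensor_assoc A H H (tensor_map (tensor A H) H \<rho>R id (\<rho>R a))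
          = tensor_map A (tensor H H) id (comult H) (\<rho>R a)"
      using coassoc_transfer[OF A H H A H \<rho>R H_comult f(1)] f by (simp add: \<rho>R)
    show "tensor_lift A (\<lambda>b h. counit H h \<odot>\<^bsub>A\<^esub> b) (\<rho>R a) = a"
      using counit_right_transfer[OF A H H_counit f(1)] f by (simp add: \<rho>R)
  qed
  have bi: "bicomodule_algebra L H A \<rho>L \<rho>R"
    unfolding bicomodule_algebra_def
  proof (intro conjI ballI left right)
    fix a assume "a \<in> carrier A"
    with A obtain f where f: "f \<in> carrier F" "a = s f" by (rule epi_cases)
    show "tensor_assoc L A H (tensor_map (tensor L A) H \<rho>L id (\<rho>R a))
          = tensor_map L (tensor A H) id \<rho>R (\<rho>L a)"
      using coassoc_transfer[OF L A H A A \<rho>L \<rho>R f(1)] f by (simp add: \<rho>L \<rho>R)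
  qed
  have "left_cleft_object L A \<rho>L"
    unfolding left_cleft_object_def
  proof (intro conjI left)
    obtain \<phi> \<psi> where 1: "k_linear L A \<phi>" "k_linear L A \<psi>" "\<And>f. f \<in> carrier F \<Longrightarrow> \<phi> (\<pi> f) = s f"
      "convolution_inverse L A \<phi> \<psi>"
      using convolution_inverse_transfer[OF A L L_comult L_counit] kerL ker_S S_closed by blast
    have "\<rho>L (\<phi> h) = tensor_map L A id \<phi> (comult L h)" if h: "h \<in> carrier L" for h
    proof -
      from L h obtain f where f: "f \<in> carrier F" "h = \<pi> f" by (rule epi_cases)
      have "tensor_map L A id \<phi> (comult L h) = tensor_map L A (\<lambda>x. id (\<pi> x)) (\<lambda>x. \<phi> (\<pi> x)) (\<Delta> f)"
        unfolding f(2) L_comult[OF f(1)]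
        by (rule tensor_map_comp[OF F.kmod_axioms F.kmod_axioms L.kmod_axioms L.kmod_axioms L.kmod_axioms
              A.kmod_axioms epiD(4)[OF L] epiD(4)[OF L] k_linear_id(1) 1(1) \<Delta>_closed[OF f(1)]])
      also have "\<dots> = tensor_map L A \<pi> s (\<Delta> f)"
        by (rule FF.tensor_map_cong[OF L.kmod_axioms A.kmod_axioms epiD(4)[OF L] epiD(4)[OF A] \<Delta>_closed[OF f(1)]])
          (simp_all add: 1(3))
      finally show ?thesis using f by (simp add: 1(3) \<rho>L)
    qed
    with 1 show "\<exists>\<phi> \<psi>. k_linear L A \<phi> \<and> k_linear L A \<psi> \<and> convolution_inverse L A \<phi> \<psi> \<and>
        (\<forall>h\<in>carrier L. \<rho>L (\<phi> h) = tensor_map L A id \<phi> (comult L h))" by blast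
    \<comment> \<open>The counit of \<open>F\<close> descends to \<open>A\<close> because
      \<open>s\<close> and \<open>\<pi>\<close> have the same kernel. Applied to the factor
      \<open>A\<close> of the coaction, it recovers \<open>\<pi> f\<close> from
      \<open>\<rho>L (s f)\<close>.\<close>
    obtain e where e: "k_linear A base_ring e" "\<And>f. f \<in> carrier F \<Longrightarrow> e (s f) = \<epsilon> f"
      using surj_factor[OF F.kmod_axioms A.kmod_axioms kmod_base_ring epiD(4)[OF A] epiD(5)[OF A]
          algebra_hom_linear[OF \<epsilon>]] kerL ker_\<epsilon> by auto
    show "bij_betw (\<lambda>c. c \<odot>\<^bsub>A\<^esub> \<one>\<^bsub>A\<^esub>) UNIV {a \<in> carrier A. \<rho>L a = pure_tensor L A \<one>\<^bsub>L\<^esub> a}"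
    proof (rule coinvariants[OF A L])
      show "\<pi> f = \<epsilon> f \<odot>\<^bsub>L\<^esub> \<one>\<^bsub>L\<^esub>" if f: "f \<in> carrier F" "\<rho>L (s f) = pure_tensor L A \<one>\<^bsub>L\<^esub> (s f)" for f
      proof -
        note b = bilin_counit_right[OF L.kmod_axioms algebra_hom_linear[OF counit_linear[OF A e(2)]] A.kmod_axioms]
        have "\<pi> f = tensor_lift L (\<lambda>b h. e h \<odot>\<^bsub>L\<^esub> b) (tensor_map L A \<pi> s (\<Delta> f))"
          by (rule counit_right_transfer[OF L A e(2) f(1), symmetric])
        also have "\<dots> = e (s f) \<odot>\<^bsub>L\<^esub> \<one>\<^bsub>L\<^esub>"
          using f k_linear_closed[OF epiD(4)[OF A]]
          by (simp add: \<rho>L[symmetric] LA.tensor_lift_pure[OF L.kmod_axioms b])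
        finally show ?thesis by (simp add: e f)
      qed
      show "\<rho>L (c \<odot>\<^bsub>A\<^esub> \<one>\<^bsub>A\<^esub>) = pure_tensor L A \<one>\<^bsub>L\<^esub> (c \<odot>\<^bsub>A\<^esub> \<one>\<^bsub>A\<^esub>)" for c
        by (simp add: k_linear_smult[OF algebra_hom_linear[OF ahL]] algebra_hom_one[OF ahL]
            LA.tensor_one k_linear_smult[OF bilin_right[OF LA.bilin_pure]])
    qed (use kerL ker_\<epsilon> in auto)
  qed
  moreover have "right_cleft_object H A \<rho>R"
    unfolding right_cleft_object_def
  proof (intro conjI right)
    obtain \<phi> \<psi> where 1: "k_linear H A \<phi>" "k_linear H A \<psi>" "\<And>f. f \<in> carrier F \<Longrightarrow> \<phi> (t f) = s f"
      "convolution_inverse H A \<phi> \<psi>"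
      using convolution_inverse_transfer[OF A H H_comult H_counit] kerL kerH ker_S S_closed by blast
    have "\<rho>R (\<phi> h) = tensor_map A H \<phi> id (comult H h)" if h: "h \<in> carrier H" for h
    proof -
      from H h obtain f where f: "f \<in> carrier F" "h = t f" by (rule epi_cases)
      have "tensor_map A H \<phi> id (comult H h) = tensor_map A H (\<lambda>x. \<phi> (t x)) (\<lambda>x. id (t x)) (\<Delta> f)"
        unfolding f(2) H_comult[OF f(1)]
        by (rule tensor_map_comp[OF F.kmod_axioms F.kmod_axioms H.kmod_axioms H.kmod_axioms A.kmod_axioms
              H.kmod_axioms epiD(4)[OF H] epiD(4)[OF H] 1(1) k_linear_id(1) \<Delta>_closed[OF f(1)]])
      also have "\<dots> = tensor_map A H s t (\<Delta> f)"
        by (rule FF.tensor_map_cong[OF A.kmod_axioms H.kmod_axioms epiD(4)[OF A] epiD(4)[OF H] \<Delta>_closed[OF f(1)]])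
          (simp_all add: 1(3))
      finally show ?thesis using f by (simp add: 1(3) \<rho>R)
    qed
    with 1 show "\<exists>\<phi> \<psi>. k_linear H A \<phi> \<and> k_linear H A \<psi> \<and> convolution_inverse H A \<phi> \<psi> \<and>
        (\<forall>h\<in>carrier H. \<rho>R (\<phi> h) = tensor_map A H \<phi> id (comult H h))" by blast
    obtain e where e: "k_linear A base_ring e" "\<And>f. f \<in> carrier F \<Longrightarrow> e (s f) = \<epsilon> f"
      using surj_factor[OF F.kmod_axioms A.kmod_axioms kmod_base_ring epiD(4)[OF A] epiD(5)[OF A]
          algebra_hom_linear[OF \<epsilon>]] kerL ker_\<epsilon> by auto
    show "bij_betw (\<lambda>c. c \<odot>\<^bsub>A\<^esub> \<one>\<^bsub>A\<^esub>) UNIV {a \<in> carrier A. \<rho>R a = pure_tensor A H a \<one>\<^bsub>H\<^esub>}"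
    proof (rule coinvariants[OF A H])
      show "t f = \<epsilon> f \<odot>\<^bsub>H\<^esub> \<one>\<^bsub>H\<^esub>" if f: "f \<in> carrier F" "\<rho>R (s f) = pure_tensor A H (s f) \<one>\<^bsub>H\<^esub>" for f
      proof -
        note b = bilin_counit_left[OF H.kmod_axioms algebra_hom_linear[OF counit_linear[OF A e(2)]] A.kmod_axioms]
        have "t f = tensor_lift H (\<lambda>h b. e h \<odot>\<^bsub>H\<^esub> b) (tensor_map A H s t (\<Delta> f))"
          by (rule counit_left_transfer[OF H A e(2) f(1), symmetric])
        also have "\<dots> = e (s f) \<odot>\<^bsub>H\<^esub> \<one>\<^bsub>H\<^esub>"
          using f k_linear_closed[OF epiD(4)[OF A]]
          by (simp add: \<rho>R[symmetric] AH.tensor_lift_pure[OF H.kmod_axioms b])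
        finally show ?thesis by (simp add: e f)
      qed
      show "\<rho>R (c \<odot>\<^bsub>A\<^esub> \<one>\<^bsub>A\<^esub>) = pure_tensor A H (c \<odot>\<^bsub>A\<^esub> \<one>\<^bsub>A\<^esub>) \<one>\<^bsub>H\<^esub>" for c
        by (simp add: k_linear_smult[OF algebra_hom_linear[OF ahR]] algebra_hom_one[OF ahR]
            AH.tensor_one k_linear_smult[OF bilin_left[OF AH.bilin_pure]])
    qed (use kerL kerH ker_\<epsilon> in auto)
  qed
  ultimately show ?thesis
    unfolding bicleft_object_def using hopf_L hopf_H bi by blast
qed

end

section \<open>Associated graded modules\<close>

locale filt = kmod M for M :: "('k::comm_ring_1, 'a, 'm) module_scheme" (structure) +
  fixes Fil :: "nat \<Rightarrow> 'a set"
  assumes submod_Fil: "submod M (Fil n)" and Fil_Suc: "Fil n \<subseteq> Fil (Suc n)"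
begin

abbreviation "fb \<equiv> fil_below M Fil"
abbreviation "cl \<equiv> \<lambda>a n. fb n +> a n"

lemma fb_0: "fb 0 = {\<zero>}" and fb_Suc: "fb (Suc n) = Fil n"
  by (simp_all add: fil_below_def)

lemma Fil_mono: "m \<le> n \<Longrightarrow> Fil m \<subseteq> Fil n"
  by (rule lift_Suc_mono_le[of Fil]) (rule Fil_Suc)

lemma submod_fb: "submod M (fb n)"
proof (cases n)
  case 0
  show ?thesis unfolding 0 fb_0 by unfold_locales auto
qed (simp add: fb_Suc submod_Fil)

sublocale Fil: submod M "Fil n" for n by (rule submod_Fil)
sublocale fb: submod M "fb n" for n by (rule submod_fb)

lemma fb_sub_Fil: "fb n \<subseteq> Fil n"
  using Fil_Suc by (cases n) (auto simp: fb_0 fb_Suc)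

lemma Fil_sub_fb: "m < n \<Longrightarrow> Fil m \<subseteq> fb n"
  using Fil_mono by (cases n) (auto simp: fb_Suc less_Suc_eq_le)

lemma Fil_carrier: "a \<in> Fil n \<Longrightarrow> a \<in> carrier M"
  using Fil.sub by blast

lemma fb_coset_self: "a \<in> carrier M \<Longrightarrow> fb n +> a = fb n \<longleftrightarrow> a \<in> fb n"
  by (rule fb.coset_eq_self_iff)

text \<open>Sequences of representatives, almost all of them of lower filtration. \<open>gr\<close>
  is the image of this module under componentwise classes, so bilinear identities can be computed in
  \<open>M\<close> before passing to cosets. Only the module fields are meaningful.\<close>

definition seqs :: "('k, nat \<Rightarrow> 'a) module" where
  "seqs = \<lparr>carrier = {a. (\<forall>n. a n \<in> Fil n) \<and> finite {n. a n \<notin> fb n}}, monoid.mult = undefined, one = undefined,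
     zero = (\<lambda>_. \<zero>), add = (\<lambda>a b n. a n \<oplus> b n), smult = (\<lambda>c a n. c \<odot> a n)\<rparr>"

lemma seqs_Fil: "a \<in> carrier seqs \<Longrightarrow> a n \<in> Fil n"
  by (simp add: seqs_def)

lemma seqs_carrier: "a \<in> carrier seqs \<Longrightarrow> a n \<in> carrier M"
  using seqs_Fil Fil_carrier by blast

lemma seqs_simps:
  "zero seqs = (\<lambda>_. \<zero>)" "add seqs = (\<lambda>a b n. a n \<oplus> b n)" "smult seqs = (\<lambda>c a n. c \<odot> a n)"
  by (simp_all add: seqs_def)

lemma kmod_seqs: "kmod seqs"
proof -
  have add: "(\<lambda>n. a n \<oplus> b n) \<in> carrier seqs" if "a \<in> carrier seqs" "b \<in> carrier seqs" for a b
  proof -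
    have "{n. a n \<oplus> b n \<notin> fb n} \<subseteq> {n. a n \<notin> fb n} \<union> {n. b n \<notin> fb n}"
      using fb.add_mem by auto
    with that show ?thesis by (auto simp: seqs_def Fil.add_mem elim: finite_subset)
  qed
  have smult: "(\<lambda>n. c \<odot> a n) \<in> carrier seqs" if "a \<in> carrier seqs" for a c
  proof -
    have "{n. c \<odot> a n \<notin> fb n} \<subseteq> {n. a n \<notin> fb n}" using fb.smult_mem by auto
    with that show ?thesis by (auto simp: seqs_def Fil.smult_mem elim: finite_subset)
  qed
  interpret S: abelian_group seqs
  proof (rule abelian_groupI)
    fix a b c assume abc: "a \<in> carrier seqs" "b \<in> carrier seqs" "c \<in> carrier seqs"
    then have c: "a n \<in> carrier M" "b n \<in> carrier M" "c n \<in> carrier M" for n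
      using Fil_carrier[of _ n] by (auto simp: seqs_def)
    from abc show "a \<oplus>\<^bsub>seqs\<^esub> b \<in> carrier seqs" using add by (simp add: seqs_def)
    show "a \<oplus>\<^bsub>seqs\<^esub> b \<oplus>\<^bsub>seqs\<^esub> c = a \<oplus>\<^bsub>seqs\<^esub> (b \<oplus>\<^bsub>seqs\<^esub> c)" "a \<oplus>\<^bsub>seqs\<^esub> b = b \<oplus>\<^bsub>seqs\<^esub> a"
      "\<zero>\<^bsub>seqs\<^esub> \<oplus>\<^bsub>seqs\<^esub> a = a"
      using c by (auto simp: seqs_def fun_eq_iff a_assoc intro!: a_comm)
    have "(\<lambda>n. (-1) \<odot> a n) \<oplus>\<^bsub>seqs\<^esub> a = \<zero>\<^bsub>seqs\<^esub>"
      using c by (auto simp: seqs_def fun_eq_iff minus_eq_smult[symmetric] l_neg)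
    with smult[OF abc(1)] show "\<exists>b\<in>carrier seqs. b \<oplus>\<^bsub>seqs\<^esub> a = \<zero>\<^bsub>seqs\<^esub>" by blast
  next
    show "\<zero>\<^bsub>seqs\<^esub> \<in> carrier seqs" by (simp add: seqs_def)
  qed
  show ?thesis
    by unfold_locales
      (use smult in \<open>auto simp: seqs_simps fun_eq_iff seqs_carrier smult_l_distr smult_r_distr smult_smult\<close>)
qed

lemma gr_carrier: "carrier (gr M Fil) = cl ` carrier seqs"
proof (intro equalityI subsetI)
  fix y assume "y \<in> carrier (gr M Fil)"
  then have y: "\<forall>n. \<exists>a\<in>Fil n. y n = fb n +> a" "finite {n. y n \<noteq> fb n}" by (auto simp: gr_def)
  from y(1) obtain a where a: "\<And>n. a n \<in> Fil n" "\<And>n. y n = fb n +> a n" by metis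
  from a y(2) have "a \<in> carrier seqs" "y = cl a"
    by (auto simp: seqs_def fb_coset_self Fil_carrier[OF a(1)])
  then show "y \<in> cl ` carrier seqs" by blast
next
  fix y assume "y \<in> cl ` carrier seqs"
  then obtain a where a: "y = cl a" "\<And>n. a n \<in> Fil n" "finite {n. a n \<notin> fb n}"
    by (auto simp: seqs_def)
  then show "y \<in> carrier (gr M Fil)"
    by (auto simp: gr_def fb_coset_self Fil_carrier[OF a(2)])
qed

lemma gr_cases:
  assumes "y \<in> carrier (gr M Fil)"
  obtains a where "a \<in> carrier seqs" "y = cl a"
  using assms unfolding gr_carrier by (elim imageE)

lemma kmod_gr: "kmod (gr M Fil)" and k_linear_cl: "k_linear seqs (gr M Fil) cl"
proof -
  have add: "cl x \<oplus>\<^bsub>gr M Fil\<^esub> cl y = cl (x \<oplus>\<^bsub>seqs\<^esub> y)" if "x \<in> carrier seqs" "y \<in> carrier seqs" for x y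
    using seqs_carrier[OF that(1)] seqs_carrier[OF that(2)]
    by (simp add: gr_def seqs_def fun_eq_iff fb.coset_sum)
  have smult: "c \<odot>\<^bsub>gr M Fil\<^esub> cl x = cl (c \<odot>\<^bsub>seqs\<^esub> x)" if "x \<in> carrier seqs" for c x
    using seqs_carrier[OF that] by (simp add: gr_def seqs_def fun_eq_iff fb.coset_smult)
  have zero: "\<zero>\<^bsub>gr M Fil\<^esub> = cl \<zero>\<^bsub>seqs\<^esub>"
    by (simp add: gr_def seqs_def fun_eq_iff)
  show "kmod (gr M Fil)" "k_linear seqs (gr M Fil) cl"
    by (rule kmod_surj_image[where f = cl, OF kmod_seqs gr_carrier];
        (erule (1) add | rule zero | erule smult))+
qed

lemma cl_eq_iff:
  "(\<And>n. a n \<in> carrier M) \<Longrightarrow> (\<And>n. b n \<in> carrier M) \<Longrightarrow> cl a = cl b \<longleftrightarrow> (\<forall>n. a n \<oplus> \<ominus> b n \<in> fb n)"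
  by (simp add: fun_eq_iff fb.coset_eq_iff)

lemma gr_zero: "\<zero>\<^bsub>gr M Fil\<^esub> = fb"
  by (simp add: gr_def)

lemma cl_eq_zero_iff: "(\<And>n. a n \<in> carrier M) \<Longrightarrow> cl a = \<zero>\<^bsub>gr M Fil\<^esub> \<longleftrightarrow> (\<forall>n. a n \<in> fb n)"
  by (simp add: gr_zero fun_eq_iff fb_coset_self)

end

context submod
begin

lemma coset_finsum:
  assumes "\<And>i. i \<in> I \<Longrightarrow> x i \<in> carrier M" "\<And>i. i \<in> I \<Longrightarrow> y i \<in> carrier M"
    and "\<And>i. i \<in> I \<Longrightarrow> J +> x i = J +> y i"
  shows "J +> (\<Oplus>i\<in>I. x i) = J +> (\<Oplus>i\<in>I. y i)"
proof -
  interpret Q: kmod "quotient_algebra M J" by (rule kmod_quotient)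
  have "J +> (\<Oplus>i\<in>I. x i) = (\<Oplus>\<^bsub>quotient_algebra M J\<^esub>i\<in>I. J +> x i)"
    by (rule k_linear_finsum[OF kmod_axioms kmod_quotient k_linear_proj]) (use assms in auto)
  also have "\<dots> = (\<Oplus>\<^bsub>quotient_algebra M J\<^esub>i\<in>I. J +> y i)"
    by (rule Q.finsum_cong') (use assms in \<open>auto simp: quotient_carrier\<close>)
  also have "\<dots> = J +> (\<Oplus>i\<in>I. y i)"
    by (rule k_linear_finsum[OF kmod_axioms kmod_quotient k_linear_proj, symmetric]) (use assms in auto)
  finally show ?thesis .
qed

lemma finsum_mem:
  assumes "\<And>i. i \<in> I \<Longrightarrow> x i \<in> J" shows "(\<Oplus>i\<in>I. x i) \<in> J"
  using assms
proof (induction I rule: infinite_finite_induct)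
  case (insert i I)
  then have "x i \<in> carrier M" "x \<in> I \<rightarrow> carrier M" using sub by auto
  with insert show ?case by (simp add: add_mem)
qed auto

end

locale filt_bilin = A: filt A FA + B: filt B FB + C: filt C FC
  for A :: "('k::comm_ring_1, 'a, 'm) module_scheme" and FA
    and B :: "('k, 'b, 'n) module_scheme" and FB and C :: "('k, 'c, 'o) module_scheme" and FC +
  fixes \<beta>
  assumes \<beta>: "bilin A B C \<beta>" and \<beta>_Fil: "a \<in> FA i \<Longrightarrow> b \<in> FB j \<Longrightarrow> \<beta> a b \<in> FC (i + j)"
begin

lemma \<beta>_fb_left:
  assumes "a \<in> A.fb i" "b \<in> FB j" shows "\<beta> a b \<in> C.fb (i + j)"
proof (cases i)
  case 0
  then have "a = \<zero>\<^bsub>A\<^esub>" using assms(1) by (simp add: A.fb_0)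
  then show ?thesis
    using k_linear_zero[OF A.kmod_axioms C.kmod_axioms bilin_left[OF \<beta>, of b]] B.Fil_carrier[OF assms(2)]
    by simp
next
  case (Suc m)
  then show ?thesis using assms \<beta>_Fil[of a m b j] by (simp add: A.fb_Suc C.fb_Suc)
qed

lemma \<beta>_fb_right:
  assumes "a \<in> FA i" "b \<in> B.fb j" shows "\<beta> a b \<in> C.fb (i + j)"
proof (cases j)
  case 0
  then have "b = \<zero>\<^bsub>B\<^esub>" using assms(2) by (simp add: B.fb_0)
  then show ?thesis
    using k_linear_zero[OF B.kmod_axioms C.kmod_axioms bilin_right[OF \<beta>, of a]] A.Fil_carrier[OF assms(1)]
    by simp
next
  case (Suc m)
  then show ?thesis using assms \<beta>_Fil[of a i b m] by (simp add: B.fb_Suc C.fb_Suc)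
qed

lemma \<beta>_closed: "a \<in> carrier A \<Longrightarrow> b \<in> carrier B \<Longrightarrow> \<beta> a b \<in> carrier C"
  by (rule bilin_closed[OF \<beta>])

lemma \<beta>_coset_cong:
  assumes "a \<in> FA i" "a' \<in> FA i" "b \<in> FB j" "b' \<in> FB j"
    and "a \<oplus>\<^bsub>A\<^esub> \<ominus>\<^bsub>A\<^esub> a' \<in> A.fb i" "b \<oplus>\<^bsub>B\<^esub> \<ominus>\<^bsub>B\<^esub> b' \<in> B.fb j"
  shows "C.fb (i + j) +>\<^bsub>C\<^esub> \<beta> a b = C.fb (i + j) +>\<^bsub>C\<^esub> \<beta> a' b'"
proof -
  note c = assms(1,2)[THEN A.Fil_carrier] assms(3,4)[THEN B.Fil_carrier]
  have "C.fb (i + j) +>\<^bsub>C\<^esub> \<beta> a b = C.fb (i + j) +>\<^bsub>C\<^esub> \<beta> a' b"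
    using \<beta>_fb_left[OF assms(5,3)] c
    by (simp add: C.fb.coset_eq_iff \<beta>_closed k_linear_add[OF bilin_left[OF \<beta>]]
        k_linear_minus[OF A.kmod_axioms C.kmod_axioms bilin_left[OF \<beta>]])
  also have "\<dots> = C.fb (i + j) +>\<^bsub>C\<^esub> \<beta> a' b'"
    using \<beta>_fb_right[OF assms(2,6)] c
    by (simp add: C.fb.coset_eq_iff \<beta>_closed k_linear_add[OF bilin_right[OF \<beta>]]
        k_linear_minus[OF B.kmod_axioms C.kmod_axioms bilin_right[OF \<beta>]])
  finally show ?thesis .
qed

text \<open>\<open>gr_bilinear\<close> is a union over all choices of representatives. Changing one
  representative changes a product by an element of lower filtration, so all choices give the same
  coset and the union is that coset.\<close>

lemma gr_bilinear_cl:
  assumes a: "\<And>i. a i \<in> FA i" and b: "\<And>i. b i \<in> FB i"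
  shows "gr_bilinear C FC \<beta> (A.cl a) (B.cl b) n
    = C.fb n +>\<^bsub>C\<^esub> (\<Oplus>\<^bsub>C\<^esub>i\<in>{..n}. \<beta> (a i) (b (n - i)))"
proof -
  have *: "C.fb n +>\<^bsub>C\<^esub> (\<Oplus>\<^bsub>C\<^esub>i\<in>{..n}. \<beta> (a' i) (b' (n - i)))
      = C.fb n +>\<^bsub>C\<^esub> (\<Oplus>\<^bsub>C\<^esub>i\<in>{..n}. \<beta> (a i) (b (n - i)))"
    if "\<forall>i. a' i \<in> A.cl a i \<and> b' i \<in> B.cl b i" for a' b'
  proof -
    have a': "a' i \<in> carrier A" "a' i \<oplus>\<^bsub>A\<^esub> \<ominus>\<^bsub>A\<^esub> a i \<in> A.fb i" for i
      using that A.fb.coset_memD[of "a' i" i "a i"] A.Fil_carrier[OF a] by auto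
    have b': "b' i \<in> carrier B" "b' i \<oplus>\<^bsub>B\<^esub> \<ominus>\<^bsub>B\<^esub> b i \<in> B.fb i" for i
      using that B.fb.coset_memD[of "b' i" i "b i"] B.Fil_carrier[OF b] by auto
    \<comment> \<open>A representative differs from \<open>a i\<close> by an element of lower
      filtration, hence stays in the same term of the filtration; the estimate on products requires
      this.\<close>
    have aF: "a' i \<in> FA i" for i
      using A.Fil.add_mem[OF subsetD[OF A.fb_sub_Fil a'(2)[of i]] a[of i]] a'(1)[of i] A.Fil_carrier[OF a[of i]]
      by (simp add: A.a_assoc A.l_neg)
    have bF: "b' i \<in> FB i" for i
      using B.Fil.add_mem[OF subsetD[OF B.fb_sub_Fil b'(2)[of i]] b[of i]] b'(1)[of i] B.Fil_carrier[OF b[of i]]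
      by (simp add: B.a_assoc B.l_neg)
    have "C.fb n +>\<^bsub>C\<^esub> \<beta> (a' i) (b' (n - i)) = C.fb n +>\<^bsub>C\<^esub> \<beta> (a i) (b (n - i))" if "i \<le> n" for i
      using \<beta>_coset_cong[OF aF a bF b a'(2) b'(2), of i "n - i"] that by simp
    then show ?thesis
      by (intro C.fb.coset_finsum)
        (auto intro!: \<beta>_closed a'(1) b'(1) A.Fil_carrier[OF a] B.Fil_carrier[OF b])
  qed
  let ?X = "{C.fb n +>\<^bsub>C\<^esub> (\<Oplus>\<^bsub>C\<^esub>i\<in>{..n}. \<beta> (a' i) (b' (n - i)))
        | a' b'. \<forall>i. a' i \<in> A.cl a i \<and> b' i \<in> B.cl b i}"
  have "?X \<subseteq> {C.fb n +>\<^bsub>C\<^esub> (\<Oplus>\<^bsub>C\<^esub>i\<in>{..n}. \<beta> (a i) (b (n - i)))}"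
    using * by blast
  moreover have "C.fb n +>\<^bsub>C\<^esub> (\<Oplus>\<^bsub>C\<^esub>i\<in>{..n}. \<beta> (a i) (b (n - i))) \<in> ?X"
    using A.fb.coset_self[OF A.Fil_carrier[OF a]] B.fb.coset_self[OF B.Fil_carrier[OF b]] by blast
  ultimately have "?X = {C.fb n +>\<^bsub>C\<^esub> (\<Oplus>\<^bsub>C\<^esub>i\<in>{..n}. \<beta> (a i) (b (n - i)))}" by blast
  then show ?thesis unfolding gr_bilinear_def by simp
qed

lemma conv_closed:
  assumes "a \<in> carrier A.seqs" "b \<in> carrier B.seqs"
  shows "(\<lambda>n. \<Oplus>\<^bsub>C\<^esub>i\<in>{..n}. \<beta> (a i) (b (n - i))) \<in> carrier C.seqs"
proof -
  have 1: "\<beta> (a i) (b (n - i)) \<in> FC n" if "i \<le> n" for i n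
    using \<beta>_Fil[OF A.seqs_Fil[OF assms(1), of i] B.seqs_Fil[OF assms(2), of "n - i"]] that by simp
  obtain N where N: "\<And>n. n \<ge> N \<Longrightarrow> a n \<in> A.fb n"
  proof -
    have "finite {n. a n \<notin> A.fb n}" using assms by (simp add: A.seqs_def)
    then obtain N where "\<forall>n\<in>{n. a n \<notin> A.fb n}. n < N" unfolding finite_nat_set_iff_bounded by blast
    then show thesis using that[of N] by (auto simp: not_less[symmetric])
  qed
  obtain N' where N': "\<And>n. n \<ge> N' \<Longrightarrow> b n \<in> B.fb n"
  proof -
    have "finite {n. b n \<notin> B.fb n}" using assms by (simp add: B.seqs_def)
    then obtain N where "\<forall>n\<in>{n. b n \<notin> B.fb n}. n < N" unfolding finite_nat_set_iff_bounded by blast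
    then show thesis using that[of N] by (auto simp: not_less[symmetric])
  qed
  \<comment> \<open>If \<open>n \<ge> N + N'\<close>, then \<open>i \<ge> N\<close> or
    \<open>n - i \<ge> N'\<close>, so one of the two factors is already of lower filtration.\<close>
  have 2: "\<beta> (a i) (b (n - i)) \<in> C.fb n" if "i \<le> n" "n \<ge> N + N'" for i n
  proof (cases "i \<ge> N")
    case True
    then show ?thesis using \<beta>_fb_left[OF N B.seqs_Fil[OF assms(2), of "n - i"], of i] that by simp
  next
    case False
    then have "n - i \<ge> N'" using that by simp
    then show ?thesis using \<beta>_fb_right[OF A.seqs_Fil[OF assms(1), of i] N', of "n - i"] that by simp
  qed
  have 3: "(\<Oplus>\<^bsub>C\<^esub>i\<in>{..n}. \<beta> (a i) (b (n - i))) \<in> C.fb n" if "n \<ge> N + N'" for n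
    using 2 that by (intro C.fb.finsum_mem) auto
  have 4: "(\<Oplus>\<^bsub>C\<^esub>i\<in>{..n}. \<beta> (a i) (b (n - i))) \<in> FC n" for n
    using 1 by (intro C.Fil.finsum_mem) auto
  have "{n. (\<Oplus>\<^bsub>C\<^esub>i\<in>{..n}. \<beta> (a i) (b (n - i))) \<notin> C.fb n} \<subseteq> {..<N + N'}"
    using 3 by (auto simp: not_le[symmetric] simp del: not_le)
  then show ?thesis
    using 4 by (auto simp: C.seqs_def elim: finite_subset)
qed

lemma gr_bilinear_seqs:
  assumes "a \<in> carrier A.seqs" "b \<in> carrier B.seqs"
  shows "gr_bilinear C FC \<beta> (A.cl a) (B.cl b) = C.cl (\<lambda>n. \<Oplus>\<^bsub>C\<^esub>i\<in>{..n}. \<beta> (a i) (b (n - i)))"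
  using gr_bilinear_cl[OF A.seqs_Fil[OF assms(1)] B.seqs_Fil[OF assms(2)]] by (rule ext)

lemma bilin_conv: "bilin A.seqs B.seqs C.seqs (\<lambda>a b n. \<Oplus>\<^bsub>C\<^esub>i\<in>{..n}. \<beta> (a i) (b (n - i)))"
proof (intro bilinI k_linearI)
  note ac = A.seqs_carrier and bc = B.seqs_carrier
  show "a \<in> carrier A.seqs \<Longrightarrow> b \<in> carrier B.seqs \<Longrightarrow>
      (\<lambda>n. \<Oplus>\<^bsub>C\<^esub>i\<in>{..n}. \<beta> (a i) (b (n - i))) \<in> carrier C.seqs"
    "b \<in> carrier B.seqs \<Longrightarrow> a \<in> carrier A.seqs \<Longrightarrow>
      (\<lambda>n. \<Oplus>\<^bsub>C\<^esub>i\<in>{..n}. \<beta> (a i) (b (n - i))) \<in> carrier C.seqs" for a b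
    by (rule conv_closed; assumption)+
  have ext: "(\<Oplus>\<^bsub>C\<^esub>i\<in>{..n}. h i) = (\<Oplus>\<^bsub>C\<^esub>i\<in>{..n}. h1 i) \<oplus>\<^bsub>C\<^esub> (\<Oplus>\<^bsub>C\<^esub>i\<in>{..n}. h2 i)"
    if "\<And>i. h1 i \<in> carrier C" "\<And>i. h2 i \<in> carrier C" "\<And>i. h i = h1 i \<oplus>\<^bsub>C\<^esub> h2 i" for h h1 h2 and n :: nat
    unfolding that(3) by (rule C.finsum_addf) (use that in auto)
  show "(\<lambda>n. \<Oplus>\<^bsub>C\<^esub>i\<in>{..n}. \<beta> (a i) ((b \<oplus>\<^bsub>B.seqs\<^esub> b') (n - i)))
      = (\<lambda>n. \<Oplus>\<^bsub>C\<^esub>i\<in>{..n}. \<beta> (a i) (b (n - i))) \<oplus>\<^bsub>C.seqs\<^esub> (\<lambda>n. \<Oplus>\<^bsub>C\<^esub>i\<in>{..n}. \<beta> (a i) (b' (n - i)))"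
    if "a \<in> carrier A.seqs" "b \<in> carrier B.seqs" "b' \<in> carrier B.seqs" for a b b'
    by (simp add: C.seqs_def B.seqs_def, rule HOL.ext, rule ext)
      (simp_all add: \<beta>_closed ac[OF that(1)] bc[OF that(2)] bc[OF that(3)] k_linear_add[OF bilin_right[OF \<beta>]])
  show "(\<lambda>n. \<Oplus>\<^bsub>C\<^esub>i\<in>{..n}. \<beta> ((a \<oplus>\<^bsub>A.seqs\<^esub> a') i) (b (n - i)))
      = (\<lambda>n. \<Oplus>\<^bsub>C\<^esub>i\<in>{..n}. \<beta> (a i) (b (n - i))) \<oplus>\<^bsub>C.seqs\<^esub> (\<lambda>n. \<Oplus>\<^bsub>C\<^esub>i\<in>{..n}. \<beta> (a' i) (b (n - i)))"
    if "b \<in> carrier B.seqs" "a \<in> carrier A.seqs" "a' \<in> carrier A.seqs" for a a' b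
    by (simp add: C.seqs_def A.seqs_def, rule HOL.ext, rule ext)
      (simp_all add: \<beta>_closed bc[OF that(1)] ac[OF that(2)] ac[OF that(3)] k_linear_add[OF bilin_left[OF \<beta>]])
  have smult: "(\<Oplus>\<^bsub>C\<^esub>i\<in>{..n}. h i) = c \<odot>\<^bsub>C\<^esub> (\<Oplus>\<^bsub>C\<^esub>i\<in>{..n}. h1 i)"
    if "\<And>i. h1 i \<in> carrier C" "\<And>i. h i = c \<odot>\<^bsub>C\<^esub> h1 i" for h h1 c and n :: nat
    unfolding that(2) by (rule C.smult_finsum[symmetric]) (use that in auto)
  show "(\<lambda>n. \<Oplus>\<^bsub>C\<^esub>i\<in>{..n}. \<beta> (a i) ((c \<odot>\<^bsub>B.seqs\<^esub> b) (n - i)))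
      = c \<odot>\<^bsub>C.seqs\<^esub> (\<lambda>n. \<Oplus>\<^bsub>C\<^esub>i\<in>{..n}. \<beta> (a i) (b (n - i)))"
    if "a \<in> carrier A.seqs" "b \<in> carrier B.seqs" for a b c
    by (simp add: C.seqs_def B.seqs_def, rule HOL.ext, rule smult)
      (simp_all add: \<beta>_closed ac[OF that(1)] bc[OF that(2)] k_linear_smult[OF bilin_right[OF \<beta>]])
  show "(\<lambda>n. \<Oplus>\<^bsub>C\<^esub>i\<in>{..n}. \<beta> ((c \<odot>\<^bsub>A.seqs\<^esub> a) i) (b (n - i)))
      = c \<odot>\<^bsub>C.seqs\<^esub> (\<lambda>n. \<Oplus>\<^bsub>C\<^esub>i\<in>{..n}. \<beta> (a i) (b (n - i)))"
    if "b \<in> carrier B.seqs" "a \<in> carrier A.seqs" for a b c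
    by (simp add: C.seqs_def A.seqs_def, rule HOL.ext, rule smult)
      (simp_all add: \<beta>_closed bc[OF that(1)] ac[OF that(2)] k_linear_smult[OF bilin_left[OF \<beta>]])
qed

lemma bilin_gr: "bilin (gr A FA) (gr B FB) (gr C FC) (gr_bilinear C FC \<beta>)"
proof (rule bilinI)
  note b = bilin_linear[OF bilin_conv C.k_linear_cl]
  fix y assume "y \<in> carrier (gr A FA)"
  then obtain a where a: "a \<in> carrier A.seqs" "y = A.cl a" by (rule A.gr_cases)
  note l = bilin_right[OF b a(1)]
  show "k_linear (gr B FB) (gr C FC) (gr_bilinear C FC \<beta> y)"
  proof (rule k_linearI)
    fix z assume "z \<in> carrier (gr B FB)"
    then obtain c where c: "c \<in> carrier B.seqs" "z = B.cl c" by (rule B.gr_cases)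
    show "gr_bilinear C FC \<beta> y z \<in> carrier (gr C FC)"
      using k_linear_closed[OF l c(1)] by (simp add: a c gr_bilinear_seqs)
    show "gr_bilinear C FC \<beta> y (d \<odot>\<^bsub>gr B FB\<^esub> z) = d \<odot>\<^bsub>gr C FC\<^esub> gr_bilinear C FC \<beta> y z" for d
      using k_linear_smult[OF l c(1), of d] kmod.smult_closed[OF B.kmod_seqs c(1), of d]
      by (simp add: a c gr_bilinear_seqs k_linear_smult[OF B.k_linear_cl, symmetric])
    fix z' assume "z' \<in> carrier (gr B FB)"
    then obtain c' where c': "c' \<in> carrier B.seqs" "z' = B.cl c'" by (rule B.gr_cases)
    show "gr_bilinear C FC \<beta> y (z \<oplus>\<^bsub>gr B FB\<^esub> z') = gr_bilinear C FC \<beta> y z \<oplus>\<^bsub>gr C FC\<^esub> gr_bilinear C FC \<beta> y z'"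
      using k_linear_add[OF l c(1) c'(1)] abelian_monoid.a_closed[OF _ c(1) c'(1)] kmod.axioms(1)[OF B.kmod_seqs]
      by (simp add: a c c' gr_bilinear_seqs k_linear_add[OF B.k_linear_cl, symmetric] abelian_group_def)
  qed
next
  note b = bilin_linear[OF bilin_conv C.k_linear_cl]
  fix z assume "z \<in> carrier (gr B FB)"
  then obtain c where c: "c \<in> carrier B.seqs" "z = B.cl c" by (rule B.gr_cases)
  note l = bilin_left[OF b c(1)]
  show "k_linear (gr A FA) (gr C FC) (\<lambda>y. gr_bilinear C FC \<beta> y z)"
  proof (rule k_linearI)
    fix y assume "y \<in> carrier (gr A FA)"
    then obtain a where a: "a \<in> carrier A.seqs" "y = A.cl a" by (rule A.gr_cases)
    show "gr_bilinear C FC \<beta> y z \<in> carrier (gr C FC)"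
      using k_linear_closed[OF l a(1)] by (simp add: a c gr_bilinear_seqs)
    show "gr_bilinear C FC \<beta> (d \<odot>\<^bsub>gr A FA\<^esub> y) z = d \<odot>\<^bsub>gr C FC\<^esub> gr_bilinear C FC \<beta> y z" for d
      using k_linear_smult[OF l a(1), of d] kmod.smult_closed[OF A.kmod_seqs a(1), of d]
      by (simp add: a c gr_bilinear_seqs k_linear_smult[OF A.k_linear_cl, symmetric])
    fix y' assume "y' \<in> carrier (gr A FA)"
    then obtain a' where a': "a' \<in> carrier A.seqs" "y' = A.cl a'" by (rule A.gr_cases)
    show "gr_bilinear C FC \<beta> (y \<oplus>\<^bsub>gr A FA\<^esub> y') z = gr_bilinear C FC \<beta> y z \<oplus>\<^bsub>gr C FC\<^esub> gr_bilinear C FC \<beta> y' z"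
      using k_linear_add[OF l a(1) a'(1)] abelian_monoid.a_closed[OF _ a(1) a'(1)] kmod.axioms(1)[OF A.kmod_seqs]
      by (simp add: a c a' gr_bilinear_seqs k_linear_add[OF A.k_linear_cl, symmetric] abelian_group_def)
  qed
qed

end

lemma gr_map_cl:
  assumes "filt A FA" "filt B FB" and f: "k_linear A B f"
    and fil: "\<And>n a. a \<in> FA n \<Longrightarrow> f a \<in> FB n" and a: "a \<in> carrier A"
    and y: "y n = fil_below A FA n +>\<^bsub>A\<^esub> a"
  shows "gr_map B FB f y n = fil_below B FB n +>\<^bsub>B\<^esub> f a"
proof -
  interpret A: filt A FA by fact
  interpret B: filt B FB by fact
  have fb: "f u \<in> B.fb n" if "u \<in> A.fb n" for u
  proof (cases n)
    case 0
    then show ?thesis using that k_linear_zero[OF A.kmod_axioms B.kmod_axioms f] by (simp add: A.fb_0 B.fb_0)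
  qed (use that fil in \<open>simp add: A.fb_Suc B.fb_Suc\<close>)
  show ?thesis
    unfolding gr_map_def y
  proof (rule A.fb.coset_union[OF a])
    fix x assume "x \<in> A.fb n +>\<^bsub>A\<^esub> a"
    with A.fb.coset_memD[OF this a] fb[of "x \<oplus>\<^bsub>A\<^esub> \<ominus>\<^bsub>A\<^esub> a"] a
    show "B.fb n +>\<^bsub>B\<^esub> f x = B.fb n +>\<^bsub>B\<^esub> f a"
      by (simp add: B.fb.coset_eq_iff k_linear_closed[OF f] k_linear_add[OF f]
          k_linear_minus[OF A.kmod_axioms B.kmod_axioms f])
  qed
qed

section \<open>The tensor product filtration and the canonical map on associated graded
  modules\<close>

locale filt_pair = A: filt A FA + B: filt B FB
  for A :: "('k::comm_ring_1, 'a, 'm) module_scheme" and FA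
    and B :: "('k, 'b, 'n) module_scheme" and FB
begin

sublocale kmod_pair A B ..

abbreviation "TF \<equiv> tensor_filtration A FA B FB"

lemma TF_index_carrier: "(\<Union>i\<le>n. FA i \<times> FB (n - i)) \<subseteq> carrier A \<times> carrier B"
  using A.Fil_carrier B.Fil_carrier by blast

lemma TF_carrier: "t \<in> TF n \<Longrightarrow> t \<in> carrier T"
  using TF_index_carrier[of n] unfolding tensor_filtration_def tensor_def by (auto simp: FP.quotient_carrier)

lemma TF_pure:
  assumes "a \<in> FA i" "b \<in> FB j" shows "pure_tensor A B a b \<in> TF (i + j)"
proof -
  have "(a, b) \<in> (\<Union>l\<le>i + j. FA l \<times> FB (i + j - l))" using assms by (auto intro!: bexI[of _ i])
  then have "keys (single (a, b) (1::'k)) \<subseteq> (\<Union>l\<le>i + j. FA l \<times> FB (i + j - l))" by simp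
  then show ?thesis unfolding tensor_filtration_def pure_tensor_def by blast
qed

lemma filt_T: "filt T TF"
proof -
  interpret T: kmod T by (rule kmod_tensor)
  show ?thesis
  proof (unfold_locales, goal_cases)
    case 1 show ?case using TF_carrier by blast
  next
    case (2 n)
    have "\<zero>\<^bsub>T\<^esub> = K +>\<^bsub>FP\<^esub> 0" using FP.coset_zero by (simp add: tensor_def)
    then show ?case unfolding tensor_filtration_def by (intro CollectI exI[of _ 0]) simp
  next
    case (3 n x y)
    then obtain f h where fh: "x = K +>\<^bsub>FP\<^esub> f" "keys f \<subseteq> (\<Union>i\<le>n. FA i \<times> FB (n - i))"
      "y = K +>\<^bsub>FP\<^esub> h" "keys h \<subseteq> (\<Union>i\<le>n. FA i \<times> FB (n - i))"
      unfolding tensor_filtration_def by blast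
    then have "x \<oplus>\<^bsub>T\<^esub> y = K +>\<^bsub>FP\<^esub> (f + h)"
      using TF_index_carrier[of n] by (simp add: tensor_def FP.quotient_add)
    then show ?case using fh unfolding tensor_filtration_def by (intro CollectI exI[of _ "f + h"]) simp
  next
    case (4 n x c)
    then obtain f where f: "x = K +>\<^bsub>FP\<^esub> f" "keys f \<subseteq> (\<Union>i\<le>n. FA i \<times> FB (n - i))"
      unfolding tensor_filtration_def by blast
    then have "c \<odot>\<^bsub>T\<^esub> x = K +>\<^bsub>FP\<^esub> (Poly_Mapping.map ((*) c) f)"
      using TF_index_carrier[of n] by (simp add: tensor_def FP.quotient_smult)
    then show ?case using f unfolding tensor_filtration_def
      by (intro CollectI exI[of _ "Poly_Mapping.map ((*) c) f"]) simp
  next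
    case (5 n)
    have *: "(\<Union>i\<le>n. FA i \<times> FB (n - i)) \<subseteq> (\<Union>i\<le>Suc n. FA i \<times> FB (Suc n - i))"
    proof
      fix x assume "x \<in> (\<Union>i\<le>n. FA i \<times> FB (n - i))"
      then obtain i where "i \<le> n" "x \<in> FA i \<times> FB (n - i)" by blast
      moreover have "FB (n - i) \<subseteq> FB (Suc n - i)" by (rule B.Fil_mono) simp
      ultimately show "x \<in> (\<Union>i\<le>Suc n. FA i \<times> FB (Suc n - i))"
        by (intro UN_I[of i]) auto
    qed
    show ?case
    proof
      fix x assume "x \<in> TF n"
      then obtain f where "x = K +>\<^bsub>FP\<^esub> f" "keys f \<subseteq> (\<Union>i\<le>n. FA i \<times> FB (n - i))"
        unfolding tensor_filtration_def by (elim CollectE exE conjE)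
      then show "x \<in> TF (Suc n)"
        unfolding tensor_filtration_def by (intro CollectI exI conjI order_trans[OF _ *])
    qed
  qed
qed

lemma TF_induct [consumes 1, case_names zero pure add]:
  assumes "t \<in> TF n" and "P \<zero>\<^bsub>T\<^esub>"
    and pure: "\<And>i a b. i \<le> n \<Longrightarrow> a \<in> FA i \<Longrightarrow> b \<in> FB (n - i) \<Longrightarrow> P (pure_tensor A B a b)"
    and add: "\<And>s t. s \<in> carrier T \<Longrightarrow> t \<in> carrier T \<Longrightarrow> P s \<Longrightarrow> P t \<Longrightarrow> P (s \<oplus>\<^bsub>T\<^esub> t)"
  shows "P t"
proof -
  obtain f where f: "t = K +>\<^bsub>FP\<^esub> f" "keys f \<subseteq> (\<Union>i\<le>n. FA i \<times> FB (n - i))"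
    using assms(1) unfolding tensor_filtration_def by blast
  from f(2) have "P (K +>\<^bsub>FP\<^esub> f)"
  proof (induction f rule: pm_induct)
    case zero
    then show ?case using assms(2) FP.coset_zero by (simp add: tensor_def)
  next
    case (add s c h)
    obtain i a b where s: "s = (a, b)" "i \<le> n" "a \<in> FA i" "b \<in> FB (n - i)" using add.hyps by auto
    note ab = A.Fil_carrier[OF s(3)] B.Fil_carrier[OF s(4)]
    have h: "keys h \<subseteq> carrier A \<times> carrier B" using add.hyps TF_index_carrier[of n] by blast
    have "K +>\<^bsub>FP\<^esub> single s c = c \<odot>\<^bsub>T\<^esub> pure_tensor A B a b"
      using s ab by (simp add: tensor_def pure_tensor_def FP.quotient_smult)
    also have "\<dots> = pure_tensor A B (c \<odot>\<^bsub>A\<^esub> a) b"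
      using k_linear_smult[OF bilin_left[OF bilin_pure]] ab by simp
    finally have 1: "K +>\<^bsub>FP\<^esub> single s c = pure_tensor A B (c \<odot>\<^bsub>A\<^esub> a) b" .
    have 2: "K +>\<^bsub>FP\<^esub> (single s c + h) = (K +>\<^bsub>FP\<^esub> single s c) \<oplus>\<^bsub>T\<^esub> (K +>\<^bsub>FP\<^esub> h)"
      using s ab h by (simp add: tensor_def FP.quotient_add)
    have 3: "K +>\<^bsub>FP\<^esub> h \<in> carrier T" using h by (auto simp: tensor_def FP.quotient_carrier)
    show ?case
      unfolding 2 unfolding 1
      using assms(4)[OF pure_closed[OF A.smult_closed[OF ab(1)] ab(2)] 3
          pure[OF s(2) A.Fil.smult_mem[OF s(3)] s(4)] add.IH] .
  qed
  then show ?thesis using f(1) by simp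
qed

sublocale TF: filt T TF by (rule filt_T)

sublocale pure: filt_bilin A FA B FB T TF "pure_tensor A B"
  by (intro filt_bilin.intro A.filt_axioms B.filt_axioms filt_T filt_bilin_axioms.intro bilin_pure TF_pure)

sublocale grAB: kmod_pair "gr A FA" "gr B FB"
  by (intro kmod_pair.intro A.kmod_gr B.kmod_gr)

lemma gr_tensor_linear: "k_linear (tensor (gr A FA) (gr B FB)) (gr T TF) (gr_tensor A FA B FB)"
  unfolding gr_tensor_def by (rule grAB.tensor_lift_linear[OF TF.kmod_gr pure.bilin_gr])

lemma gr_tensor_pure:
  assumes "a \<in> carrier A.seqs" "b \<in> carrier B.seqs"
  shows "gr_tensor A FA B FB (pure_tensor (gr A FA) (gr B FB) (A.cl a) (B.cl b))
    = TF.cl (\<lambda>n. \<Oplus>\<^bsub>T\<^esub>i\<in>{..n}. pure_tensor A B (a i) (b (n - i)))"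
  unfolding gr_tensor_def
  using assms by (subst grAB.tensor_lift_pure[OF TF.kmod_gr pure.bilin_gr])
    (auto simp: A.gr_carrier B.gr_carrier pure.gr_bilinear_seqs)

end

section \<open>The bosonization\<close>

lemma word_char_simps [simp]:
  "word_char \<chi> [] a = 1" "word_char \<chi> (i # w) a = \<chi> i a * word_char \<chi> w a"
  "word_char \<chi> (u @ v) a = word_char \<chi> u a * word_char \<chi> v a"
  by (simp_all add: word_char_def)

lemma word_degree_simps [simp]:
  "word_degree g [] = 0" "word_degree g (i # w) = g i + word_degree g w"
  "word_degree g (u @ v) = word_degree g u + word_degree g v"
  by (simp_all add: word_degree_def)

lemma bosonization_simps [simp]:
  "carrier (bosonization \<chi>) = UNIV" "one (bosonization \<chi>) = single ([], 0) 1"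
  "zero (bosonization \<chi>) = 0" "add (bosonization \<chi>) = (+)"
  "smult (bosonization \<chi>) = (\<lambda>c. Poly_Mapping.map ((*) c))"
  by (simp_all add: bosonization_def)

locale characters =
  fixes \<chi> :: "'i \<Rightarrow> 'g::ab_group_add \<Rightarrow> 'k::comm_ring_1"
  assumes character: "character (\<chi> i)"
begin

lemma \<chi>_add: "\<chi> i (a + b) = \<chi> i a * \<chi> i b"
  using character by (auto simp: character_def)

text \<open>\<open>\<chi> i 0\<close> is an idempotent that divides 1.\<close>

lemma \<chi>_zero [simp]: "\<chi> i 0 = 1"
proof -
  have "\<chi> i 0 dvd 1" using character[of i] by (simp add: character_def)
  then obtain c where "1 = \<chi> i 0 * c" by (elim dvdE)
  moreover have "\<chi> i 0 = \<chi> i 0 * \<chi> i 0" using \<chi>_add[of i 0 0] by simp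
  ultimately show ?thesis by (metis mult.assoc mult.right_neutral)
qed

lemma \<chi>_inverse [simp]: "\<chi> i a * \<chi> i (- a) = 1" "\<chi> i (- a) * \<chi> i a = 1"
  using \<chi>_add[of i a "- a"] \<chi>_add[of i "- a" a] by simp_all

lemma \<chi>_inverse_left [simp]: "\<chi> i a * (\<chi> i (- a) * c) = c" "\<chi> i (- a) * (\<chi> i a * c) = c"
  by (simp_all flip: mult.assoc)

lemma \<chi>_eq_minus_iff: "\<chi> i a = \<chi> j (- b) \<longleftrightarrow> \<chi> i a * \<chi> j b = 1"
proof
  assume "\<chi> i a * \<chi> j b = 1"
  then have "\<chi> i a * \<chi> j b * \<chi> j (- b) = \<chi> j (- b)" by simp
  then show "\<chi> i a = \<chi> j (- b)" by (simp add: mult.assoc)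
qed simp

lemma word_char_add: "word_char \<chi> w (a + b) = word_char \<chi> w a * word_char \<chi> w b"
  by (induction w) (simp_all add: \<chi>_add mult_ac)

lemma word_char_zero [simp]: "word_char \<chi> w 0 = 1"
  by (induction w) simp_all

abbreviation "F \<equiv> bosonization \<chi>"
abbreviation fmul (infixl "\<star>" 70) where "x \<star> y \<equiv> x \<otimes>\<^bsub>F\<^esub> y"
abbreviation fscale (infixr "*\<^sub>k" 75) where "c *\<^sub>k x \<equiv> Poly_Mapping.map ((*) c) x"

lemma kalg_F: "kalg F"
  unfolding bosonization_def
  by (rule twist.kalg_T, unfold_locales) (auto simp: word_char_add algebra_simps)

sublocale F: kalg F by (rule kalg_F)
sublocale FF: kalg_pair F F ..

lemma fmul_single [simp]:
  "single (u, a) c \<star> single (v, b) d = single (u @ v, a + b) (word_char \<chi> v a * c * d)"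
  by (simp add: bosonization_def)

lemma fmul_assoc: "(x \<star> y) \<star> z = x \<star> (y \<star> z)"
  using F.m_assoc[of x y z] by simp

lemma fmul_distrib:
  "(x + y) \<star> z = x \<star> z + y \<star> z" "z \<star> (x + y) = z \<star> x + z \<star> y"
  "(x - y) \<star> z = x \<star> z - y \<star> z" "z \<star> (x - y) = z \<star> x - z \<star> y"
  by (simp_all add: bosonization_def twisted_mult_add_left twisted_mult_add_right
      twisted_mult_diff_left twisted_mult_diff_right)

lemma fmul_zero [simp]: "0 \<star> x = 0" "x \<star> 0 = 0"
  by (simp_all add: bosonization_def)

lemma fmul_scale: "(c *\<^sub>k x) \<star> y = c *\<^sub>k (x \<star> y)" "x \<star> (c *\<^sub>k y) = c *\<^sub>k (x \<star> y)"
  by (simp_all add: bosonization_def twisted_mult_scale_left twisted_mult_scale_right)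

lemma fmul_one [simp]: "single ([], 0) 1 \<star> x = x" "x \<star> single ([], 0) 1 = x"
  using F.l_one[of x] F.r_one[of x] by simp_all

lemma F_minus [simp]: "\<ominus>\<^bsub>F\<^esub> x = - x"
  by (simp add: bosonization_def twisted_a_inv)

lemma fscale_simps:
  "c *\<^sub>k (x + y) = c *\<^sub>k x + c *\<^sub>k y" "c *\<^sub>k (x - y) = c *\<^sub>k x - c *\<^sub>k y" "c *\<^sub>k d *\<^sub>k x = (c * d) *\<^sub>k x"
  "1 *\<^sub>k x = x" "c *\<^sub>k 0 = 0"
  for x y :: "'i list \<times> 'g \<Rightarrow>\<^sub>0 'k"
  by (simp_all add: pm.scale_right_distrib pm.scale_right_diff_distrib)

lemma pscale_id [simp]: "Poly_Mapping.map (\<lambda>c. c) x = x"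
  by (rule poly_mapping_eqI) (simp add: Poly_Mapping.map.rep_eq when_def)

lemma var_mult_single [simp]: "var i \<star> single (w, a) c = single (i # w, a) c"
  by (simp add: var_def)

lemma grouplike_mult_single [simp]: "grouplike a \<star> single (w, b) c = single (w, a + b) (word_char \<chi> w a * c)"
  by (simp add: grouplike_def)

lemma grouplike_mult: "grouplike a \<star> grouplike b = grouplike (a + b)"
  by (simp add: grouplike_def)

lemma grouplike_zero: "grouplike 0 = single ([], 0) 1"
  by (simp add: grouplike_def)

lemma grouplike_var: "grouplike a \<star> var i = \<chi> i a *\<^sub>k (var i \<star> grouplike a)"
  by (simp add: grouplike_def var_def)

lemma F_induct [case_names zero add single]:
  fixes f :: "'i list \<times> 'g \<Rightarrow>\<^sub>0 'k"
  assumes "P 0" "\<And>x y. P x \<Longrightarrow> P y \<Longrightarrow> P (x + y)" "\<And>w a c. P (single (w, a) c)"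
  shows "P f"
proof -
  have "keys f \<subseteq> UNIV" by simp
  then show ?thesis
  proof (induction f rule: pm_induct)
    case (add s c h)
    then show ?case using assms(2) assms(3)[of "fst s" "snd s" c] by simp
  qed (rule assms)
qed

lemma linear_F_eqI:
  assumes "kmod B" "k_linear F B f" "k_linear F B h"
    and "\<And>w a. f (single (w, a) 1) = h (single (w, a) 1)"
  shows "f x = h x"
proof (induction x rule: F_induct)
  case zero
  show ?case using k_linear_zero[OF F.kmod_axioms assms(1,2)] k_linear_zero[OF F.kmod_axioms assms(1,3)] by simp
next
  case (add x y)
  then show ?case using k_linear_add[OF assms(2), of x y] k_linear_add[OF assms(3), of x y] by simp
next
  case (single w a c)
  then show ?case
    using k_linear_smult[OF assms(2), of "single (w, a) 1" c] k_linear_smult[OF assms(3), of "single (w, a) 1" c]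
    by (simp add: assms(4))
qed

lemma linear_F_multI:
  assumes "kalg B" "k_linear F B f"
    and "\<And>w a v b. f (single (w, a) 1 \<star> single (v, b) 1) = f (single (w, a) 1) \<otimes>\<^bsub>B\<^esub> f (single (v, b) 1)"
  shows "f (x \<star> y) = f x \<otimes>\<^bsub>B\<^esub> f y"
proof -
  interpret B: kalg B by fact
  have cl: "f z \<in> carrier B" for z using k_linear_closed[OF assms(2)] by simp
  have ad: "f (z + z') = f z \<oplus>\<^bsub>B\<^esub> f z'" for z z' using k_linear_add[OF assms(2)] by simp
  have sm: "f (c *\<^sub>k z) = c \<odot>\<^bsub>B\<^esub> f z" for c z using k_linear_smult[OF assms(2)] by simp
  have 1: "k_linear F B (\<lambda>y. f (single (w, a) 1 \<star> y))" for w a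
    by (rule k_linearI) (simp_all add: cl ad sm fmul_distrib fmul_scale)
  have 2: "k_linear F B (\<lambda>y. f (single (w, a) 1) \<otimes>\<^bsub>B\<^esub> f y)" for w a
    by (rule k_linearI) (simp_all add: cl ad sm B.r_distr B.smult_mult_right)
  have 3: "f (single (w, a) 1 \<star> y) = f (single (w, a) 1) \<otimes>\<^bsub>B\<^esub> f y" for w a
    by (rule linear_F_eqI[OF B.kmod_axioms 1 2]) (rule assms(3))
  have 4: "k_linear F B (\<lambda>x. f (x \<star> y))"
    by (rule k_linearI) (simp_all add: cl ad sm fmul_distrib fmul_scale)
  have 5: "k_linear F B (\<lambda>x. f x \<otimes>\<^bsub>B\<^esub> f y)"
    by (rule k_linearI) (simp_all add: cl ad sm B.l_distr B.smult_mult_left)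
  show ?thesis
    by (rule linear_F_eqI[OF B.kmod_axioms 4 5]) (rule 3)
qed

lemma algebra_hom_F_eqI:
  assumes "kalg B" "algebra_hom F B f" "algebra_hom F B h"
    and "\<And>i. f (var i) = h (var i)" "\<And>a. f (grouplike a) = h (grouplike a)"
  shows "f x = h x"
proof (rule linear_F_eqI[OF kalg_kmod[OF assms(1)] algebra_hom_linear[OF assms(2)] algebra_hom_linear[OF assms(3)]])
  fix w a
  show "f (single (w, a) 1) = h (single (w, a) 1)"
  proof (induction w)
    case (Cons i w)
    then show ?case
      using algebra_hom_mult[OF assms(2), of "var i" "single (w, a) 1"]
        algebra_hom_mult[OF assms(3), of "var i" "single (w, a) 1"]
      by (simp add: assms(4))
  qed (use assms(5) in \<open>simp add: grouplike_def\<close>)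
qed

lemma linear_extension_F:
  assumes "kmod B" "\<And>p. \<phi> p \<in> carrier B"
  shows "k_linear F B (linear_extension B \<phi>)" "linear_extension B \<phi> (single p 1) = \<phi> p"
proof -
  interpret B: kmod B by fact
  show "k_linear F B (linear_extension B \<phi>)"
    using assms(2) by (intro k_linearI) (auto simp: B.lin_ext_closed B.lin_ext_add B.lin_ext_smult)
  show "linear_extension B \<phi> (single p 1) = \<phi> p"
    using assms(2) by (simp add: B.lin_ext_single)
qed

text \<open>The universal property of \<open>F\<close>: it is presented by the letters and the group
  elements, with the group law and the straightening relation \<open>GX\<close>. The map is defined
  on the normal forms, a word followed by a group element.\<close>

lemma algebra_hom_extension:
  assumes B: "kalg B" and X: "\<And>i. X i \<in> carrier B" and G: "\<And>a. G a \<in> carrier B"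
    and G0: "G 0 = \<one>\<^bsub>B\<^esub>" and G_add: "\<And>a b. G (a + b) = G a \<otimes>\<^bsub>B\<^esub> G b"
    and GX: "\<And>a i. G a \<otimes>\<^bsub>B\<^esub> X i = \<chi> i a \<odot>\<^bsub>B\<^esub> (X i \<otimes>\<^bsub>B\<^esub> G a)"
  defines "f \<equiv> linear_extension B (\<lambda>(w, a). foldr (\<lambda>i t. X i \<otimes>\<^bsub>B\<^esub> t) w (G a))"
  shows "algebra_hom F B f" "f (var i) = X i" "f (grouplike a) = G a"
    and "f (single (w, a) 1) = foldr (\<lambda>i t. X i \<otimes>\<^bsub>B\<^esub> t) w (G a)"
proof -
  interpret B: kalg B by fact
  let ?W = "\<lambda>w t. foldr (\<lambda>i t. X i \<otimes>\<^bsub>B\<^esub> t) w t"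
  have W: "?W w t \<in> carrier B" if "t \<in> carrier B" for w t
    using that by (induction w) (auto simp: X)
  have WG: "(case p of (w, a) \<Rightarrow> ?W w (G a)) \<in> carrier B" for p
    by (auto simp: W G split: prod.split)
  note f = linear_extension_F[OF B.kmod_axioms, of "\<lambda>(w, a). ?W w (G a)", OF WG, folded f_def]
  show sing: "f (single (w, a) 1) = ?W w (G a)" for w a using f(2) by simp
  show "f (grouplike a) = G a" for a by (simp add: grouplike_def sing)
  show "f (var i) = X i" for i by (simp add: var_def sing G0 X)
  have Wt: "?W w s \<otimes>\<^bsub>B\<^esub> t = ?W w (s \<otimes>\<^bsub>B\<^esub> t)" if "s \<in> carrier B" "t \<in> carrier B" for w s t
    using that by (induction w) (auto simp: B.m_assoc X W)
  have Wsm: "?W w (c \<odot>\<^bsub>B\<^esub> t) = c \<odot>\<^bsub>B\<^esub> ?W w t" if "t \<in> carrier B" for w t c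
    using that by (induction w) (auto simp: B.smult_mult_right X W)
  \<comment> \<open>Moving a group element past a word collects one character value per letter. This
    is the same factor as in the product of the bosonization, hence multiplicativity.\<close>
  have GW: "G a \<otimes>\<^bsub>B\<^esub> ?W w t = word_char \<chi> w a \<odot>\<^bsub>B\<^esub> ?W w (G a \<otimes>\<^bsub>B\<^esub> t)" if t: "t \<in> carrier B" for a w t
  proof (induction w)
    case (Cons i w)
    have "G a \<otimes>\<^bsub>B\<^esub> (X i \<otimes>\<^bsub>B\<^esub> ?W w t) = \<chi> i a \<odot>\<^bsub>B\<^esub> (X i \<otimes>\<^bsub>B\<^esub> (G a \<otimes>\<^bsub>B\<^esub> ?W w t))"
      using t by (simp add: B.m_assoc[symmetric] G X W GX B.smult_mult_left)
    with Cons show ?case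
      using t by (simp add: B.smult_mult_right G X W B.smult_smult)
  qed (use t G in simp)
  show "algebra_hom F B f"
  proof (rule algebra_homI[OF f(1)])
    show "f \<one>\<^bsub>F\<^esub> = \<one>\<^bsub>B\<^esub>" by (simp add: sing G0)
    show "f (x \<star> y) = f x \<otimes>\<^bsub>B\<^esub> f y" for x y
    proof (rule linear_F_multI[OF B f(1)])
      fix w a v b
      have "f (single (w, a) 1 \<star> single (v, b) 1) = word_char \<chi> v a \<odot>\<^bsub>B\<^esub> f (single (w @ v, a + b) 1)"
        using k_linear_smult[OF f(1), of "single (w @ v, a + b) 1" "word_char \<chi> v a"] by simp
      also have "\<dots> = f (single (w, a) 1) \<otimes>\<^bsub>B\<^esub> f (single (v, b) 1)"
        by (simp add: sing Wt G W GW Wsm G_add)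
      finally show "f (single (w, a) 1 \<star> single (v, b) 1) = f (single (w, a) 1) \<otimes>\<^bsub>B\<^esub> f (single (v, b) 1)" .
    qed
  qed
qed

lemma F_counit_superset:
  "finite K \<Longrightarrow> keys f \<subseteq> K \<Longrightarrow> F_counit f = (\<Sum>p\<in>K. if fst p = [] then lookup f p else 0)"
  unfolding F_counit_def
  by (subst sum.inter_filter[symmetric]) (auto intro!: sum.mono_neutral_left simp: in_keys_iff)

lemma F_counit_add: "F_counit (x + y) = F_counit x + F_counit y"
  by (simp add: F_counit_superset[of "keys x \<union> keys y"] keys_add sum.distrib[symmetric])
    (rule sum.cong, auto simp: lookup_add)

lemma F_counit_scale: "F_counit (c *\<^sub>k x) = c * F_counit x"
  by (simp add: F_counit_superset[of "keys x"] keys_pscale sum_distrib_left)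
    (rule sum.cong, auto)

lemma F_counit_single [simp]: "F_counit (single (w, a) c) = (if w = [] then c else 0)"
  by (simp add: F_counit_superset[of "{(w, a)}"])

lemma F_counit_hom: "algebra_hom F base_ring F_counit"
proof (rule algebra_homI)
  show l: "k_linear F base_ring F_counit"
    by (rule k_linearI) (simp_all add: F_counit_add F_counit_scale)
  show "F_counit (x \<star> y) = F_counit x \<otimes>\<^bsub>base_ring\<^esub> F_counit y" for x y
    by (rule linear_F_multI[OF kalg_base_ring l]) auto
qed simp

lemma F_counit_generators [simp]: "F_counit (var i) = 0" "F_counit (grouplike a) = 1"
  by (simp_all add: var_def grouplike_def)

abbreviation "FF \<equiv> tensor F F"
abbreviation pure (infix "\<otimes>\<^sub>k" 72) where "x \<otimes>\<^sub>k y \<equiv> pure_tensor F F x y"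

lemma pure_F:
  "(x + x') \<otimes>\<^sub>k y = x \<otimes>\<^sub>k y \<oplus>\<^bsub>FF\<^esub> x' \<otimes>\<^sub>k y" "x \<otimes>\<^sub>k (y + y') = x \<otimes>\<^sub>k y \<oplus>\<^bsub>FF\<^esub> x \<otimes>\<^sub>k y'"
  "(c *\<^sub>k x) \<otimes>\<^sub>k y = c \<odot>\<^bsub>FF\<^esub> (x \<otimes>\<^sub>k y)" "x \<otimes>\<^sub>k (c *\<^sub>k y) = c \<odot>\<^bsub>FF\<^esub> (x \<otimes>\<^sub>k y)"
  using k_linear_add[OF bilin_left[OF FF.bilin_pure], of y x x'] k_linear_add[OF bilin_right[OF FF.bilin_pure], of x y y']
    k_linear_smult[OF bilin_left[OF FF.bilin_pure], of y x c] k_linear_smult[OF bilin_right[OF FF.bilin_pure], of x y c]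
  by simp_all

lemma pure_F_mult: "(x \<otimes>\<^sub>k y) \<otimes>\<^bsub>FF\<^esub> (x' \<otimes>\<^sub>k y') = (x \<star> x') \<otimes>\<^sub>k (y \<star> y')"
  using FF.pure_mult[of x y x' y'] by simp

lemma pure_F_closed [simp]: "x \<otimes>\<^sub>k y \<in> carrier FF"
  using FF.pure_closed[of x y] by simp

sublocale FFa: kalg FF by (rule FF.kalg_tensor)

end

section \<open>The Hopf structure of the bosonization\<close>

locale yd = characters \<chi> for \<chi> :: "'i \<Rightarrow> 'g::ab_group_add \<Rightarrow> 'k::comm_ring_1" +
  fixes g :: "'i \<Rightarrow> 'g"
begin

abbreviation "\<Delta> \<equiv> F_comult g \<chi>"
abbreviation "DX \<equiv> \<lambda>i. var i \<otimes>\<^sub>k single ([], 0) 1 \<oplus>\<^bsub>FF\<^esub> grouplike (g i) \<otimes>\<^sub>k var i"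

lemma F_comult_hom: "algebra_hom F FF \<Delta>"
  and F_comult_var: "\<Delta> (var i) = DX i"
  and F_comult_grouplike: "\<Delta> (grouplike a) = grouplike a \<otimes>\<^sub>k grouplike a"
proof -
  have GX: "grouplike a \<otimes>\<^sub>k grouplike a \<otimes>\<^bsub>FF\<^esub> DX i
    = \<chi> i a \<odot>\<^bsub>FF\<^esub> (DX i \<otimes>\<^bsub>FF\<^esub> (grouplike a \<otimes>\<^sub>k grouplike a))" for a i
    by (simp add: FFa.r_distr FFa.l_distr FFa.smult_r_distr pure_F_mult grouplike_var pure_F
        grouplike_mult add.commute)
  note * = algebra_hom_extension[OF FF.kalg_tensor, where X = DX and G = "\<lambda>a. grouplike a \<otimes>\<^sub>k grouplike a", OF _ _ _ _ GX]
  have "\<Delta> = linear_extension FF (\<lambda>(w, a). foldr (\<lambda>i t. DX i \<otimes>\<^bsub>FF\<^esub> t) w (grouplike a \<otimes>\<^sub>k grouplike a))"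
    by (simp add: F_comult_def Let_def)
  then show "algebra_hom F FF \<Delta>" "\<Delta> (var i) = DX i" "\<Delta> (grouplike a) = grouplike a \<otimes>\<^sub>k grouplike a"
    using * by (simp_all add: grouplike_zero FF.tensor_one pure_F_mult grouplike_mult)
qed

lemma F_comult_linear: "k_linear F FF \<Delta>"
  by (rule algebra_hom_linear[OF F_comult_hom])

lemma F_comult_closed [simp]: "\<Delta> x \<in> carrier FF"
  using k_linear_closed[OF F_comult_linear, of x] by simp

lemma F_comult_var_mult: "\<Delta> (var i \<star> x) = DX i \<otimes>\<^bsub>FF\<^esub> \<Delta> x"
  using algebra_hom_mult[OF F_comult_hom, of "var i" x] by (simp add: F_comult_var)

lemma F_comult_one: "\<Delta> (single ([], 0) 1) = single ([], 0) 1 \<otimes>\<^sub>k single ([], 0) 1"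
  using F_comult_grouplike[of 0] by (simp add: grouplike_zero)

text \<open>Both sides are algebra maps, so they need to be compared on letters and group elements
  only. The counit axioms below are obtained in the same way.\<close>

lemma F_coassoc:
  "tensor_assoc F F F (tensor_map FF F \<Delta> id (\<Delta> h)) = tensor_map F FF id \<Delta> (\<Delta> h)"
proof -
  interpret FFF: kmod_triple F F F ..
  interpret F_FF: kalg_pair F FF by (intro kalg_pair.intro kalg_F FF.kalg_tensor)
  interpret FF_F: kalg_pair FF F by (intro kalg_pair.intro kalg_F FF.kalg_tensor)
  interpret R: kalg "tensor F FF" by (rule F_FF.kalg_tensor)
  interpret L: kalg "tensor FF F" by (rule FF_F.kalg_tensor)
  note m1 = tensor_map[OF F.kmod_axioms F.kmod_axioms FFa.kmod_axioms F.kmod_axioms F_comult_linear k_linear_id(1)]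
  note m2 = tensor_map[OF F.kmod_axioms F.kmod_axioms F.kmod_axioms FFa.kmod_axioms k_linear_id(1) F_comult_linear]
  have 1: "algebra_hom F (tensor F FF) (\<lambda>h. tensor_assoc F F F (tensor_map FF F \<Delta> id (\<Delta> h)))"
    by (intro algebra_hom_comp[OF algebra_hom_comp[OF F_comult_hom] tensor_assoc_algebra_hom]
        tensor_map_algebra_hom F_comult_hom algebra_hom_id kalg_F FFa.kalg_axioms)
  have 2: "algebra_hom F (tensor F FF) (\<lambda>h. tensor_map F FF id \<Delta> (\<Delta> h))"
    by (intro algebra_hom_comp[OF F_comult_hom] tensor_map_algebra_hom F_comult_hom algebra_hom_id kalg_F FFa.kalg_axioms)
  note a = k_linear_add[OF m1(2)] k_linear_add[OF m2(2)] m1(1) m2(1)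
    k_linear_add[OF FFF.tensor_assoc_linear] FFF.tensor_assoc_pure
    k_linear_add[OF bilin_left[OF FFF.AB_C.bilin_pure]] k_linear_add[OF bilin_right[OF FFF.A_BC.bilin_pure]]
  show ?thesis
    by (rule algebra_hom_F_eqI[OF F_FF.kalg_tensor 1 2])
      (simp_all add: F_comult_var F_comult_grouplike F_comult_one a R.a_assoc L.a_closed
        FFF.AB_C.pure_closed FFF.A_BC.pure_closed)
qed

lemma F_counit_left: "tensor_lift F (\<lambda>a b. F_counit a *\<^sub>k b) (\<Delta> h) = h"
  and F_counit_right: "tensor_lift F (\<lambda>a b. F_counit b *\<^sub>k a) (\<Delta> h) = h"
proof -
  have b1: "bilin F F F (\<lambda>a b. F_counit a *\<^sub>k b)" and b2: "bilin F F F (\<lambda>a b. F_counit b *\<^sub>k a)"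
    by (auto intro!: bilinI k_linearI simp: F_counit_add F_counit_scale pm.scale_left_distrib fscale_simps mult.commute)
  note l1 = FF.tensor_lift[OF F.kmod_axioms b1] and l2 = FF.tensor_lift[OF F.kmod_axioms b2]
  have m: "F_counit (x \<star> y) = F_counit x * F_counit y" for x y
    using algebra_hom_mult[OF F_counit_hom, of x y] by simp
  have h1: "algebra_hom FF F (tensor_lift F (\<lambda>a b. F_counit a *\<^sub>k b))"
    by (rule FF.tensor_algebra_homI[OF kalg_F l1(2)]) (simp_all add: l1(1) m fmul_scale fscale_simps mult.commute)
  have h2: "algebra_hom FF F (tensor_lift F (\<lambda>a b. F_counit b *\<^sub>k a))"
    by (rule FF.tensor_algebra_homI[OF kalg_F l2(2)]) (simp_all add: l2(1) m fmul_scale fscale_simps mult.commute)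
  show "tensor_lift F (\<lambda>a b. F_counit a *\<^sub>k b) (\<Delta> h) = h"
    by (rule algebra_hom_F_eqI[OF kalg_F algebra_hom_comp[OF F_comult_hom h1] algebra_hom_id(2)])
      (simp_all add: F_comult_var F_comult_grouplike k_linear_add[OF l1(2)] l1(1))
  show "tensor_lift F (\<lambda>a b. F_counit b *\<^sub>k a) (\<Delta> h) = h"
    by (rule algebra_hom_F_eqI[OF kalg_F algebra_hom_comp[OF F_comult_hom h2] algebra_hom_id(2)])
      (simp_all add: F_comult_var F_comult_grouplike k_linear_add[OF l2(2)] l2(1))
qed

definition Sx :: "'i \<Rightarrow> 'i list \<times> 'g \<Rightarrow>\<^sub>0 'k" where
  "Sx i = - (grouplike (- g i) \<star> var i)"

text \<open>The antipode is antimultiplicative: letters of the word are read from the left and their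
  images multiplied on the right, in front of which stands the inverse of the group element.\<close>

definition Sw :: "'i list \<Rightarrow> 'g \<Rightarrow> 'i list \<times> 'g \<Rightarrow>\<^sub>0 'k" where
  "Sw w a = foldr (\<lambda>i t. t \<star> Sx i) w (grouplike (- a))"

definition S :: "('i list \<times> 'g \<Rightarrow>\<^sub>0 'k) \<Rightarrow> 'i list \<times> 'g \<Rightarrow>\<^sub>0 'k" where
  "S = linear_extension F (\<lambda>(w, a). Sw w a)"

lemma S_linear: "k_linear F F S"
  unfolding S_def by (rule linear_extension_F[OF F.kmod_axioms]) simp

lemma S_add: "S (x + y) = S x + S y" and S_scale: "S (c *\<^sub>k x) = c *\<^sub>k S x"
  using k_linear_add[OF S_linear, of x y] k_linear_smult[OF S_linear, of x c] by simp_all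

lemma S_single: "S (single (w, a) c) = c *\<^sub>k Sw w a"
  unfolding S_def by (subst F.lin_ext_single) simp_all

lemma S_zero [simp]: "S 0 = 0"
  using S_scale[of 0 0] by simp

lemma S_uminus: "S (- x) = - S x"
  using S_add[of x "- x"] by (simp add: eq_neg_iff_add_eq_0 add.commute)

lemma S_diff: "S (x - y) = S x - S y"
  using S_add[of x "- y"] by (simp add: S_uminus)

lemma S_var_mult: "S (var i \<star> x) = S x \<star> Sx i"
proof (induction x rule: F_induct)
  case (add x y)
  then show ?case by (simp add: fmul_distrib S_add)
qed (simp_all add: S_single Sw_def fmul_scale)

lemma S_grouplike [simp]: "S (grouplike a) = grouplike (- a)"
  by (simp add: grouplike_def S_single Sw_def fscale_simps)

lemma S_var: "S (var i) = Sx i"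
  using S_var_mult[of i "single ([], 0) 1"] S_grouplike[of 0] by (simp add: grouplike_zero)

lemma Sx_grouplike: "Sx i \<star> grouplike (- a) = \<chi> i a *\<^sub>k (grouplike (- a) \<star> Sx i)"
  by (simp add: Sx_def grouplike_def var_def single_uminus[symmetric] algebra_simps)

lemma Sw_grouplike: "Sw w b \<star> grouplike (- a) = word_char \<chi> w a *\<^sub>k Sw w (a + b)"
proof (induction w)
  case Nil
  then show ?case by (simp add: Sw_def grouplike_mult fscale_simps add.commute)
next
  case (Cons i w)
  have "Sw (i # w) b \<star> grouplike (- a) = Sw w b \<star> (Sx i \<star> grouplike (- a))"
    by (simp add: Sw_def fmul_assoc)
  also have "\<dots> = \<chi> i a *\<^sub>k ((Sw w b \<star> grouplike (- a)) \<star> Sx i)"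
    by (simp add: Sx_grouplike fmul_scale fmul_assoc)
  also have "\<dots> = word_char \<chi> (i # w) a *\<^sub>k Sw (i # w) (a + b)"
    unfolding Cons by (simp add: Sw_def fmul_scale fscale_simps)
  finally show ?case .
qed

lemma S_grouplike_mult: "S (grouplike a \<star> x) = S x \<star> grouplike (- a)"
proof (induction x rule: F_induct)
  case (add x y)
  then show ?case by (simp add: fmul_distrib S_add)
qed (simp_all add: S_single fmul_scale Sw_grouplike fscale_simps mult.commute)

lemma S_mult: "S (x \<star> y) = S y \<star> S x"
proof (induction x rule: F_induct)
  case (single w a c)
  have "S (single (w, a) 1 \<star> y) = S y \<star> S (single (w, a) 1)" for y
  proof (induction w)
    case Nil
    show ?case using S_grouplike_mult[of a y] by (simp flip: grouplike_def)
  next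
    case (Cons i w)
    have "S (single (i # w, a) 1 \<star> y) = S (var i \<star> (single (w, a) 1 \<star> y))"
      by (simp flip: fmul_assoc)
    also have "\<dots> = S y \<star> S (var i \<star> single (w, a) 1)"
      by (simp only: S_var_mult Cons fmul_assoc)
    finally show ?case by simp
  qed
  then have "S (c *\<^sub>k (single (w, a) 1 \<star> y)) = S y \<star> S (c *\<^sub>k single (w, a) 1)"
    by (simp only: S_scale fmul_scale)
  then show ?case by (simp flip: fmul_scale)
qed (simp_all add: fmul_distrib S_add)

lemma bilin_fmul: "bilin F F F (\<lambda>a b. a \<star> b)"
  by (auto intro!: bilinI k_linearI simp: fmul_distrib fmul_scale)

lemma F_antipode_right: "tensor_lift F (\<lambda>a b. a \<star> S b) (\<Delta> h) = F_counit h *\<^sub>k single ([], 0) 1"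
proof -
  note b = bilin_comp[OF bilin_fmul k_linear_id(2) S_linear]
  note l = FF.tensor_lift[OF F.kmod_axioms b]
  let ?m = "tensor_lift F (\<lambda>a b. a \<star> S b)"
  have lp: "?m (a \<otimes>\<^sub>k b) = a \<star> S b" for a b using l(1)[of a b] by simp
  have la: "?m (s \<oplus>\<^bsub>FF\<^esub> t) = ?m s + ?m t" if "s \<in> carrier FF" "t \<in> carrier FF" for s t
    using k_linear_add[OF l(2) that] by simp
  \<comment> \<open>On \<open>\<Delta> x\<close> the value of \<open>?m\<close> is a scalar by
    induction, and the two terms then cancel since \<open>Sx i\<close> is minus the inverse group
    element times \<open>var i\<close>.\<close>
  have DX: "?m (DX i \<otimes>\<^bsub>FF\<^esub> t) = var i \<star> ?m t + grouplike (g i) \<star> ?m t \<star> Sx i" if "t \<in> carrier FF" for i t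
    using that
  proof (induction t rule: FF.tensor_induct)
    case (pure a b)
    then show ?case by (simp add: FFa.l_distr pure_F_mult lp la S_var_mult fmul_assoc)
  next
    case (add s t)
    then show ?case by (simp add: FFa.r_distr la fmul_distrib algebra_simps)
  qed
  have 1: "k_linear F F (\<lambda>h. ?m (\<Delta> h))" by (rule k_linear_comp[OF F_comult_linear l(2)])
  have 2: "k_linear F F (\<lambda>h. F_counit h *\<^sub>k single ([], 0) 1)"
    by (rule k_linearI) (simp_all add: F_counit_add F_counit_scale single_add)
  have "?m (\<Delta> (single (w, a) 1)) = F_counit (single (w, a) 1) *\<^sub>k single ([], 0) 1" for w a
  proof (induction w)
    case Nil
    show ?case
      using F_comult_grouplike[of a] by (simp add: grouplike_def lp S_single Sw_def fscale_simps)
  next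
    case (Cons i w)
    have "?m (\<Delta> (single (i # w, a) 1)) = ?m (DX i \<otimes>\<^bsub>FF\<^esub> \<Delta> (single (w, a) 1))"
      by (simp flip: F_comult_var_mult)
    also have "\<dots> = 0"
      by (subst DX) (simp_all add: Cons Sx_def grouplike_def var_def single_uminus[symmetric] single_add[symmetric])
    finally show ?case by simp
  qed
  then show ?thesis by (rule linear_F_eqI[OF F.kmod_axioms 1 2])
qed

lemma F_antipode_left: "tensor_lift F (\<lambda>a b. S a \<star> b) (\<Delta> h) = F_counit h *\<^sub>k single ([], 0) 1"
proof -
  note b = bilin_comp[OF bilin_fmul S_linear k_linear_id(2)]
  note l = FF.tensor_lift[OF F.kmod_axioms b]
  let ?m = "tensor_lift F (\<lambda>a b. S a \<star> b)"
  have lp: "?m (a \<otimes>\<^sub>k b) = S a \<star> b" for a b using l(1)[of a b] by simp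
  have la: "?m (s \<oplus>\<^bsub>FF\<^esub> t) = ?m s + ?m t" if "s \<in> carrier FF" "t \<in> carrier FF" for s t
    using k_linear_add[OF l(2) that] by simp
  \<comment> \<open>On this side the cancellation is independent of \<open>t\<close>:
    antimultiplicativity puts \<open>Sx i\<close> and \<open>grouplike (- g i) \<star> var i\<close>
    into the same place between the two legs.\<close>
  have DX: "?m (DX i \<otimes>\<^bsub>FF\<^esub> t) = 0" if "t \<in> carrier FF" for i t
    using that
  proof (induction t rule: FF.tensor_induct)
    case (pure a b)
    have "S a \<star> Sx i \<star> b + S a \<star> grouplike (- g i) \<star> (var i \<star> b) = S a \<star> (Sx i + grouplike (- g i) \<star> var i) \<star> b"
      by (simp only: fmul_assoc fmul_distrib)
    then show ?case
      by (simp add: FFa.l_distr pure_F_mult lp la S_var_mult S_grouplike_mult Sx_def)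
  next
    case (add s t)
    then show ?case by (simp add: FFa.r_distr la)
  qed
  have 1: "k_linear F F (\<lambda>h. ?m (\<Delta> h))" by (rule k_linear_comp[OF F_comult_linear l(2)])
  have 2: "k_linear F F (\<lambda>h. F_counit h *\<^sub>k single ([], 0) 1)"
    by (rule k_linearI) (simp_all add: F_counit_add F_counit_scale single_add)
  have "?m (\<Delta> (single (w, a) 1)) = F_counit (single (w, a) 1) *\<^sub>k single ([], 0) 1" for w a
  proof (cases w)
    case Nil
    then show ?thesis
      using F_comult_grouplike[of a] by (simp add: grouplike_def lp S_single Sw_def fscale_simps)
  next
    case (Cons i v)
    have "?m (\<Delta> (single (i # v, a) 1)) = ?m (DX i \<otimes>\<^bsub>FF\<^esub> \<Delta> (single (v, a) 1))"
      by (simp flip: F_comult_var_mult)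
    also have "\<dots> = 0" by (subst DX) simp_all
    finally show ?thesis using Cons by simp
  qed
  then show ?thesis by (rule linear_F_eqI[OF F.kmod_axioms 1 2])
qed

lemma hopf_data_F: "hopf_data F \<Delta> F_counit S"
  by (intro hopf_data.intro hopf_data_axioms.intro kalg_F F_comult_hom F_counit_hom F_coassoc S_linear)
    (simp_all add: F_counit_left F_counit_right F_antipode_left F_antipode_right)

sublocale hopf_data F \<Delta> F_counit S by (rule hopf_data_F)

end

section \<open>The braided coproduct\<close>

lemma tensor_algebra_simps [simp]:
  "carrier tensor_algebra = UNIV" "one tensor_algebra = single [] 1" "zero tensor_algebra = 0"
  "add tensor_algebra = (+)" "smult tensor_algebra = (\<lambda>c. Poly_Mapping.map ((*) c))"
  by (simp_all add: tensor_algebra_def)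

lemma kalg_tensor_algebra: "kalg tensor_algebra"
  unfolding tensor_algebra_def by (rule twist.kalg_T, unfold_locales) auto

lemma tensor_algebra_mult_single [simp]:
  "single u a \<otimes>\<^bsub>tensor_algebra\<^esub> single v b = single (u @ v) (a * b)"
  by (simp add: tensor_algebra_def)

lemma lin_ext_tensor_algebra:
  "linear_extension tensor_algebra f h = (\<Sum>s\<in>keys h. Poly_Mapping.map ((*) (lookup h s)) (f s))"
  unfolding tensor_algebra_def by (rule lin_ext_twisted) simp

context kmod
begin

lemma k_linear_lin_ext_twisted:
  assumes "\<And>s. s \<in> S \<Longrightarrow> \<phi> s \<in> carrier M"
  shows "k_linear (twisted_algebra S m e \<tau>) M (linear_extension M \<phi>)"
  using assms by (intro k_linearI) (auto simp: lin_ext_closed lin_ext_add lin_ext_smult Pi_def subset_iff)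

lemma k_linear_lin_ext_tensor_algebra:
  "(\<And>s. \<phi> s \<in> carrier M) \<Longrightarrow> k_linear tensor_algebra M (linear_extension M \<phi>)"
  unfolding tensor_algebra_def by (rule k_linear_lin_ext_twisted)

lemma lin_ext_mult_single:
  assumes "\<And>s. \<phi> s \<in> carrier M"
  shows "linear_extension M \<phi> (single s c \<otimes>\<^bsub>tensor_algebra\<^esub> f) = c \<odot> linear_extension M (\<lambda>u. \<phi> (s @ u)) f"
    and "linear_extension M \<phi> (f \<otimes>\<^bsub>tensor_algebra\<^esub> single s c) = c \<odot> linear_extension M (\<lambda>u. \<phi> (u @ s)) f"
proof -
  have *: "keys f \<subseteq> UNIV" by simp
  then show "linear_extension M \<phi> (single s c \<otimes>\<^bsub>tensor_algebra\<^esub> f) = c \<odot> linear_extension M (\<lambda>u. \<phi> (s @ u)) f"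
    by (induction f rule: pm_induct)
      (auto simp: tensor_algebra_def twisted_mult_add_right lin_ext_add lin_ext_single assms smult_r_distr
        smult_smult lin_ext_closed)
  from * show "linear_extension M \<phi> (f \<otimes>\<^bsub>tensor_algebra\<^esub> single s c) = c \<odot> linear_extension M (\<lambda>u. \<phi> (u @ s)) f"
    by (induction f rule: pm_induct)
      (auto simp: tensor_algebra_def twisted_mult_add_left lin_ext_add lin_ext_single assms smult_r_distr
        smult_smult lin_ext_closed mult.commute)
qed

end

context yd
begin

abbreviation "BS \<equiv> braided_square g \<chi>"

text \<open>The braided coproduct of a basis word, as an element of the free module on pairs of
  words.\<close>

definition bc :: "'i list \<Rightarrow> 'i list \<times> 'i list \<Rightarrow>\<^sub>0 'k" where
  "bc w = foldr (\<lambda>i t. (single ([i], []) 1 + single ([], [i]) 1) \<otimes>\<^bsub>BS\<^esub> t) w \<one>\<^bsub>BS\<^esub>"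

lemma bc_Nil: "bc [] = single ([], []) 1"
  by (simp add: bc_def braided_square_def)

lemma lin_ext_bc_Nil: "kmod M \<Longrightarrow> \<phi> ([], []) \<in> carrier M \<Longrightarrow> linear_extension M \<phi> (bc []) = \<phi> ([], [])"
  by (simp add: bc_Nil kmod.lin_ext_single kmod.smult_one)

text \<open>\<open>bc w\<close> is never written out; it is only evaluated against functions of its
  two legs. Prepending a letter puts it in front of either leg, and in front of the second leg it
  has to cross \<open>u\<close>, at the cost of \<open>word_char \<chi> u (g i)\<close>. Every
  expansion below is an induction on this rule.\<close>

lemma lin_ext_bc_Cons:
  assumes "kmod M" and cl: "\<And>p. \<phi> p \<in> carrier M"
  shows "linear_extension M \<phi> (bc (i # w))
    = linear_extension M (\<lambda>(u, v). \<phi> (i # u, v) \<oplus>\<^bsub>M\<^esub> word_char \<chi> u (g i) \<odot>\<^bsub>M\<^esub> \<phi> (u, i # v)) (bc w)"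
proof -
  interpret M: kmod M by fact
  let ?\<psi> = "\<lambda>(u, v). \<phi> (i # u, v) \<oplus>\<^bsub>M\<^esub> word_char \<chi> u (g i) \<odot>\<^bsub>M\<^esub> \<phi> (u, i # v)"
  have cl': "?\<psi> p \<in> carrier M" for p using cl by (auto split: prod.split)
  have "linear_extension M \<phi> ((single ([i], []) 1 + single ([], [i]) 1) \<otimes>\<^bsub>BS\<^esub> t)
    = linear_extension M ?\<psi> t" for t
  proof -
    have "keys t \<subseteq> UNIV" by simp
    then show ?thesis
    proof (induction t rule: pm_induct)
      case (add s c t)
      have "linear_extension M \<phi> ((single ([i], []) 1 + single ([], [i]) 1) \<otimes>\<^bsub>BS\<^esub> single s c)
        = linear_extension M ?\<psi> (single s c)"
        using cl' cl
        by (cases s) (simp add: braided_square_def twisted_mult_add_left M.lin_ext_add M.lin_ext_single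
            M.smult_r_distr M.smult_smult mult.commute Pi_def)
      with add.IH show ?case
        using cl cl' by (simp add: braided_square_def twisted_mult_add_right M.lin_ext_add Pi_def)
    qed (simp add: braided_square_def)
  qed
  then show ?thesis by (simp add: bc_def)
qed

text \<open>The letters of the two legs together are those of \<open>w\<close>. In this way
  hypotheses on the letters of \<open>w\<close>, such as lying in one block, reach \<open>u\<close>
  and \<open>v\<close>.\<close>

lemma lin_ext_bc_cong:
  assumes M: "kmod M" and "\<And>p. \<phi> p \<in> carrier M" "\<And>p. \<psi> p \<in> carrier M"
    and "\<And>u v. mset u + mset v = mset w \<Longrightarrow> \<phi> (u, v) = \<psi> (u, v)"
  shows "linear_extension M \<phi> (bc w) = linear_extension M \<psi> (bc w)"
  using assms(2-)
proof (induction w arbitrary: \<phi> \<psi>)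
  case Nil
  then show ?case by (simp add: lin_ext_bc_Nil[OF M])
next
  case (Cons i w)
  interpret M: kmod M by fact
  show ?case
    unfolding lin_ext_bc_Cons[OF M Cons.prems(1)] lin_ext_bc_Cons[OF M Cons.prems(2)]
    by (rule Cons.IH) (use Cons.prems in \<open>auto split: prod.split\<close>)
qed

text \<open>The component of the braided coproduct whose first leg is empty is
  \<open>1 \<otimes> w\<close>, with coefficient one. The next lemma treats the empty second
  leg.\<close>

lemma lin_ext_bc_left:
  assumes M: "kmod M" and "\<And>w. \<theta> w \<in> carrier M"
  shows "linear_extension M (\<lambda>(u, v). if u = [] then \<theta> v else \<zero>\<^bsub>M\<^esub>) (bc w) = \<theta> w"
  using assms(2)
proof (induction w arbitrary: \<theta>)
  case Nil
  then show ?case by (subst lin_ext_bc_Nil[OF M]) auto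
next
  case (Cons i w)
  interpret M: kmod M by fact
  have "(\<lambda>(u, v). (if i # u = [] then \<theta> v else \<zero>\<^bsub>M\<^esub>) \<oplus>\<^bsub>M\<^esub>
      word_char \<chi> u (g i) \<odot>\<^bsub>M\<^esub> (if u = [] then \<theta> (i # v) else \<zero>\<^bsub>M\<^esub>))
    = (\<lambda>(u, v). if u = [] then \<theta> (i # v) else \<zero>\<^bsub>M\<^esub>)"
    using Cons.prems by auto
  with Cons show ?case by (subst lin_ext_bc_Cons[OF M]) (auto split: prod.split)
qed

lemma lin_ext_bc_right:
  assumes M: "kmod M" and "\<And>w. \<theta> w \<in> carrier M"
  shows "linear_extension M (\<lambda>(u, v). if v = [] then \<theta> u else \<zero>\<^bsub>M\<^esub>) (bc w) = \<theta> w"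
  using assms(2)
proof (induction w arbitrary: \<theta>)
  case Nil
  then show ?case by (subst lin_ext_bc_Nil[OF M]) auto
next
  case (Cons i w)
  interpret M: kmod M by fact
  have "(\<lambda>(u, v). (if v = [] then \<theta> (i # u) else \<zero>\<^bsub>M\<^esub>) \<oplus>\<^bsub>M\<^esub>
      word_char \<chi> u (g i) \<odot>\<^bsub>M\<^esub> (if i # v = [] then \<theta> u else \<zero>\<^bsub>M\<^esub>))
    = (\<lambda>(u, v). if v = [] then \<theta> (i # u) else \<zero>\<^bsub>M\<^esub>)"
    using Cons.prems by auto
  with Cons show ?case by (subst lin_ext_bc_Cons[OF M]) (auto split: prod.split)
qed

lemma k_linear_lin_ext_BS:
  "kmod M \<Longrightarrow> (\<And>p. \<phi> p \<in> carrier M) \<Longrightarrow> k_linear BS M (linear_extension M \<phi>)"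
  unfolding braided_square_def by (rule kmod.k_linear_lin_ext_twisted)

lemma lin_ext_braided_comult:
  assumes "kmod M" "\<And>p. \<phi> p \<in> carrier M"
  shows "linear_extension M \<phi> (braided_comult g \<chi> r) = linear_extension M (\<lambda>w. linear_extension M \<phi> (bc w)) r"
proof -
  have "bc = (\<lambda>w. foldr (\<lambda>i t. (single ([i], []) 1 + single ([], [i]) 1) \<otimes>\<^bsub>BS\<^esub> t) w \<one>\<^bsub>BS\<^esub>)"
    by (rule ext) (simp add: bc_def)
  then have "braided_comult g \<chi> r = linear_extension BS bc r"
    by (simp add: braided_comult_def)
  moreover have "kmod BS" unfolding braided_square_def by (rule kmod_twisted)
  ultimately show ?thesis
    using k_linear_lin_ext[OF _ assms(1) k_linear_lin_ext_BS[OF assms], of bc r]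
    by (simp add: braided_square_def)
qed

text \<open>Primitivity is an identity in the tensor square of \<open>TV / (P)\<close>. A function
  \<open>\<beta>\<close> of two words extends bilinearly to \<open>TV\<close> and descends to this
  quotient as soon as it kills the elements of \<open>P\<close>, surrounded by arbitrary words, in
  either argument; applying it to the identity gives the claim. Coproduct, antipode and all operator
  identities for relators are instances with different \<open>\<beta>\<close>.\<close>

lemma primitive_apply:
  assumes prim: "primitive_modulo g \<chi> (Idl\<^bsub>tensor_algebra\<^esub> P) r"
    and M: "kmod M" and cl: "\<And>u v. \<beta> u v \<in> carrier M"
    and left: "\<And>\<rho> u w v. \<rho> \<in> P \<Longrightarrow> linear_extension M (\<lambda>x. \<beta> (u @ x @ w) v) \<rho> = \<zero>\<^bsub>M\<^esub>"
    and right: "\<And>\<rho> u w v. \<rho> \<in> P \<Longrightarrow> linear_extension M (\<lambda>x. \<beta> v (u @ x @ w)) \<rho> = \<zero>\<^bsub>M\<^esub>"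
  shows "linear_extension M (\<lambda>w. linear_extension M (\<lambda>(u, v). \<beta> u v) (bc w)) r
    = linear_extension M (\<lambda>u. \<beta> u []) r \<oplus>\<^bsub>M\<^esub> linear_extension M (\<beta> []) r"
proof -
  let ?A = "tensor_algebra :: ('k, 'i list \<Rightarrow>\<^sub>0 'k) module"
  define J where "J = Idl\<^bsub>?A\<^esub> P"
  interpret A: kalg ?A by (rule kalg_tensor_algebra)
  interpret M: kmod M by fact
  have J: "ideal J ?A" unfolding J_def by (rule A.genideal_ideal) simp
  interpret J: submod ?A J by (rule ideal_submod[OF kalg_tensor_algebra J])
  \<comment> \<open>The surrounding words are quantified inside the set so that it is closed under
    multiplication from both sides.\<close>
  have ideal_vanishing: "ideal {f. \<forall>u w. linear_extension M (\<lambda>x. \<theta> (u @ x @ w)) f = \<zero>\<^bsub>M\<^esub>} ?A" (is "ideal ?U _")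
    if cl: "\<And>w. \<theta> w \<in> carrier M" for \<theta>
  proof (rule idealI[OF A.ring_axioms])
    show "subgroup ?U (add_monoid ?A)"
    proof
      fix x assume x: "x \<in> ?U"
      have "inv\<^bsub>add_monoid ?A\<^esub> x = - x"
        using twisted_a_inv[of x UNIV "(@)" "[]" "\<lambda>_ _. 1"] by (simp add: a_inv_def tensor_algebra_def)
      with x show "inv\<^bsub>add_monoid ?A\<^esub> x \<in> ?U" using cl by (simp add: M.lin_ext_uminus)
    qed (use cl in \<open>auto simp: M.lin_ext_add\<close>)
    fix f x :: "'i list \<Rightarrow>\<^sub>0 'k" assume f: "f \<in> ?U"
    have "keys x \<subseteq> UNIV" by simp
    then show "x \<otimes>\<^bsub>?A\<^esub> f \<in> ?U"
    proof (induction x rule: pm_induct)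
      case (add s c x)
      have "linear_extension M (\<lambda>x. \<theta> (u @ x @ w)) (single s c \<otimes>\<^bsub>?A\<^esub> f) = \<zero>\<^bsub>M\<^esub>" for u w
      proof -
        have "linear_extension M (\<lambda>x. \<theta> ((u @ s) @ x @ w)) f = \<zero>\<^bsub>M\<^esub>" using f by blast
        then show ?thesis using cl by (subst M.lin_ext_mult_single(1)) auto
      qed
      with add.IH show ?case
        using cl by (simp add: tensor_algebra_def twisted_mult_add_left M.lin_ext_add)
    qed (simp add: tensor_algebra_def)
    have "keys x \<subseteq> UNIV" by simp
    then show "f \<otimes>\<^bsub>?A\<^esub> x \<in> ?U"
    proof (induction x rule: pm_induct)
      case (add s c x)
      have "linear_extension M (\<lambda>x. \<theta> (u @ x @ w)) (f \<otimes>\<^bsub>?A\<^esub> single s c) = \<zero>\<^bsub>M\<^esub>" for u w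
      proof -
        have "linear_extension M (\<lambda>x. \<theta> (u @ x @ (s @ w))) f = \<zero>\<^bsub>M\<^esub>" using f by blast
        then show ?thesis using cl by (subst M.lin_ext_mult_single(2)) auto
      qed
      with add.IH show ?case
        using cl by (simp add: tensor_algebra_def twisted_mult_add_right M.lin_ext_add)
    qed (simp add: tensor_algebra_def)
  qed
  have vanish: "linear_extension M \<theta> j = \<zero>\<^bsub>M\<^esub>"
    if "\<And>w. \<theta> w \<in> carrier M" "\<And>\<rho> u w. \<rho> \<in> P \<Longrightarrow> linear_extension M (\<lambda>x. \<theta> (u @ x @ w)) \<rho> = \<zero>\<^bsub>M\<^esub>" "j \<in> J"
    for \<theta> j
  proof -
    have "J \<subseteq> {f. \<forall>u w. linear_extension M (\<lambda>x. \<theta> (u @ x @ w)) f = \<zero>\<^bsub>M\<^esub>}"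
      unfolding J_def by (rule A.genideal_minimal[OF ideal_vanishing]) (use that in auto)
    then have "\<forall>u w. linear_extension M (\<lambda>x. \<theta> (u @ x @ w)) j = \<zero>\<^bsub>M\<^esub>" using that(3) by blast
    from this[rule_format, of "[]" "[]"] show ?thesis by simp
  qed
  let ?B = "\<lambda>f h. linear_extension M (\<lambda>u. linear_extension M (\<beta> u) h) f"
  have B1: "k_linear ?A M (\<lambda>f. ?B f h)" for h
    by (rule M.k_linear_lin_ext_tensor_algebra) (simp add: M.lin_ext_closed cl)
  have B2: "k_linear ?A M (?B f)" for f
    by (rule k_linearI)
      (simp_all add: M.lin_ext_closed cl M.lin_ext_add M.lin_ext_smult M.lin_ext_fun_add M.lin_ext_fun_smult Pi_def)
  have K2: "?B f j = \<zero>\<^bsub>M\<^esub>" if "j \<in> J" for f j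
    by (rule M.lin_ext_const_zero) (rule vanish[OF cl right that])
  have K1: "?B j h = \<zero>\<^bsub>M\<^esub>" if "j \<in> J" for j h
  proof (rule vanish[OF _ _ that])
    fix \<rho> u w assume \<rho>: "\<rho> \<in> P"
    have "keys h \<subseteq> UNIV" by simp
    then show "linear_extension M (\<lambda>x. linear_extension M (\<beta> (u @ x @ w)) h) \<rho> = \<zero>\<^bsub>M\<^esub>"
    proof (induction h rule: pm_induct)
      case (add s c h)
      then show ?case
        using left[OF \<rho>, of u w s] cl
        by (simp add: M.lin_ext_add M.lin_ext_single M.lin_ext_fun_add M.lin_ext_fun_smult M.lin_ext_closed Pi_def)
    qed (simp add: M.lin_ext_const_zero)
  qed (simp add: M.lin_ext_closed cl)
  define Q where "Q = quotient_algebra ?A J"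
  define \<pi> where "\<pi> = (\<lambda>f. J +>\<^bsub>?A\<^esub> f)"
  have Q: "kalg Q" unfolding Q_def by (rule kalg_quotient[OF kalg_tensor_algebra J])
  interpret Q: kalg Q by (rule Q)
  interpret QQ: kalg_pair Q Q ..
  have Q_cases: "\<exists>f. X = \<pi> f" if "X \<in> carrier Q" for X
    using that J.quotient_carrier by (auto simp: Q_def \<pi>_def)
  have \<pi>_closed: "\<pi> f \<in> carrier Q" for f
    using J.quotient_carrier by (auto simp: Q_def \<pi>_def)
  \<comment> \<open>The bilinear map descends in two steps, first in the second argument with a
    fixed representative of the first, then in the first argument.\<close>
  define \<beta>' where "\<beta>' X Y = on_cosets (\<lambda>f. on_cosets (?B f) Y) X" for X Y
  have L: "on_cosets (?B f) (\<pi> h) = ?B f h" "k_linear Q M (on_cosets (?B f))" for f h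
    using J.on_cosets_linear(1)[OF M B2[of f] K2, of h] J.on_cosets_linear(2)[OF M B2[of f] K2]
    by (simp_all add: \<pi>_def Q_def)
  have L': "\<beta>' (\<pi> f) (\<pi> h) = ?B f h" for f h
    using J.on_cosets_linear(1)[OF M B1[of h] K1, of f] by (simp add: \<beta>'_def L(1)) (simp add: \<pi>_def)
  have bil: "bilin Q Q M \<beta>'"
  proof (rule bilinI)
    fix X assume "X \<in> carrier Q"
    then obtain f where f: "X = \<pi> f" using Q_cases by blast
    show "k_linear Q M (\<beta>' X)"
      by (rule k_linear_cong[OF Q.kmod_axioms _ L(2)[of f]]) (use Q_cases f L L' in force)
  next
    fix Y assume "Y \<in> carrier Q"
    then obtain h where h: "Y = \<pi> h" using Q_cases by blast
    show "k_linear Q M (\<lambda>X. \<beta>' X Y)"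
      using J.on_cosets_linear(2)[OF M B1[of h] K1] unfolding \<beta>'_def h L(1) Q_def by simp
  qed
  note tl = QQ.tensor_lift[OF M bil]
  have B_single: "?B (single u 1) (single v 1) = \<beta> u v" for u v
    by (simp add: M.lin_ext_single cl M.lin_ext_closed)
  have "tensor_lift M \<beta>' (linear_extension (tensor Q Q)
           (\<lambda>(u, v). pure_tensor Q Q (\<pi> (single u 1)) (\<pi> (single v 1))) (braided_comult g \<chi> r))
    = linear_extension M (\<lambda>(u, v). \<beta> u v) (braided_comult g \<chi> r)"
    by (subst k_linear_lin_ext[OF QQ.kmod_tensor M tl(2)])
      (auto simp: tl(1) \<pi>_closed L' B_single case_prod_unfold)
  moreover have "linear_extension (tensor Q Q)
           (\<lambda>(u, v). pure_tensor Q Q (\<pi> (single u 1)) (\<pi> (single v 1))) (braided_comult g \<chi> r)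
    = pure_tensor Q Q (\<pi> r) (\<pi> (single [] 1)) \<oplus>\<^bsub>tensor Q Q\<^esub> pure_tensor Q Q (\<pi> (single [] 1)) (\<pi> r)"
    using prim unfolding primitive_modulo_def J_def[symmetric] Q_def \<pi>_def Let_def
    by (simp add: quotient_one)
  moreover have "tensor_lift M \<beta>' (pure_tensor Q Q (\<pi> r) (\<pi> (single [] 1)) \<oplus>\<^bsub>tensor Q Q\<^esub> pure_tensor Q Q (\<pi> (single [] 1)) (\<pi> r))
    = ?B r (single [] 1) \<oplus>\<^bsub>M\<^esub> ?B (single [] 1) r"
    by (subst k_linear_add[OF tl(2)]) (simp_all add: \<pi>_closed tl(1) L')
  moreover have "?B r (single [] 1) = linear_extension M (\<lambda>u. \<beta> u []) r" "?B (single [] 1) r = linear_extension M (\<beta> []) r"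
    by (simp_all add: M.lin_ext_single cl M.lin_ext_closed)
  ultimately show ?thesis
    by (subst lin_ext_braided_comult[OF M, symmetric]) (auto simp: cl)
qed

section \<open>Homogeneity of the relators\<close>

abbreviation "act \<equiv> braid_generator_act g \<chi>"

definition swap :: "nat \<Rightarrow> 'i list \<Rightarrow> 'i list" where
  "swap s w = w[s := w ! Suc s, Suc s := w ! s]"

definition swap_coeff :: "nat \<times> bool \<Rightarrow> 'i list \<Rightarrow> 'k" where
  "swap_coeff p w = (let i = w ! fst p; j = w ! Suc (fst p) in if snd p then \<chi> j (g i) else \<chi> i (- g j))"

lemma act_single: "act (s, e) (single w c) = single (swap s w) (swap_coeff (s, e) w * c)"
proof -
  interpret kalg "tensor_algebra :: ('k, 'i list \<Rightarrow>\<^sub>0 'k) module" by (rule kalg_tensor_algebra)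
  show ?thesis
    unfolding braid_generator_act_def prod.case
    by (subst lin_ext_single) (auto simp: swap_def swap_coeff_def Let_def mult.commute)
qed

lemma act_add: "act p (x + y) = act p x + act p y"
proof -
  interpret kalg "tensor_algebra :: ('k, 'i list \<Rightarrow>\<^sub>0 'k) module" by (rule kalg_tensor_algebra)
  show ?thesis
    unfolding braid_generator_act_def by (cases p) (simp add: lin_ext_add)
qed

lemma act_zero [simp]: "act p 0 = 0"
  using act_add[of p 0 0] by simp

lemma act_keys:
  assumes "\<And>w. w \<in> keys x \<Longrightarrow> P (swap (fst p) w)" "w \<in> keys (act p x)" shows "P w"
proof -
  have "keys (act p x) \<subseteq> swap (fst p) ` K" if "keys x \<subseteq> K" for K
    using that
  proof (induction x rule: pm_induct)
    case (add s c h)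
    obtain a e where "p = (a, e)" by (cases p)
    then have "keys (act p (single s c)) \<subseteq> swap (fst p) ` K" using add by (simp add: act_single)
    with add show ?case by (simp add: act_add)
  qed simp
  from this[of "keys x"] assms show ?thesis by auto
qed

lemma length_swap [simp]: "length (swap s w) = length w"
  by (simp add: swap_def)

lemma mset_swap: "s + 1 < length w \<Longrightarrow> mset (swap s w) = mset w"
  unfolding swap_def by (rule Multiset.mset_swap) auto

lemma foldr_act_keys:
  assumes "\<beta> \<in> braid_words l" "keys x \<subseteq> {w. length w = l \<and> mset w = m}"
  shows "keys (foldr act \<beta> x) \<subseteq> {w. length w = l \<and> mset w = m}"
  using assms(1)
proof (induction \<beta>)
  case (Cons p \<beta>)
  then have IH: "keys (foldr act \<beta> x) \<subseteq> {w. length w = l \<and> mset w = m}" and p: "fst p + 1 < l"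
    by (auto simp: braid_words_def split: prod.splits)
  have "length w = l \<and> mset w = m" if "w \<in> keys (act p (foldr act \<beta> x))" for w
    by (rule act_keys[where P = "\<lambda>w. length w = l \<and> mset w = m", OF _ that])
      (use IH p mset_swap in auto)
  then show ?case by auto
qed (use assms in simp)

lemma act_length: "keys x \<subseteq> {w. length w = l} \<Longrightarrow> keys (act p x) \<subseteq> {w. length w = l}"
  using act_keys[of x "\<lambda>w. length w = l" p] by fastforce

lemma foldr_act_length: "keys x \<subseteq> {w. length w = l} \<Longrightarrow> keys (foldr act \<beta> x) \<subseteq> {w. length w = l}"
  by (induction \<beta>) (auto dest: act_length)

lemma foldr_act_add: "foldr act \<beta> (x + y) = foldr act \<beta> x + foldr act \<beta> y"
  by (induction \<beta>) (simp_all add: act_add)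

lemma foldr_act_zero [simp]: "foldr act \<beta> 0 = 0"
  by (induction \<beta>) simp_all

lemma foldr_act_eqI:
  assumes "\<And>w c. length w = l \<Longrightarrow> foldr act \<beta> (single w c) = foldr act \<gamma> (single w c)"
    and "keys x \<subseteq> {w. length w = l}"
  shows "foldr act \<beta> x = foldr act \<gamma> x"
  using assms(2) by (induction x rule: pm_induct) (auto simp: foldr_act_add assms(1))

lemma swap_nth:
  "Suc s < length w \<Longrightarrow> t < length w \<Longrightarrow> swap s w ! t = (if t = s then w ! Suc s else if t = Suc s then w ! s else w ! t)"
  by (auto simp: swap_def nth_list_update)

text \<open>\<open>on_cosets\<close> can evaluate a class of words only if equivalent words act
  equally. For \<open>far\<close> and \<open>near\<close> both sides carry the same product of
  coefficients over crossed pairs of letters; for \<open>inverse\<close> the two coefficients are a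
  character value and its inverse.\<close>

lemma braid_equiv_act:
  "braid_equiv l \<beta> \<gamma> \<Longrightarrow> keys x \<subseteq> {w. length w = l} \<Longrightarrow> foldr act \<beta> x = foldr act \<gamma> x"
proof (induction arbitrary: x rule: braid_equiv.induct)
  case (mult \<alpha> \<beta> \<gamma> \<delta>)
  then show ?case using foldr_act_length by simp
next
  case (inverse s e)
  have "swap s (swap s w) = w" if "length w = l" for w :: "'i list"
    by (rule nth_equalityI) (use that inverse.hyps in \<open>auto simp: swap_nth\<close>)
  then have "foldr act [(s, e), (s, \<not> e)] (single w c) = foldr act [] (single w c)" if "length w = l" for w c
    using that inverse.hyps by (simp add: act_single swap_coeff_def Let_def swap_nth mult.assoc[symmetric])
  then show ?case by (rule foldr_act_eqI[OF _ inverse.prems])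
next
  case (far s t)
  have "swap s (swap t w) = swap t (swap s w)" if "length w = l" for w :: "'i list"
    by (rule nth_equalityI) (use that far.hyps in \<open>auto simp: swap_nth\<close>)
  then have "foldr act [(s, True), (t, True)] (single w c) = foldr act [(t, True), (s, True)] (single w c)"
    if "length w = l" for w c
    using that far.hyps by (simp add: act_single swap_coeff_def Let_def swap_nth mult_ac)
  then show ?case by (rule foldr_act_eqI[OF _ far.prems])
next
  case (near s)
  have "swap s (swap (s + 1) (swap s w)) = swap (s + 1) (swap s (swap (s + 1) w))" if "length w = l" for w :: "'i list"
    by (rule nth_equalityI) (use that near.hyps in \<open>auto simp: swap_nth\<close>)
  then have "foldr act [(s, True), (s + 1, True), (s, True)] (single w c)
      = foldr act [(s + 1, True), (s, True), (s + 1, True)] (single w c)" if "length w = l" for w c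
    using that near.hyps by (simp add: act_single swap_coeff_def Let_def swap_nth mult_ac)
  then show ?case by (rule foldr_act_eqI[OF _ near.prems])
qed auto

text \<open>Braid generators permute letters, so all words of a relator have one multiset of
  letters. Its words then share \<open>word_degree\<close> and \<open>word_char\<close>, which lets
  group elements and character values be pulled out of sums over a relator.\<close>

lemma braid_relators_homogeneous:
  assumes "r \<in> braid_relators g \<chi> blk"
  obtains w where "length w \<ge> 2" "\<And>i j. i \<in> set w \<Longrightarrow> j \<in> set w \<Longrightarrow> blk i = blk j"
    "\<And>v. v \<in> keys r \<Longrightarrow> mset v = mset w"
proof -
  obtain \<xi> w where r: "r = braid_algebra_act g \<chi> \<xi> w" and w: "length w \<ge> 2"
    "\<forall>i\<in>set w. \<forall>j\<in>set w. blk i = blk j" and \<xi>: "keys \<xi> \<subseteq> braid_group (length w)"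
    using assms by (auto simp: braid_relators_def)
  let ?f = "\<lambda>\<beta>. foldr act \<beta> (single w 1)"
  have "keys (on_cosets ?f X) \<subseteq> {v. mset v = mset w}" if "X \<in> keys \<xi>" for X
  proof -
    from that \<xi> obtain \<beta> where \<beta>: "\<beta> \<in> braid_words (length w)"
      "X = {(\<beta>, \<gamma>). braid_equiv (length w) \<beta> \<gamma>} `` {\<beta>}"
      unfolding braid_group_def by (auto elim!: quotientE)
    then have "\<beta> \<in> X" by (auto intro: braid_equiv.refl)
    moreover have "?f \<gamma> = ?f \<beta>" if "\<gamma> \<in> X" for \<gamma>
      using that \<beta>(2) braid_equiv_act[of "length w" \<beta> \<gamma> "single w 1"] by auto
    ultimately have "?f ` X = (\<lambda>_. ?f \<beta>) ` X" by (intro image_cong HOL.refl)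
    also have "\<dots> = {?f \<beta>}" using \<open>\<beta> \<in> X\<close> by auto
    finally have "on_cosets ?f X = ?f \<beta>" by (simp add: on_cosets_def)
    then show ?thesis using foldr_act_keys[OF \<beta>(1), of "single w 1" "mset w"] by auto
  qed
  then have "keys r \<subseteq> {v. mset v = mset w}"
    unfolding r braid_algebra_act_def lin_ext_tensor_algebra
    by (intro order_trans[OF keys_sum] UN_least keys_pscale_subset)
  with w show thesis using that[of w] by blast
qed

end

section \<open>The defining ideals\<close>

lemma word_char_mset: "mset u = mset v \<Longrightarrow> word_char \<chi> u a = word_char \<chi> v a"
  unfolding word_char_def by (simp flip: prod_mset_prod_list)

lemma word_degree_mset: "mset u = mset v \<Longrightarrow> word_degree g u = word_degree g v"
  unfolding word_degree_def by (simp flip: sum_mset_sum_list)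

context characters
begin

lemma TV_incl_eq_lin_ext: "TV_incl f = linear_extension F (\<lambda>w. single (w, 0) 1) f"
  unfolding TV_incl_def bosonization_def by (simp add: lin_ext_twisted)

lemma linear_TV_incl:
  "kmod M \<Longrightarrow> k_linear F M h \<Longrightarrow> h (TV_incl r) = linear_extension M (\<lambda>w. h (single (w, 0) 1)) r"
  unfolding TV_incl_eq_lin_ext by (rule k_linear_lin_ext[OF F.kmod_axioms]) simp_all

text \<open>Translates the vanishing conditions of \<open>primitive_apply\<close> into membership of
  \<open>u r w\<close> in an ideal of \<open>F\<close>.\<close>

lemma linear_words:
  assumes "kmod M" "k_linear F M h"
  shows "linear_extension M (\<lambda>x. h (single (u @ x @ w, a) 1)) r
    = h (single (u, 0) 1 \<star> TV_incl r \<star> single (w, a) 1)"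
proof -
  have "k_linear F M (\<lambda>x. h (single (u, 0) 1 \<star> x \<star> single (w, a) 1))"
    by (rule k_linear_comp[OF _ assms(2)], rule k_linearI) (simp_all add: fmul_distrib fmul_scale)
  from linear_TV_incl[OF assms(1) this, of r] show ?thesis by simp
qed

lemma F_ideal:
  assumes "ideal J F"
  shows "x \<in> J \<Longrightarrow> y \<star> x \<in> J" "x \<in> J \<Longrightarrow> x \<star> y \<in> J" "x \<in> J \<Longrightarrow> y \<in> J \<Longrightarrow> x + y \<in> J"
    "x \<in> J \<Longrightarrow> c *\<^sub>k x \<in> J" "0 \<in> J" "x \<in> J \<Longrightarrow> - x \<in> J" "x \<in> J \<Longrightarrow> y \<in> J \<Longrightarrow> x - y \<in> J"
proof -
  interpret J: ideal J F by fact
  interpret S: submod F J by (rule ideal_submod[OF kalg_F assms])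
  show "x \<in> J \<Longrightarrow> y \<star> x \<in> J" "x \<in> J \<Longrightarrow> x \<star> y \<in> J" using J.I_l_closed[of x y] J.I_r_closed[of x y] by simp_all
  show add: "x \<in> J \<Longrightarrow> y \<in> J \<Longrightarrow> x + y \<in> J" for x y using S.add_mem[of x y] by simp
  show "x \<in> J \<Longrightarrow> c *\<^sub>k x \<in> J" using S.smult_mem[of x c] by simp
  show "0 \<in> J" using S.zero_mem by simp
  show neg: "x \<in> J \<Longrightarrow> - x \<in> J" for x using S.minus_mem[of x] by simp
  show "x \<in> J \<Longrightarrow> y \<in> J \<Longrightarrow> x - y \<in> J" using add[of x "- y"] neg[of y] by simp
qed

lemma F_idealI:
  assumes "0 \<in> J" "\<And>x y. x \<in> J \<Longrightarrow> y \<in> J \<Longrightarrow> x + y \<in> J" "\<And>x y. x \<in> J \<Longrightarrow> y \<star> x \<in> J"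
    "\<And>x y. x \<in> J \<Longrightarrow> x \<star> y \<in> J"
  shows "ideal J F"
proof (rule idealI[OF F.ring_axioms])
  show "subgroup J (add_monoid F)"
  proof
    fix x assume "x \<in> J"
    moreover have "single ([], 0) (-1) \<star> x = - x"
    proof -
      have "single ([], 0) (-1) \<star> x = (0 - single ([], 0) 1) \<star> x" by (simp add: single_uminus)
      also have "\<dots> = - x" unfolding fmul_distrib by simp
      finally show ?thesis .
    qed
    moreover have "inv\<^bsub>add_monoid F\<^esub> x = - x"
      using F_minus[of x] by (simp add: a_inv_def)
    ultimately show "inv\<^bsub>add_monoid F\<^esub> x \<in> J" using assms(3)[of x "single ([], 0) (-1)"] by simp
  qed (use assms in auto)
qed (use assms in auto)

abbreviation "proj \<equiv> F_proj \<chi>"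
abbreviation "Fq \<equiv> F_quotient \<chi>"

lemma proj_zero_iff: "ideal J F \<Longrightarrow> proj J f = \<zero>\<^bsub>Fq J\<^esub> \<longleftrightarrow> f \<in> J"
proof -
  assume "ideal J F"
  then interpret S: submod F J by (rule ideal_submod[OF kalg_F])
  show ?thesis using S.coset_eq_self_iff[of f] by (simp add: F_proj_def F_quotient_def)
qed

lemma proj_eq_iff: "ideal J F \<Longrightarrow> proj J x = proj J y \<longleftrightarrow> x - y \<in> J"
proof -
  assume "ideal J F"
  then interpret S: submod F J by (rule ideal_submod[OF kalg_F])
  show ?thesis using S.coset_eq_iff[of x y] by (simp add: F_proj_def)
qed

lemma kalg_Fq: "ideal J F \<Longrightarrow> kalg (Fq J)"
  and proj_hom: "ideal J F \<Longrightarrow> algebra_hom F (Fq J) (proj J)"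
  unfolding F_quotient_def F_proj_def by (rule kalg_quotient[OF kalg_F]; assumption)+

lemma proj_linear: "ideal J F \<Longrightarrow> k_linear F (Fq J) (proj J)"
  by (rule algebra_hom_linear[OF proj_hom])

lemma proj_closed [simp]: "ideal J F \<Longrightarrow> proj J f \<in> carrier (Fq J)"
  using k_linear_closed[OF proj_linear, of J f] by simp

lemma proj_surj: "ideal J F \<Longrightarrow> proj J ` carrier F = carrier (Fq J)"
  unfolding F_quotient_def F_proj_def
  using submod.quotient_carrier[OF ideal_submod[OF kalg_F], of J] by simp

lemma proj_add: "ideal J F \<Longrightarrow> proj J (x + y) = proj J x \<oplus>\<^bsub>Fq J\<^esub> proj J y"
  and proj_scale: "ideal J F \<Longrightarrow> proj J (c *\<^sub>k x) = c \<odot>\<^bsub>Fq J\<^esub> proj J x"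
  and proj_mult: "ideal J F \<Longrightarrow> proj J (x \<star> y) = proj J x \<otimes>\<^bsub>Fq J\<^esub> proj J y"
  and proj_zero: "ideal J F \<Longrightarrow> proj J 0 = \<zero>\<^bsub>Fq J\<^esub>"
  using k_linear_add[OF proj_linear, of J x y] k_linear_smult[OF proj_linear, of J x c]
    algebra_hom_mult[OF proj_hom, of J x y] k_linear_zero[OF F.kmod_axioms _ proj_linear, of J]
    kalg_kmod[OF kalg_Fq, of J]
  by simp_all

end

lemma (in yd) epi_Fq: "ideal J F \<Longrightarrow> epi (Fq J) (proj J)"
  unfolding epi_def using kalg_Fq proj_hom proj_surj by blast

context yd
begin

lemma pure_single_left: "single p c \<otimes>\<^sub>k y = c \<odot>\<^bsub>FF\<^esub> (single p 1 \<otimes>\<^sub>k y)"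
  using pure_F(3)[of c "single p 1" y] by simp

text \<open>The link between the two coproducts: a summand \<open>u \<otimes> v\<close> of the
  braided coproduct becomes \<open>u g_v a \<otimes> v a\<close>, where \<open>g_v\<close> is the
  degree of \<open>v\<close>. Through it primitivity in \<open>TV\<close> yields statements about
  \<open>F\<close>.\<close>

lemma comult_word:
  "\<Delta> (single (w, a) 1) = linear_extension FF
     (\<lambda>(u, v). single (u, word_degree g v + a) 1 \<otimes>\<^sub>k single (v, a) 1) (bc w)"
proof (induction w)
  case Nil
  show ?case
    using F_comult_grouplike[of a] by (subst lin_ext_bc_Nil[OF FFa.kmod_axioms]) (simp_all add: grouplike_def)
next
  case (Cons i w)
  let ?\<phi> = "\<lambda>(u, v). single (u, word_degree g v + a) 1 \<otimes>\<^sub>k single (v, a) 1"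
  have cl: "?\<phi> p \<in> carrier FF" for p by (simp split: prod.split)
  have lin: "k_linear FF FF (\<lambda>t. DX i \<otimes>\<^bsub>FF\<^esub> t)"
    by (rule k_linearI) (simp_all add: FFa.r_distr FFa.smult_mult_right)
  have "\<Delta> (single (i # w, a) 1) = DX i \<otimes>\<^bsub>FF\<^esub> \<Delta> (single (w, a) 1)"
    by (simp flip: F_comult_var_mult)
  also have "\<dots> = linear_extension FF (\<lambda>p. DX i \<otimes>\<^bsub>FF\<^esub> ?\<phi> p) (bc w)"
    unfolding Cons by (rule k_linear_lin_ext[OF FFa.kmod_axioms FFa.kmod_axioms lin]) (use cl in auto)
  also have "(\<lambda>p. DX i \<otimes>\<^bsub>FF\<^esub> ?\<phi> p)
    = (\<lambda>(u, v). ?\<phi> (i # u, v) \<oplus>\<^bsub>FF\<^esub> word_char \<chi> u (g i) \<odot>\<^bsub>FF\<^esub> ?\<phi> (u, i # v))"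
  proof
    fix p :: "'i list \<times> 'i list"
    obtain u v where p: "p = (u, v)" by (cases p)
    have "DX i \<otimes>\<^bsub>FF\<^esub> ?\<phi> (u, v) = ?\<phi> (i # u, v) \<oplus>\<^bsub>FF\<^esub> word_char \<chi> u (g i) \<odot>\<^bsub>FF\<^esub> ?\<phi> (u, i # v)"
      by (simp add: FFa.l_distr pure_F_mult pure_F add.assoc pure_single_left[of _ "word_char \<chi> u (g i)"])
    then show "DX i \<otimes>\<^bsub>FF\<^esub> ?\<phi> p = (\<lambda>(u, v). ?\<phi> (i # u, v) \<oplus>\<^bsub>FF\<^esub> word_char \<chi> u (g i) \<odot>\<^bsub>FF\<^esub> ?\<phi> (u, i # v)) p"
      by (simp add: p)
  qed
  also have "linear_extension FF \<dots> (bc w) = linear_extension FF ?\<phi> (bc (i # w))"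
    by (rule lin_ext_bc_Cons[OF FFa.kmod_axioms cl, symmetric])
  finally show ?case .
qed

abbreviation "tm J K \<equiv> tensor_map (Fq J) (Fq K) (proj J) (proj K)"

lemma tm:
  assumes J: "ideal J F" and K: "ideal K F"
  shows tm_linear: "k_linear FF (tensor (Fq J) (Fq K)) (tm J K)"
    and tm_pure: "tm J K (x \<otimes>\<^sub>k y) = pure_tensor (Fq J) (Fq K) (proj J x) (proj K y)"
    and tm_hom: "algebra_hom FF (tensor (Fq J) (Fq K)) (tm J K)"
    and kalg_pair_Fq: "kalg_pair (Fq J) (Fq K)"
  using tensor_map[OF F.kmod_axioms F.kmod_axioms kalg_kmod[OF kalg_Fq[OF J]] kalg_kmod[OF kalg_Fq[OF K]]
      proj_linear[OF J] proj_linear[OF K]]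
    tensor_map_algebra_hom[OF kalg_F kalg_F kalg_Fq[OF J] kalg_Fq[OF K] proj_hom[OF J] proj_hom[OF K]]
  by (simp_all add: kalg_pair.intro kalg_Fq J K)

lemma kernel_F_ideal: "kalg B \<Longrightarrow> algebra_hom F B f \<Longrightarrow> ideal {x. f x = \<zero>\<^bsub>B\<^esub>} F"
  using kernel_ideal[OF kalg_F, of B f] by simp

end

definition linking :: "('i \<Rightarrow> 'g) \<Rightarrow> ('i \<Rightarrow> 'i \<Rightarrow> 'k) \<Rightarrow> ('i \<Rightarrow> 'i \<Rightarrow> 'k) \<Rightarrow> 'i \<Rightarrow> 'i \<Rightarrow> 'i list \<times> 'g::ab_group_add \<Rightarrow>\<^sub>0 'k::comm_ring_1"
  where "linking g m n i j = single ([], g i + g j) (m i j) + single ([], 0) (n i j)"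

section \<open>The ideals \<open>I m n\<close> under coproduct, counit and antipode\<close>

locale presentation = yd \<chi> g
  for \<chi> :: "'i \<Rightarrow> 'g::ab_group_add \<Rightarrow> 'k::comm_ring_1" and g :: "'i \<Rightarrow> 'g" +
  fixes blk :: "'i \<Rightarrow> nat" and R :: "('i list \<Rightarrow>\<^sub>0 'k) set" and Rc :: "nat \<Rightarrow> ('i list \<Rightarrow>\<^sub>0 'k) set" and L :: nat
  assumes q_inverse: "blk i \<noteq> blk j \<Longrightarrow> \<chi> j (g i) * \<chi> i (g j) = 1"
    and R_relators: "R \<subseteq> braid_relators g \<chi> blk"
    and Rc_0: "Rc 0 = {}" and Rc_Suc: "h < L \<Longrightarrow> Rc h \<subseteq> Rc (Suc h)" and Rc_L: "Rc L = R"
    and prim: "h < L \<Longrightarrow> r \<in> Rc (Suc h) \<Longrightarrow> primitive_modulo g \<chi> (Idl\<^bsub>tensor_algebra\<^esub> (Rc h)) r"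
begin

lemma Rc_subset: "h \<le> L \<Longrightarrow> Rc h \<subseteq> R"
proof (induction rule: inc_induct)
  case base
  then show ?case by (simp add: Rc_L)
next
  case (step h)
  then show ?case using Rc_Suc by blast
qed

lemma R_level: "r \<in> R \<Longrightarrow> \<exists>h<L. r \<in> Rc (Suc h)"
  using Rc_0 Rc_L by (cases L) auto

lemma R_homogeneous:
  assumes "r \<in> R"
  obtains w where "length w \<ge> 2" "\<And>i j. i \<in> set w \<Longrightarrow> j \<in> set w \<Longrightarrow> blk i = blk j"
    "\<And>v. v \<in> keys r \<Longrightarrow> mset v = mset w"
  using braid_relators_homogeneous[OF subsetD[OF R_relators assms]] by blast

lemma R_mset: "r \<in> R \<Longrightarrow> \<exists>w. length w \<ge> 2 \<and> (\<forall>v\<in>keys r. mset v = mset w)"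
  by (erule R_homogeneous) blast

definition ad :: "'i \<Rightarrow> 'i \<Rightarrow> 'i list \<times> 'g \<Rightarrow>\<^sub>0 'k" where
  "ad i j = single ([i, j], 0) 1 - single ([j, i], 0) (\<chi> j (g i))"

lemma TV_incl_ad: "TV_incl (braided_commutator g \<chi> i j) = ad i j"
  unfolding TV_incl_eq_lin_ext braided_commutator_def ad_def
  by (subst F.lin_ext_diff) (simp_all add: F.lin_ext_single)

definition I :: "('i \<Rightarrow> 'i \<Rightarrow> 'k) \<Rightarrow> ('i \<Rightarrow> 'i \<Rightarrow> 'k) \<Rightarrow> ('i list \<times> 'g \<Rightarrow>\<^sub>0 'k) set" where
  "I m n = defining_ideal g \<chi> blk R (\<lambda>(i, j). linking g m n i j)"

lemma I_ideal [simp]: "ideal (I m n) F"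
  unfolding I_def defining_ideal_def by (rule F.genideal_ideal) simp

lemma I_R: "r \<in> R \<Longrightarrow> TV_incl r \<in> I m n"
  and I_ad: "blk j < blk i \<Longrightarrow> ad i j - linking g m n i j \<in> I m n"
proof -
  have "TV_incl ` R \<union> {TV_incl (braided_commutator g \<chi> i j) - linking g m n i j | i j. (i, j) \<in> Theta blk} \<subseteq> I m n"
    unfolding I_def defining_ideal_def prod.case by (rule F.genideal_self) simp
  then show "r \<in> R \<Longrightarrow> TV_incl r \<in> I m n" "blk j < blk i \<Longrightarrow> ad i j - linking g m n i j \<in> I m n"
    by (auto simp: Theta_def TV_incl_ad) blast
qed

lemma I_minimal:
  assumes "ideal J F" "\<And>r. r \<in> R \<Longrightarrow> TV_incl r \<in> J" "\<And>i j. blk j < blk i \<Longrightarrow> ad i j - linking g m n i j \<in> J"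
  shows "I m n \<subseteq> J"
  unfolding I_def defining_ideal_def
  by (rule F.genideal_minimal[OF assms(1)]) (use assms(2,3) in \<open>auto simp: Theta_def TV_incl_ad\<close>)

text \<open>Modulo earlier relators, which lie in \<open>J\<close> and \<open>K\<close>, a primitive
  relator has coproduct \<open>r \<otimes> 1 + g_r \<otimes> r\<close> with \<open>g_r\<close> its
  degree, and both terms vanish in the quotients.\<close>

lemma comult_R:
  assumes J: "ideal J F" "\<And>r. r \<in> R \<Longrightarrow> TV_incl r \<in> J" and K: "ideal K F" "\<And>r. r \<in> R \<Longrightarrow> TV_incl r \<in> K"
    and r: "r \<in> R"
  shows "tm J K (\<Delta> (TV_incl r)) = \<zero>\<^bsub>tensor (Fq J) (Fq K)\<^esub>"
proof -
  interpret JK: kalg_pair "Fq J" "Fq K" by (rule kalg_pair_Fq[OF J(1) K(1)])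
  interpret T: kalg "tensor (Fq J) (Fq K)" by (rule JK.kalg_tensor)
  let ?T = "tensor (Fq J) (Fq K)"
  let ?p = "\<lambda>x y. pure_tensor (Fq J) (Fq K) (proj J x) (proj K y)"
  obtain h where h: "h < L" "r \<in> Rc (Suc h)" using R_level[OF r] by blast
  have lin1: "k_linear F ?T (\<lambda>x. ?p x y)" for y
    by (rule k_linear_comp[OF proj_linear[OF J(1)] bilin_left[OF JK.bilin_pure]]) (simp add: K)
  have lin2: "k_linear F ?T (?p x)" for x
    by (rule k_linear_comp[OF proj_linear[OF K(1)] bilin_right[OF JK.bilin_pure]]) (simp add: J)
  have p0: "?p x y = \<zero>\<^bsub>?T\<^esub>" if "x \<in> J \<or> y \<in> K" for x y
    using that k_linear_zero[OF JK.B.kmod_axioms T.kmod_axioms bilin_right[OF JK.bilin_pure], of "proj J x"]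
      k_linear_zero[OF JK.A.kmod_axioms T.kmod_axioms bilin_left[OF JK.bilin_pure], of "proj K y"]
    by (auto simp: proj_zero_iff[OF J(1), symmetric] proj_zero_iff[OF K(1), symmetric] J K)
  let ?\<beta> = "\<lambda>u v. ?p (single (u, word_degree g v) 1) (single (v, 0) 1)"
  have cl: "?\<beta> u v \<in> carrier ?T" for u v by (simp add: J K)
  have mem: "single (u, 0) 1 \<star> TV_incl \<rho> \<star> single (w, a) 1 \<in> J" "single (u, 0) 1 \<star> TV_incl \<rho> \<star> single (w, a) 1 \<in> K"
    if "\<rho> \<in> R" for \<rho> u w a
    by (rule F_ideal(2)[OF J(1) F_ideal(1)[OF J(1) J(2)[OF that]]]
        F_ideal(2)[OF K(1) F_ideal(1)[OF K(1) K(2)[OF that]]])+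
  \<comment> \<open>The degree of the second leg also occurs in the first leg, so the expression is
    not visibly linear in the relator. The degree is constant on the words of \<open>\<rho>\<close>;
    with this constant inserted it is.\<close>
  have deg: "linear_extension ?T (\<lambda>x. ?\<beta> v (u @ x @ w)) \<rho> = \<zero>\<^bsub>?T\<^esub>" if \<rho>: "\<rho> \<in> R" for \<rho> u v w
  proof -
    obtain w0 where w0: "\<forall>v\<in>keys \<rho>. mset v = mset w0" using R_mset[OF \<rho>] by blast
    have deg: "word_degree g x = word_degree g w0" if "x \<in> keys \<rho>" for x
      by (rule word_degree_mset) (use w0 that in blast)
    have "linear_extension ?T (\<lambda>x. ?\<beta> v (u @ x @ w)) \<rho>
      = linear_extension ?T (\<lambda>x. ?p (single (v, word_degree g (u @ w0 @ w)) 1) (single (u @ x @ w, 0) 1)) \<rho>"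
      by (rule T.lin_ext_cong) (use J(1) K(1) in \<open>simp_all add: deg\<close>)
    also have "\<dots> = ?p (single (v, word_degree g (u @ w0 @ w)) 1) (single (u, 0) 1 \<star> TV_incl \<rho> \<star> single (w, 0) 1)"
      by (rule linear_words[OF T.kmod_axioms lin2])
    also have "\<dots> = \<zero>\<^bsub>?T\<^esub>" by (rule p0) (rule disjI2, rule mem(2)[OF \<rho>])
    finally show ?thesis .
  qed
  have "tm J K (\<Delta> (TV_incl r)) = linear_extension ?T (\<lambda>w. tm J K (\<Delta> (single (w, 0) 1))) r"
    by (rule linear_TV_incl[OF T.kmod_axioms k_linear_comp[OF F_comult_linear tm_linear[OF J(1) K(1)]]])
  also have "\<dots> = linear_extension ?T (\<lambda>w. linear_extension ?T (\<lambda>(u, v). ?\<beta> u v) (bc w)) r"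
  proof (rule T.lin_ext_cong)
    fix w
    show "tm J K (\<Delta> (single (w, 0) 1)) = linear_extension ?T (\<lambda>(u, v). ?\<beta> u v) (bc w)"
      unfolding comult_word
      by (subst k_linear_lin_ext[OF FFa.kmod_axioms T.kmod_axioms tm_linear[OF J(1) K(1)]])
        (auto simp: tm_pure[OF J(1) K(1)] case_prod_unfold)
  qed (auto intro!: T.lin_ext_closed simp: J K)
  also have "\<dots> = linear_extension ?T (\<lambda>u. ?\<beta> u []) r \<oplus>\<^bsub>?T\<^esub> linear_extension ?T (?\<beta> []) r"
  proof (rule primitive_apply[OF prim[OF h] T.kmod_axioms cl])
    fix \<rho> u v w assume "\<rho> \<in> Rc h"
    then have \<rho>: "\<rho> \<in> R" using Rc_subset[of h] h by auto
    have "linear_extension ?T (\<lambda>x. ?\<beta> (u @ x @ w) v) \<rho>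
      = ?p (single (u, 0) 1 \<star> TV_incl \<rho> \<star> single (w, word_degree g v) 1) (single (v, 0) 1)"
      by (rule linear_words[OF T.kmod_axioms lin1])
    also have "\<dots> = \<zero>\<^bsub>?T\<^esub>" by (rule p0) (rule disjI1, rule mem(1)[OF \<rho>])
    finally show "linear_extension ?T (\<lambda>x. ?\<beta> (u @ x @ w) v) \<rho> = \<zero>\<^bsub>?T\<^esub>" .
    show "linear_extension ?T (\<lambda>x. ?\<beta> v (u @ x @ w)) \<rho> = \<zero>\<^bsub>?T\<^esub>" by (rule deg[OF \<rho>])
  qed
  also have "linear_extension ?T (\<lambda>u. ?\<beta> u []) r = \<zero>\<^bsub>?T\<^esub>"
    using linear_words[OF T.kmod_axioms lin1, of "[]" "[]" 0 "single ([], 0) 1" r] mem(1)[OF r, of "[]" "[]" 0]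
    by (simp add: p0)
  also have "linear_extension ?T (?\<beta> []) r = \<zero>\<^bsub>?T\<^esub>"
    using deg[OF r, of "[]" "[]" "[]"] by simp
  finally show ?thesis by simp
qed

text \<open>Skew primitivity: the mixed terms in \<open>x_i g_j \<otimes> x_j\<close> cancel by
  \<open>q_inverse\<close>, those in \<open>x_j g_i \<otimes> x_i\<close> by the definition of
  \<open>ad\<close>.\<close>

lemma comult_ad:
  assumes "blk i \<noteq> blk j"
  shows "\<Delta> (ad i j) = ad i j \<otimes>\<^sub>k single ([], 0) 1 \<oplus>\<^bsub>FF\<^esub> grouplike (g i + g j) \<otimes>\<^sub>k ad i j"
proof -
  let ?q = "\<chi> j (g i)"
  have q: "?q * \<chi> i (g j) = 1" by (rule q_inverse[OF assms])
  have scale: "single p c = c *\<^sub>k single p 1" for p :: "'i list \<times> 'g" and c :: 'k by simp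
  have xx: "\<Delta> (single ([i, j], 0) 1) = DX i \<otimes>\<^bsub>FF\<^esub> DX j" for i j
    using F_comult_var_mult[of i "var j"] by (simp add: F_comult_var) (simp add: var_def)
  have DXX: "DX i \<otimes>\<^bsub>FF\<^esub> DX j = single ([i, j], 0) 1 \<otimes>\<^sub>k single ([], 0) 1
      \<oplus>\<^bsub>FF\<^esub> single ([i], g j) 1 \<otimes>\<^sub>k single ([j], 0) 1
      \<oplus>\<^bsub>FF\<^esub> (\<chi> j (g i) \<odot>\<^bsub>FF\<^esub> (single ([j], g i) 1 \<otimes>\<^sub>k single ([i], 0) 1)
      \<oplus>\<^bsub>FF\<^esub> single ([], g i + g j) 1 \<otimes>\<^sub>k single ([i, j], 0) 1)" for i j
    by (simp add: FFa.l_distr FFa.r_distr pure_F_mult var_def grouplike_def FFa.a_ac pure_single_left[of _ "\<chi> j (g i)"])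
  let ?a = "single ([i, j], 0) 1 \<otimes>\<^sub>k single ([], 0) 1" and ?b = "single ([i], g j) 1 \<otimes>\<^sub>k single ([j], 0) 1"
    and ?c = "single ([j], g i) 1 \<otimes>\<^sub>k single ([i], 0) 1" and ?d = "single ([], g i + g j) 1 \<otimes>\<^sub>k single ([i, j], 0) 1"
    and ?a' = "single ([j, i], 0) 1 \<otimes>\<^sub>k single ([], 0) 1" and ?d' = "single ([], g i + g j) 1 \<otimes>\<^sub>k single ([j, i], 0) 1"
  have ad: "ad i j = single ([i, j], 0) 1 + (- ?q) *\<^sub>k single ([j, i], 0) 1"
    by (simp add: ad_def single_uminus[symmetric])
  have z: "?b \<oplus>\<^bsub>FF\<^esub> (- 1) \<odot>\<^bsub>FF\<^esub> ?b = \<zero>\<^bsub>FF\<^esub>" "?q \<odot>\<^bsub>FF\<^esub> ?c \<oplus>\<^bsub>FF\<^esub> (- ?q) \<odot>\<^bsub>FF\<^esub> ?c = \<zero>\<^bsub>FF\<^esub>"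
    by (simp_all add: FFa.smult_uminus FFa.r_neg)
  have "\<Delta> (ad i j) = DX i \<otimes>\<^bsub>FF\<^esub> DX j \<oplus>\<^bsub>FF\<^esub> (- ?q) \<odot>\<^bsub>FF\<^esub> (DX j \<otimes>\<^bsub>FF\<^esub> DX i)"
    using k_linear_add[OF F_comult_linear, of "single ([i, j], 0) 1" "(- ?q) *\<^sub>k single ([j, i], 0) 1"]
      k_linear_smult[OF F_comult_linear, of "single ([j, i], 0) 1" "- ?q"]
    by (simp add: ad xx del: pscale_single)
  also have "(- ?q) \<odot>\<^bsub>FF\<^esub> (DX j \<otimes>\<^bsub>FF\<^esub> DX i) = (- ?q) \<odot>\<^bsub>FF\<^esub> ?a' \<oplus>\<^bsub>FF\<^esub> ((- ?q) \<odot>\<^bsub>FF\<^esub> ?c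
      \<oplus>\<^bsub>FF\<^esub> ((- 1) \<odot>\<^bsub>FF\<^esub> ?b \<oplus>\<^bsub>FF\<^esub> (- ?q) \<odot>\<^bsub>FF\<^esub> ?d'))"
    unfolding DXX using q by (simp add: FFa.smult_r_distr FFa.smult_smult FFa.a_assoc add.commute)
  also have "DX i \<otimes>\<^bsub>FF\<^esub> DX j \<oplus>\<^bsub>FF\<^esub> \<dots>
    = (?a \<oplus>\<^bsub>FF\<^esub> (- ?q) \<odot>\<^bsub>FF\<^esub> ?a') \<oplus>\<^bsub>FF\<^esub> (?d \<oplus>\<^bsub>FF\<^esub> (- ?q) \<odot>\<^bsub>FF\<^esub> ?d')
      \<oplus>\<^bsub>FF\<^esub> ((?b \<oplus>\<^bsub>FF\<^esub> (- 1) \<odot>\<^bsub>FF\<^esub> ?b) \<oplus>\<^bsub>FF\<^esub> (?q \<odot>\<^bsub>FF\<^esub> ?c \<oplus>\<^bsub>FF\<^esub> (- ?q) \<odot>\<^bsub>FF\<^esub> ?c))"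
    unfolding DXX by (simp add: FFa.a_ac)
  also have "\<dots> = (?a \<oplus>\<^bsub>FF\<^esub> (- ?q) \<odot>\<^bsub>FF\<^esub> ?a') \<oplus>\<^bsub>FF\<^esub> (?d \<oplus>\<^bsub>FF\<^esub> (- ?q) \<odot>\<^bsub>FF\<^esub> ?d')"
    unfolding z by simp
  finally show ?thesis
    by (simp only: ad pure_F grouplike_def)
qed

text \<open>In the quotients \<open>\<Delta> (ad i j)\<close> becomes \<open>m g \<otimes> 1 + n 1
  \<otimes> 1 + m' g \<otimes> g + n' g \<otimes> 1\<close> with \<open>g = g_i g_j\<close>. The
  condition \<open>n' = - m\<close> removes the mixed terms and leaves the coproduct of
  \<open>m' g + n\<close>. One computation thus covers the coproducts of \<open>H^0\<close> and
  \<open>H^\<lambda>\<close> and both coactions on \<open>A(\<lambda>)\<close>.\<close>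

lemma comult_I:
  assumes "n' = (\<lambda>i j. - m i j)" and f: "f \<in> I m' n"
  shows "tm (I m n) (I m' n') (\<Delta> f) = \<zero>\<^bsub>tensor (Fq (I m n)) (Fq (I m' n'))\<^esub>"
proof -
  let ?J = "I m n" and ?K = "I m' n'"
  let ?T = "tensor (Fq ?J) (Fq ?K)"
  interpret JK: kalg_pair "Fq ?J" "Fq ?K" by (rule kalg_pair_Fq) simp_all
  interpret T: kalg ?T by (rule JK.kalg_tensor)
  note h = algebra_hom_comp[OF F_comult_hom tm_hom[OF I_ideal I_ideal], of m n m' n']
  let ?h = "\<lambda>f. tm ?J ?K (\<Delta> f)"
  have add: "?h (x + y) = ?h x \<oplus>\<^bsub>?T\<^esub> ?h y" for x y using k_linear_add[OF algebra_hom_linear[OF h], of x y] by simp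
  have scale: "?h (c *\<^sub>k x) = c \<odot>\<^bsub>?T\<^esub> ?h x" for c x using k_linear_smult[OF algebra_hom_linear[OF h], of x c] by simp
  let ?p = "\<lambda>x y. pure_tensor (Fq ?J) (Fq ?K) (proj ?J x) (proj ?K y)"
  have pl: "?p (x + x') y = ?p x y \<oplus>\<^bsub>?T\<^esub> ?p x' y" "?p (c *\<^sub>k x) y = c \<odot>\<^bsub>?T\<^esub> ?p x y"
    "?p x (y + y') = ?p x y \<oplus>\<^bsub>?T\<^esub> ?p x y'" "?p x (c *\<^sub>k y) = c \<odot>\<^bsub>?T\<^esub> ?p x y" for x x' y y' c
    by (simp_all add: proj_add proj_scale k_linear_add[OF bilin_left[OF JK.bilin_pure]]
        k_linear_add[OF bilin_right[OF JK.bilin_pure]] k_linear_smult[OF bilin_left[OF JK.bilin_pure]]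
        k_linear_smult[OF bilin_right[OF JK.bilin_pure]])
  have "I m' n \<subseteq> {x. ?h x = \<zero>\<^bsub>?T\<^esub>}"
  proof (rule I_minimal[OF kernel_F_ideal[OF JK.kalg_tensor h]])
    show "TV_incl r \<in> {x. ?h x = \<zero>\<^bsub>?T\<^esub>}" if "r \<in> R" for r
      using comult_R[OF I_ideal I_R I_ideal I_R that] by simp
    fix i j assume ij: "blk j < blk i"
    let ?G = "single ([], g i + g j) 1 :: 'i list \<times> 'g \<Rightarrow>\<^sub>0 'k" and ?e = "single ([], 0) 1 :: 'i list \<times> 'g \<Rightarrow>\<^sub>0 'k"
    have lk: "linking g a b i j = a i j *\<^sub>k ?G + b i j *\<^sub>k ?e" for a b
      by (simp add: linking_def)
    have n': "n' i j = - m i j" by (simp add: assms(1))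
    have eq: "proj (I a b) (ad i j) = proj (I a b) (linking g a b i j)" for a b
      using I_ad[OF ij, of a b] by (simp add: proj_eq_iff)
    have "?h (ad i j) = ?p (ad i j) ?e \<oplus>\<^bsub>?T\<^esub> ?p ?G (ad i j)"
      using ij by (simp add: comult_ad k_linear_add[OF tm_linear] tm_pure grouplike_def)
    also have "\<dots> = ?p (linking g m n i j) ?e \<oplus>\<^bsub>?T\<^esub> ?p ?G (linking g m' n' i j)"
      by (simp only: eq)
    also have "\<dots> = (m i j \<odot>\<^bsub>?T\<^esub> ?p ?G ?e \<oplus>\<^bsub>?T\<^esub> n i j \<odot>\<^bsub>?T\<^esub> ?p ?e ?e)
        \<oplus>\<^bsub>?T\<^esub> (m' i j \<odot>\<^bsub>?T\<^esub> ?p ?G ?G \<oplus>\<^bsub>?T\<^esub> (- m i j) \<odot>\<^bsub>?T\<^esub> ?p ?G ?e)"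
      by (simp only: lk pl n')
    also have "\<dots> = (m i j \<odot>\<^bsub>?T\<^esub> ?p ?G ?e \<oplus>\<^bsub>?T\<^esub> (- m i j) \<odot>\<^bsub>?T\<^esub> ?p ?G ?e)
        \<oplus>\<^bsub>?T\<^esub> (m' i j \<odot>\<^bsub>?T\<^esub> ?p ?G ?G \<oplus>\<^bsub>?T\<^esub> n i j \<odot>\<^bsub>?T\<^esub> ?p ?e ?e)"
      by (simp add: T.a_ac)
    also have "\<dots> = m' i j \<odot>\<^bsub>?T\<^esub> ?p ?G ?G \<oplus>\<^bsub>?T\<^esub> n i j \<odot>\<^bsub>?T\<^esub> ?p ?e ?e"
      by (simp add: T.smult_uminus T.r_neg)
    also have "\<dots> = ?h (linking g m' n i j)"
      using F_comult_grouplike[of "g i + g j"]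
      by (simp only: lk add scale tm_pure[OF I_ideal I_ideal] grouplike_def F_comult_one)
    finally have "?h (ad i j) = ?h (linking g m' n i j)" .
    then have "?h (ad i j + (-1) *\<^sub>k linking g m' n i j) = \<zero>\<^bsub>?T\<^esub>"
      unfolding add scale using k_linear_closed[OF algebra_hom_linear[OF h], of "linking g m' n i j"]
      by (simp add: T.minus_eq_smult[symmetric] T.r_neg)
    then show "ad i j - linking g m' n i j \<in> {x. ?h x = \<zero>\<^bsub>?T\<^esub>}" by simp
  qed
  then show ?thesis using f by blast
qed

abbreviation "I0 \<equiv> I (\<lambda>_ _. 0) (\<lambda>_ _. 0)"

lemma linking_zero [simp]: "linking g (\<lambda>_ _. 0) (\<lambda>_ _. 0) i j = 0"
  by (simp add: linking_def)

lemma I0_ad: "blk j < blk i \<Longrightarrow> ad i j \<in> I0"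
  using I_ad[of j i "\<lambda>_ _. 0" "\<lambda>_ _. 0"] by simp

text \<open>The right-hand side \<open>m g_i g_j + n\<close> has counit \<open>m + n\<close>. The
  case \<open>n = - m\<close> includes \<open>H^0\<close> and \<open>H^\<lambda>\<close>; to
  \<open>A(\<lambda>)\<close> the counit of \<open>F\<close> does not descend in general.\<close>

lemma counit_I:
  assumes n: "n = (\<lambda>i j. - m i j)" and f: "f \<in> I m n"
  shows "F_counit f = 0"
proof -
  have "I m n \<subseteq> {f. F_counit f = \<zero>\<^bsub>base_ring\<^esub>}"
  proof (rule I_minimal[OF kernel_F_ideal[OF kalg_base_ring F_counit_hom]])
    fix r assume "r \<in> R"
    then obtain w where w: "length w \<ge> 2" "\<forall>v\<in>keys r. mset v = mset w" using R_mset by blast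
    then have ne: "v \<noteq> []" if "v \<in> keys r" for v using that by fastforce
    have "F_counit (TV_incl r :: 'i list \<times> 'g \<Rightarrow>\<^sub>0 'k) = linear_extension base_ring (\<lambda>w. F_counit (single (w, 0) 1 :: 'i list \<times> 'g \<Rightarrow>\<^sub>0 'k)) r"
      by (rule linear_TV_incl[OF kmod_base_ring algebra_hom_linear[OF F_counit_hom]])
    also have "\<dots> = \<zero>\<^bsub>base_ring\<^esub>"
      by (rule kmod.lin_ext_const_zero[OF kmod_base_ring]) (use ne in simp)
    finally show "(TV_incl r :: 'i list \<times> 'g \<Rightarrow>\<^sub>0 'k) \<in> {f. F_counit f = \<zero>\<^bsub>base_ring\<^esub>}" by simp
  next
    fix i j
    have "ad i j - linking g m n i j = single ([i, j], 0) 1 + single ([j, i], 0) (- \<chi> j (g i))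
        + (single ([], g i + g j) (- m i j) + single ([], 0) (m i j))"
      by (simp add: ad_def linking_def n single_uminus)
    then show "ad i j - linking g m n i j \<in> {f. F_counit f = \<zero>\<^bsub>base_ring\<^esub>}"
      by (simp only: mem_Collect_eq F_counit_add) simp
  qed
  then show ?thesis using f by auto
qed

lemma counit_I0: "f \<in> I0 \<Longrightarrow> F_counit f = 0"
  by (rule counit_I) simp_all

text \<open>Evaluate \<open>S(u g_v) v\<close> on the coproduct of a relator: the antipode axiom
  gives zero, primitivity gives \<open>S(r)\<close> plus a left multiple of \<open>r\<close>.
  Earlier relators in the left leg appear under \<open>S\<close>, which is why the proof follows the
  chain.\<close>

lemma antipode_Rc:
  assumes J: "ideal J F" "\<And>r. r \<in> R \<Longrightarrow> TV_incl r \<in> J"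
  shows "h \<le> L \<Longrightarrow> r \<in> Rc h \<Longrightarrow> S (TV_incl r) \<in> J"
proof (induction h arbitrary: r)
  case 0
  then show ?case by (simp add: Rc_0)
next
  case (Suc h)
  interpret M: kalg "Fq J" by (rule kalg_Fq[OF J(1)])
  let ?M = "Fq J"
  have h: "h < L" using Suc.prems by simp
  have rR: "r \<in> R" using Rc_subset[of "Suc h"] Suc.prems by auto
  obtain w0 where w0: "length w0 \<ge> 2" "\<forall>v\<in>keys r. mset v = mset w0" using R_mset[OF rR] by blast
  let ?\<beta> = "\<lambda>u v. proj J (S (single (u, word_degree g v) 1) \<star> single (v, 0) 1)"
  have lin1: "k_linear F ?M (\<lambda>x. proj J (S x \<star> y))" and lin2: "k_linear F ?M (\<lambda>x. proj J (S y \<star> x))" for y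
    by (rule k_linearI; simp add: J S_add S_scale fmul_distrib fmul_scale proj_add proj_scale)+
  have z: "proj J x = \<zero>\<^bsub>?M\<^esub>" if "x \<in> J" for x using that by (simp add: proj_zero_iff[OF J(1)])
  have deg: "linear_extension ?M (\<lambda>x. ?\<beta> v (u @ x @ w)) \<rho> = \<zero>\<^bsub>?M\<^esub>" if \<rho>: "\<rho> \<in> R" for \<rho> u v w
  proof -
    obtain w0 where w0: "\<forall>v\<in>keys \<rho>. mset v = mset w0" using R_mset[OF \<rho>] by blast
    have deg: "word_degree g x = word_degree g w0" if "x \<in> keys \<rho>" for x
      by (rule word_degree_mset) (use w0 that in blast)
    have "linear_extension ?M (\<lambda>x. ?\<beta> v (u @ x @ w)) \<rho>
      = linear_extension ?M (\<lambda>x. proj J (S (single (v, word_degree g (u @ w0 @ w)) 1) \<star> single (u @ x @ w, 0) 1)) \<rho>"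
      by (rule M.lin_ext_cong) (use J(1) in \<open>simp_all add: deg\<close>)
    also have "\<dots> = proj J (S (single (v, word_degree g (u @ w0 @ w)) 1) \<star> (single (u, 0) 1 \<star> TV_incl \<rho> \<star> single (w, 0) 1))"
      by (rule linear_words[OF M.kmod_axioms lin2])
    also have "\<dots> = \<zero>\<^bsub>?M\<^esub>"
      by (rule z) (intro F_ideal(1)[OF J(1)] F_ideal(2)[OF J(1)] J(2)[OF \<rho>])
    finally show ?thesis .
  qed
  have "linear_extension ?M (\<lambda>w. linear_extension ?M (\<lambda>(u, v). ?\<beta> u v) (bc w)) r
      = linear_extension ?M (\<lambda>u. ?\<beta> u []) r \<oplus>\<^bsub>?M\<^esub> linear_extension ?M (?\<beta> []) r"
  proof (rule primitive_apply[OF prim[OF h Suc.prems(2)] M.kmod_axioms])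
    fix \<rho> u v w assume \<rho>: "\<rho> \<in> Rc h"
    then have \<rho>R: "\<rho> \<in> R" using Rc_subset[of h] h by auto
    have "S (single (u, 0) 1 \<star> TV_incl \<rho> \<star> single (w, word_degree g v) 1) \<star> single (v, 0) 1 \<in> J"
      unfolding S_mult
      by (rule F_ideal(2)[OF J(1)], rule F_ideal(1)[OF J(1)], rule F_ideal(2)[OF J(1)],
          rule Suc.IH[OF less_imp_le[OF h] \<rho>])
    moreover have "linear_extension ?M (\<lambda>x. ?\<beta> (u @ x @ w) v) \<rho>
      = proj J (S (single (u, 0) 1 \<star> TV_incl \<rho> \<star> single (w, word_degree g v) 1) \<star> single (v, 0) 1)"
      by (rule linear_words[OF M.kmod_axioms lin1])
    ultimately show "linear_extension ?M (\<lambda>x. ?\<beta> (u @ x @ w) v) \<rho> = \<zero>\<^bsub>?M\<^esub>" by (simp add: z)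
    show "linear_extension ?M (\<lambda>x. ?\<beta> v (u @ x @ w)) \<rho> = \<zero>\<^bsub>?M\<^esub>" by (rule deg[OF \<rho>R])
  qed (simp add: J)
  also have "linear_extension ?M (?\<beta> []) r = \<zero>\<^bsub>?M\<^esub>"
    using deg[OF rR, of "[]" "[]" "[]"] by simp
  also have "linear_extension ?M (\<lambda>u. ?\<beta> u []) r = proj J (S (TV_incl r))"
    using linear_words[OF M.kmod_axioms lin1, of "[]" "[]" 0 "single ([], 0) 1" r] by simp
  \<comment> \<open>By \<open>comult_word\<close> the inner sum is the antipode identity for the
    word \<open>w\<close>, whose counit is zero because the words of a relator are not
    empty.\<close>
  also have "linear_extension ?M (\<lambda>w. linear_extension ?M (\<lambda>(u, v). ?\<beta> u v) (bc w)) r = \<zero>\<^bsub>?M\<^esub>"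
  proof (rule M.lin_ext_const_zero)
    fix w assume "w \<in> keys r"
    then have w: "w \<noteq> []" using w0 by fastforce
    note b = bilin_comp[OF bilin_fmul S_linear k_linear_id(2)]
    note l = FF.tensor_lift[OF F.kmod_axioms b]
    note ll = k_linear_comp[OF l(2) proj_linear[OF J(1)]]
    have "linear_extension ?M (\<lambda>(u, v). ?\<beta> u v) (bc w) = proj J (tensor_lift F (\<lambda>a b. S a \<star> b) (\<Delta> (single (w, 0) 1)))"
      unfolding comult_word
      by (subst k_linear_lin_ext[OF FFa.kmod_axioms M.kmod_axioms ll]) (auto simp: l(1) case_prod_unfold)
    also have "\<dots> = \<zero>\<^bsub>?M\<^esub>"
      using w by (simp add: F_antipode_left proj_zero J)
    finally show "linear_extension ?M (\<lambda>(u, v). ?\<beta> u v) (bc w) = \<zero>\<^bsub>?M\<^esub>" .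
  qed
  finally show ?case by (simp add: J proj_zero_iff[symmetric])
qed

text \<open>\<open>S\<close> reverses \<open>x_i x_j\<close>, and \<open>q_inverse\<close> turns
  \<open>S (ad i j)\<close> into a multiple of \<open>ad i j\<close> again.\<close>

lemma antipode_I0: "f \<in> I0 \<Longrightarrow> S f \<in> I0"
proof -
  have "I0 \<subseteq> {f. S f \<in> I0}"
  proof (rule I_minimal)
    show "ideal {f. S f \<in> I0} F"
      by (rule F_idealI) (auto simp: S_add S_mult intro: F_ideal[OF I_ideal])
    show "TV_incl r \<in> {f. S f \<in> I0}" if "r \<in> R" for r
      using antipode_Rc[OF I_ideal I_R order_refl] that by (simp add: Rc_L)
    fix i j assume ij: "blk j < blk i"
    then have q: "\<chi> j (g i) * \<chi> i (g j) = 1" using q_inverse[of i j] by simp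
    have xx: "S (single ([i, j], 0) 1) = \<chi> j (g i) *\<^sub>k (grouplike (- g i - g j) \<star> single ([j, i], 0) 1)" for i j
    proof -
      have 1: "S (single ([i, j], 0) 1) = Sx j \<star> Sx i"
        using S_var_mult[of i "var j"] by (simp add: S_var) (simp add: var_def)
      have c: "\<chi> j (g i) * (a * (b * (\<chi> j (- g i) * c))) = a * (b * c)" for a b c
      proof -
        have "\<chi> j (g i) * (a * (b * (\<chi> j (- g i) * c))) = (\<chi> j (g i) * \<chi> j (- g i)) * (a * (b * c))"
          by (simp only: mult_ac)
        then show ?thesis by simp
      qed
      have "Sx j \<star> Sx i = \<chi> j (g i) *\<^sub>k (grouplike (- g i - g j) \<star> single ([j, i], 0) 1)"
        by (simp add: c Sx_def grouplike_def var_def single_uminus[symmetric] algebra_simps \<chi>_add[of _ "- g i" "- g j", simplified])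
      with 1 show ?thesis by simp
    qed
    have "S (ad i j) = S (single ([i, j], 0) 1) - \<chi> j (g i) *\<^sub>k S (single ([j, i], 0) 1)"
      unfolding ad_def S_diff by (simp flip: S_scale)
    also have "\<dots> = - (grouplike (- g i - g j) \<star> ad i j)"
    proof -
      have "\<chi> j (g i) * (\<chi> i (g j) * c) = c" for c using q by (simp flip: mult.assoc)
      moreover have "- g j - g i = - g i - g j" by simp
      ultimately show ?thesis
        unfolding xx by (simp only: ad_def fmul_distrib fscale_simps fmul_scale minus_diff_eq) (simp add: fmul_scale[symmetric] mult.assoc, simp only: mult_ac)
    qed
    finally show "ad i j - linking g (\<lambda>_ _. 0) (\<lambda>_ _. 0) i j \<in> {f. S f \<in> I0}"
      using I0_ad[OF ij] by (auto intro: F_ideal[OF I_ideal])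
  qed
  then show "f \<in> I0 \<Longrightarrow> S f \<in> I0" by auto
qed

end

section \<open>Skew derivations\<close>

lemma pscale_cong [cong]:
  fixes c :: "'k::comm_ring_1"
  shows "c = d \<Longrightarrow> x = y \<Longrightarrow> Poly_Mapping.map ((*) c) x = Poly_Mapping.map ((*) d) y"
  by simp

context characters
begin

definition tw :: "('i \<Rightarrow> 'k) \<Rightarrow> ('g \<Rightarrow> 'k) \<Rightarrow> ('i list \<times> 'g \<Rightarrow>\<^sub>0 'k) \<Rightarrow> 'i list \<times> 'g \<Rightarrow>\<^sub>0 'k" where
  "tw s t = linear_extension F (\<lambda>(w, a). single (w, a) (prod_list (map s w) * t a))"

fun skw :: "('i \<Rightarrow> 'k) \<Rightarrow> ('i \<Rightarrow> 'k) \<Rightarrow> ('i \<Rightarrow> 'g) \<Rightarrow> 'i list \<Rightarrow> 'g \<Rightarrow> 'i list \<times> 'g \<Rightarrow>\<^sub>0 'k" where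
  "skw s c \<gamma> [] a = 0"
| "skw s c \<gamma> (j # w) a = single ([], \<gamma> j) (c j) \<star> single (w, a) 1 + s j *\<^sub>k (var j \<star> skw s c \<gamma> w a)"

text \<open>The skew derivation with \<open>x\<^sub>j \<mapsto> c\<^sub>j \<gamma>\<^sub>j \<in> k\<Gamma>\<close> and twist \<open>x\<^sub>j \<mapsto> s\<^sub>j x\<^sub>j\<close>.\<close>

definition skd :: "('i \<Rightarrow> 'k) \<Rightarrow> ('i \<Rightarrow> 'k) \<Rightarrow> ('i \<Rightarrow> 'g) \<Rightarrow> ('i list \<times> 'g \<Rightarrow>\<^sub>0 'k) \<Rightarrow> 'i list \<times> 'g \<Rightarrow>\<^sub>0 'k" where
  "skd s c \<gamma> = linear_extension F (\<lambda>(w, a). skw s c \<gamma> w a)"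

lemma lin_F:
  fixes \<phi> :: "'i list \<times> 'g \<Rightarrow> 'i list \<times> 'g \<Rightarrow>\<^sub>0 'k"
  shows "linear_extension F \<phi> (x + y) = linear_extension F \<phi> x + linear_extension F \<phi> y"
    and "linear_extension F \<phi> (c *\<^sub>k x) = c *\<^sub>k linear_extension F \<phi> x"
    and "linear_extension F \<phi> (single p c) = c *\<^sub>k \<phi> p"
  by (simp_all add: F.lin_ext_add F.lin_ext_smult F.lin_ext_single)

lemma tw_add: "tw s t (x + y) = tw s t x + tw s t y" and tw_scale: "tw s t (c *\<^sub>k x) = c *\<^sub>k tw s t x"
  and tw_single: "tw s t (single (w, a) c) = single (w, a) (prod_list (map s w) * t a * c)"
  by (simp_all add: tw_def lin_F mult_ac)

lemma skd_add: "skd s c \<gamma> (x + y) = skd s c \<gamma> x + skd s c \<gamma> y"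
  and skd_scale: "skd s c \<gamma> (d *\<^sub>k x) = d *\<^sub>k skd s c \<gamma> x"
  and skd_single: "skd s c \<gamma> (single (w, a) d) = d *\<^sub>k skw s c \<gamma> w a"
  by (simp_all add: skd_def lin_F)

lemma tw_linear: "k_linear F F (tw s t)" and skd_linear: "k_linear F F (skd s c \<gamma>)"
  by (rule k_linearI; simp add: tw_add tw_scale skd_add skd_scale)+

lemma skd_zero [simp]: "skd s c \<gamma> 0 = 0" and tw_zero [simp]: "tw s t 0 = 0"
  by (simp_all add: skd_def tw_def)

lemma skd_grouplike [simp]: "skd s c \<gamma> (single ([], a) d) = 0"
  by (simp add: skd_single)

lemma skd_var_mult: "skd s c \<gamma> (var j \<star> f) = single ([], \<gamma> j) (c j) \<star> f + s j *\<^sub>k (var j \<star> skd s c \<gamma> f)"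
proof (induction f rule: F_induct)
  case (add x y)
  then show ?case by (simp add: fmul_distrib skd_add fscale_simps algebra_simps)
next
  case (single w a d)
  have "single ([], \<gamma> j) (c j) \<star> single (w, a) d = d *\<^sub>k (single ([], \<gamma> j) (c j) \<star> single (w, a) 1)"
    by (simp add: mult_ac)
  then show ?case
    by (simp add: skd_single fscale_simps fmul_scale mult_ac del: fmul_single)
qed simp

lemma tw_mult:
  assumes "\<And>a b. t (a + b) = t a * t b"
  shows "tw s t (x \<star> y) = tw s t x \<star> tw s t y"
proof (induction x rule: F_induct)
  case (single w a c)
  show ?case
  proof (induction y rule: F_induct)
    case (single v b d)
    then show ?case by (simp add: tw_single assms mult_ac)
  qed (simp_all add: fmul_distrib tw_add)
qed (simp_all add: fmul_distrib tw_add)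

text \<open>A skew derivation sending \<open>x_j\<close> to \<open>c j \<gamma> j\<close> must
  respect \<open>a x_j = \<chi>_j(a) x_j a\<close>. As \<open>\<gamma> j\<close> commutes with
  \<open>a\<close>, the group twist \<open>t\<close> has to be \<open>\<chi> j\<close> wherever
  \<open>c j\<close> is nonzero, which is \<open>compat\<close>.\<close>

lemma skd_grouplike_mult:
  assumes compat: "\<And>j a. c j \<noteq> 0 \<Longrightarrow> t a = \<chi> j a"
  shows "skd s c \<gamma> (grouplike a \<star> f) = t a *\<^sub>k (grouplike a \<star> skd s c \<gamma> f)"
proof -
  have *: "word_char \<chi> w a *\<^sub>k skw s c \<gamma> w (a + b) = t a *\<^sub>k (grouplike a \<star> skw s c \<gamma> w b)" for w b
  proof (induction w)
    case (Cons j w)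
    have 1: "word_char \<chi> (j # w) a *\<^sub>k (single ([], \<gamma> j) (c j) \<star> single (w, a + b) 1)
        = t a *\<^sub>k (grouplike a \<star> (single ([], \<gamma> j) (c j) \<star> single (w, b) 1))"
    proof (cases "c j = 0")
      case False
      then show ?thesis using compat[OF False, of a] by (simp add: word_char_add add_ac mult_ac)
    qed simp
    have "word_char \<chi> (j # w) a *\<^sub>k s j *\<^sub>k (var j \<star> skw s c \<gamma> w (a + b))
      = (\<chi> j a * s j) *\<^sub>k (var j \<star> (word_char \<chi> w a *\<^sub>k skw s c \<gamma> w (a + b)))"
      by (simp add: fscale_simps fmul_scale mult_ac)
    also have "\<dots> = t a *\<^sub>k s j *\<^sub>k ((\<chi> j a *\<^sub>k (var j \<star> grouplike a)) \<star> skw s c \<gamma> w b)"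
      unfolding Cons.IH by (simp add: fscale_simps fmul_scale fmul_assoc mult_ac)
    also have "\<dots> = t a *\<^sub>k (grouplike a \<star> (s j *\<^sub>k (var j \<star> skw s c \<gamma> w b)))"
      by (simp only: grouplike_var[symmetric] fmul_assoc fmul_scale)
    finally show ?case
      by (simp only: skw.simps fscale_simps fmul_distrib 1)
  qed simp
  show ?thesis
  proof (induction f rule: F_induct)
    case (add x y)
    then show ?case by (simp add: fmul_distrib skd_add fscale_simps)
  next
    case (single w b d)
    show ?case
      using arg_cong[OF *[of w b], of "\<lambda>x. d *\<^sub>k x"]
      by (simp add: skd_single fscale_simps fmul_scale mult_ac)
  qed simp
qed

lemma skd_mult:
  assumes compat: "\<And>j a. c j \<noteq> 0 \<Longrightarrow> t a = \<chi> j a" and t: "\<And>a b. t (a + b) = t a * t b"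
  shows "skd s c \<gamma> (f \<star> h) = skd s c \<gamma> f \<star> h + tw s t f \<star> skd s c \<gamma> h"
proof (induction f rule: F_induct)
  case (add x y)
  then show ?case by (simp add: fmul_distrib skd_add tw_add algebra_simps)
next
  case (single w a d)
  have "skd s c \<gamma> (single (w, a) 1 \<star> h) = skd s c \<gamma> (single (w, a) 1) \<star> h + tw s t (single (w, a) 1) \<star> skd s c \<gamma> h"
  proof (induction w)
    case Nil
    show ?case
      using skd_grouplike_mult[of c t s \<gamma> a h, OF compat]
      by (simp add: grouplike_def tw_single) (simp flip: fmul_scale)
  next
    case (Cons j w)
    have "single (j # w, a) 1 = var j \<star> single (w, a) 1" by simp
    moreover have "tw s t (single (j # w, a) 1) = s j *\<^sub>k (var j \<star> tw s t (single (w, a) 1))"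
      by (simp add: tw_single mult_ac)
    ultimately show ?case
      by (simp only: fmul_assoc skd_var_mult Cons fmul_distrib fscale_simps fmul_scale) (simp add: algebra_simps)
  qed
  from arg_cong[OF this, of "\<lambda>x. d *\<^sub>k x"] show ?case
    by (simp only: skd_scale[symmetric] tw_scale[symmetric] fmul_scale[symmetric] fscale_simps pscale_single mult_1_right)
qed simp

text \<open>Compare on a letter: \<open>tw\<close> scales the value \<open>c k \<gamma> k\<close> by
  \<open>t (\<gamma> k)\<close> and the argument by \<open>s k\<close>; by hypothesis these differ
  by the constant \<open>q\<close>.\<close>

lemma tw_skd:
  assumes t: "\<And>a b. t (a + b) = t a * t b" and "\<And>k. t (\<gamma> k) * c k = q * s k * c k"
  shows "tw s t (skd s' c \<gamma> f) = q *\<^sub>k skd s' c \<gamma> (tw s t f)"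
proof (induction f rule: F_induct)
  case (add x y)
  then show ?case by (simp add: skd_add tw_add fscale_simps)
next
  case (single w a d)
  have "tw s t (skd s' c \<gamma> (single (w, a) 1)) = q *\<^sub>k skd s' c \<gamma> (tw s t (single (w, a) 1))"
  proof (induction w)
    case (Cons j w)
    have v: "single (j # w, a) 1 = var j \<star> single (w, a) 1" by simp
    have tv: "tw s t (var j \<star> f) = s j *\<^sub>k (var j \<star> tw s t f)" for f
      by (induction f rule: F_induct) (simp_all add: fmul_distrib tw_add tw_single fscale_simps mult.assoc)
    have tg: "tw s t (single ([], \<gamma> j) (c j) \<star> f) = (q * s j) *\<^sub>k (single ([], \<gamma> j) (c j) \<star> tw s t f)" for f
      by (simp add: tw_mult[OF t] tw_single assms(2) fmul_scale[symmetric])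
    show ?case
      unfolding v
      by (simp only: skd_var_mult tw_add tw_scale tv tg Cons skd_scale fscale_simps fmul_scale)
        (simp add: fscale_simps fmul_scale mult_ac)
  qed (simp add: tw_single)
  from arg_cong[OF this, of "\<lambda>x. d *\<^sub>k x"] show ?case
    by (simp add: skd_scale[symmetric] tw_scale[symmetric] fscale_simps mult_ac)
qed simp

text \<open>Compare both sides on \<open>x_j y\<close>. Condition 1 matches the terms in
  \<open>\<gamma>' j\<close> times the first derivation of \<open>y\<close>, condition 2 those in
  \<open>\<gamma> j\<close> times the second; the rest is the claim for \<open>y\<close>. The factor
  \<open>q\<close> has to be the same for all letters.\<close>

lemma skd_commute:
  assumes t: "\<And>a b. t (a + b) = t a * t b" "\<And>a b. t' (a + b) = t' a * t' b"
    and c: "\<And>j a. c j \<noteq> 0 \<Longrightarrow> t a = \<chi> j a" "\<And>j a. c' j \<noteq> 0 \<Longrightarrow> t' a = \<chi> j a"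
    and 1: "\<And>k. t (\<gamma>' k) * c' k = q * s k * c' k" and 2: "\<And>k. s' k * c k = q * t' (\<gamma> k) * c k"
  shows "skd s c \<gamma> (skd s' c' \<gamma>' f) = q *\<^sub>k skd s' c' \<gamma>' (skd s c \<gamma> f)"
proof (induction f rule: F_induct)
  case (add x y)
  then show ?case by (simp add: skd_add fscale_simps)
next
  case (single w a d)
  let ?A = "skd s c \<gamma>" and ?B = "skd s' c' \<gamma>'"
  have "?A (?B (single (w, a) 1)) = q *\<^sub>k ?B (?A (single (w, a) 1))"
  proof (induction w)
    case (Cons j w)
    let ?y = "single (w, a) 1" and ?x = "var j"
    have v: "single (j # w, a) 1 = ?x \<star> ?y" by simp
    have A: "?A (single ([], \<gamma>' j) (c' j) \<star> ?y) = (q * s j) *\<^sub>k (single ([], \<gamma>' j) (c' j) \<star> ?A ?y)"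
    proof -
      have "tw s t (single ([], \<gamma>' j) (c' j)) = (q * s j) *\<^sub>k single ([], \<gamma>' j) (c' j)"
        by (simp add: tw_single 1)
      then show ?thesis
        by (simp add: skd_mult[of c t, OF c(1) t(1)] fmul_scale del: fmul_single pscale_single Poly_Mapping.map_single)
    qed
    have B: "q *\<^sub>k ?B (single ([], \<gamma> j) (c j) \<star> ?y) = s' j *\<^sub>k (single ([], \<gamma> j) (c j) \<star> ?B ?y)"
    proof -
      have "q *\<^sub>k tw s' t' (single ([], \<gamma> j) (c j)) = s' j *\<^sub>k single ([], \<gamma> j) (c j)"
        by (simp add: tw_single 2 mult.assoc)
      then have "q *\<^sub>k (tw s' t' (single ([], \<gamma> j) (c j)) \<star> x) = s' j *\<^sub>k (single ([], \<gamma> j) (c j) \<star> x)" for x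
        by (simp only: fmul_scale[symmetric])
      then show ?thesis
        by (simp add: skd_mult[of c' t', OF c(2) t(2)] del: fmul_single pscale_single Poly_Mapping.map_single)
    qed
    have "?A (?B (?x \<star> ?y)) = (q * s j) *\<^sub>k (single ([], \<gamma>' j) (c' j) \<star> ?A ?y)
        + (s' j *\<^sub>k (single ([], \<gamma> j) (c j) \<star> ?B ?y) + (s' j * s j * q) *\<^sub>k (?x \<star> ?B (?A ?y)))"
      by (simp only: skd_var_mult skd_add skd_scale A Cons fscale_simps fmul_scale mult.assoc)
    also have "\<dots> = q *\<^sub>k ?B (?A (?x \<star> ?y))"
      by (simp only: skd_var_mult skd_add skd_scale B fscale_simps fmul_scale) (simp add: mult_ac add_ac)
    finally show ?case unfolding v .
  qed simp
  from arg_cong[OF this, of "\<lambda>x. d *\<^sub>k x"] show ?case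
    by (simp add: skd_single fscale_simps mult_ac skd_scale)
qed simp

lemma skd_zero_coeff: "(\<And>j. c j = 0) \<Longrightarrow> skd s c \<gamma> f = 0"
proof (induction f rule: F_induct)
  case (single w a d)
  have "skw s c \<gamma> w a = 0" by (induction w) (simp_all add: single)
  then show ?case by (simp add: skd_single)
qed (simp_all add: skd_add)

lemma skd_degree:
  "keys f \<subseteq> {p. length (fst p) \<le> k} \<Longrightarrow> keys (skd s c \<gamma> f) \<subseteq> {p. length (fst p) < k}"
proof (induction f rule: pm_induct)
  case (add p d f)
  have *: "keys (skw s c \<gamma> w a) \<subseteq> {p. length (fst p) < length w}" for w a
  proof (induction w)
    case (Cons j w)
    have "keys (single ([], \<gamma> j) (c j) \<star> single (w, a) 1) \<subseteq> {p. length (fst p) < length (j # w)}"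
      by simp
    moreover have "keys (var j \<star> f) \<subseteq> {p. length (fst p) < length (j # w)}"
      if "keys f \<subseteq> {p. length (fst p) < length w}" for f :: "'i list \<times> 'g \<Rightarrow>\<^sub>0 'k"
      using that
    proof (induction f rule: pm_induct)
      case (add p d f)
      then show ?case by (cases p) (simp add: fmul_distrib)
    qed simp
    ultimately show ?case using Cons by simp
  qed simp
  obtain w a where p: "p = (w, a)" "length w \<le> k" using add by (cases p) auto
  have "keys (skw s c \<gamma> w a) \<subseteq> {p. length (fst p) < k}" using *[of w a] p(2) by auto
  with add show ?case by (simp add: skd_add skd_single p)
qed simp

end

section \<open>The operators of the linking relations\<close>

locale linked = presentation \<chi> g blk R Rc L
  for \<chi> :: "'i \<Rightarrow> 'g::ab_group_add \<Rightarrow> 'k::comm_ring_1" and g blk R Rc L +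
  fixes m n :: "'i \<Rightarrow> 'i \<Rightarrow> 'k"
  assumes m_Xi: "m i j \<noteq> 0 \<Longrightarrow> (i, j) \<in> Xi \<chi> blk" and n_Xi: "n i j \<noteq> 0 \<Longrightarrow> (i, j) \<in> Xi \<chi> blk"
begin

text \<open>Both twists invert \<open>\<chi> i\<close> on the group, as the linked pairs demand. The
  letter twists are dictated by the expansions over the braided coproduct:
  \<open>\<chi> j (g i)\<close> lets \<open>M_i\<close> move past the letters of its block in
  \<open>Q_expand\<close>, and \<open>\<chi> i (- g j)\<close> lets \<open>N\<close> stay to the
  left of \<open>Q\<close> in \<open>X_expand\<close>. On letters of other blocks the two coincide
  by \<open>q_inv\<close>.\<close>

abbreviation "\<sigma> i \<equiv> tw (\<lambda>j. \<chi> j (g i)) (\<lambda>a. \<chi> i (- a))"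
abbreviation "\<sigma>' i \<equiv> tw (\<lambda>j. \<chi> i (- g j)) (\<lambda>a. \<chi> i (- a))"
abbreviation "DM i \<equiv> skd (\<lambda>j. \<chi> j (g i)) (m i) (\<lambda>k. g i + g k)"
abbreviation "DN i \<equiv> skd (\<lambda>j. \<chi> i (- g j)) (n i) (\<lambda>_. 0)"

lemma Xi_D:
  assumes "(i, k) \<in> Xi \<chi> blk"
  shows "blk k < blk i" "\<chi> k a = \<chi> i (- a)" "\<chi> i a = \<chi> k (- a)"
  using assms by (auto simp: Xi_def Theta_def \<chi>_eq_minus_iff mult.commute)

lemma q_inv: "blk i \<noteq> blk j \<Longrightarrow> \<chi> j (g i) = \<chi> i (- g j)"
  by (simp add: \<chi>_eq_minus_iff q_inverse)

lemma \<chi>_minus_add: "\<chi> i (- (a + b)) = \<chi> i (- a) * \<chi> i (- b)"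
  using \<chi>_add[of i "- a" "- b"] by simp

lemma \<chi>_minus_diff: "\<chi> i (- a - b) = \<chi> i (- a) * \<chi> i (- b)"
  using \<chi>_add[of i "- a" "- b"] by simp

lemma m_compat: "m i j \<noteq> 0 \<Longrightarrow> \<chi> i (- a) = \<chi> j a" and n_compat: "n i j \<noteq> 0 \<Longrightarrow> \<chi> i (- a) = \<chi> j a"
  using Xi_D(2)[OF m_Xi] Xi_D(2)[OF n_Xi] by metis+

lemma DM_mult: "DM i (f \<star> h) = DM i f \<star> h + \<sigma> i f \<star> DM i h"
  by (rule skd_mult) (simp_all add: m_compat \<chi>_minus_diff)

lemma DN_mult: "DN i (f \<star> h) = DN i f \<star> h + \<sigma>' i f \<star> DN i h"
  by (rule skd_mult) (simp_all add: n_compat \<chi>_minus_diff)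

text \<open>Valid for all \<open>i\<close> and \<open>j\<close>: it is applied inside one block for
  \<open>Q_DN\<close> and across blocks for \<open>X_commutator\<close>.\<close>

lemma DM_DN: "DM i (DN j f) = \<chi> j (g i) *\<^sub>k DN j (DM i f)"
proof (rule skd_commute[where t = "\<lambda>a. \<chi> i (- a)" and t' = "\<lambda>a. \<chi> j (- a)"])
  fix k
  show "\<chi> i (- 0) * n j k = \<chi> j (g i) * \<chi> k (g i) * n j k"
    by (cases "n j k = 0") (simp_all add: n_compat[symmetric])
  show "\<chi> j (- g k) * m i k = \<chi> j (g i) * \<chi> j (- (g i + g k)) * m i k"
    by (simp add: \<chi>_minus_diff mult.assoc)
qed (simp_all add: m_compat n_compat \<chi>_minus_diff)

lemma DN_DM: "blk i \<noteq> blk j \<Longrightarrow> DN i (DM j f) = \<chi> j (g i) *\<^sub>k DM j (DN i f)"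
  using q_inverse[of i j] by (simp add: DM_DN fscale_simps)

text \<open>If \<open>k\<close> and \<open>j\<close> share a block, \<open>q_inverse\<close> says
  nothing about them. The linked partners help: replacing \<open>\<chi> j\<close> by the inverse of
  \<open>\<chi> l\<close> and \<open>\<chi> k\<close> by the inverse of \<open>\<chi> i\<close>
  leads through pairs of indices that lie in different blocks.\<close>

lemma Xi_Xi:
  assumes ik: "(i, k) \<in> Xi \<chi> blk" and jl: "(j, l) \<in> Xi \<chi> blk" and ji: "blk j < blk i"
  shows "\<chi> k (g j) = \<chi> j (- g k)"
proof (cases "blk k = blk j")
  case False
  then show ?thesis by (intro q_inv) simp
next
  case True
  have "\<chi> j (- g k) = \<chi> l (g k)" using Xi_D(2)[OF jl, of "g k"] by simp
  also have "\<dots> = \<chi> k (- g l)" using Xi_D(1)[OF jl] True by (intro q_inv) simp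
  also have "\<dots> = \<chi> i (g l)" using Xi_D(3)[OF ik, of "g l"] by simp
  also have "\<dots> = \<chi> l (- g i)" using Xi_D(1)[OF jl] ji by (intro q_inv) simp
  also have "\<dots> = \<chi> j (g i)" using Xi_D(3)[OF jl, of "g i"] by simp
  also have "\<dots> = \<chi> i (- g j)" using ji by (intro q_inv) simp
  also have "\<dots> = \<chi> k (g j)" using Xi_D(2)[OF ik, of "g j"] by simp
  finally show ?thesis ..
qed

lemma DM_DM:
  assumes ji: "blk j < blk i"
  shows "DM i (DM j f) = \<chi> j (g i) *\<^sub>k DM j (DM i f)"
\<comment> \<open>Either \<open>M_j\<close> is zero, or a nonzero coefficient supplies the second
  linked pair that \<open>Xi_Xi\<close> asks for.\<close>
proof (cases "\<forall>l. m j l = 0")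
  case True
  then show ?thesis by (simp add: skd_zero_coeff)
next
  case False
  then obtain l where jl: "(j, l) \<in> Xi \<chi> blk" using m_Xi by blast
  show ?thesis
  proof (rule skd_commute[where t = "\<lambda>a. \<chi> i (- a)" and t' = "\<lambda>a. \<chi> j (- a)"])
    fix k
    show "\<chi> i (- (g j + g k)) * m j k = \<chi> j (g i) * \<chi> k (g i) * m j k"
    proof (cases "m j k = 0")
      case False
      then have "blk k < blk j" by (rule Xi_D(1)[OF m_Xi])
      then show ?thesis using ji q_inv[of i j] q_inv[of i k] by (simp add: \<chi>_minus_diff)
    qed simp
    show "\<chi> k (g j) * m i k = \<chi> j (g i) * \<chi> j (- (g i + g k)) * m i k"
    proof (cases "m i k = 0")
      case False
      then have "\<chi> k (g j) = \<chi> j (- g k)" by (rule Xi_Xi[OF m_Xi jl ji])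
      then show ?thesis by (simp add: \<chi>_minus_diff mult.assoc)
    qed simp
  qed (simp_all add: m_compat \<chi>_minus_diff)
qed

lemma DN_DN:
  assumes ji: "blk j < blk i"
  shows "DN i (DN j f) = \<chi> j (g i) *\<^sub>k DN j (DN i f)"
proof (cases "\<forall>l. n j l = 0")
  case True
  then show ?thesis by (simp add: skd_zero_coeff)
next
  case False
  then obtain l where jl: "(j, l) \<in> Xi \<chi> blk" using n_Xi by blast
  show ?thesis
  proof (rule skd_commute[where t = "\<lambda>a. \<chi> i (- a)" and t' = "\<lambda>a. \<chi> j (- a)"])
    fix k
    show "\<chi> i (- 0) * n j k = \<chi> j (g i) * \<chi> i (- g k) * n j k"
    proof (cases "n j k = 0")
      case False
      then have jk: "(j, k) \<in> Xi \<chi> blk" by (rule n_Xi)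
      have "\<chi> i (- g k) = \<chi> k (g i)" using ji Xi_D(1)[OF jk] by (intro q_inv[symmetric]) simp
      also have "\<dots> = \<chi> j (- g i)" by (rule Xi_D(2)[OF jk])
      finally show ?thesis by simp
    qed simp
    show "\<chi> j (- g k) * n i k = \<chi> j (g i) * \<chi> j (- 0) * n i k"
    proof (cases "n i k = 0")
      case False
      then have ik: "(i, k) \<in> Xi \<chi> blk" by (rule n_Xi)
      have "\<chi> j (- g k) = \<chi> k (g j)" by (rule Xi_Xi[OF ik jl ji, symmetric])
      also have "\<dots> = \<chi> i (- g j)" by (rule Xi_D(2)[OF ik])
      also have "\<dots> = \<chi> j (g i)" using ji by (intro q_inv[symmetric]) simp
      finally show ?thesis by simp
    qed simp
  qed (simp_all add: n_compat \<chi>_minus_diff)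
qed

text \<open>Inside one block, the indices \<open>k\<close> linked to \<open>j\<close> lie in a
  strictly lower block, so \<open>q_inverse\<close> applies to \<open>i\<close> and \<open>k\<close>
  although it says nothing about \<open>i\<close> and \<open>j\<close>.\<close>

lemma \<sigma>'_DN:
  assumes "blk i = blk j" shows "\<sigma>' i (DN j f) = \<chi> j (g i) *\<^sub>k DN j (\<sigma>' i f)"
proof (rule tw_skd)
  fix k
  show "\<chi> i (- 0) * n j k = \<chi> j (g i) * \<chi> i (- g k) * n j k"
  proof (cases "n j k = 0")
    case False
    then have jk: "(j, k) \<in> Xi \<chi> blk" by (rule n_Xi)
    have "\<chi> i (- g k) = \<chi> k (g i)" using assms Xi_D(1)[OF jk] by (intro q_inv[symmetric]) simp
    also have "\<dots> = \<chi> j (- g i)" by (rule Xi_D(2)[OF jk])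
    finally show ?thesis by simp
  qed simp
qed (simp add: \<chi>_minus_diff)

lemma DM_\<sigma>:
  assumes "blk i = blk j" shows "DM i (\<sigma> j f) = \<chi> j (g i) *\<^sub>k \<sigma> j (DM i f)"
proof -
  have "\<sigma> j (DM i f) = \<chi> j (- g i) *\<^sub>k DM i (\<sigma> j f)"
  proof (rule tw_skd)
    fix k
    show "\<chi> j (- (g i + g k)) * m i k = \<chi> j (- g i) * \<chi> k (g j) * m i k"
    proof (cases "m i k = 0")
      case False
      then have "blk k < blk i" by (rule Xi_D(1)[OF m_Xi])
      then have "\<chi> k (g j) = \<chi> j (- g k)" using assms by (intro q_inv) simp
      then show ?thesis by (simp only: \<chi>_minus_add)
    qed simp
  qed (simp add: \<chi>_minus_diff)
  then show ?thesis by (simp add: fscale_simps)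
qed

end

section \<open>Relators evaluated at operators\<close>

context characters
begin

text \<open>The operator \<open>r(D)\<close>: the noncommutative polynomial \<open>r\<close> with
  \<open>D i\<close> substituted for \<open>x_i\<close>.\<close>

definition opr :: "('i \<Rightarrow> ('i list \<times> 'g \<Rightarrow>\<^sub>0 'k) \<Rightarrow> 'i list \<times> 'g \<Rightarrow>\<^sub>0 'k) \<Rightarrow> ('i list \<Rightarrow>\<^sub>0 'k) \<Rightarrow>
    ('i list \<times> 'g \<Rightarrow>\<^sub>0 'k) \<Rightarrow> 'i list \<times> 'g \<Rightarrow>\<^sub>0 'k" where
  "opr D r f = linear_extension F (\<lambda>w. foldr D w f) r"

lemma foldr_linear: "(\<And>i. k_linear F F (D i)) \<Longrightarrow> k_linear F F (foldr D w)"
  by (induction w) (auto simp: comp_def id_def intro: k_linear_comp k_linear_id)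

lemma linear_F: 
  assumes "k_linear F F D"
  shows "D (x + y) = D x + D y" "D (c *\<^sub>k x) = c *\<^sub>k D x" "D 0 = 0"
  using k_linear_add[OF assms, of x y] k_linear_smult[OF assms, of x c]
    k_linear_zero[OF F.kmod_axioms F.kmod_axioms assms] by simp_all

lemma opr_words:
  assumes "\<And>i. k_linear F F (D i)" "kmod M" "k_linear F M h"
  shows "linear_extension M (\<lambda>x. h (foldr D (u @ x @ w) f)) r = h (foldr D u (opr D r (foldr D w f)))"
  unfolding opr_def
  by (subst k_linear_lin_ext[OF F.kmod_axioms assms(2) k_linear_comp[OF foldr_linear[OF assms(1)] assms(3)]]) simp_all

lemma opr_linear:
  assumes "\<And>i. k_linear F F (D i)" shows "k_linear F F (opr D r)"
proof (rule k_linearI)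
  note l = linear_F[OF foldr_linear[of D, OF assms]]
  show "opr D r (x \<oplus>\<^bsub>F\<^esub> y) = opr D r x \<oplus>\<^bsub>F\<^esub> opr D r y" for x y
    using F.lin_ext_fun_add[of "\<lambda>w. foldr D w x" r "\<lambda>w. foldr D w y"] by (simp add: opr_def l)
  show "opr D r (c \<odot>\<^bsub>F\<^esub> x) = c \<odot>\<^bsub>F\<^esub> opr D r x" for c x
    using F.lin_ext_fun_smult[of "\<lambda>w. foldr D w x" r c] by (simp add: opr_def l)
qed simp

text \<open>\<open>F\<close> arises from \<open>k\<Gamma>\<close> by repeated left multiplication
  with letters, so a map obeying a Leibniz rule vanishes once it kills the generators.\<close>

lemma linear_F_vanish:
  assumes T: "k_linear F F T" and "\<And>a. T (single ([], a) 1) = 0" "\<And>k y. T y = 0 \<Longrightarrow> T (var k \<star> y) = 0"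
  shows "T f = 0"
proof (induction f rule: F_induct)
  case (single w a c)
  have "T (single (w, a) 1) = 0"
  proof (induction w)
    case (Cons k w)
    then show ?case using assms(3)[of "single (w, a) 1" k] by simp
  qed (rule assms(2))
  then show ?case using linear_F(2)[OF T, of c "single (w, a) 1"] by simp
qed (simp_all add: linear_F[OF T])

lemma foldr_tw: "foldr (\<lambda>i. tw (s i) (t i)) w f
    = tw (\<lambda>j. prod_list (map (\<lambda>i. s i j) w)) (\<lambda>a. prod_list (map (\<lambda>i. t i a) w)) f"
proof (induction w)
  case Nil
  have "prod_list (map (\<lambda>j. 1 :: 'k) w) = 1" for w :: "'i list" by (induction w) simp_all
  then show ?case by (induction f rule: F_induct) (simp_all add: tw_add tw_single)
next
  case (Cons i w)
  have *: "prod_list (map (\<lambda>j. p j * q j :: 'k) v) = prod_list (map p v) * prod_list (map q v)"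
    for p q and v :: "'i list" by (induction v) (simp_all add: mult_ac)
  show ?case
    unfolding foldr.simps comp_apply Cons
    by (induction f rule: F_induct) (simp_all add: tw_add tw_single * mult_ac)
qed

text \<open>Twists commute, so the twist along a word depends only on its letters and is constant
  over the words of a relator.\<close>

lemma foldr_tw_mset: "mset v = mset w \<Longrightarrow> foldr (\<lambda>i. tw (s i) (t i)) v f = foldr (\<lambda>i. tw (s i) (t i)) w f"
  unfolding foldr_tw by (simp flip: prod_mset_prod_list)

end

context presentation
begin

text \<open>\<open>primitive_apply\<close> for a function of words that is itself an expansion over
  the braided coproduct. The expansions hold for words in a single block; relators consist of such
  words.\<close>

lemma primitive_expand:
  assumes h: "h < L" "r \<in> Rc (Suc h)" and M: "kmod M" and cl: "\<And>a c. \<beta> a c \<in> carrier M"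
    and expand: "\<And>w b. \<forall>i\<in>set w. blk i = b \<Longrightarrow> \<phi> w = linear_extension M (\<lambda>(a, c). \<beta> a c) (bc w)"
    and left: "\<And>\<rho> u w v. \<rho> \<in> Rc h \<Longrightarrow> linear_extension M (\<lambda>x. \<beta> (u @ x @ w) v) \<rho> = \<zero>\<^bsub>M\<^esub>"
    and right: "\<And>\<rho> u w v. \<rho> \<in> Rc h \<Longrightarrow> linear_extension M (\<lambda>x. \<beta> v (u @ x @ w)) \<rho> = \<zero>\<^bsub>M\<^esub>"
  shows "linear_extension M \<phi> r = linear_extension M (\<lambda>u. \<beta> u []) r \<oplus>\<^bsub>M\<^esub> linear_extension M (\<beta> []) r"
proof -
  interpret M: kmod M by fact
  have "r \<in> R" using Rc_subset[of "Suc h"] h by auto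
  then have "\<exists>w0. (\<forall>i\<in>set w0. \<forall>j\<in>set w0. blk i = blk j) \<and> (\<forall>v\<in>keys r. mset v = mset w0)"
    by (rule R_homogeneous) blast
  then obtain w0 where w0: "\<forall>i\<in>set w0. \<forall>j\<in>set w0. blk i = blk j" "\<forall>v\<in>keys r. mset v = mset w0"
    by blast
  have "linear_extension M \<phi> r = linear_extension M (\<lambda>w. linear_extension M (\<lambda>(a, c). \<beta> a c) (bc w)) r"
  proof (rule M.lin_ext_cong)
    fix w assume "w \<in> keys r"
    then have "set w = set w0" using w0(2) mset_eq_setD by blast
    then have "blk i = blk (hd w0)" if "i \<in> set w" for i
      using w0(1)[rule_format, of i "hd w0"] that by (metis empty_iff hd_in_set list.set(1))
    then have "\<forall>i\<in>set w. blk i = blk (hd w0)" by blast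
    then show "\<phi> w = linear_extension M (\<lambda>(a, c). \<beta> a c) (bc w)" by (rule expand)
  qed (auto intro!: M.lin_ext_closed cl)
  also have "\<dots> = linear_extension M (\<lambda>u. \<beta> u []) r \<oplus>\<^bsub>M\<^esub> linear_extension M (\<beta> []) r"
    by (rule primitive_apply[OF prim[OF h] M cl left right])
  finally show ?thesis .
qed

lemma lin_ext_bc_Cons_F:
  fixes \<phi> :: "'i list \<times> 'i list \<Rightarrow> 'i list \<times> 'g \<Rightarrow>\<^sub>0 'k"
  assumes "\<And>u v. mset u + mset v = mset w \<Longrightarrow> \<psi> (u, v) = \<phi> (i # u, v) + word_char \<chi> u (g i) *\<^sub>k \<phi> (u, i # v)"
  shows "linear_extension F \<psi> (bc w) = linear_extension F \<phi> (bc (i # w))"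
  by (subst lin_ext_bc_Cons[OF F.kmod_axioms]) (auto intro!: lin_ext_bc_cong[OF F.kmod_axioms] simp: assms)

lemma linear_lin_ext_F:
  "k_linear F F D \<Longrightarrow> D (linear_extension F \<phi> t) = linear_extension F (\<lambda>p. D (\<phi> p)) t"
  by (rule k_linear_lin_ext[OF F.kmod_axioms F.kmod_axioms]) simp_all

lemma set_eq_of_mset: "mset u + mset v = mset w \<Longrightarrow> set w = set u \<union> set v"
  by (metis set_mset_mset set_mset_union)

end

context linked
begin

lemma DM_linear: "k_linear F F (DM i)" and DN_linear: "k_linear F F (DN i)"
  and \<sigma>_linear: "k_linear F F (\<sigma> i)"
  by (rule skd_linear tw_linear)+

lemma var_eq: "var i = var i \<star> single ([], 0) 1"
  by simp

lemma DM_var: "DM i (var k) = single ([], g i + g k) (m i k)" and DN_var: "DN i (var k) = single ([], 0) (n i k)"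
  by (subst var_eq, subst skd_var_mult, simp)+

lemma foldr_DN_\<sigma>':
  "\<forall>j\<in>set a. blk j = blk i \<Longrightarrow> \<sigma>' i (foldr DN a f) = word_char \<chi> a (g i) *\<^sub>k foldr DN a (\<sigma>' i f)"
  by (induction a) (simp_all add: \<sigma>'_DN skd_scale fscale_simps)

lemma foldr_\<sigma>_DM:
  "\<forall>j\<in>set a. blk j = blk i \<Longrightarrow> DM i (foldr \<sigma> a f) = word_char \<chi> a (g i) *\<^sub>k foldr \<sigma> a (DM i f)"
  by (induction a) (simp_all add: DM_\<sigma> tw_scale fscale_simps)

text \<open>Iterated Leibniz rule for \<open>N\<close>. Applying \<open>N_i\<close> to the left
  factor extends the leg \<open>a\<close>; moving \<open>\<sigma>' i\<close> past the derivations in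
  \<open>a\<close> gives the factor \<open>word_char \<chi> a (g i)\<close> of the braided coproduct
  and extends \<open>c\<close>.\<close>

lemma DN_expand:
  "\<forall>i\<in>set w. blk i = b \<Longrightarrow>
    foldr DN w (x \<star> y) = linear_extension F (\<lambda>(a, c). foldr DN a (foldr \<sigma>' c x) \<star> foldr DN c y) (bc w)"
proof (induction w)
  case Nil
  show ?case by (subst lin_ext_bc_Nil[OF F.kmod_axioms]) simp_all
next
  case (Cons i w)
  show ?case
    unfolding foldr.simps comp_apply Cons.IH[OF Cons.prems[unfolded list.set ball_simps, THEN conjunct2]]
      linear_lin_ext_F[OF DN_linear]
  proof (rule lin_ext_bc_Cons_F)
    fix u v :: "'i list" assume "mset u + mset v = mset w"
    then have "\<forall>j\<in>set u. blk j = blk i" using set_eq_of_mset[of u v w] Cons.prems by auto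
    then show "DN i (case (u, v) of (a, c) \<Rightarrow> foldr DN a (foldr \<sigma>' c x) \<star> foldr DN c y)
      = (case (i # u, v) of (a, c) \<Rightarrow> foldr DN a (foldr \<sigma>' c x) \<star> foldr DN c y)
        + word_char \<chi> u (g i) *\<^sub>k (case (u, i # v) of (a, c) \<Rightarrow> foldr DN a (foldr \<sigma>' c x) \<star> foldr DN c y)"
      by (simp add: DN_mult foldr_DN_\<sigma>' fmul_scale)
  qed
qed

text \<open>For \<open>M\<close> the legs exchange roles, because the factor now arises from moving
  \<open>M_i\<close> past the twists in \<open>a\<close>. Hence \<open>a\<close> differentiates
  \<open>y\<close> while twisting \<open>x\<close>, and \<open>c\<close> differentiates
  \<open>x\<close>.\<close>

lemma DM_expand:
  "\<forall>i\<in>set w. blk i = b \<Longrightarrow>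
    foldr DM w (x \<star> y) = linear_extension F (\<lambda>(a, c). foldr \<sigma> a (foldr DM c x) \<star> foldr DM a y) (bc w)"
proof (induction w)
  case Nil
  show ?case by (subst lin_ext_bc_Nil[OF F.kmod_axioms]) simp_all
next
  case (Cons i w)
  show ?case
    unfolding foldr.simps comp_apply Cons.IH[OF Cons.prems[unfolded list.set ball_simps, THEN conjunct2]]
      linear_lin_ext_F[OF DM_linear]
  proof (rule lin_ext_bc_Cons_F)
    fix u v :: "'i list" assume "mset u + mset v = mset w"
    then have u: "\<forall>j\<in>set u. blk j = blk i" using set_eq_of_mset[of u v w] Cons.prems by auto
    show "DM i (case (u, v) of (a, c) \<Rightarrow> foldr \<sigma> a (foldr DM c x) \<star> foldr DM a y)
      = (case (i # u, v) of (a, c) \<Rightarrow> foldr \<sigma> a (foldr DM c x) \<star> foldr DM a y)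
        + word_char \<chi> u (g i) *\<^sub>k (case (u, i # v) of (a, c) \<Rightarrow> foldr \<sigma> a (foldr DM c x) \<star> foldr DM a y)"
      unfolding prod.case foldr.simps comp_apply DM_mult foldr_\<sigma>_DM[OF u] fmul_scale by (rule add.commute)
  qed
qed

text \<open>Words of a relator have at least two letters: the first operator applied sends
  \<open>x_k\<close> into \<open>k\<Gamma>\<close>, and the second one kills
  \<open>k\<Gamma>\<close>.\<close>

lemma opr_kills_generators:
  assumes D: "\<And>i. k_linear F F (D i)" "\<And>i a c. D i (single ([], a) c) = 0" "\<And>i k. \<exists>a c. D i (var k) = single ([], a) c"
    and r: "r \<in> R"
  shows "opr D r (single ([], a) 1) = 0" "opr D r (var k) = 0"
proof -
  obtain w0 where w0: "length w0 \<ge> 2" "\<forall>v\<in>keys r. mset v = mset w0" using R_mset[OF r] by blast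
  have 0: "foldr D w 0 = 0" for w by (rule linear_F(3)[OF foldr_linear[OF D(1)]])
  have *: "\<exists>u i j. w = u @ [i, j]" if "w \<in> keys r" for w
  proof -
    have "length w \<ge> 2" using w0 that by (metis size_mset)
    then have "Suc (Suc 0) \<le> length (rev w)" by simp
    then obtain j i u where "rev w = j # i # u" unfolding Suc_le_length_iff by blast
    then have "w = rev u @ [i, j]" by (metis append.assoc append_Cons append_Nil rev.simps(2) rev_rev_ident)
    then show ?thesis by blast
  qed
  have "foldr D w (single ([], a) 1) = 0" if "w \<in> keys r" for w
    using *[OF that] by (auto simp: D(2) 0 linear_F(3)[OF D(1)])
  then show "opr D r (single ([], a) 1) = 0"
    unfolding opr_def by (intro F.lin_ext_const_zero[simplified])
  have "foldr D w (var k) = 0" if w: "w \<in> keys r" for w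
  proof -
    obtain u i j where "w = u @ [i, j]" using *[OF w] by blast
    moreover obtain b c where "D j (var k) = single ([], b) c" using D(3) by blast
    ultimately show ?thesis by (simp add: D(2) 0 linear_F(3)[OF D(1)])
  qed
  then show "opr D r (var k) = 0"
    unfolding opr_def by (intro F.lin_ext_const_zero[simplified])
qed

text \<open>By primitivity \<open>r(N)\<close> is again a skew derivation, and it vanishes on
  generators. The earlier relators vanish as operators on all of \<open>F\<close> by induction, so
  the equality is exact and not only modulo the ideal of \<open>H^0\<close>.\<close>

lemma DN_relation: "h \<le> L \<Longrightarrow> r \<in> Rc h \<Longrightarrow> opr DN r f = 0"
proof (induction h arbitrary: r f)
  case 0
  then show ?case by (simp add: Rc_0)
next
  case (Suc h)
  have h: "h < L" and r: "r \<in> Rc (Suc h)" and rR: "r \<in> R" using Suc.prems Rc_subset[of "Suc h"] by auto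
  have IH: "opr DN \<rho> f = 0" if "\<rho> \<in> Rc h" for \<rho> f using Suc.IH[OF _ that] h by simp
  note 0 = linear_F(3)[OF foldr_linear[of DN, OF DN_linear]]
  have lr: "k_linear F F (\<lambda>x. x \<star> y)" and ll: "k_linear F F (\<lambda>x. y \<star> x)" for y
    by (rule k_linearI; simp add: fmul_distrib fmul_scale)+
  have \<sigma>c: "linear_extension F (\<lambda>c. P (foldr \<sigma>' (u @ c @ w) x) c) \<rho> = linear_extension F (\<lambda>c. P (foldr \<sigma>' (u @ w0 @ w) x) c) \<rho>"
    if "\<forall>v\<in>keys \<rho>. mset v = mset w0" for P :: "_ \<Rightarrow> _ \<Rightarrow> 'i list \<times> 'g \<Rightarrow>\<^sub>0 'k" and u w x \<rho> w0
  proof (rule F.lin_ext_cong)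
    fix c assume "c \<in> keys \<rho>"
    then have "mset (u @ c @ w) = mset (u @ w0 @ w)" using that by simp
    from foldr_tw_mset[OF this] show "P (foldr \<sigma>' (u @ c @ w) x) c = P (foldr \<sigma>' (u @ w0 @ w) x) c" by metis
  qed simp
  \<comment> \<open>The witness is \<open>x\<close> twisted along the letters of \<open>r\<close>;
    its value is irrelevant for vanishing on products.\<close>
  have mult: "\<exists>z. opr DN r (x \<star> y) = opr DN r x \<star> y + z \<star> opr DN r y" for x y
  proof -
    obtain w0 where w0: "\<forall>v\<in>keys r. mset v = mset w0" using R_mset[OF rR] by blast
    let ?\<beta> = "\<lambda>a c. foldr DN a (foldr \<sigma>' c x) \<star> foldr DN c y"
    have "opr DN r (x \<star> y) = linear_extension F (\<lambda>a. ?\<beta> a []) r \<oplus>\<^bsub>F\<^esub> linear_extension F (?\<beta> []) r"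
      unfolding opr_def
    proof (rule primitive_expand[OF h r F.kmod_axioms])
      show "foldr DN w (x \<star> y) = linear_extension F (\<lambda>(a, c). ?\<beta> a c) (bc w)" if "\<forall>i\<in>set w. blk i = b" for w b
        by (rule DN_expand[OF that])
    next
      fix \<rho> u v w assume \<rho>: "\<rho> \<in> Rc h"
      show "linear_extension F (\<lambda>x. ?\<beta> (u @ x @ w) v) \<rho> = \<zero>\<^bsub>F\<^esub>"
        by (subst opr_words[where D = DN, OF DN_linear F.kmod_axioms lr]) (simp add: IH[OF \<rho>] 0)
      have "\<rho> \<in> R" using \<rho> Rc_subset[of h] h by auto
      then obtain w0 where w0: "\<forall>v\<in>keys \<rho>. mset v = mset w0" using R_mset by blast
      have "linear_extension F (\<lambda>x. ?\<beta> v (u @ x @ w)) \<rho>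
        = linear_extension F (\<lambda>c. foldr DN v (foldr \<sigma>' (u @ w0 @ w) x) \<star> foldr DN (u @ c @ w) y) \<rho>"
        by (rule \<sigma>c[OF w0])
      also have "\<dots> = \<zero>\<^bsub>F\<^esub>"
        by (subst opr_words[where D = DN, OF DN_linear F.kmod_axioms ll]) (simp add: IH[OF \<rho>] 0)
      finally show "linear_extension F (\<lambda>x. ?\<beta> v (u @ x @ w)) \<rho> = \<zero>\<^bsub>F\<^esub>" .
    qed simp_all
    also have "linear_extension F (\<lambda>a. ?\<beta> a []) r = opr DN r x \<star> y"
      using opr_words[where D = DN, OF DN_linear F.kmod_axioms lr, where u = "[]" and w = "[]"] by simp
    also have "linear_extension F (?\<beta> []) r = foldr \<sigma>' w0 x \<star> opr DN r y"
      using \<sigma>c[OF w0, of "\<lambda>z c. z \<star> foldr DN c y" "[]" "[]"] opr_words[where D = DN, OF DN_linear F.kmod_axioms ll, where u = "[]" and w = "[]"] by simp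
    finally show ?thesis by auto
  qed
  have gen: "opr DN r (single ([], a) 1) = 0" "opr DN r (var k) = 0" for a k
    by (rule opr_kills_generators[OF DN_linear _ _ rR]; use DN_var in auto)+
  show ?case
  proof (rule linear_F_vanish[OF opr_linear[where D = DN, OF DN_linear]])
    show "opr DN r (single ([], a) 1) = 0" for a by (rule gen)
    show "opr DN r (var k \<star> y) = 0" if "opr DN r y = 0" for k y
      using mult[of "var k" y] that gen by auto
  qed
qed

lemma DM_relation: "h \<le> L \<Longrightarrow> r \<in> Rc h \<Longrightarrow> opr DM r f = 0"
proof (induction h arbitrary: r f)
  case 0
  then show ?case by (simp add: Rc_0)
next
  case (Suc h)
  have h: "h < L" and r: "r \<in> Rc (Suc h)" and rR: "r \<in> R" using Suc.prems Rc_subset[of "Suc h"] by auto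
  have IH: "opr DM \<rho> f = 0" if "\<rho> \<in> Rc h" for \<rho> f using Suc.IH[OF _ that] h by simp
  note 0 = linear_F(3)[OF foldr_linear[of DM, OF DM_linear]]
  note \<sigma>0 = linear_F(3)[OF foldr_linear[of \<sigma>, OF \<sigma>_linear]]
  have lr: "k_linear F F (\<lambda>x. foldr \<sigma> u x \<star> y)" and ll: "k_linear F F (\<lambda>x. y \<star> x)" for y u
    by (rule k_linearI; simp add: fmul_distrib fmul_scale linear_F[OF foldr_linear[of \<sigma>, OF \<sigma>_linear]])+
  have \<sigma>c: "linear_extension F (\<lambda>c. P (foldr \<sigma> (u @ c @ w) x) c) \<rho> = linear_extension F (\<lambda>c. P (foldr \<sigma> (u @ w0 @ w) x) c) \<rho>"
    if "\<forall>v\<in>keys \<rho>. mset v = mset w0" for P :: "_ \<Rightarrow> _ \<Rightarrow> 'i list \<times> 'g \<Rightarrow>\<^sub>0 'k" and u w x \<rho> w0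
  proof (rule F.lin_ext_cong)
    fix c assume "c \<in> keys \<rho>"
    then have "mset (u @ c @ w) = mset (u @ w0 @ w)" using that by simp
    from foldr_tw_mset[OF this] show "P (foldr \<sigma> (u @ c @ w) x) c = P (foldr \<sigma> (u @ w0 @ w) x) c" by metis
  qed simp
  have mult: "\<exists>z. opr DM r (x \<star> y) = opr DM r x \<star> y + z \<star> opr DM r y" for x y
  proof -
    obtain w0 where w0: "\<forall>v\<in>keys r. mset v = mset w0" using R_mset[OF rR] by blast
    let ?\<beta> = "\<lambda>a c. foldr \<sigma> a (foldr DM c x) \<star> foldr DM a y"
    have "opr DM r (x \<star> y) = linear_extension F (\<lambda>a. ?\<beta> a []) r \<oplus>\<^bsub>F\<^esub> linear_extension F (?\<beta> []) r"
      unfolding opr_def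
    proof (rule primitive_expand[OF h r F.kmod_axioms])
      show "foldr DM w (x \<star> y) = linear_extension F (\<lambda>(a, c). ?\<beta> a c) (bc w)" if "\<forall>i\<in>set w. blk i = b" for w b
        by (rule DM_expand[OF that])
    next
      fix \<rho> u v w assume \<rho>: "\<rho> \<in> Rc h"
      show "linear_extension F (\<lambda>x. ?\<beta> v (u @ x @ w)) \<rho> = \<zero>\<^bsub>F\<^esub>"
        by (subst opr_words[where D = DM, OF DM_linear F.kmod_axioms lr]) (simp add: IH[OF \<rho>] 0 \<sigma>0)
      have "\<rho> \<in> R" using \<rho> Rc_subset[of h] h by auto
      then obtain w0 where w0: "\<forall>v\<in>keys \<rho>. mset v = mset w0" using R_mset by blast
      have "linear_extension F (\<lambda>x. ?\<beta> (u @ x @ w) v) \<rho>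
        = linear_extension F (\<lambda>c. foldr \<sigma> (u @ w0 @ w) (foldr DM v x) \<star> foldr DM (u @ c @ w) y) \<rho>"
        by (rule \<sigma>c[OF w0])
      also have "\<dots> = \<zero>\<^bsub>F\<^esub>"
        by (subst opr_words[where D = DM, OF DM_linear F.kmod_axioms ll]) (simp add: IH[OF \<rho>] 0)
      finally show "linear_extension F (\<lambda>x. ?\<beta> (u @ x @ w) v) \<rho> = \<zero>\<^bsub>F\<^esub>" .
    qed simp_all
    also have "linear_extension F (?\<beta> []) r = opr DM r x \<star> y"
      using opr_words[where D = DM, OF DM_linear F.kmod_axioms lr[of "[]" y], where u = "[]" and w = "[]"] by simp
    also have "linear_extension F (\<lambda>a. ?\<beta> a []) r = foldr \<sigma> w0 x \<star> opr DM r y"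
      using \<sigma>c[OF w0, of "\<lambda>z c. z \<star> foldr DM c y" "[]" "[]"] opr_words[where D = DM, OF DM_linear F.kmod_axioms ll, where u = "[]" and w = "[]"] by simp
    finally have "opr DM r (x \<star> y) = foldr \<sigma> w0 x \<star> opr DM r y + opr DM r x \<star> y" by simp
    also have "\<dots> = opr DM r x \<star> y + foldr \<sigma> w0 x \<star> opr DM r y" by (rule add.commute)
    finally have "opr DM r (x \<star> y) = opr DM r x \<star> y + foldr \<sigma> w0 x \<star> opr DM r y" .
    then show ?thesis by (rule exI[where x = "foldr \<sigma> w0 x"])
  qed
  have gen: "opr DM r (single ([], a) 1) = 0" "opr DM r (var k) = 0" for a k
    by (rule opr_kills_generators[OF DM_linear _ _ rR]; use DM_var in auto)+
  show ?case
  proof (rule linear_F_vanish[OF opr_linear[where D = DM, OF DM_linear]])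
    show "opr DM r (single ([], a) 1) = 0" for a by (rule gen)
    show "opr DM r (var k \<star> y) = 0" if "opr DM r y = 0" for k y
      using mult[of "var k" y] that gen by auto
  qed
qed

lemma opr_DM [simp]: "r \<in> R \<Longrightarrow> opr DM r f = 0" and opr_DN [simp]: "r \<in> R \<Longrightarrow> opr DN r f = 0"
  using DM_relation[of L r f] DN_relation[of L r f] by (simp_all add: Rc_L)

end

section \<open>Stability of the ideal of \<open>H^0\<close> under the skew derivations\<close>

context linked
begin

text \<open>\<open>N_i\<close> contracts the first leg of the braided coproduct with the functional
  \<open>x_k \<mapsto> n i k\<close> on words of length one; \<open>\<phi>M\<close> contracts the
  second leg, and the group element it produces crosses the first leg at the cost of a character
  value. In this form primitivity can be applied to \<open>N_i r\<close> and
  \<open>M_i r\<close>.\<close>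

definition \<phi>N :: "'i \<Rightarrow> 'i list \<Rightarrow> 'i list \<Rightarrow> 'i list \<times> 'g \<Rightarrow>\<^sub>0 'k" where
  "\<phi>N i u v = (if length u = 1 then single (v, 0) (n i (hd u)) else 0)"

definition \<phi>M :: "'i \<Rightarrow> 'i list \<Rightarrow> 'i list \<Rightarrow> 'i list \<times> 'g \<Rightarrow>\<^sub>0 'k" where
  "\<phi>M i u v = (if length v = 1 then single (u, g i + g (hd v)) (m i (hd v) * word_char \<chi> u (g i)) else 0)"

lemma scale_var_linear: "k_linear F F (\<lambda>x. c *\<^sub>k (var j \<star> x))"
  by (rule k_linearI) (simp_all add: fmul_distrib fmul_scale fscale_simps mult.commute)

lemma DN_word: "DN i (single (w, 0) 1) = linear_extension F (\<lambda>(u, v). \<phi>N i u v) (bc w)"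
proof (induction w)
  case Nil
  show ?case by (subst lin_ext_bc_Nil[OF F.kmod_axioms]) (simp_all add: \<phi>N_def)
next
  case (Cons j w)
  have "linear_extension F (\<lambda>(u, v). \<phi>N i u v) (bc (j # w))
    = linear_extension F (\<lambda>p. (\<lambda>(u, v). if u = [] then single (v, 0) (n i j) else 0) p
        + \<chi> i (- g j) *\<^sub>k (var j \<star> (\<lambda>(u, v). \<phi>N i u v) p)) (bc w)"
  proof (rule lin_ext_bc_Cons_F[symmetric])
    fix u v :: "'i list"
    show "(\<lambda>(u, v). if u = [] then single (v, 0) (n i j) else 0) (u, v) + \<chi> i (- g j) *\<^sub>k (var j \<star> (\<lambda>(u, v). \<phi>N i u v) (u, v))
      = (\<lambda>(u, v). \<phi>N i u v) (j # u, v) + word_char \<chi> u (g j) *\<^sub>k (\<lambda>(u, v). \<phi>N i u v) (u, j # v)"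
    proof (cases u)
      case (Cons k u')
      \<comment> \<open>The twist of \<open>N_i\<close> and the braiding factor of the single letter
        \<open>k\<close> agree because \<open>i\<close> and \<open>k\<close> are linked whenever
        \<open>n i k\<close> is nonzero.\<close>
      have "\<chi> i (- g j) * n i k = \<chi> k (g j) * n i k"
        by (cases "n i k = 0") (simp_all add: n_compat)
      with Cons show ?thesis by (simp add: \<phi>N_def)
    qed (simp add: \<phi>N_def)
  qed
  also have "\<dots> = linear_extension F (\<lambda>(u, v). if u = [] then single (v, 0) (n i j) else 0) (bc w)
      + linear_extension F (\<lambda>p. \<chi> i (- g j) *\<^sub>k (var j \<star> (\<lambda>(u, v). \<phi>N i u v) p)) (bc w)"
    using F.lin_ext_fun_add[of "\<lambda>(u, v). if u = [] then single (v, 0) (n i j) else 0" "bc w"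
        "\<lambda>p. \<chi> i (- g j) *\<^sub>k (var j \<star> (\<lambda>(u, v). \<phi>N i u v) p)"] by simp
  also have "linear_extension F (\<lambda>(u, v). if u = [] then single (v, 0) (n i j) else 0) (bc w) = single (w, 0) (n i j)"
    by (rule lin_ext_bc_left[OF F.kmod_axioms, unfolded bosonization_simps]) simp
  also have "linear_extension F (\<lambda>p. \<chi> i (- g j) *\<^sub>k (var j \<star> (\<lambda>(u, v). \<phi>N i u v) p)) (bc w)
    = \<chi> i (- g j) *\<^sub>k (var j \<star> DN i (single (w, 0) 1))"
    unfolding Cons.IH by (rule linear_lin_ext_F[OF scale_var_linear, symmetric])
  also have "single (w, 0) (n i j) + \<dots> = DN i (var j \<star> single (w, 0) 1)"
    unfolding skd_var_mult by simp
  finally show ?case by simp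
qed

lemma DM_word: "DM i (single (w, 0) 1) = linear_extension F (\<lambda>(u, v). \<phi>M i u v) (bc w)"
proof (induction w)
  case Nil
  show ?case by (subst lin_ext_bc_Nil[OF F.kmod_axioms]) (simp_all add: \<phi>M_def)
next
  case (Cons j w)
  let ?\<theta> = "\<lambda>u. single (u, g i + g j) (m i j * word_char \<chi> u (g i + g j))"
  have "linear_extension F (\<lambda>(u, v). \<phi>M i u v) (bc (j # w))
    = linear_extension F (\<lambda>p. (\<lambda>(u, v). if v = [] then ?\<theta> u else 0) p
        + \<chi> j (g i) *\<^sub>k (var j \<star> (\<lambda>(u, v). \<phi>M i u v) p)) (bc w)"
  proof (rule lin_ext_bc_Cons_F[symmetric])
    fix u v :: "'i list"
    show "(\<lambda>(u, v). if v = [] then ?\<theta> u else 0) (u, v) + \<chi> j (g i) *\<^sub>k (var j \<star> (\<lambda>(u, v). \<phi>M i u v) (u, v))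
      = (\<lambda>(u, v). \<phi>M i u v) (j # u, v) + word_char \<chi> u (g j) *\<^sub>k (\<lambda>(u, v). \<phi>M i u v) (u, j # v)"
      by (cases v) (simp_all add: \<phi>M_def word_char_add mult_ac)
  qed
  also have "\<dots> = linear_extension F (\<lambda>(u, v). if v = [] then ?\<theta> u else 0) (bc w)
      + linear_extension F (\<lambda>p. \<chi> j (g i) *\<^sub>k (var j \<star> (\<lambda>(u, v). \<phi>M i u v) p)) (bc w)"
    using F.lin_ext_fun_add[of "\<lambda>(u, v). if v = [] then ?\<theta> u else 0" "bc w"
        "\<lambda>p. \<chi> j (g i) *\<^sub>k (var j \<star> (\<lambda>(u, v). \<phi>M i u v) p)"] by simp
  also have "linear_extension F (\<lambda>(u, v). if v = [] then ?\<theta> u else 0) (bc w) = ?\<theta> w"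
    by (rule lin_ext_bc_right[OF F.kmod_axioms, unfolded bosonization_simps]) simp
  also have "linear_extension F (\<lambda>p. \<chi> j (g i) *\<^sub>k (var j \<star> (\<lambda>(u, v). \<phi>M i u v) p)) (bc w)
    = \<chi> j (g i) *\<^sub>k (var j \<star> DM i (single (w, 0) 1))"
    unfolding Cons.IH by (rule linear_lin_ext_F[OF scale_var_linear, symmetric])
  also have "?\<theta> w + \<dots> = DM i (var j \<star> single (w, 0) 1)"
    unfolding skd_var_mult by (simp add: mult.commute)
  finally show ?case by simp
qed

lemma proj_I0: "proj I0 x = \<zero>\<^bsub>Fq I0\<^esub> \<longleftrightarrow> x \<in> I0"
  by (rule proj_zero_iff) simp

lemma proj_I0_closed: "proj I0 x \<in> carrier (Fq I0)"
  by simp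

lemma kmod_Fq_I0: "kmod (Fq I0)"
  by (rule kalg_kmod[OF kalg_Fq]) simp

lemma proj_I0_linear: "k_linear F (Fq I0) (proj I0)"
  by (rule proj_linear) simp

lemma R_length: "r \<in> R \<Longrightarrow> w \<in> keys r \<Longrightarrow> length w \<ge> 2"
  using R_mset by (metis size_mset)

text \<open>A primitive relator has coproduct \<open>r \<otimes> 1 + 1 \<otimes> r\<close> modulo
  earlier relators, and neither first leg contains a word of length one. Earlier relators in the
  first leg are too long to be seen by \<open>\<phi>N\<close>; in the second leg they lie in
  \<open>I0\<close>.\<close>

lemma DN_R:
  assumes r: "r \<in> R"
  shows "DN i (TV_incl r) \<in> I0"
proof -
  interpret M: kmod "Fq I0" by (rule kmod_Fq_I0)
  obtain h where h: "h < L" "r \<in> Rc (Suc h)" using R_level[OF r] by blast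
  let ?\<beta> = "\<lambda>u v. proj I0 (\<phi>N i u v)"
  have z: "linear_extension (Fq I0) f \<rho> = \<zero>\<^bsub>Fq I0\<^esub>" if "\<And>x. length x \<ge> 2 \<Longrightarrow> f x = \<zero>\<^bsub>Fq I0\<^esub>" "\<rho> \<in> R" for f \<rho>
    by (rule M.lin_ext_const_zero) (rule that(1), rule R_length[OF that(2)])
  have "proj I0 (DN i (TV_incl r)) = linear_extension (Fq I0) (\<lambda>w. proj I0 (DN i (single (w, 0) 1))) r"
    by (rule linear_TV_incl[OF kmod_Fq_I0 k_linear_comp[OF DN_linear proj_I0_linear]])
  also have "\<dots> = linear_extension (Fq I0) (\<lambda>u. ?\<beta> u []) r \<oplus>\<^bsub>Fq I0\<^esub> linear_extension (Fq I0) (?\<beta> []) r"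
  proof (rule primitive_expand[OF h kmod_Fq_I0])
    show "proj I0 (DN i (single (w, 0) 1)) = linear_extension (Fq I0) (\<lambda>(a, c). ?\<beta> a c) (bc w)" for w
      unfolding DN_word
      by (subst k_linear_lin_ext[OF F.kmod_axioms kmod_Fq_I0 proj_I0_linear]) (simp_all add: case_prod_unfold)
    fix \<rho> u w v assume "\<rho> \<in> Rc h"
    then have \<rho>: "\<rho> \<in> R" using Rc_subset[of h] h by auto
    show "linear_extension (Fq I0) (\<lambda>x. ?\<beta> (u @ x @ w) v) \<rho> = \<zero>\<^bsub>Fq I0\<^esub>"
      by (rule z[OF _ \<rho>]) (simp add: \<phi>N_def proj_zero)
    show "linear_extension (Fq I0) (\<lambda>x. ?\<beta> v (u @ x @ w)) \<rho> = \<zero>\<^bsub>Fq I0\<^esub>"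
    proof (cases "length v = 1")
      case True
      have "k_linear F F (\<lambda>x. n i (hd v) *\<^sub>k x)"
        by (rule k_linearI) (simp_all add: fscale_simps mult.commute)
      note l = k_linear_comp[OF this proj_I0_linear]
      have "linear_extension (Fq I0) (\<lambda>x. ?\<beta> v (u @ x @ w)) \<rho>
        = linear_extension (Fq I0) (\<lambda>x. proj I0 (n i (hd v) *\<^sub>k single (u @ x @ w, 0) 1)) \<rho>"
        using True by (simp add: \<phi>N_def)
      also have "\<dots> = proj I0 (n i (hd v) *\<^sub>k (single (u, 0) 1 \<star> TV_incl \<rho> \<star> single (w, 0) 1))"
        by (rule linear_words[OF kmod_Fq_I0 l])
      also have "\<dots> = \<zero>\<^bsub>Fq I0\<^esub>"
        unfolding proj_I0
        by (rule F_ideal(4)[OF I_ideal], rule F_ideal(2)[OF I_ideal], rule F_ideal(1)[OF I_ideal], rule I_R[OF \<rho>])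
      finally show ?thesis .
    qed (simp add: \<phi>N_def proj_zero M.lin_ext_const_zero)
  qed simp
  also have "\<dots> = \<zero>\<^bsub>Fq I0\<^esub>"
    by (subst (1 2) z[OF _ r]) (simp_all add: \<phi>N_def proj_zero)
  finally show ?thesis unfolding proj_I0 .
qed

lemma DM_R:
  assumes r: "r \<in> R"
  shows "DM i (TV_incl r) \<in> I0"
proof -
  interpret M: kmod "Fq I0" by (rule kmod_Fq_I0)
  obtain h where h: "h < L" "r \<in> Rc (Suc h)" using R_level[OF r] by blast
  let ?\<beta> = "\<lambda>u v. proj I0 (\<phi>M i u v)"
  have z: "linear_extension (Fq I0) f \<rho> = \<zero>\<^bsub>Fq I0\<^esub>" if "\<And>x. length x \<ge> 2 \<Longrightarrow> f x = \<zero>\<^bsub>Fq I0\<^esub>" "\<rho> \<in> R" for f \<rho>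
    by (rule M.lin_ext_const_zero) (rule that(1), rule R_length[OF that(2)])
  have "proj I0 (DM i (TV_incl r)) = linear_extension (Fq I0) (\<lambda>w. proj I0 (DM i (single (w, 0) 1))) r"
    by (rule linear_TV_incl[OF kmod_Fq_I0 k_linear_comp[OF DM_linear proj_I0_linear]])
  also have "\<dots> = linear_extension (Fq I0) (\<lambda>u. ?\<beta> u []) r \<oplus>\<^bsub>Fq I0\<^esub> linear_extension (Fq I0) (?\<beta> []) r"
  proof (rule primitive_expand[OF h kmod_Fq_I0])
    show "proj I0 (DM i (single (w, 0) 1)) = linear_extension (Fq I0) (\<lambda>(a, c). ?\<beta> a c) (bc w)" for w
      unfolding DM_word
      by (subst k_linear_lin_ext[OF F.kmod_axioms kmod_Fq_I0 proj_I0_linear]) (simp_all add: case_prod_unfold)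
    fix \<rho> u w v assume "\<rho> \<in> Rc h"
    then have \<rho>: "\<rho> \<in> R" using Rc_subset[of h] h by auto
    show "linear_extension (Fq I0) (\<lambda>x. ?\<beta> v (u @ x @ w)) \<rho> = \<zero>\<^bsub>Fq I0\<^esub>"
      by (rule z[OF _ \<rho>]) (simp add: \<phi>M_def proj_zero)
    show "linear_extension (Fq I0) (\<lambda>x. ?\<beta> (u @ x @ w) v) \<rho> = \<zero>\<^bsub>Fq I0\<^esub>"
    proof (cases "length v = 1")
      case True
      obtain w0 where w0: "\<forall>v\<in>keys \<rho>. mset v = mset w0" using R_mset[OF \<rho>] by blast
      \<comment> \<open>\<open>\<phi>M\<close> contains the character of its first leg; on the words
        of a relator it is constant and is evaluated at the reference word
        \<open>w0\<close>.\<close>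
      define c where "c = m i (hd v) * word_char \<chi> (u @ w0 @ w) (g i)"
      have "k_linear F F (\<lambda>x. c *\<^sub>k x)"
        by (rule k_linearI) (simp_all add: fscale_simps mult.commute)
      note l = k_linear_comp[OF this proj_I0_linear]
      have "linear_extension (Fq I0) (\<lambda>x. ?\<beta> (u @ x @ w) v) \<rho>
        = linear_extension (Fq I0) (\<lambda>x. proj I0 (c *\<^sub>k single (u @ x @ w, g i + g (hd v)) 1)) \<rho>"
      proof (rule M.lin_ext_cong)
        fix x assume "x \<in> keys \<rho>"
        then have "word_char \<chi> x (g i) = word_char \<chi> w0 (g i)" by (intro word_char_mset) (use w0 in blast)
        then show "?\<beta> (u @ x @ w) v = proj I0 (c *\<^sub>k single (u @ x @ w, g i + g (hd v)) 1)"
          using True by (simp add: \<phi>M_def c_def)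
      qed simp
      also have "\<dots> = proj I0 (c *\<^sub>k (single (u, 0) 1 \<star> TV_incl \<rho> \<star> single (w, g i + g (hd v)) 1))"
        by (rule linear_words[OF kmod_Fq_I0 l])
      also have "\<dots> = \<zero>\<^bsub>Fq I0\<^esub>"
        unfolding proj_I0
        by (rule F_ideal(4)[OF I_ideal], rule F_ideal(2)[OF I_ideal], rule F_ideal(1)[OF I_ideal], rule I_R[OF \<rho>])
      finally show ?thesis .
    qed (simp add: \<phi>M_def proj_zero M.lin_ext_const_zero)
  qed simp
  also have "\<dots> = \<zero>\<^bsub>Fq I0\<^esub>"
    by (subst (1 2) z[OF _ r]) (simp_all add: \<phi>M_def proj_zero)
  finally show ?thesis unfolding proj_I0 .
qed

lemma ad_eq: "ad i j = var i \<star> var j - \<chi> j (g i) *\<^sub>k (var j \<star> var i)"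
  by (simp add: ad_def var_def)

text \<open>The value is exactly zero. For \<open>M\<close> the coefficients of \<open>m i j\<close>
  cancel after straightening, those of \<open>m i k\<close> by \<open>q_inverse\<close>; for
  \<open>N\<close> the compatibility of linked characters is used as well.\<close>

lemma DM_ad: "blk k < blk j \<Longrightarrow> DM i (ad j k) = 0"
  and DN_ad: "blk k < blk j \<Longrightarrow> DN i (ad j k) = 0"
proof -
  assume kj: "blk k < blk j"
  then have q: "\<chi> k (g j) * \<chi> j (g k) = 1" using q_inverse[of j k] by simp
  have diff: "D (x - y) = D x - D y" if "k_linear F F D" for D x y
    using linear_F(1)[OF that, of "x - y" y] by (simp add: eq_diff_eq)
  have c1: "\<chi> k (g j) * (m i k * (\<chi> j (g k) * \<chi> j (g i))) = m i k * \<chi> j (g i)"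
    using arg_cong[OF q, of "\<lambda>c. c * (m i k * \<chi> j (g i))"] by (simp add: mult_ac)
  show "DM i (ad j k) = 0"
    using c1
    by (simp add: ad_eq diff[OF DM_linear] linear_F(2)[OF DM_linear] skd_var_mult DM_var)
      (simp add: var_def \<chi>_add fscale_simps mult_ac add.commute)
  have c2: "\<chi> k (g j) * (n i j * \<chi> i (- g k)) = n i j"
  proof (cases "n i j = 0")
    case False
    then show ?thesis using q by (simp add: n_compat mult_ac)
  qed simp
  have c3: "\<chi> i (- g j) * n i k = \<chi> k (g j) * n i k"
    by (cases "n i k = 0") (simp_all add: n_compat)
  show "DN i (ad j k) = 0"
    using c2 c3
    by (simp add: ad_eq diff[OF DN_linear] linear_F(2)[OF DN_linear] skd_var_mult DN_var)
      (simp add: var_def fscale_simps mult_ac add.commute)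
qed

text \<open>Each generator of \<open>I0\<close> is an eigenvector of \<open>tw\<close>, since all
  its words have the same letters.\<close>

lemma tw_I0:
  assumes t: "\<And>a b. t (a + b) = t a * t b" and f: "f \<in> I0"
  shows "tw s t f \<in> I0"
proof -
  have "I0 \<subseteq> {f. tw s t f \<in> I0}"
  proof (rule I_minimal)
    show "ideal {f. tw s t f \<in> I0} F"
      by (rule F_idealI) (auto simp: tw_add tw_mult[OF t] intro: F_ideal[OF I_ideal])
    fix r assume r: "r \<in> R"
    obtain w0 where w0: "\<forall>v\<in>keys r. mset v = mset w0" using R_mset[OF r] by blast
    let ?c = "prod_list (map s w0) * t 0"
    have l: "k_linear F F (\<lambda>x. ?c *\<^sub>k x)"
      by (rule k_linearI) (simp_all add: fscale_simps mult.commute)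
    have "tw s t (TV_incl r) = linear_extension F (\<lambda>w. tw s t (single (w, 0) 1)) r"
      by (rule linear_TV_incl[OF F.kmod_axioms tw_linear])
    also have "\<dots> = linear_extension F (\<lambda>w. ?c *\<^sub>k single (w, 0) 1) r"
    proof (rule F.lin_ext_cong)
      fix w assume "w \<in> keys r"
      then have "mset w = mset w0" using w0 by blast
      then have "prod_list (map s w) = prod_list (map s w0)" by (simp flip: prod_mset_prod_list)
      then show "tw s t (single (w, 0) 1) = ?c *\<^sub>k single (w, 0) 1" by (simp add: tw_single)
    qed simp
    also have "\<dots> = ?c *\<^sub>k TV_incl r"
      by (rule linear_TV_incl[OF F.kmod_axioms l, symmetric])
    finally show "TV_incl r \<in> {f. tw s t f \<in> I0}"
      using F_ideal(4)[OF I_ideal I_R[OF r]] by simp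
  next
    fix i j assume ij: "blk j < blk i"
    have "tw s t (x - y) = tw s t x - tw s t y" for x y
      using tw_add[of s t "x - y" y] by (simp add: eq_diff_eq)
    then have "tw s t (ad i j) = (s i * s j * t 0) *\<^sub>k ad i j"
      by (simp add: ad_def fscale_simps tw_single mult_ac)
    then show "ad i j - linking g (\<lambda>_ _. 0) (\<lambda>_ _. 0) i j \<in> {f. tw s t f \<in> I0}"
      using F_ideal(4)[OF I_ideal I0_ad[OF ij]] by simp
  qed
  then show ?thesis using f by blast
qed

lemma skew_I0:
  assumes add: "\<And>x y. D (x + y) = D x + D y" and 0: "D 0 = 0" and mult: "\<And>x y. D (x \<star> y) = D x \<star> y + T x \<star> D y"
    and T: "\<And>x. x \<in> I0 \<Longrightarrow> T x \<in> I0"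
    and gen: "\<And>r. r \<in> R \<Longrightarrow> D (TV_incl r) \<in> I0" "\<And>i j. blk j < blk i \<Longrightarrow> D (ad i j) = 0"
    and f: "f \<in> I0"
  shows "D f \<in> I0"
proof -
  note I = F_ideal[OF I_ideal]
  \<comment> \<open>Membership in \<open>I0\<close> is part of the set because the Leibniz rule also
    produces the terms \<open>x \<star> D y\<close> with \<open>x\<close> in the ideal, up to the
    twist, and \<open>D x \<star> y\<close> with \<open>y\<close> in it.\<close>
  have "I0 \<subseteq> {f. f \<in> I0 \<and> D f \<in> I0}"
  proof (rule I_minimal)
    show "ideal {f. f \<in> I0 \<and> D f \<in> I0} F"
      by (rule F_idealI) (auto simp: add mult 0 intro!: I(3) intro: I(1,2,5) T)
    show "ad i j - linking g (\<lambda>_ _. 0) (\<lambda>_ _. 0) i j \<in> {f. f \<in> I0 \<and> D f \<in> I0}" if "blk j < blk i" for i j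
      using I0_ad[OF that] gen(2)[OF that] I(5) by simp
  qed (use gen(1) I_R in blast)
  then show ?thesis using f by blast
qed

lemma DM_I0: "f \<in> I0 \<Longrightarrow> DM i f \<in> I0" and DN_I0: "f \<in> I0 \<Longrightarrow> DN i f \<in> I0"
  by (rule skew_I0[OF _ _ DM_mult], simp_all only: skd_add skd_zero DM_R DM_ad,
      rule tw_I0, simp_all add: \<chi>_minus_diff,
      rule skew_I0[OF _ _ DN_mult], simp_all only: skd_add skd_zero DN_R DN_ad,
      rule tw_I0, simp_all add: \<chi>_minus_diff)

end

section \<open>The deformed action and its relations\<close>

lemma (in characters) sum_linear: "k_linear F F D \<Longrightarrow> k_linear F F D' \<Longrightarrow> k_linear F F (\<lambda>f. D f + D' f)"
  by (rule k_linearI) (simp_all add: linear_F fscale_simps add.commute add.left_commute)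

context linked
begin

text \<open>
  \<open>X i\<close> is the action of \<open>x\<^sub>i\<close> on \<open>F / I0 = H\<^sup>0\<close> transported from \<open>F / I m n\<close>: the commutator of
  \<open>X i\<close> and \<open>X j\<close> produces the linking term in addition to \<open>ad i j\<close>.
\<close>

abbreviation "Q i f \<equiv> var i \<star> f + DM i f"
abbreviation "X i f \<equiv> Q i f + DN i f"

lemma var_linear: "k_linear F F ((\<star>) x)"
  by (rule k_linearI) (simp_all add: fmul_distrib fmul_scale)

lemma fmul_right_linear: "k_linear F F (\<lambda>x. x \<star> y)"
  by (rule k_linearI) (simp_all add: fmul_distrib fmul_scale)

lemma Q_linear: "k_linear F F (Q i)" and X_linear: "k_linear F F (X i)"
  by (intro sum_linear var_linear DM_linear DN_linear)+

lemma Q_I0: "f \<in> I0 \<Longrightarrow> Q i f \<in> I0" and X_I0: "f \<in> I0 \<Longrightarrow> X i f \<in> I0"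
  by (intro F_ideal(1,3)[OF I_ideal] DM_I0 DN_I0; assumption)+

lemma foldr_I0: "(\<And>i f. f \<in> I0 \<Longrightarrow> D i f \<in> I0) \<Longrightarrow> f \<in> I0 \<Longrightarrow> foldr D w f \<in> I0"
  by (induction w) auto

lemma m_block: "blk i \<le> blk j \<Longrightarrow> m i j = 0" and n_block: "blk i \<le> blk j \<Longrightarrow> n i j = 0"
  using Xi_D(1)[OF m_Xi, of i j] Xi_D(1)[OF n_Xi, of i j] by force+

text \<open>\<open>M_i\<close> annihilates the letters of its own block, so on words of that block
  only the twist is left. Thus \<open>M_i\<close> and left multiplication q-commute like the two
  legs of the braided coproduct.\<close>

lemma DM_block:
  "\<forall>j\<in>set a. blk j = blk i \<Longrightarrow>
    DM i (single (a, 0) 1 \<star> y) = word_char \<chi> a (g i) *\<^sub>k (single (a, 0) 1 \<star> DM i y)"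
proof (induction a)
  case (Cons j a)
  then have "m i j = 0" by (intro m_block) simp
  have v: "single (j # a, 0) 1 \<star> f = var j \<star> (single (a, 0) 1 \<star> f)" for f
    unfolding fmul_assoc[symmetric] by simp
  show ?case
    unfolding v skd_var_mult \<open>m i j = 0\<close> using Cons by (simp add: fmul_scale fscale_simps)
qed (simp add: fscale_simps)

text \<open>A braided binomial formula. It handles two summands at a time, so \<open>X\<close> is
  expanded in two stages: first \<open>Q = x + M\<close>, then \<open>X = Q + N\<close>, with
  \<open>N\<close> on the left.\<close>

lemma Q_expand:
  "\<forall>i\<in>set w. blk i = b \<Longrightarrow>
    foldr Q w f = linear_extension F (\<lambda>(a, c). single (a, 0) 1 \<star> foldr DM c f) (bc w)"
proof (induction w)
  case Nil
  show ?case by (subst lin_ext_bc_Nil[OF F.kmod_axioms]) simp_all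
next
  case (Cons i w)
  show ?case
    unfolding foldr.simps comp_apply Cons.IH[OF Cons.prems[unfolded list.set ball_simps, THEN conjunct2]]
      linear_lin_ext_F[OF Q_linear]
  proof (rule lin_ext_bc_Cons_F)
    fix u v :: "'i list" assume "mset u + mset v = mset w"
    then have u: "\<forall>j\<in>set u. blk j = blk i" using set_eq_of_mset[of u v w] Cons.prems by auto
    have "var i \<star> (single (u, 0) 1 \<star> y) = single (i # u, 0) 1 \<star> y" for y
      unfolding fmul_assoc[symmetric] by simp
    then show "Q i (case (u, v) of (a, c) \<Rightarrow> single (a, 0) 1 \<star> foldr DM c f)
      = (case (i # u, v) of (a, c) \<Rightarrow> single (a, 0) 1 \<star> foldr DM c f)
        + word_char \<chi> u (g i) *\<^sub>k (case (u, i # v) of (a, c) \<Rightarrow> single (a, 0) 1 \<star> foldr DM c f)"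
      unfolding prod.case foldr.simps comp_apply DM_block[OF u] by simp
  qed
qed

text \<open>Here the twist \<open>\<chi> j (- g i)\<close> of \<open>N_j\<close> on the letter
  \<open>i\<close> is what produces the factor \<open>\<chi> j (g i)\<close>; on the part
  \<open>M_i\<close> of \<open>Q i\<close> the same factor comes from \<open>DM_DN\<close>.\<close>

lemma Q_DN:
  assumes "blk i = blk j" shows "Q i (DN j f) = \<chi> j (g i) *\<^sub>k DN j (Q i f)"
proof -
  have "n j i = 0" by (rule n_block) (simp add: assms)
  then have "\<chi> j (g i) *\<^sub>k DN j (var i \<star> f) = var i \<star> DN j f"
    unfolding skd_var_mult by (simp add: fscale_simps)
  then show ?thesis unfolding skd_add fscale_simps DM_DN by simp
qed

lemma Q_foldr_DN:
  "\<forall>j\<in>set a. blk j = blk i \<Longrightarrow> Q i (foldr DN a f) = word_char \<chi> a (g i) *\<^sub>k foldr DN a (Q i f)"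
proof (induction a)
  case (Cons j a)
  then have "blk i = blk j" by simp
  show ?case
    unfolding foldr.simps comp_apply Q_DN[OF \<open>blk i = blk j\<close>]
    using Cons by (simp add: fscale_simps skd_scale)
qed (simp add: fscale_simps)

lemma X_expand:
  "\<forall>i\<in>set w. blk i = b \<Longrightarrow>
    foldr X w f = linear_extension F (\<lambda>(a, c). foldr DN a (foldr Q c f)) (bc w)"
proof (induction w)
  case Nil
  show ?case by (subst lin_ext_bc_Nil[OF F.kmod_axioms]) simp_all
next
  case (Cons i w)
  show ?case
    unfolding foldr.simps comp_apply Cons.IH[OF Cons.prems[unfolded list.set ball_simps, THEN conjunct2]]
      linear_lin_ext_F[OF X_linear]
  proof (rule lin_ext_bc_Cons_F)
    fix u v :: "'i list" assume "mset u + mset v = mset w"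
    then have u: "\<forall>j\<in>set u. blk j = blk i" using set_eq_of_mset[of u v w] Cons.prems by auto
    show "X i (case (u, v) of (a, c) \<Rightarrow> foldr DN a (foldr Q c f))
      = (case (i # u, v) of (a, c) \<Rightarrow> foldr DN a (foldr Q c f))
        + word_char \<chi> u (g i) *\<^sub>k (case (u, i # v) of (a, c) \<Rightarrow> foldr DN a (foldr Q c f))"
      unfolding prod.case foldr.simps comp_apply Q_foldr_DN[OF u] by (rule add.commute)
  qed
qed

text \<open>The two primitive terms are left multiplication by \<open>r\<close>, which has values in
  \<open>I0\<close>, and \<open>r(M)\<close>, which is zero. Earlier relators disappear for the same
  two reasons.\<close>

lemma Q_relation:
  assumes r: "r \<in> R"
  shows "opr Q r f \<in> I0"
proof -
  interpret M: kmod "Fq I0" by (rule kmod_Fq_I0)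
  obtain h where h: "h < L" "r \<in> Rc (Suc h)" using R_level[OF r] by blast
  let ?\<beta> = "\<lambda>a c. proj I0 (single (a, 0) 1 \<star> foldr DM c f)"
  have l: "k_linear F (Fq I0) (\<lambda>x. proj I0 (x \<star> y))" and l': "k_linear F (Fq I0) (\<lambda>x. proj I0 (y \<star> x))" for y
    by (rule k_linear_comp[OF fmul_right_linear proj_I0_linear] k_linear_comp[OF var_linear proj_I0_linear])+
  have left: "linear_extension (Fq I0) (\<lambda>x. ?\<beta> (u @ x @ w) v) \<rho> = \<zero>\<^bsub>Fq I0\<^esub>" if \<rho>: "\<rho> \<in> R" for u v w \<rho>
    unfolding linear_words[OF kmod_Fq_I0 l] proj_I0
    by (rule F_ideal(2)[OF I_ideal], rule F_ideal(2)[OF I_ideal], rule F_ideal(1)[OF I_ideal], rule I_R[OF \<rho>])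
  have right: "linear_extension (Fq I0) (\<lambda>x. ?\<beta> v (u @ x @ w)) \<rho> = \<zero>\<^bsub>Fq I0\<^esub>" if \<rho>: "\<rho> \<in> R" for u v w \<rho>
    unfolding opr_words[where D = DM, OF DM_linear kmod_Fq_I0 l'] opr_DM[OF \<rho>]
      linear_F(3)[OF foldr_linear[of DM, OF DM_linear]] by (simp add: proj_zero)
  have "proj I0 (opr Q r f) = linear_extension (Fq I0) (\<lambda>w. proj I0 (foldr Q w f)) r"
    unfolding opr_def by (rule k_linear_lin_ext[OF F.kmod_axioms kmod_Fq_I0 proj_I0_linear]) simp_all
  also have "\<dots> = linear_extension (Fq I0) (\<lambda>u. ?\<beta> u []) r \<oplus>\<^bsub>Fq I0\<^esub> linear_extension (Fq I0) (?\<beta> []) r"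
  proof (rule primitive_expand[OF h kmod_Fq_I0 proj_I0_closed])
    show "proj I0 (foldr Q w f) = linear_extension (Fq I0) (\<lambda>(a, c). ?\<beta> a c) (bc w)" if "\<forall>i\<in>set w. blk i = b" for w b
      unfolding Q_expand[OF that]
      by (subst k_linear_lin_ext[OF F.kmod_axioms kmod_Fq_I0 proj_I0_linear]) (simp_all add: case_prod_unfold)
    fix \<rho> u v w assume "\<rho> \<in> Rc h"
    then have \<rho>: "\<rho> \<in> R" using Rc_subset[of h] h by auto
    show "linear_extension (Fq I0) (\<lambda>x. ?\<beta> (u @ x @ w) v) \<rho> = \<zero>\<^bsub>Fq I0\<^esub>" by (rule left[OF \<rho>])
    show "linear_extension (Fq I0) (\<lambda>x. ?\<beta> v (u @ x @ w)) \<rho> = \<zero>\<^bsub>Fq I0\<^esub>" by (rule right[OF \<rho>])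
  qed
  also have "\<dots> = \<zero>\<^bsub>Fq I0\<^esub>"
    using left[OF r, of "[]" "[]" "[]"] right[OF r, of "[]" "[]" "[]"] by simp
  finally show ?thesis unfolding proj_I0 .
qed

lemma X_relation:
  assumes r: "r \<in> R"
  shows "opr X r f \<in> I0"
proof -
  interpret M: kmod "Fq I0" by (rule kmod_Fq_I0)
  obtain h where h: "h < L" "r \<in> Rc (Suc h)" using R_level[OF r] by blast
  let ?\<beta> = "\<lambda>a c. proj I0 (foldr DN a (foldr Q c f))"
  have l: "k_linear F (Fq I0) (\<lambda>x. proj I0 (foldr DN v x))" for v
    by (rule k_linear_comp[OF foldr_linear[of DN, OF DN_linear] proj_I0_linear])
  have left: "linear_extension (Fq I0) (\<lambda>x. ?\<beta> (u @ x @ w) v) \<rho> = \<zero>\<^bsub>Fq I0\<^esub>" if \<rho>: "\<rho> \<in> R" for u v w \<rho>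
    unfolding opr_words[where D = DN, OF DN_linear kmod_Fq_I0 proj_I0_linear] opr_DN[OF \<rho>]
      linear_F(3)[OF foldr_linear[of DN, OF DN_linear]] by (simp add: proj_zero)
  \<comment> \<open>Unlike \<open>r(N)\<close>, the operator \<open>r(Q)\<close> vanishes only
    modulo \<open>I0\<close>; the operators applied after it have to preserve
    \<open>I0\<close>.\<close>
  have right: "linear_extension (Fq I0) (\<lambda>x. ?\<beta> v (u @ x @ w)) \<rho> = \<zero>\<^bsub>Fq I0\<^esub>" if \<rho>: "\<rho> \<in> R" for u v w \<rho>
    unfolding opr_words[where D = Q, OF Q_linear kmod_Fq_I0 l] proj_I0
    by (rule foldr_I0[OF DN_I0], assumption, rule foldr_I0[OF Q_I0], assumption, rule Q_relation[OF \<rho>])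
  have "proj I0 (opr X r f) = linear_extension (Fq I0) (\<lambda>w. proj I0 (foldr X w f)) r"
    unfolding opr_def by (rule k_linear_lin_ext[OF F.kmod_axioms kmod_Fq_I0 proj_I0_linear]) simp_all
  also have "\<dots> = linear_extension (Fq I0) (\<lambda>u. ?\<beta> u []) r \<oplus>\<^bsub>Fq I0\<^esub> linear_extension (Fq I0) (?\<beta> []) r"
  proof (rule primitive_expand[OF h kmod_Fq_I0 proj_I0_closed])
    show "proj I0 (foldr X w f) = linear_extension (Fq I0) (\<lambda>(a, c). ?\<beta> a c) (bc w)" if "\<forall>i\<in>set w. blk i = b" for w b
      unfolding X_expand[OF that]
      by (subst k_linear_lin_ext[OF F.kmod_axioms kmod_Fq_I0 proj_I0_linear]) (simp_all add: case_prod_unfold)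
    fix \<rho> u v w assume "\<rho> \<in> Rc h"
    then have \<rho>: "\<rho> \<in> R" using Rc_subset[of h] h by auto
    show "linear_extension (Fq I0) (\<lambda>x. ?\<beta> (u @ x @ w) v) \<rho> = \<zero>\<^bsub>Fq I0\<^esub>" by (rule left[OF \<rho>])
    show "linear_extension (Fq I0) (\<lambda>x. ?\<beta> v (u @ x @ w)) \<rho> = \<zero>\<^bsub>Fq I0\<^esub>" by (rule right[OF \<rho>])
  qed
  also have "\<dots> = \<zero>\<^bsub>Fq I0\<^esub>"
    using left[OF r, of "[]" "[]" "[]"] right[OF r, of "[]" "[]" "[]"] by simp
  finally show ?thesis unfolding proj_I0 .
qed

text \<open>All pairs of skew derivations q-commute with the factor \<open>\<chi> j (g i)\<close>,
  and \<open>x_i\<close> passes \<open>M_j\<close> and \<open>N_j\<close> since \<open>m j i\<close>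
  and \<open>n j i\<close> vanish for \<open>i\<close> in the higher block. What remains is the
  commutator of the letters and the effect of \<open>M_i\<close> and \<open>N_i\<close> on the
  letter \<open>x_j\<close>, which is the linking term.\<close>

lemma X_commutator:
  assumes ji: "blk j < blk i"
  shows "X i (X j f) - \<chi> j (g i) *\<^sub>k X j (X i f) = ad i j \<star> f + linking g m n i j \<star> f"
proof -
  let ?q = "\<chi> j (g i)"
  have q: "?q * \<chi> i (g j) = 1" using ji q_inverse[of i j] by simp
  have M1: "DM i (var j \<star> f) = single ([], g i + g j) (m i j) \<star> f + ?q *\<^sub>k (var j \<star> DM i f)"
    and N1: "DN i (var j \<star> f) = single ([], 0) (n i j) \<star> f + ?q *\<^sub>k (var j \<star> DN i f)"
    using q_inv[of i j] ji by (simp_all add: skd_var_mult)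
  have "m j i = 0" "n j i = 0" using ji by (simp_all add: m_block n_block)
  have M2: "?q *\<^sub>k DM j (var i \<star> f) = var i \<star> DM j f" and N2: "?q *\<^sub>k DN j (var i \<star> f) = var i \<star> DN j f"
    unfolding skd_var_mult \<open>m j i = 0\<close> \<open>n j i = 0\<close> using q by (simp_all add: fscale_simps)
  have MM: "DM i (DM j f) = ?q *\<^sub>k DM j (DM i f)" by (rule DM_DM[OF ji])
  have NN: "DN i (DN j f) = ?q *\<^sub>k DN j (DN i f)" by (rule DN_DN[OF ji])
  have MN: "DM i (DN j f) = ?q *\<^sub>k DN j (DM i f)" by (rule DM_DN)
  have NM: "DN i (DM j f) = ?q *\<^sub>k DM j (DN i f)" using ji by (intro DN_DM) simp
  have ad: "ad i j \<star> f = var i \<star> (var j \<star> f) - ?q *\<^sub>k (var j \<star> (var i \<star> f))"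
    unfolding ad_eq fmul_distrib fmul_scale fmul_assoc ..
  show ?thesis
    unfolding skd_add fmul_distrib fscale_simps linking_def ad M1 N1 M2 N2 MM NN MN NM
    by (simp only: diff_conv_add_uminus minus_add_distrib add_ac add_minus_cancel minus_add_cancel)
      (simp add: algebra_simps)
qed

definition Psi :: "('i list \<times> 'g \<Rightarrow>\<^sub>0 'k) \<Rightarrow> ('i list \<times> 'g \<Rightarrow>\<^sub>0 'k) \<Rightarrow> 'i list \<times> 'g \<Rightarrow>\<^sub>0 'k" where
  "Psi f y = linear_extension F (\<lambda>(w, a). foldr X w (grouplike a \<star> y)) f"

lemma Psi_add: "Psi (f + h) y = Psi f y + Psi h y" and Psi_scale: "Psi (c *\<^sub>k f) y = c *\<^sub>k Psi f y"
  and Psi_single: "Psi (single (w, a) c) y = c *\<^sub>k foldr X w (grouplike a \<star> y)" and Psi_zero: "Psi 0 y = 0"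
  using F.lin_ext_add[of "\<lambda>(w, a). foldr X w (grouplike a \<star> y)" f h]
    F.lin_ext_smult[of "\<lambda>(w, a). foldr X w (grouplike a \<star> y)" f c]
    F.lin_ext_single[of "\<lambda>(w, a). foldr X w (grouplike a \<star> y)" "(w, a)" c]
  by (simp_all add: Psi_def)

lemma Psi_linear: "k_linear F F (\<lambda>f. Psi f y)"
  by (rule k_linearI) (simp_all only: bosonization_simps Psi_add Psi_scale UNIV_I)

text \<open>For \<open>Psi\<close> to be an action, the operators must satisfy the straightening
  relation of \<open>F\<close>. The group twist of \<open>M_i\<close> and \<open>N_i\<close> is the
  inverse of \<open>\<chi> i\<close>, so all three summands of \<open>X i\<close> scale
  alike.\<close>

lemma grouplike_X: "grouplike a \<star> X i y = \<chi> i a *\<^sub>k X i (grouplike a \<star> y)"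
proof -
  have "skd s c \<gamma> (grouplike a \<star> f) = \<chi> i (- a) *\<^sub>k (grouplike a \<star> skd s c \<gamma> f)"
    if "\<And>j. c j \<noteq> 0 \<Longrightarrow> (i, j) \<in> Xi \<chi> blk" for s c \<gamma> f
    using skd_grouplike_mult[where t = "\<lambda>a. \<chi> i (- a)"] Xi_D(2)[OF that] by metis
  from this[OF m_Xi] this[OF n_Xi]
  have "\<chi> i a *\<^sub>k DM i (grouplike a \<star> f) = grouplike a \<star> DM i f" "\<chi> i a *\<^sub>k DN i (grouplike a \<star> f) = grouplike a \<star> DN i f" for f
    by (simp_all add: fscale_simps)
  moreover have "\<chi> i a *\<^sub>k (var i \<star> (grouplike a \<star> y)) = grouplike a \<star> (var i \<star> y)"
    unfolding fmul_assoc[symmetric] grouplike_var fmul_scale ..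
  ultimately show ?thesis unfolding fscale_simps fmul_distrib by simp
qed

lemma grouplike_foldr_X: "grouplike a \<star> foldr X v y = word_char \<chi> v a *\<^sub>k foldr X v (grouplike a \<star> y)"
proof (induction v)
  case (Cons i v)
  show ?case
    unfolding foldr.simps comp_apply grouplike_X Cons linear_F(2)[OF X_linear] by (simp add: fscale_simps)
qed (simp add: fscale_simps)

lemma Psi_mult: "Psi (f \<star> h) y = Psi f (Psi h y)"
proof (induction f rule: F_induct)
  case (single w a c)
  note l = linear_F[OF foldr_linear[of X, OF X_linear]]
  show ?case
  proof (induction h rule: F_induct)
    case (single v b d)
    have "grouplike a \<star> (grouplike b \<star> y) = grouplike (a + b) \<star> y" by (simp add: grouplike_mult fmul_assoc[symmetric])
    then show ?case
      unfolding fmul_single Psi_single fmul_scale grouplike_foldr_X l(2) foldr_append comp_apply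
      by (simp add: fscale_simps mult_ac)
  qed (simp_all only: fmul_distrib fmul_zero Psi_add Psi_single Psi_zero l fscale_simps)
qed (simp_all add: fmul_distrib Psi_add Psi_zero)

lemma foldr_X_I0: "f \<in> I0 \<Longrightarrow> foldr X w f \<in> I0"
  by (rule foldr_I0[OF X_I0])

lemma Psi_I0: "y \<in> I0 \<Longrightarrow> Psi f y \<in> I0"
proof (induction f rule: F_induct)
  case (single w a c)
  then show ?case
    unfolding Psi_single by (intro F_ideal(4)[OF I_ideal] foldr_X_I0 F_ideal(1)[OF I_ideal])
qed (auto simp: Psi_add Psi_zero intro: F_ideal[OF I_ideal])

theorem Psi_ideal: "f \<in> I m n \<Longrightarrow> Psi f y \<in> I0"
proof -
  \<comment> \<open>Quantifying over \<open>y\<close> gives closure under right multiplication by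
    \<open>Psi_mult\<close>; closure under left multiplication is \<open>Psi_I0\<close>.\<close>
  have "I m n \<subseteq> {f. \<forall>y. Psi f y \<in> I0}"
  proof (rule I_minimal)
    show "ideal {f. \<forall>y. Psi f y \<in> I0} F"
      by (rule F_idealI) (auto simp: Psi_add Psi_zero Psi_mult Psi_I0 intro: F_ideal[OF I_ideal])
    fix r assume r: "r \<in> R"
    have "Psi (TV_incl r) y = opr X r y" for y
      unfolding opr_def linear_TV_incl[OF F.kmod_axioms Psi_linear] Psi_single
      by (simp add: grouplike_zero fscale_simps)
    then show "TV_incl r \<in> {f. \<forall>y. Psi f y \<in> I0}" using X_relation[OF r] by simp
  next
    fix i j assume ij: "blk j < blk i"
    have diff: "Psi (f - h) y = Psi f y - Psi h y" for f h y
      using Psi_add[of "f - h" h y] by (simp add: eq_diff_eq)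
    have "Psi (ad i j) y = X i (X j y) - \<chi> j (g i) *\<^sub>k X j (X i y)" for y
      unfolding ad_def diff Psi_single by (simp add: grouplike_zero fscale_simps)
    moreover have "Psi (linking g m n i j) y = linking g m n i j \<star> y" for y
    proof -
      have "linking g m n i j = m i j *\<^sub>k grouplike (g i + g j) + n i j *\<^sub>k grouplike 0"
        by (simp add: linking_def grouplike_def)
      moreover have "Psi (grouplike a) y = grouplike a \<star> y" for a
        by (simp add: grouplike_def Psi_single fscale_simps)
      ultimately show ?thesis by (simp only: Psi_add Psi_scale fmul_distrib fmul_scale)
    qed
    ultimately have "Psi (ad i j - linking g m n i j) y = ad i j \<star> y" for y
      unfolding diff X_commutator[OF ij] by simp
    then show "ad i j - linking g m n i j \<in> {f. \<forall>y. Psi f y \<in> I0}"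
      using F_ideal(2)[OF I_ideal I0_ad[OF ij]] by simp
  qed
  then show "f \<in> I m n \<Longrightarrow> Psi f y \<in> I0" by blast
qed

definition Phi :: "('i list \<times> 'g \<Rightarrow>\<^sub>0 'k) \<Rightarrow> 'i list \<times> 'g \<Rightarrow>\<^sub>0 'k" where
  "Phi f = Psi f (single ([], 0) 1)"

lemma Phi_linear: "k_linear F F Phi"
  unfolding Phi_def by (rule Psi_linear)

lemma Phi_ideal: "f \<in> I m n \<Longrightarrow> Phi f \<in> I0"
  unfolding Phi_def by (rule Psi_ideal)

text \<open>\<open>M_i\<close> and \<open>N_i\<close> lower the degree, so on the leading word
  \<open>X i\<close> only prepends the letter \<open>i\<close>.\<close>

lemma Phi_word: "keys (Phi (single (w, a) 1) - single (w, a) 1) \<subseteq> {p. length (fst p) < length w}"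
proof (induction w)
  case Nil
  show ?case by (simp add: Phi_def Psi_single grouplike_def fscale_simps)
next
  case (Cons i w)
  define e where "e = Phi (single (w, a) 1) - single (w, a) 1"
  have e: "keys e \<subseteq> {p. length (fst p) < length w}" using Cons unfolding e_def .
  have w: "Phi (single (w, a) 1) = single (w, a) 1 + e" by (simp add: e_def)
  have "Phi (single (i # w, a) 1) = X i (Phi (single (w, a) 1))"
    by (simp add: Phi_def Psi_single fscale_simps)
  also have "\<dots> = single (i # w, a) 1 + (var i \<star> e + DM i (single (w, a) 1 + e) + DN i (single (w, a) 1 + e))"
    unfolding w fmul_distrib by (simp add: add.assoc)
  finally have "Phi (single (i # w, a) 1) - single (i # w, a) 1
    = var i \<star> e + DM i (single (w, a) 1 + e) + DN i (single (w, a) 1 + e)" by simp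
  moreover have "keys (var i \<star> e) \<subseteq> {p. length (fst p) < length (i # w)}"
    using e
  proof (induction e rule: pm_induct)
    case (add p d f)
    then show ?case by (cases p) (simp add: fmul_distrib)
  qed simp
  moreover have "keys (single (w, a) 1 + e) \<subseteq> {p. length (fst p) \<le> length w}"
    by (rule keys_add_subset) (use e in auto)
  note skd_degree[OF this]
  then have "keys (skd s c \<gamma> (single (w, a) 1 + e)) \<subseteq> {p. length (fst p) < length (i # w)}" for s c \<gamma>
    by fastforce
  ultimately show ?case by simp
qed

lemma Phi_low: "keys f \<subseteq> {p. length (fst p) \<le> k} \<Longrightarrow> keys (Phi f - f) \<subseteq> {p. length (fst p) < k}"
proof (induction f rule: pm_induct)
  case zero
  then show ?case by (simp add: Phi_def Psi_zero)
next
  case (add p d f)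
  then obtain w a where p: "p = (w, a)" "length w \<le> k" by (cases p) auto
  have "Phi (single p d + f) - (single p d + f) = (Phi f - f) + d *\<^sub>k (Phi (single (w, a) 1) - single (w, a) 1)"
    using linear_F(2)[OF Phi_linear, of d "single (w, a) 1"] by (simp add: p linear_F(1)[OF Phi_linear] fscale_simps)
  moreover have "keys (d *\<^sub>k (Phi (single (w, a) 1) - single (w, a) 1)) \<subseteq> {p. length (fst p) < k}"
    using Phi_word[of w a] p(2) by (intro keys_pscale_subset) auto
  ultimately show ?case using add(3) by (simp only: keys_add_subset)
qed

end

section \<open>Homogeneous components\<close>

context characters
begin

abbreviation comp :: "nat \<Rightarrow> ('i list \<times> 'g \<Rightarrow>\<^sub>0 'k) \<Rightarrow> 'i list \<times> 'g \<Rightarrow>\<^sub>0 'k" where "comp \<equiv> F_component"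

lemma lookup_comp: "lookup (comp n f) p = (if length (fst p) = n then lookup f p else 0)"
proof -
  have "lookup (comp n f) p = (\<Sum>q\<in>{q \<in> keys f. length (fst q) = n}. if q = p then lookup f q else 0)"
    unfolding F_component_def lookup_sum lookup_single when_def by (rule sum.cong) auto
  also have "\<dots> = (if length (fst p) = n then lookup f p else 0)"
    by (subst sum.delta) (auto simp: in_keys_iff)
  finally show ?thesis .
qed

lemma keys_comp: "keys (comp n f) \<subseteq> {p. length (fst p) = n}"
  by (auto simp: in_keys_iff lookup_comp split: if_splits)

lemma keys_comp_le: "keys (comp n f) \<subseteq> {p. length (fst p) \<le> n}"
  using keys_comp[of n f] by auto

lemma comp_add: "comp n (x + y) = comp n x + comp n y"
  and comp_diff: "comp n (x - y) = comp n x - comp n y"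
  and comp_scale: "comp n (c *\<^sub>k x) = c *\<^sub>k comp n x"
  and comp_comp: "comp n (comp m' x) = (if n = m' then comp n x else 0)"
  by (rule poly_mapping_eqI; simp add: lookup_comp lookup_add lookup_minus Poly_Mapping.map.rep_eq when_def)+

lemma comp_zero [simp]: "comp n 0 = 0"
  by (rule poly_mapping_eqI) (simp add: lookup_comp)

lemma comp_single: "comp n (single (w, a) c) = (if length w = n then single (w, a) c else 0)"
  by (rule poly_mapping_eqI) (auto simp: lookup_comp lookup_single when_def)

lemma comp_linear: "k_linear F F (comp n)"
  by (rule k_linearI) (simp_all add: comp_add comp_scale)

lemma comp_low: "keys f \<subseteq> {p. length (fst p) < n} \<Longrightarrow> comp n f = 0"
  by (rule poly_mapping_eqI) (auto simp: lookup_comp in_keys_iff)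

lemma comp_high: "keys f \<subseteq> {p. length (fst p) < n} \<Longrightarrow> n \<le> m' \<Longrightarrow> comp m' f = 0"
  by (rule comp_low) auto

lemma comp_homogeneous:
  "keys f \<subseteq> {p. length (fst p) = n} \<Longrightarrow> comp m' f = (if m' = n then f else 0)"
  by (rule poly_mapping_eqI) (auto simp: lookup_comp in_keys_iff)

lemma comp_top: "keys f \<subseteq> {p. length (fst p) \<le> n} \<Longrightarrow> keys (f - comp n f) \<subseteq> {p. length (fst p) < n}"
  by (auto simp: in_keys_iff lookup_minus lookup_comp subset_iff split: if_splits)

lemma comp_sum: "keys f \<subseteq> {p. length (fst p) < N} \<Longrightarrow> (\<Sum>n<N. comp n f) = f"
  by (rule poly_mapping_eqI) (auto simp: lookup_sum lookup_comp in_keys_iff subset_iff)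

lemma bounded_degree: "\<exists>N. keys f \<subseteq> {p. length (fst p) < N}"
proof -
  have "finite ((\<lambda>p. length (fst p)) ` keys f)" by simp
  then obtain N where "\<forall>n\<in>(\<lambda>p. length (fst p)) ` keys f. n \<le> N" by (auto simp: finite_nat_set_iff_bounded_le)
  then have "keys f \<subseteq> {p. length (fst p) < Suc N}" by auto
  then show ?thesis by blast
qed

lemma comp_mult: "comp n (x \<star> y) = (\<Sum>i\<le>n. comp i x \<star> comp (n - i) y)"
proof (induction x rule: F_induct)
  case (single u a c)
  show ?case
  proof (induction y rule: F_induct)
    case (single v b d)
    have "(\<Sum>i\<le>n. comp i (single (u, a) c) \<star> comp (n - i) (single (v, b) d))
      = (\<Sum>i\<le>n. if i = length u then (if n - length u = length v then single (u, a) c \<star> single (v, b) d else 0) else 0)"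
      by (rule sum.cong) (auto simp: comp_single)
    also have "\<dots> = comp n (single (u, a) c \<star> single (v, b) d)"
      by (subst sum.delta) (auto simp: comp_single)
    finally show ?case ..
  qed (simp_all add: comp_add fmul_distrib sum.distrib)
qed (simp_all add: comp_add fmul_distrib sum.distrib)

lemma F_ideal_sum:
  assumes "ideal J F" "\<And>i. i \<in> A \<Longrightarrow> f i \<in> J"
  shows "sum f A \<in> J"
  using assms(2) by (induction A rule: infinite_finite_induct) (auto intro: F_ideal[OF assms(1)])

lemma proj_sum:
  assumes J: "ideal J F"
  shows "finite A \<Longrightarrow> proj J (sum f A) = (\<Oplus>\<^bsub>Fq J\<^esub>i\<in>A. proj J (f i))"
proof (induction A rule: finite_induct)
  case (insert i A)
  interpret Q: kalg "Fq J" by (rule kalg_Fq[OF J])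
  show ?case using insert by (simp add: proj_add J Q.finsum_insert Pi_def)
next
  case empty
  interpret Q: kalg "Fq J" by (rule kalg_Fq[OF J])
  show ?case by (simp add: proj_zero J)
qed

lemma F_counit_comp: "F_counit (comp 0 f) = F_counit f"
proof -
  have "F_counit (0 :: 'i list \<times> 'g \<Rightarrow>\<^sub>0 'k) = 0" by (simp add: F_counit_def)
  then show ?thesis by (induction f rule: F_induct) (simp_all add: comp_add F_counit_add comp_single)
qed

end

context presentation
begin

lemma TV_incl_homogeneous:
  assumes "r \<in> R"
  obtains n where "keys (TV_incl r :: 'i list \<times> 'g \<Rightarrow>\<^sub>0 'k) \<subseteq> {p. length (fst p) = n}"
proof -
  obtain w where w: "\<forall>v\<in>keys r. mset v = mset w" using R_mset[OF assms] by blast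
  have len: "length v = length w" if "v \<in> keys r" for v
    using w that size_mset by metis
  have "keys (TV_incl r :: 'i list \<times> 'g \<Rightarrow>\<^sub>0 'k) \<subseteq> (\<Union>v\<in>keys r. keys (single (v, 0::'g) (lookup r v)))"
    unfolding TV_incl_def by (rule keys_sum)
  also have "\<dots> \<subseteq> {p. length (fst p) = length w}" using len by auto
  finally show thesis by (rule that)
qed

lemma keys_ad: "keys (ad i j) \<subseteq> {p. length (fst p) = 2}"
  unfolding ad_def by (rule keys_diff_subset) auto

text \<open>\<open>I0\<close> is a graded ideal because its generators are homogeneous. For
  \<open>I m n\<close> this fails in general, and \<open>Phi\<close> bridges the difference.\<close>

lemma comp_I0:
  assumes "f \<in> I0" shows "comp n f \<in> I0"
proof -
  have "I0 \<subseteq> {f. \<forall>n. comp n f \<in> I0}"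
  proof (rule I_minimal)
    show "ideal {f. \<forall>n. comp n f \<in> I0} F"
      by (rule F_idealI) (auto simp: comp_add comp_mult intro: F_ideal[OF I_ideal] F_ideal_sum[OF I_ideal])
    fix r assume r: "r \<in> R"
    obtain m where "keys (TV_incl r :: 'i list \<times> 'g \<Rightarrow>\<^sub>0 'k) \<subseteq> {p. length (fst p) = m}"
      using r by (rule TV_incl_homogeneous)
    note comp_homogeneous[OF this]
    then show "TV_incl r \<in> {f. \<forall>n. comp n f \<in> I0}" using I_R[OF r] F_ideal(5)[OF I_ideal] by simp
  next
    fix i j assume "blk j < blk i"
    from I0_ad[OF this] show "ad i j - linking g (\<lambda>_ _. 0) (\<lambda>_ _. 0) i j \<in> {f. \<forall>n. comp n f \<in> I0}"
      using comp_homogeneous[OF keys_ad] F_ideal(5)[OF I_ideal] by simp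
  qed
  then show ?thesis using assms by blast
qed

end

section \<open>The associated graded algebra of a deformation\<close>

text \<open>\<open>P\<close> witnesses that the leading forms of \<open>J\<close> lie in the ideal of \<open>H\<^sup>0\<close>.\<close>

locale deformed = presentation \<chi> g blk R Rc L
  for \<chi> :: "'i \<Rightarrow> 'g::ab_group_add \<Rightarrow> 'k::comm_ring_1" and g blk R Rc L +
  fixes J :: "('i list \<times> 'g \<Rightarrow>\<^sub>0 'k) set" and P
  assumes J_ideal [simp]: "ideal J F" and J_R: "r \<in> R \<Longrightarrow> TV_incl r \<in> J"
    and J_ad: "blk j < blk i \<Longrightarrow> \<exists>l. keys l \<subseteq> {p. length (fst p) < 2} \<and> ad i j - l \<in> J"
    and P_linear: "k_linear F F P" and P_J: "f \<in> J \<Longrightarrow> P f \<in> I0"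
    and P_low: "keys f \<subseteq> {p. length (fst p) \<le> n} \<Longrightarrow> keys (P f - f) \<subseteq> {p. length (fst p) < n}"
begin

abbreviation "qf \<equiv> quotient_filtration \<chi> J"
abbreviation "sy \<equiv> symbol_map \<chi> J"

sublocale Q: kalg "Fq J" by (rule kalg_Fq) simp

lemma qf_iff: "x \<in> qf n \<longleftrightarrow> (\<exists>f. keys f \<subseteq> {p. length (fst p) \<le> n} \<and> x = proj J f)"
  by (auto simp: quotient_filtration_def F_filtration_def)

sublocale Q: filt "Fq J" qf
proof (rule filt.intro[OF Q.kmod_axioms filt_axioms.intro])
  show "qf n \<subseteq> qf (Suc n)" for n
  proof
    fix x assume "x \<in> qf n"
    then obtain f where "keys f \<subseteq> {p. length (fst p) \<le> n}" "x = proj J f" unfolding qf_iff by blast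
    moreover from this(1) have "keys f \<subseteq> {p. length (fst p) \<le> Suc n}" by auto
    ultimately show "x \<in> qf (Suc n)" unfolding qf_iff by blast
  qed
  show "submod (Fq J) (qf n)" for n
  proof
    show "qf n \<subseteq> carrier (Fq J)" by (auto simp: qf_iff)
    show "\<zero>\<^bsub>Fq J\<^esub> \<in> qf n" unfolding qf_iff by (rule exI[of _ 0]) (simp add: proj_zero)
    fix x assume "x \<in> qf n"
    then obtain f where f: "keys f \<subseteq> {p. length (fst p) \<le> n}" "x = proj J f" unfolding qf_iff by blast
    show "c \<odot>\<^bsub>Fq J\<^esub> x \<in> qf n" for c
      unfolding qf_iff by (rule exI[of _ "c *\<^sub>k f"]) (simp add: f proj_scale)
    fix y assume "y \<in> qf n"
    then obtain h where h: "keys h \<subseteq> {p. length (fst p) \<le> n}" "y = proj J h" unfolding qf_iff by blast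
    show "x \<oplus>\<^bsub>Fq J\<^esub> y \<in> qf n"
      unfolding qf_iff by (rule exI[of _ "f + h"]) (simp add: f h proj_add)
  qed
qed

lemma fb_iff: "x \<in> Q.fb n \<longleftrightarrow> (\<exists>f. keys f \<subseteq> {p. length (fst p) < n} \<and> x = proj J f)"
proof (cases n)
  case 0
  then show ?thesis by (auto simp: Q.fb_0 proj_zero)
next
  case (Suc m)
  then show ?thesis by (simp add: Q.fb_Suc qf_iff less_Suc_eq_le)
qed

lemma fbI: "keys f \<subseteq> {p. length (fst p) < n} \<Longrightarrow> proj J f \<in> Q.fb n"
  unfolding fb_iff by blast

definition lift :: "('i list \<times> 'g \<Rightarrow>\<^sub>0 'k) \<Rightarrow> nat \<Rightarrow> ('i list \<times> 'g \<Rightarrow>\<^sub>0 'k) set" where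
  "lift f n = proj J (comp n f)"

lemma sy_eq: "sy f = Q.cl (lift f)"
  by (simp add: symbol_map_def lift_def)

lemma lift_closed [simp]: "lift f n \<in> carrier (Fq J)"
  by (simp add: lift_def)

lemma lift_seqs: "lift f \<in> carrier Q.seqs"
proof -
  obtain N where N: "keys f \<subseteq> {p. length (fst p) < N}" using bounded_degree[of f] by blast
  have "lift f n \<in> qf n" for n unfolding lift_def qf_iff using keys_comp_le by blast
  moreover have "lift f n \<in> Q.fb n" if "n \<ge> N" for n
    using comp_high[OF N that] by (simp add: lift_def proj_zero)
  then have "{n. lift f n \<notin> Q.fb n} \<subseteq> {..<N}" using not_less by blast
  then have "finite {n. lift f n \<notin> Q.fb n}" by (rule finite_subset) simp
  ultimately show ?thesis by (simp add: Q.seqs_def)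
qed

lemma lift_linear: "k_linear F Q.seqs lift"
  by (rule k_linearI) (simp_all only: lift_seqs, simp_all add: Q.seqs_simps lift_def fun_eq_iff comp_add comp_scale proj_add proj_scale)

lemma sy_linear: "k_linear F (gr (Fq J) qf) sy"
  using k_linear_comp[OF lift_linear Q.k_linear_cl] by (simp add: sy_eq[abs_def])

lemma sy_mult: "sy (x \<star> y) = sy x \<otimes>\<^bsub>gr (Fq J) qf\<^esub> sy y"
proof -
  interpret m: filt_bilin "Fq J" qf "Fq J" qf "Fq J" qf "monoid.mult (Fq J)"
  proof
    show "bilin (Fq J) (Fq J) (Fq J) (monoid.mult (Fq J))" by (rule kalg_bilin_mult[OF Q.kalg_axioms])
    fix a b i j assume "a \<in> qf i" "b \<in> qf j"
    then obtain f h where f: "keys f \<subseteq> {p. length (fst p) \<le> i}" "a = proj J f"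
      and h: "keys h \<subseteq> {p. length (fst p) \<le> j}" "b = proj J h" unfolding qf_iff by blast
    have "keys (f \<star> h) \<subseteq> {p. length (fst p) \<le> i + j}"
      using f(1)
    proof (induction f rule: pm_induct)
      case (add p c f)
      have "keys (single p c \<star> h) \<subseteq> {p. length (fst p) \<le> i + j}"
        using h(1)
      proof (induction h rule: pm_induct)
        case (add q d h)
        have "keys (single p c \<star> single q d) \<subseteq> {p. length (fst p) \<le> i + j}"
          using add(1) \<open>p \<in> _\<close> by (cases p; cases q) auto
        then show ?case using add by (simp add: fmul_distrib)
      qed simp
      then show ?case using add by (simp add: fmul_distrib)
    qed simp
    then show "a \<otimes>\<^bsub>Fq J\<^esub> b \<in> qf (i + j)"
      unfolding qf_iff f(2) h(2) using proj_mult[OF J_ideal] by metis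
  qed
  have "sy x \<otimes>\<^bsub>gr (Fq J) qf\<^esub> sy y = Q.cl (\<lambda>n. \<Oplus>\<^bsub>Fq J\<^esub>i\<in>{..n}. lift x i \<otimes>\<^bsub>Fq J\<^esub> lift y (n - i))"
    using m.gr_bilinear_seqs[OF lift_seqs lift_seqs, of x y] by (simp add: gr_def sy_eq)
  also have "(\<lambda>n. \<Oplus>\<^bsub>Fq J\<^esub>i\<in>{..n}. lift x i \<otimes>\<^bsub>Fq J\<^esub> lift y (n - i)) = lift (x \<star> y)"
    by (rule HOL.ext) (simp add: lift_def comp_mult proj_sum proj_mult)
  finally show ?thesis by (simp add: sy_eq)
qed

lemma sy_surj: "carrier (gr (Fq J) qf) = sy ` UNIV"
proof
  show "sy ` UNIV \<subseteq> carrier (gr (Fq J) qf)" using k_linear_closed[OF sy_linear] by auto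
  show "carrier (gr (Fq J) qf) \<subseteq> sy ` UNIV"
  proof
    fix y assume "y \<in> carrier (gr (Fq J) qf)"
    then obtain a where a: "a \<in> carrier Q.seqs" "y = Q.cl a" by (rule Q.gr_cases)
    then have "\<forall>n. \<exists>f. keys f \<subseteq> {p. length (fst p) \<le> n} \<and> a n = proj J f"
      using Q.seqs_Fil[OF a(1)] by (simp add: qf_iff)
    then obtain f where f: "\<And>n. keys (f n) \<subseteq> {p. length (fst p) \<le> n}" "\<And>n. a n = proj J (f n)" by metis
    define N where "N = {n. a n \<notin> Q.fb n}"
    have "finite N" using a(1) by (simp add: Q.seqs_def N_def)
    \<comment> \<open>Only finitely many entries have a nonzero class, and an entry matters only
      through its top component; the sum of these is a preimage.\<close>
    define h where "h = (\<Sum>n\<in>N. comp n (f n))"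
    have ch: "comp n h = (if n \<in> N then comp n (f n) else 0)" for n
      using \<open>finite N\<close> by (rule_tac poly_mapping_eqI) (auto simp: h_def lookup_comp lookup_sum)
    have "a n \<oplus>\<^bsub>Fq J\<^esub> \<ominus>\<^bsub>Fq J\<^esub> lift h n \<in> Q.fb n" for n
    proof (cases "n \<in> N")
      case True
      have "a n \<oplus>\<^bsub>Fq J\<^esub> \<ominus>\<^bsub>Fq J\<^esub> lift h n = proj J (f n - comp n (f n))"
        using k_linear_add[OF proj_linear[OF J_ideal], of "f n - comp n (f n)" "comp n (f n)"] True
        by (simp add: f(2) lift_def ch Q.a_assoc Q.r_neg)
      also have "\<dots> \<in> Q.fb n" by (rule fbI[OF comp_top[OF f(1)]])
      finally show ?thesis .
    next
      case False
      then show ?thesis using Q.fb.add_mem[of "a n" n "\<zero>\<^bsub>Fq J\<^esub>"] by (simp add: N_def lift_def ch proj_zero)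
    qed
    then have "y = sy h"
      unfolding a(2) sy_eq by (subst Q.cl_eq_iff) (auto simp: Q.seqs_carrier[OF a(1)])
    then show "y \<in> sy ` UNIV" by blast
  qed
qed

lemma sy_one: "sy (single ([], 0) 1) = \<one>\<^bsub>gr (Fq J) qf\<^esub>"
proof
  fix n
  have "Q.fb n +>\<^bsub>Fq J\<^esub> \<zero>\<^bsub>Fq J\<^esub> = Q.fb n" by (simp add: Q.fb_coset_self)
  moreover have "proj J (single ([], 0) 1) = \<one>\<^bsub>Fq J\<^esub>"
    using algebra_hom_one[OF proj_hom[OF J_ideal]] by simp
  ultimately show "sy (single ([], 0) 1) n = \<one>\<^bsub>gr (Fq J) qf\<^esub> n"
    by (simp add: sy_eq lift_def gr_def comp_single proj_zero)
qed

lemma epi_sy: "epi (gr (Fq J) qf) sy"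
proof -
  have z: "\<zero>\<^bsub>gr (Fq J) qf\<^esub> = sy \<zero>\<^bsub>F\<^esub>"
    using k_linear_zero[OF F.kmod_axioms Q.kmod_gr sy_linear] by simp
  have "sy (x + y) = sy x \<oplus>\<^bsub>gr (Fq J) qf\<^esub> sy y" "sy (c *\<^sub>k x) = c \<odot>\<^bsub>gr (Fq J) qf\<^esub> sy x" for x y c
    using k_linear_add[OF sy_linear, of x y] k_linear_smult[OF sy_linear, of x c] by simp_all
  note op = this sy_mult sy_one z
  have "kalg (gr (Fq J) qf)"
    by (rule kalg_surj_image(1)[where f = sy, OF kalg_F]) (simp_all add: op sy_surj)
  moreover have "algebra_hom F (gr (Fq J) qf) sy"
    by (rule kalg_surj_image(2)[where f = sy, OF kalg_F]) (simp_all add: op sy_surj)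
  ultimately show ?thesis by (simp add: epi_def sy_surj)
qed

text \<open>Suppose \<open>comp n f\<close> agrees modulo \<open>J\<close> with some
  \<open>h\<close> of lower degree. Then \<open>P (comp n f - h)\<close> lies in \<open>I0\<close>,
  and its component of degree \<open>n\<close> is \<open>comp n f\<close> by unitriangularity; as
  \<open>I0\<close> is graded, \<open>comp n f\<close> lies in \<open>I0\<close>. Conversely, the
  generators of \<open>I0\<close> are the leading forms of generators of \<open>J\<close>.\<close>

lemma sy_zero_iff: "sy f = \<zero>\<^bsub>gr (Fq J) qf\<^esub> \<longleftrightarrow> f \<in> I0"
proof
  have iff: "sy f = \<zero>\<^bsub>gr (Fq J) qf\<^esub> \<longleftrightarrow> (\<forall>n. proj J (comp n f) \<in> Q.fb n)" for f
    unfolding sy_eq using Q.cl_eq_zero_iff[of "lift f"] by (simp add: lift_def)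
  show "f \<in> I0" if "sy f = \<zero>\<^bsub>gr (Fq J) qf\<^esub>"
  proof -
    have "comp n f \<in> I0" for n
    proof -
      have "proj J (comp n f) \<in> Q.fb n" using that iff by blast
      then obtain h where h: "keys h \<subseteq> {p. length (fst p) < n}" "proj J (comp n f) = proj J h"
        unfolding fb_iff by blast
      then have "P (comp n f - h) \<in> I0" by (intro P_J) (simp add: proj_eq_iff)
      then have 1: "comp n (P (comp n f - h)) \<in> I0" by (rule comp_I0)
      have "keys (comp n f - h) \<subseteq> {p. length (fst p) \<le> n}"
        using h(1) keys_comp_le by (intro keys_diff_subset) auto
      from comp_low[OF P_low[OF this]] have "comp n (P (comp n f - h)) = comp n (comp n f - h)"
        by (simp add: comp_diff)
      also have "\<dots> = comp n f" by (simp add: comp_diff comp_comp comp_low[OF h(1)])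
      finally show ?thesis using 1 by simp
    qed
    then show ?thesis
      using bounded_degree[of f] comp_sum F_ideal_sum[OF I_ideal] by metis
  qed
  show "sy f = \<zero>\<^bsub>gr (Fq J) qf\<^esub>" if "f \<in> I0"
  proof -
    have "I0 \<subseteq> {f. sy f = \<zero>\<^bsub>gr (Fq J) qf\<^esub>}"
    proof (rule I_minimal[OF kernel_F_ideal[OF epiD(1,3)[OF epi_sy]]])
      fix r assume r: "r \<in> R"
      obtain m where "keys (TV_incl r :: 'i list \<times> 'g \<Rightarrow>\<^sub>0 'k) \<subseteq> {p. length (fst p) = m}"
        using r by (rule TV_incl_homogeneous)
      note comp_homogeneous[OF this]
      then show "TV_incl r \<in> {f. sy f = \<zero>\<^bsub>gr (Fq J) qf\<^esub>}"
        using J_R[OF r] proj_zero_iff[OF J_ideal, of "TV_incl r"] by (simp add: iff proj_zero)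
    next
      fix i j assume "blk j < blk i"
      then obtain l where l: "keys l \<subseteq> {p. length (fst p) < 2}" "ad i j - l \<in> J" using J_ad by blast
      then have "proj J (ad i j) = proj J l" by (simp add: proj_eq_iff)
      then have "proj J (ad i j) \<in> Q.fb 2" using fbI[OF l(1)] by simp
      then show "ad i j - linking g (\<lambda>_ _. 0) (\<lambda>_ _. 0) i j \<in> {f. sy f = \<zero>\<^bsub>gr (Fq J) qf\<^esub>}"
        by (simp add: iff comp_homogeneous[OF keys_ad] proj_zero)
    qed
    then show ?thesis using that by blast
  qed
qed

lemma sy_degree: "sy ` F_degree n = gr_degree (Fq J) qf n"
proof -
  have fb: "Q.fb m +>\<^bsub>Fq J\<^esub> \<zero>\<^bsub>Fq J\<^esub> = Q.fb m" for m by (simp add: Q.fb_coset_self)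
  show ?thesis
  proof
    show "sy ` F_degree n \<subseteq> gr_degree (Fq J) qf n"
    proof
      fix y assume "y \<in> sy ` F_degree n"
      then obtain f where f: "keys f \<subseteq> {p. length (fst p) = n}" "y = sy f" by (auto simp: F_degree_def)
      moreover have "sy f \<in> carrier (gr (Fq J) qf)" using k_linear_closed[OF sy_linear, of f] by simp
      ultimately show "y \<in> gr_degree (Fq J) qf n"
        by (auto simp: gr_degree_def sy_eq lift_def comp_homogeneous[OF f(1)] proj_zero fb)
    qed
    show "gr_degree (Fq J) qf n \<subseteq> sy ` F_degree n"
    proof
      fix y assume y: "y \<in> gr_degree (Fq J) qf n"
      then obtain f where f: "y = sy f" using sy_surj by (auto simp: gr_degree_def)
      have "y = sy (comp n f)"
      proof
        fix m show "y m = sy (comp n f) m"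
          using y by (cases "m = n") (auto simp: f gr_degree_def sy_eq lift_def comp_comp proj_zero fb)
      qed
      moreover have "comp n f \<in> F_degree n" using keys_comp by (auto simp: F_degree_def)
      ultimately show "y \<in> sy ` F_degree n" by blast
    qed
  qed
qed

lemma H0_to_gr_proj: "H0_to_gr \<chi> J (proj I0 f) = sy f"
  and H0_to_gr_linear: "k_linear (Fq I0) (gr (Fq J) qf) (H0_to_gr \<chi> J)"
proof -
  interpret S: submod F I0 by (rule ideal_submod[OF kalg_F I_ideal])
  note l = S.on_cosets_linear[OF Q.kmod_gr sy_linear, OF iffD2[OF sy_zero_iff]]
  show "H0_to_gr \<chi> J (proj I0 f) = sy f" "k_linear (Fq I0) (gr (Fq J) qf) (H0_to_gr \<chi> J)"
    using l by (simp_all add: H0_to_gr_def F_proj_def F_quotient_def)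
qed

lemma Fq_I0_cases: "x \<in> carrier (Fq I0) \<Longrightarrow> \<exists>f. x = proj I0 f"
  using proj_surj[OF I_ideal] by (auto simp: image_iff) (metis I_ideal UNIV_I bosonization_simps(1) imageE proj_surj)

lemma H0_to_gr_hom: "algebra_hom (Fq I0) (gr (Fq J) qf) (H0_to_gr \<chi> J)"
proof (rule algebra_homI[OF H0_to_gr_linear])
  have 1: "proj I0 (single ([], 0) 1) = \<one>\<^bsub>Fq I0\<^esub>" using algebra_hom_one[OF proj_hom[OF I_ideal]] by simp
  show "H0_to_gr \<chi> J \<one>\<^bsub>Fq I0\<^esub> = \<one>\<^bsub>gr (Fq J) qf\<^esub>"
    unfolding 1[symmetric] H0_to_gr_proj by (rule sy_one)
  fix x y assume "x \<in> carrier (Fq I0)" "y \<in> carrier (Fq I0)"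
  then obtain f h where "x = proj I0 f" "y = proj I0 h" using Fq_I0_cases by metis
  then show "H0_to_gr \<chi> J (x \<otimes>\<^bsub>Fq I0\<^esub> y) = H0_to_gr \<chi> J x \<otimes>\<^bsub>gr (Fq J) qf\<^esub> H0_to_gr \<chi> J y"
    by (simp add: proj_mult[symmetric] H0_to_gr_proj sy_mult)
qed

lemma H0_to_gr_bij: "bij_betw (H0_to_gr \<chi> J) (carrier (Fq I0)) (carrier (gr (Fq J) qf))"
proof (rule bij_betwI')
  fix x y assume "x \<in> carrier (Fq I0)" "y \<in> carrier (Fq I0)"
  then obtain f h where fh: "x = proj I0 f" "y = proj I0 h" using Fq_I0_cases by metis
  interpret G: kmod "gr (Fq J) qf" by (rule Q.kmod_gr)
  have "sy f = sy (f - h) \<oplus>\<^bsub>gr (Fq J) qf\<^esub> sy h" using k_linear_add[OF sy_linear, of "f - h" h] by simp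
  then have "sy f = sy h \<longleftrightarrow> sy (f - h) = \<zero>\<^bsub>gr (Fq J) qf\<^esub>"
    using k_linear_closed[OF sy_linear] G.add.r_cancel_one' by (metis UNIV_I bosonization_simps(1) G.r_neg G.l_zero G.a_assoc G.a_inv_closed G.r_zero)
  then show "H0_to_gr \<chi> J x = H0_to_gr \<chi> J y \<longleftrightarrow> x = y"
    by (simp add: fh H0_to_gr_proj sy_zero_iff proj_eq_iff)
next
  show "H0_to_gr \<chi> J x \<in> carrier (gr (Fq J) qf)" if "x \<in> carrier (Fq I0)" for x
    by (rule k_linear_closed[OF H0_to_gr_linear that])
  show "\<exists>x\<in>carrier (Fq I0). y = H0_to_gr \<chi> J x" if "y \<in> carrier (gr (Fq J) qf)" for y
    using that H0_to_gr_proj proj_closed[OF I_ideal] unfolding sy_surj by (metis imageE)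
qed

theorem H0_to_gr_iso:
  "graded_algebra_iso (Fq I0) (\<lambda>n. proj I0 ` F_degree n) (gr (Fq J) qf) (gr_degree (Fq J) qf) (H0_to_gr \<chi> J)"
  unfolding graded_algebra_iso_def image_image H0_to_gr_proj
  using H0_to_gr_hom H0_to_gr_bij sy_degree by blast

end

section \<open>Tensor products of associated graded modules\<close>

lemma k_linear_plus:
  assumes "kmod N" "k_linear M N f" "k_linear M N f'"
  shows "k_linear M N (\<lambda>x. f x \<oplus>\<^bsub>N\<^esub> f' x)"
proof -
  interpret N: kmod N by fact
  show ?thesis
    by (rule k_linearI) (simp_all add: k_linear_closed[OF assms(2)] k_linear_closed[OF assms(3)]
        k_linear_add[OF assms(2)] k_linear_add[OF assms(3)] k_linear_smult[OF assms(2)] k_linear_smult[OF assms(3)]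
        N.a_ac N.smult_r_distr)
qed

context kmod_pair
begin

lemma tensor_map_add_left:
  assumes C: "kmod C" and D: "kmod D" and f: "k_linear A C f" "k_linear A C f'" and h: "k_linear B D h"
    and t: "t \<in> carrier T"
  shows "tensor_map C D (\<lambda>x. f x \<oplus>\<^bsub>C\<^esub> f' x) h t
      = tensor_map C D f h t \<oplus>\<^bsub>tensor C D\<^esub> tensor_map C D f' h t"
proof -
  interpret CD: kmod_pair C D using C D by (simp add: kmod_pair.intro)
  note m = tensor_map[OF A.kmod_axioms B.kmod_axioms C D]
  note fs = k_linear_plus[OF C f]
  show ?thesis
    by (rule tensor_linear_eq[OF m(2)[OF fs h] k_linear_plus[OF CD.kmod_tensor m(2)[OF f(1) h] m(2)[OF f(2) h]] t])
      (simp add: m(1)[OF fs h] m(1)[OF f(1) h] m(1)[OF f(2) h] k_linear_add[OF bilin_left[OF CD.bilin_pure]]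
        k_linear_closed[OF f(1)] k_linear_closed[OF f(2)] k_linear_closed[OF h])
qed

lemma tensor_map_add_right:
  assumes C: "kmod C" and D: "kmod D" and f: "k_linear A C f" and h: "k_linear B D h" "k_linear B D h'"
    and t: "t \<in> carrier T"
  shows "tensor_map C D f (\<lambda>x. h x \<oplus>\<^bsub>D\<^esub> h' x) t
      = tensor_map C D f h t \<oplus>\<^bsub>tensor C D\<^esub> tensor_map C D f h' t"
proof -
  interpret CD: kmod_pair C D using C D by (simp add: kmod_pair.intro)
  note m = tensor_map[OF A.kmod_axioms B.kmod_axioms C D]
  note hs = k_linear_plus[OF D h]
  show ?thesis
    by (rule tensor_linear_eq[OF m(2)[OF f hs] k_linear_plus[OF CD.kmod_tensor m(2)[OF f h(1)] m(2)[OF f h(2)]] t])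
      (simp add: m(1)[OF f hs] m(1)[OF f h(1)] m(1)[OF f h(2)] k_linear_add[OF bilin_right[OF CD.bilin_pure]]
        k_linear_closed[OF f] k_linear_closed[OF h(1)] k_linear_closed[OF h(2)])
qed

end

context presentation
begin

abbreviation "H0H0 \<equiv> tensor (Fq I0) (Fq I0)"
abbreviation "pc n \<equiv> (\<lambda>f. proj I0 (comp n f))"
abbreviation "pt n \<equiv> (\<lambda>f. proj I0 (\<Sum>i<n. comp i f))"

lemma pc_linear: "k_linear F (Fq I0) (pc n)"
  by (rule k_linear_comp[OF comp_linear proj_linear]) simp

lemma trunc_linear: "k_linear F F (\<lambda>f. \<Sum>i<n. comp i f)"
proof (induction n)
  case (Suc n)
  from sum_linear[OF this comp_linear] show ?case by simp
qed (rule k_linearI, simp_all)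

lemma pt_linear: "k_linear F (Fq I0) (pt n)"
  by (rule k_linear_comp[OF trunc_linear proj_linear]) simp

text \<open>The bound depends on the tensor; it exists because a tensor is a finite sum of pure
  tensors whose factors have bounded degree.\<close>

lemma trunc_tensor:
  assumes "u \<in> carrier FF"
  shows "\<exists>N. \<forall>n\<ge>N. tensor_map (Fq I0) (Fq I0) (pt n) (pt n) u = tm I0 I0 u"
  using assms
proof (induction u rule: FF.tensor_induct)
  note q = kalg_kmod[OF kalg_Fq[OF I_ideal]]
  note m = tensor_map[OF F.kmod_axioms F.kmod_axioms q q pt_linear pt_linear]
  case (pure a b)
  obtain N M where N: "keys a \<subseteq> {p. length (fst p) < N}" "keys b \<subseteq> {p. length (fst p) < M}"
    using bounded_degree by metis
  have "tensor_map (Fq I0) (Fq I0) (pt n) (pt n) (a \<otimes>\<^sub>k b) = tm I0 I0 (a \<otimes>\<^sub>k b)" if "n \<ge> max N M" for n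
  proof -
    have "keys a \<subseteq> {p. length (fst p) < n}" "keys b \<subseteq> {p. length (fst p) < n}" using N that by auto
    then show ?thesis using m(1)[of a b n n] by (simp add: comp_sum tm_pure)
  qed
  then show ?case by blast
next
  note q = kalg_kmod[OF kalg_Fq[OF I_ideal]]
  note m = tensor_map[OF F.kmod_axioms F.kmod_axioms q q pt_linear pt_linear]
  case (add s t)
  then obtain N M where "\<forall>n\<ge>N. tensor_map (Fq I0) (Fq I0) (pt n) (pt n) s = tm I0 I0 s"
    "\<forall>n\<ge>M. tensor_map (Fq I0) (Fq I0) (pt n) (pt n) t = tm I0 I0 t" by blast
  then have "tensor_map (Fq I0) (Fq I0) (pt n) (pt n) (s \<oplus>\<^bsub>FF\<^esub> t) = tm I0 I0 (s \<oplus>\<^bsub>FF\<^esub> t)" if "n \<ge> max N M" for n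
    using that add(1,2) by (simp add: k_linear_add[OF m(2)] k_linear_add[OF tm_linear])
  then show ?case by blast
qed

text \<open>Summing components in each leg gives the truncations \<open>pt n\<close>, which agree
  with the full projection for large \<open>n\<close>. This replaces a direct sum decomposition of
  the tensor product.\<close>

lemma tensor_components_zero:
  assumes u: "u \<in> carrier FF" and 0: "\<And>i j. tensor_map (Fq I0) (Fq I0) (pc i) (pc j) u = \<zero>\<^bsub>H0H0\<^esub>"
  shows "tm I0 I0 u = \<zero>\<^bsub>H0H0\<^esub>"
proof -
  note k = kalg_Fq[OF I_ideal[of "\<lambda>_ _. 0" "\<lambda>_ _. 0"]]
  note q = kalg_kmod[OF k]
  interpret HH: kalg_pair "Fq I0" "Fq I0" by (rule kalg_pair_Fq) simp_all
  interpret HH: kalg H0H0 by (rule HH.kalg_tensor)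
  have Suc: "pt (Suc n) = (\<lambda>f. pt n f \<oplus>\<^bsub>Fq I0\<^esub> pc n f)" for n by (simp add: proj_add)
  have p0: "pt 0 = (\<lambda>_. \<zero>\<^bsub>Fq I0\<^esub>)" by (simp add: proj_zero)
  have l0: "k_linear F (Fq I0) (\<lambda>_. \<zero>\<^bsub>Fq I0\<^esub>)" using pt_linear[of 0] unfolding p0 .
  have z1: "tensor_map (Fq I0) (Fq I0) (\<lambda>_. \<zero>\<^bsub>Fq I0\<^esub>) h u = \<zero>\<^bsub>H0H0\<^esub>"
    and z2: "tensor_map (Fq I0) (Fq I0) h (\<lambda>_. \<zero>\<^bsub>Fq I0\<^esub>) u = \<zero>\<^bsub>H0H0\<^esub>" if h: "k_linear F (Fq I0) h" for h
  proof -
    have zl: "k_linear FF H0H0 (\<lambda>_. \<zero>\<^bsub>H0H0\<^esub>)" by (rule k_linearI) simp_all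
    note b = k_linear_zero[OF q HH.kmod_axioms bilin_left[OF HH.bilin_pure]]
      k_linear_zero[OF q HH.kmod_axioms bilin_right[OF HH.bilin_pure]]
    note m1 = tensor_map[OF F.kmod_axioms F.kmod_axioms q q l0 h] and m2 = tensor_map[OF F.kmod_axioms F.kmod_axioms q q h l0]
    show "tensor_map (Fq I0) (Fq I0) (\<lambda>_. \<zero>\<^bsub>Fq I0\<^esub>) h u = \<zero>\<^bsub>H0H0\<^esub>"
      by (rule FF.tensor_linear_eq[OF m1(2) zl u]) (simp add: m1(1) b k_linear_closed[OF h])
    show "tensor_map (Fq I0) (Fq I0) h (\<lambda>_. \<zero>\<^bsub>Fq I0\<^esub>) u = \<zero>\<^bsub>H0H0\<^esub>"
      by (rule FF.tensor_linear_eq[OF m2(2) zl u]) (simp add: m2(1) b k_linear_closed[OF h])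
  qed
  have 1: "tensor_map (Fq I0) (Fq I0) (pc i) (pt n) u = \<zero>\<^bsub>H0H0\<^esub>" for i n
  proof (induction n)
    case 0
    show ?case unfolding p0 by (rule z2[OF pc_linear])
  next
    case IH: (Suc n)
    show ?case
      unfolding Suc FF.tensor_map_add_right[OF q q pc_linear pt_linear pc_linear u] IH 0 by simp
  qed
  have 2: "tensor_map (Fq I0) (Fq I0) (pt n) (pt n') u = \<zero>\<^bsub>H0H0\<^esub>" for n n'
  proof (induction n)
    case 0
    show ?case unfolding p0 by (rule z1[OF pt_linear])
  next
    case IH: (Suc n)
    show ?case
      unfolding Suc[of n] FF.tensor_map_add_left[OF q q pt_linear pc_linear pt_linear u] IH 1 by simp
  qed
  from trunc_tensor[OF u] show ?thesis unfolding 2 by blast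
qed

end

lemma k_linear_inj_on:
  assumes "kmod M" "kmod N" and f: "k_linear M N f" and 0: "\<And>x. x \<in> carrier M \<Longrightarrow> f x = \<zero>\<^bsub>N\<^esub> \<Longrightarrow> x = \<zero>\<^bsub>M\<^esub>"
  shows "inj_on f (carrier M)"
proof (rule inj_onI)
  interpret M: kmod M by fact
  interpret N: kmod N by fact
  fix x y assume xy: "x \<in> carrier M" "y \<in> carrier M" "f x = f y"
  then have "f (x \<oplus>\<^bsub>M\<^esub> \<ominus>\<^bsub>M\<^esub> y) = \<zero>\<^bsub>N\<^esub>"
    using k_linear_closed[OF f xy(2)]
    by (simp add: k_linear_add[OF f] k_linear_minus[OF M.kmod_axioms N.kmod_axioms f] N.r_neg)
  then have "x \<oplus>\<^bsub>M\<^esub> \<ominus>\<^bsub>M\<^esub> y = \<zero>\<^bsub>M\<^esub>" using xy by (intro 0) simp_all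
  then show "x = y" using xy M.minus_equality[of x "\<ominus>\<^bsub>M\<^esub> y"] by simp
qed

section \<open>Component projections of \<open>F / J\<close> onto \<open>H^0\<close>\<close>

context deformed
begin

text \<open>A linear map on all of \<open>F / J\<close>, well defined because \<open>P\<close> sends
  \<open>J\<close> into the graded ideal \<open>I0\<close>. It kills lower filtration and reads the
  degree \<open>i\<close> symbol as an element of \<open>H^0\<close>. Since it is not confined to a
  term of the filtration, it can be tensored over any \<open>k\<close>.\<close>

definition pr :: "nat \<Rightarrow> ('i list \<times> 'g \<Rightarrow>\<^sub>0 'k) set \<Rightarrow> ('i list \<times> 'g \<Rightarrow>\<^sub>0 'k) set" where
  "pr i = on_cosets (\<lambda>f. proj I0 (comp i (P f)))"

lemma pr_proj: "pr i (proj J f) = proj I0 (comp i (P f))"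
  and pr_linear: "k_linear (Fq J) (Fq I0) (pr i)"
proof -
  interpret S: submod F J by (rule ideal_submod[OF kalg_F J_ideal])
  have ker: "proj I0 (comp i (P f)) = \<zero>\<^bsub>Fq I0\<^esub>" if "f \<in> J" for f
    using comp_I0[OF P_J[OF that]] proj_zero_iff[OF I_ideal] by blast
  note l = S.on_cosets_linear[OF kalg_kmod[OF kalg_Fq[OF I_ideal]] k_linear_comp[OF P_linear pc_linear] ker]
  show "pr i (proj J f) = proj I0 (comp i (P f))" "k_linear (Fq J) (Fq I0) (pr i)"
    using l by (simp_all add: pr_def F_proj_def F_quotient_def)
qed

lemma P_comp: "keys f \<subseteq> {p. length (fst p) \<le> n} \<Longrightarrow> comp n (P f) = comp n f"
  using comp_low[OF P_low] by (simp add: comp_diff)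

lemma pr_fb:
  assumes "x \<in> Q.fb i" shows "pr i x = \<zero>\<^bsub>Fq I0\<^esub>"
proof -
  obtain f where f: "keys f \<subseteq> {p. length (fst p) < i}" "x = proj J f" using assms unfolding fb_iff by blast
  then have "keys f \<subseteq> {p. length (fst p) \<le> i}" by auto
  then show ?thesis by (simp add: f(2) pr_proj P_comp comp_low[OF f(1)] proj_zero)
qed

lemma pr_lift: "pr i (lift f i) = proj I0 (comp i f)"
  by (simp add: lift_def pr_proj P_comp[OF keys_comp_le] comp_comp)

lemma lift_fb: "m < i \<Longrightarrow> lift f m \<in> Q.fb i"
  unfolding lift_def by (rule fbI) (use keys_comp in fastforce)

lemma pr_lift_zero: "m < i \<Longrightarrow> pr i (lift f m) = \<zero>\<^bsub>Fq I0\<^esub>"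
  by (rule pr_fb[OF lift_fb])

end

locale deformed_pair = presentation \<chi> g blk R Rc L + J: deformed \<chi> g blk R Rc L J P + K: deformed \<chi> g blk R Rc L K P'
  for \<chi> :: "'i \<Rightarrow> 'g::ab_group_add \<Rightarrow> 'k::comm_ring_1" and g blk R Rc L J P K P'
begin

sublocale jk: filt_pair "Fq J" J.qf "Fq K" K.qf
  by (intro filt_pair.intro J.Q.filt_axioms K.Q.filt_axioms)

abbreviation "FJK \<equiv> tensor (Fq J) (Fq K)"
abbreviation "grJ \<equiv> gr (Fq J) J.qf"
abbreviation "grK \<equiv> gr (Fq K) K.qf"
abbreviation "gt \<equiv> gr_tensor (Fq J) J.qf (Fq K) K.qf"
abbreviation "syy \<equiv> tensor_map grJ grK J.sy K.sy"

text \<open>A sequence of representatives for \<open>gr_tensor\<close> of the symbol of a tensor, so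
  that \<open>pr i \<otimes> pr j\<close> can be applied before passing to classes.\<close>

definition W where
  "W = tensor_lift jk.TF.seqs (\<lambda>a b n. \<Oplus>\<^bsub>FJK\<^esub>i\<in>{..n}. pure_tensor (Fq J) (Fq K) (J.lift a i) (K.lift b (n - i)))"

lemma W_pure: "W (a \<otimes>\<^sub>k b) = (\<lambda>n. \<Oplus>\<^bsub>FJK\<^esub>i\<in>{..n}. pure_tensor (Fq J) (Fq K) (J.lift a i) (K.lift b (n - i)))"
  and W_linear: "k_linear FF jk.TF.seqs W"
  using FF.tensor_lift[OF jk.TF.kmod_seqs bilin_comp[OF jk.pure.bilin_conv J.lift_linear K.lift_linear]]
  by (simp_all add: W_def)

lemma W_eval_linear: "k_linear FF FJK (\<lambda>u. W u n)"
proof -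
  have "k_linear jk.TF.seqs FJK (\<lambda>s. s n)"
    by (rule k_linearI) (simp_all add: jk.TF.seqs_simps jk.TF.seqs_carrier)
  from k_linear_comp[OF W_linear this] show ?thesis .
qed

lemma W_closed: "u \<in> carrier FF \<Longrightarrow> W u n \<in> carrier FJK"
  by (rule k_linear_closed[OF W_eval_linear])

lemmas syy = tensor_map[OF F.kmod_axioms F.kmod_axioms J.Q.kmod_gr K.Q.kmod_gr J.sy_linear K.sy_linear]

lemma gr_tensor_W:
  assumes "u \<in> carrier FF" shows "gt (syy u) = jk.TF.cl (W u)"
proof (rule FF.tensor_linear_eq[OF k_linear_comp[OF syy(2) jk.gr_tensor_linear] k_linear_comp[OF W_linear jk.TF.k_linear_cl] assms])
  fix a b :: "'i list \<times> 'g \<Rightarrow>\<^sub>0 'k"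
  have "syy (a \<otimes>\<^sub>k b) = pure_tensor grJ grK (J.sy a) (K.sy b)" using syy(1)[of a b] by simp
  then show "gt (syy (a \<otimes>\<^sub>k b)) = jk.TF.cl (W (a \<otimes>\<^sub>k b))"
    using jk.gr_tensor_pure[OF J.lift_seqs K.lift_seqs, of a b] by (simp add: J.sy_eq K.sy_eq W_pure)
qed

lemma H0_kmod: "kmod (Fq I0)" by (rule kalg_kmod[OF kalg_Fq[OF I_ideal]])

lemmas prr = tensor_map[OF J.Q.kmod_axioms K.Q.kmod_axioms H0_kmod H0_kmod J.pr_linear K.pr_linear]

abbreviation "prr i j \<equiv> tensor_map (Fq I0) (Fq I0) (J.pr i) (K.pr j)"

lemma HH: "kalg_pair (Fq I0) (Fq I0)"
  by (rule kalg_pair_Fq) simp_all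

lemma pure_zero: "x \<in> carrier (Fq I0) \<Longrightarrow> pure_tensor (Fq I0) (Fq I0) x \<zero>\<^bsub>Fq I0\<^esub> = \<zero>\<^bsub>H0H0\<^esub>"
  "x \<in> carrier (Fq I0) \<Longrightarrow> pure_tensor (Fq I0) (Fq I0) \<zero>\<^bsub>Fq I0\<^esub> x = \<zero>\<^bsub>H0H0\<^esub>"
proof -
  interpret HH: kalg_pair "Fq I0" "Fq I0" by (rule HH)
  show "x \<in> carrier (Fq I0) \<Longrightarrow> pure_tensor (Fq I0) (Fq I0) x \<zero>\<^bsub>Fq I0\<^esub> = \<zero>\<^bsub>H0H0\<^esub>"
    by (rule k_linear_zero[OF H0_kmod HH.kmod_tensor bilin_right[OF HH.bilin_pure]])
  show "x \<in> carrier (Fq I0) \<Longrightarrow> pure_tensor (Fq I0) (Fq I0) \<zero>\<^bsub>Fq I0\<^esub> x = \<zero>\<^bsub>H0H0\<^esub>"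
    by (rule k_linear_zero[OF H0_kmod HH.kmod_tensor bilin_left[OF HH.bilin_pure]])
qed

lemma prr_fb:
  assumes "t \<in> jk.TF.fb (i + j)" shows "prr i j t = \<zero>\<^bsub>H0H0\<^esub>"
proof -
  interpret HH: kalg_pair "Fq I0" "Fq I0" by (rule HH)
  interpret H: kmod H0H0 by (rule HH.kmod_tensor)
  have 0: "prr i j \<zero>\<^bsub>FJK\<^esub> = \<zero>\<^bsub>H0H0\<^esub>"
    by (rule k_linear_zero[OF jk.TF.kmod_axioms H.kmod_axioms prr(2)])
  show ?thesis
  proof (cases "i + j")
    case 0
    with assms show ?thesis using \<open>prr i j \<zero>\<^bsub>FJK\<^esub> = _\<close> by (simp add: jk.TF.fb_0)
  next
    case (Suc n)
    then have "t \<in> jk.TF n" using assms by (simp add: jk.TF.fb_Suc)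
    then show ?thesis
    proof (induction t rule: jk.TF_induct)
      case (pure l a b)
      note ab = J.Q.Fil_carrier[OF pure(2)] K.Q.Fil_carrier[OF pure(3)]
      \<comment> \<open>Since \<open>i + j = n + 1\<close>, a pure tensor of degrees
        \<open>l\<close> and \<open>n - l\<close> falls short in one leg, and \<open>pr\<close>
        kills that leg.\<close>
      have "l < i \<or> n - l < j" using Suc pure(1) by linarith
      then have "J.pr i a = \<zero>\<^bsub>Fq I0\<^esub> \<or> K.pr j b = \<zero>\<^bsub>Fq I0\<^esub>"
        using J.Q.Fil_sub_fb[of l i] K.Q.Fil_sub_fb[of "n - l" j] pure J.pr_fb K.pr_fb by blast
      then show ?case
        using k_linear_closed[OF J.pr_linear ab(1)] k_linear_closed[OF K.pr_linear ab(2)]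
        by (auto simp: prr(1)[OF ab] pure_zero)
    next
      case (add s t)
      then show ?case by (simp add: k_linear_add[OF prr(2)])
    qed (rule 0)
  qed
qed

lemma prr_W:
  assumes "u \<in> carrier FF" shows "prr i j (W u (i + j)) = tensor_map (Fq I0) (Fq I0) (pc i) (pc j) u"
proof -
  interpret HH: kalg_pair "Fq I0" "Fq I0" by (rule HH)
  interpret H: kmod H0H0 by (rule HH.kmod_tensor)
  note m = tensor_map[OF F.kmod_axioms F.kmod_axioms H0_kmod H0_kmod pc_linear pc_linear]
  show ?thesis
  proof (rule FF.tensor_linear_eq[OF k_linear_comp[OF W_eval_linear prr(2)] m(2) assms])
    fix a b :: "'i list \<times> 'g \<Rightarrow>\<^sub>0 'k"
    note cl = k_linear_closed[OF J.pr_linear] k_linear_closed[OF K.pr_linear]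
    have "prr i j (W (a \<otimes>\<^sub>k b) (i + j))
      = (\<Oplus>\<^bsub>H0H0\<^esub>l\<in>{..i + j}. prr i j (pure_tensor (Fq J) (Fq K) (J.lift a l) (K.lift b (i + j - l))))"
      unfolding W_pure
      by (rule k_linear_finsum[OF jk.TF.kmod_axioms H.kmod_axioms prr(2)]) (simp add: jk.pure_closed)
    also have "\<dots> = (\<Oplus>\<^bsub>H0H0\<^esub>l\<in>{..i + j}. if i = l then pure_tensor (Fq I0) (Fq I0) (pc i a) (pc j b) else \<zero>\<^bsub>H0H0\<^esub>)"
    proof (rule H.finsum_cong'[OF HOL.refl])
      fix l assume l: "l \<in> {..i + j}"
      \<comment> \<open>Only the summand with \<open>l = i\<close> survives: for
        \<open>l < i\<close> the first leg is too low, for \<open>l > i\<close> the second.\<close>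
      consider "l = i" | "l < i" | "i + j - l < j" using l by fastforce
      then show "prr i j (pure_tensor (Fq J) (Fq K) (J.lift a l) (K.lift b (i + j - l)))
        = (if i = l then pure_tensor (Fq I0) (Fq I0) (pc i a) (pc j b) else \<zero>\<^bsub>H0H0\<^esub>)"
        by cases (auto simp: prr(1) J.pr_lift K.pr_lift J.pr_lift_zero K.pr_lift_zero pure_zero cl)
    qed (simp add: HH.pure_closed)
    also have "\<dots> = pure_tensor (Fq I0) (Fq I0) (pc i a) (pc j b)"
      by (rule H.finsum_singleton) (simp_all add: HH.pure_closed)
    finally show "prr i j (W (a \<otimes>\<^sub>k b) (i + j)) = tensor_map (Fq I0) (Fq I0) (pc i) (pc j) (a \<otimes>\<^sub>k b)"
      by (simp add: m(1))
  qed
qed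

text \<open>If the class is zero, every \<open>W u n\<close> lies below degree \<open>n\<close>.
  Then \<open>pr i \<otimes> pr j\<close> kills \<open>W u (i + j)\<close>, while by
  \<open>prr_W\<close> its value there is the component of \<open>u\<close> of bidegree
  \<open>(i, j)\<close>.\<close>

theorem gr_tensor_kernel:
  assumes u: "u \<in> carrier FF" and 0: "gt (syy u) = \<zero>\<^bsub>gr FJK jk.TF\<^esub>"
  shows "tm I0 I0 u = \<zero>\<^bsub>H0H0\<^esub>"
proof (rule tensor_components_zero[OF u])
  fix i j
  have "W u n \<in> jk.TF.fb n" for n
    using 0 jk.TF.cl_eq_zero_iff[of "W u"] W_closed[OF u] by (simp add: gr_tensor_W[OF u])
  from prr_fb[OF this] show "tensor_map (Fq I0) (Fq I0) (pc i) (pc j) u = \<zero>\<^bsub>H0H0\<^esub>"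
    by (simp add: prr_W[OF u])
qed

lemma syy_H0: "u \<in> carrier FF \<Longrightarrow> syy u = tensor_map grJ grK (H0_to_gr \<chi> J) (H0_to_gr \<chi> K) (tm I0 I0 u)"
  using tensor_map_comp[OF F.kmod_axioms F.kmod_axioms H0_kmod H0_kmod J.Q.kmod_gr K.Q.kmod_gr
      proj_linear[OF I_ideal] proj_linear[OF I_ideal] J.H0_to_gr_linear K.H0_to_gr_linear, of u]
  by (simp add: J.H0_to_gr_proj K.H0_to_gr_proj)

lemma proj_syK: "u \<in> carrier FF \<Longrightarrow> tensor_map (Fq I0) grK (proj I0) K.sy u = tensor_map (Fq I0) grK id (H0_to_gr \<chi> K) (tm I0 I0 u)"
  using tensor_map_comp[OF F.kmod_axioms F.kmod_axioms H0_kmod H0_kmod H0_kmod K.Q.kmod_gr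
      proj_linear[OF I_ideal] proj_linear[OF I_ideal] k_linear_id(1) K.H0_to_gr_linear, of u]
  by (simp add: K.H0_to_gr_proj)

lemma syy_proj: "u \<in> carrier FF \<Longrightarrow> tensor_map grJ grK (H0_to_gr \<chi> J) id (tensor_map (Fq I0) grK (proj I0) K.sy u) = syy u"
  using tensor_map_comp[OF F.kmod_axioms F.kmod_axioms H0_kmod K.Q.kmod_gr J.Q.kmod_gr K.Q.kmod_gr
      proj_linear[OF I_ideal] K.sy_linear J.H0_to_gr_linear k_linear_id(1), of u]
  by (simp add: J.H0_to_gr_proj)

lemma gr_tensor_inj: "inj_on gt (carrier (tensor grJ grK))"
proof (rule k_linear_inj_on[OF jk.grAB.kmod_tensor jk.TF.kmod_gr jk.gr_tensor_linear])
  fix t assume t: "t \<in> carrier (tensor grJ grK)" "gt t = \<zero>\<^bsub>gr FJK jk.TF\<^esub>"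
  \<comment> \<open>The symbol maps are onto, so every tensor comes from
    \<open>F \<otimes> F\<close>, where the kernel is known; and \<open>syy\<close> factors through
    \<open>H^0 \<otimes> H^0\<close>.\<close>
  have "t \<in> syy ` carrier FF"
    using t(1) tensor_map_surj[OF F.kmod_axioms F.kmod_axioms J.Q.kmod_gr K.Q.kmod_gr J.sy_linear K.sy_linear]
      J.sy_surj K.sy_surj by simp
  then obtain u where u: "u \<in> carrier FF" "t = syy u" by blast
  have "tm I0 I0 u = \<zero>\<^bsub>H0H0\<^esub>" by (rule gr_tensor_kernel[OF u(1)]) (use t(2) u(2) in simp)
  then show "t = \<zero>\<^bsub>tensor grJ grK\<^esub>"
    unfolding u(2) syy_H0[OF u(1)]
    using k_linear_zero[OF kmod_tensor[OF H0_kmod H0_kmod] jk.grAB.kmod_tensor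
        tensor_map_linear[OF H0_kmod H0_kmod J.Q.kmod_gr K.Q.kmod_gr J.H0_to_gr_linear K.H0_to_gr_linear]] by simp
qed

text \<open>The left coaction lands in \<open>H^0 \<otimes> gr A\<close>, with \<open>H^0\<close> in
  place of its associated graded. The kernel computation carries over because \<open>syy\<close>
  also factors through this tensor product.\<close>

lemma gr_tensor_H0_inj:
  "inj_on (gt \<circ> tensor_map grJ grK (H0_to_gr \<chi> J) id) (carrier (tensor (Fq I0) grK))"
proof (rule k_linear_inj_on[OF kmod_tensor[OF H0_kmod K.Q.kmod_gr] jk.TF.kmod_gr])
  note l = tensor_map_linear[OF H0_kmod K.Q.kmod_gr J.Q.kmod_gr K.Q.kmod_gr J.H0_to_gr_linear k_linear_id(1)]
  show "k_linear (tensor (Fq I0) grK) (gr FJK jk.TF) (gt \<circ> tensor_map grJ grK (H0_to_gr \<chi> J) id)"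
    using k_linear_comp[OF l jk.gr_tensor_linear] by (simp add: comp_def)
  fix t assume t: "t \<in> carrier (tensor (Fq I0) grK)" "(gt \<circ> tensor_map grJ grK (H0_to_gr \<chi> J) id) t = \<zero>\<^bsub>gr FJK jk.TF\<^esub>"
  have "t \<in> tensor_map (Fq I0) grK (proj I0) K.sy ` carrier FF"
    using t(1) tensor_map_surj[OF F.kmod_axioms F.kmod_axioms H0_kmod K.Q.kmod_gr proj_linear[OF I_ideal] K.sy_linear]
      proj_surj[OF I_ideal] K.sy_surj by simp
  then obtain u where u: "u \<in> carrier FF" "t = tensor_map (Fq I0) grK (proj I0) K.sy u" by blast
  have "tm I0 I0 u = \<zero>\<^bsub>H0H0\<^esub>"
    by (rule gr_tensor_kernel[OF u(1)]) (use t(2) in \<open>simp add: u(2) syy_proj[OF u(1)]\<close>)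
  then show "t = \<zero>\<^bsub>tensor (Fq I0) grK\<^esub>"
    unfolding u(2) proj_syK[OF u(1)]
    using k_linear_zero[OF kmod_tensor[OF H0_kmod H0_kmod] kmod_tensor[OF H0_kmod K.Q.kmod_gr]
        tensor_map_linear[OF H0_kmod H0_kmod H0_kmod K.Q.kmod_gr k_linear_id(1) K.H0_to_gr_linear]] by simp
qed

text \<open>The coproduct of a word is supported on pairs whose lengths add up to that of the word,
  so the degree \<open>n\<close> entry sees only the degree \<open>n\<close> component of
  \<open>f\<close>.\<close>

lemma W_comult: "W (\<Delta> f) n = tm J K (\<Delta> (comp n f))"
proof (rule linear_F_eqI[where f = "\<lambda>f. W (\<Delta> f) n" and h = "\<lambda>f. tm J K (\<Delta> (comp n f))", OF jk.TF.kmod_axioms])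
  show "k_linear F FJK (\<lambda>f. W (\<Delta> f) n)" by (rule k_linear_comp[OF F_comult_linear W_eval_linear])
  show "k_linear F FJK (\<lambda>f. tm J K (\<Delta> (comp n f)))"
    by (rule k_linear_comp[OF k_linear_comp[OF comp_linear F_comult_linear] tm_linear]) simp_all
  fix w a
  let ?p = "\<lambda>u v. single (u, word_degree g v + a) 1 \<otimes>\<^sub>k single (v, a) 1"
  let ?q = "\<lambda>u v. pure_tensor (Fq J) (Fq K) (proj J (single (u, word_degree g v + a) 1)) (proj K (single (v, a) 1))"
  have Wp: "W (?p u v) n = (if length u + length v = n then ?q u v else \<zero>\<^bsub>FJK\<^esub>)" for u v
  proof -
    have "W (?p u v) n = (\<Oplus>\<^bsub>FJK\<^esub>i\<in>{..n}. if length u = i then (if length u + length v = n then ?q u v else \<zero>\<^bsub>FJK\<^esub>) else \<zero>\<^bsub>FJK\<^esub>)"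
      unfolding W_pure
    proof (rule jk.TF.finsum_cong'[OF HOL.refl])
      fix i assume "i \<in> {..n}"
      note z = k_linear_zero[OF K.Q.kmod_axioms jk.TF.kmod_axioms bilin_right[OF jk.bilin_pure]]
        k_linear_zero[OF J.Q.kmod_axioms jk.TF.kmod_axioms bilin_left[OF jk.bilin_pure]]
      show "pure_tensor (Fq J) (Fq K) (J.lift (single (u, word_degree g v + a) 1) i) (K.lift (single (v, a) 1) (n - i))
        = (if length u = i then (if length u + length v = n then ?q u v else \<zero>\<^bsub>FJK\<^esub>) else \<zero>\<^bsub>FJK\<^esub>)"
        using \<open>i \<in> {..n}\<close> by (auto simp: J.lift_def K.lift_def comp_single proj_zero z)
    qed (simp add: jk.pure_closed)
    also have "\<dots> = (if length u + length v = n then ?q u v else \<zero>\<^bsub>FJK\<^esub>)"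
    proof (cases "length u \<le> n")
      case True
      then show ?thesis by (intro jk.TF.finsum_singleton) (simp_all add: jk.pure_closed)
    next
      case False
      then have "(\<Oplus>\<^bsub>FJK\<^esub>i\<in>{..n}. if length u = i then (if length u + length v = n then ?q u v else \<zero>\<^bsub>FJK\<^esub>) else \<zero>\<^bsub>FJK\<^esub>)
        = (\<Oplus>\<^bsub>FJK\<^esub>i\<in>{..n}. \<zero>\<^bsub>FJK\<^esub>)" by (intro jk.TF.finsum_cong') auto
      then show ?thesis using False by simp
    qed
    finally show ?thesis .
  qed
  have "W (\<Delta> (single (w, a) 1)) n = linear_extension FJK (\<lambda>p. W ((\<lambda>(u, v). ?p u v) p) n) (bc w)"
    unfolding comult_word
    by (rule k_linear_lin_ext[OF FFa.kmod_axioms jk.TF.kmod_axioms W_eval_linear]) (auto split: prod.split)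
  also have "\<dots> = linear_extension FJK (\<lambda>p. if length w = n then tm J K ((\<lambda>(u, v). ?p u v) p) else \<zero>\<^bsub>FJK\<^esub>) (bc w)"
  proof (rule lin_ext_bc_cong[OF jk.TF.kmod_axioms])
    show "W ((\<lambda>(u, v). ?p u v) p) n \<in> carrier FJK" for p by (rule W_closed) (auto split: prod.split)
    show "(if length w = n then tm J K ((\<lambda>(u, v). ?p u v) p) else \<zero>\<^bsub>FJK\<^esub>) \<in> carrier FJK" for p
      by (auto simp: tm_pure jk.pure_closed split: prod.split)
    fix u v assume "mset u + mset v = mset w"
    then have "length u + length v = length w" by (metis size_mset size_union)
    then show "W ((\<lambda>(u, v). ?p u v) (u, v)) n = (if length w = n then tm J K ((\<lambda>(u, v). ?p u v) (u, v)) else \<zero>\<^bsub>FJK\<^esub>)"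
      by (simp add: Wp tm_pure)
  qed
  also have "\<dots> = (if length w = n then tm J K (\<Delta> (single (w, a) 1)) else \<zero>\<^bsub>FJK\<^esub>)"
  proof (cases "length w = n")
    case True
    have "tm J K (\<Delta> (single (w, a) 1)) = linear_extension FJK (\<lambda>p. tm J K ((\<lambda>(u, v). ?p u v) p)) (bc w)"
      unfolding comult_word
      by (rule k_linear_lin_ext[OF FFa.kmod_axioms jk.TF.kmod_axioms tm_linear]) (auto split: prod.split)
    then show ?thesis using True by simp
  qed (simp add: jk.TF.lin_ext_const_zero)
  also have "\<dots> = tm J K (\<Delta> (comp n (single (w, a) 1)))"
  proof -
    have "tm J K (\<Delta> 0) = \<zero>\<^bsub>FJK\<^esub>"
      using k_linear_zero[OF F.kmod_axioms jk.TF.kmod_axioms k_linear_comp[OF F_comult_linear tm_linear]] by simp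
    then show ?thesis by (simp add: comp_single)
  qed
  finally show "W (\<Delta> (single (w, a) 1)) n = tm J K (\<Delta> (comp n (single (w, a) 1)))" .
qed

end

section \<open>The induced coproducts and coactions on associated graded objects\<close>

locale deformed_comult = deformed_pair \<chi> g blk R Rc L J P K P' + X: deformed \<chi> g blk R Rc L X P''
  for \<chi> :: "'i \<Rightarrow> 'g::ab_group_add \<Rightarrow> 'k::comm_ring_1" and g blk R Rc L J P K P' X P'' +
  assumes compat: "f \<in> X \<Longrightarrow> tm J K (\<Delta> f) = \<zero>\<^bsub>tensor (Fq J) (Fq K)\<^esub>"
begin

abbreviation "\<delta> \<equiv> induced_comult g \<chi> J K"

lemma tm_comult_linear: "k_linear F FJK (\<lambda>f. tm J K (\<Delta> f))"
  by (rule k_linear_comp[OF F_comult_linear tm_linear]) simp_all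

lemma \<delta>_proj: "\<delta> (proj X f) = tm J K (\<Delta> f)"
  and \<delta>_linear: "k_linear (Fq X) FJK \<delta>"
proof -
  interpret S: submod F X by (rule ideal_submod[OF kalg_F X.J_ideal])
  note l = S.on_cosets_linear[OF jk.TF.kmod_axioms tm_comult_linear compat]
  show "\<delta> (proj X f) = tm J K (\<Delta> f)" "k_linear (Fq X) FJK \<delta>"
    using l by (simp_all add: induced_comult_def F_proj_def F_quotient_def)
qed

text \<open>\<open>W\<close> takes values in sequences adapted to the filtration, so
  \<open>W_comult\<close> for a monomial is already the required estimate.\<close>

lemma \<delta>_filtered:
  assumes "x \<in> X.qf n" shows "\<delta> x \<in> jk.TF n"
proof -
  obtain f where f: "keys f \<subseteq> {p. length (fst p) \<le> n}" "x = proj X f" using assms unfolding X.qf_iff by blast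
  from f(1) have "tm J K (\<Delta> f) \<in> jk.TF n"
  proof (induction f rule: pm_induct)
    case zero
    then show ?case
      using k_linear_zero[OF F.kmod_axioms jk.TF.kmod_axioms tm_comult_linear] by simp
  next
    case (add p c f)
    obtain w a where p: "p = (w, a)" by (cases p)
    then have le: "length w \<le> n" using add(1) by simp
    have "W (\<Delta> (single p c)) (length w) = tm J K (\<Delta> (single p c))"
      by (simp add: W_comult p comp_single)
    moreover have "W (\<Delta> (single p c)) (length w) \<in> jk.TF (length w)"
      using k_linear_closed[OF W_linear] jk.TF.seqs_Fil by simp
    ultimately have "tm J K (\<Delta> (single p c)) \<in> jk.TF n" using jk.TF.Fil_mono[OF le] by auto
    then show ?case
      using jk.TF.Fil.add_mem add(3) k_linear_add[OF tm_comult_linear, of "single p c" f] by simp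
  qed
  then show ?thesis by (simp add: f(2) \<delta>_proj)
qed

lemma gr_map_\<delta>: "gr_map FJK jk.TF \<delta> (X.sy f) = gt (syy (\<Delta> f))"
proof (rule HOL.ext)
  fix n
  have "gr_map FJK jk.TF \<delta> (X.sy f) n = jk.TF.fb n +>\<^bsub>FJK\<^esub> \<delta> (X.lift f n)"
    by (rule gr_map_cl[OF X.Q.filt_axioms jk.TF.filt_axioms \<delta>_linear \<delta>_filtered]) (simp_all add: X.sy_eq)
  then show "gr_map FJK jk.TF \<delta> (X.sy f) n = gt (syy (\<Delta> f)) n"
    by (simp add: gr_tensor_W W_comult X.lift_def \<delta>_proj)
qed

text \<open>\<open>inv_into\<close> returns the intended preimage because \<open>gr_tensor\<close>
  is injective on the carrier and \<open>syy (\<Delta> f)\<close> is a preimage.\<close>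

theorem gr_comap_sy: "gr_comap (Fq J) J.qf (Fq K) K.qf \<delta> (X.sy f) = syy (\<Delta> f)"
  unfolding gr_comap_def gr_map_\<delta>
  by (rule inv_into_f_f[OF gr_tensor_inj k_linear_closed[OF syy(2)]]) simp

theorem gr_left_comap_sy:
  "inv_into (carrier (tensor (Fq I0) grK)) (gt \<circ> tensor_map grJ grK (H0_to_gr \<chi> J) id) (gr_map FJK jk.TF \<delta> (X.sy f))
    = tensor_map (Fq I0) grK (proj I0) K.sy (\<Delta> f)"
proof -
  have eq: "gr_map FJK jk.TF \<delta> (X.sy f)
    = (gt \<circ> tensor_map grJ grK (H0_to_gr \<chi> J) id) (tensor_map (Fq I0) grK (proj I0) K.sy (\<Delta> f))"
    by (simp add: gr_map_\<delta> syy_proj)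
  show ?thesis
    unfolding eq
    by (rule inv_into_f_f[OF gr_tensor_H0_inj], rule k_linear_closed[OF tensor_map_linear[OF F.kmod_axioms F.kmod_axioms
            H0_kmod K.Q.kmod_gr proj_linear[OF I_ideal] K.sy_linear]]) simp
qed

end

section \<open>Forgetting the coalgebra structure\<close>

text \<open>Tensor products, filtrations and \<open>gr\<close> read only the module fields, so
  adding coalgebra fields by \<open>module.extend\<close> does not change them. The lemmas of this
  section remove the extension.\<close>

lemma extend_simps [simp]:
  "carrier (module.extend M e) = carrier M" "monoid.mult (module.extend M e) = monoid.mult M"
  "one (module.extend M e) = one M" "zero (module.extend M e) = zero M"
  "add (module.extend M e) = add M" "smult (module.extend M e) = smult M"
  by (simp_all add: module.extend_def)

lemma extend_hopf_simps [simp]: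
  "comult (module.extend M (hopf.fields c u)) = c" "counit (module.extend M (hopf.fields c u)) = u"
  by (simp_all add: module.extend_def hopf.fields_def)

lemma extend_coset [simp]: "a_r_coset (module.extend M e) = a_r_coset M" "set_add (module.extend M e) = set_add M"
  by (intro HOL.ext; simp add: a_r_coset_def r_coset_def set_add_def set_mult_def)+

lemma extend_finsum [simp]: "finsum (module.extend M e) = finsum M"
  by (intro HOL.ext) (simp add: finsum_def finprod_def)

lemma extend_free [simp]:
  "free_on_pairs (module.extend A e) B = free_on_pairs A B" "free_on_pairs A' (module.extend B' e) = free_on_pairs A' B'"
  by (simp_all add: free_on_pairs_def)

lemma extend_tensor_kernel [simp]:
  "tensor_kernel (module.extend A e) B = tensor_kernel A B" "tensor_kernel A' (module.extend B' e) = tensor_kernel A' B'"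
  by (simp_all add: tensor_kernel_def bilinearity_relations_def)

lemma extend_tensor [simp]:
  "tensor (module.extend A e) B = tensor A B" "tensor A' (module.extend B' e) = tensor A' B'"
  by (simp_all add: tensor_def)

lemma extend_pure_tensor [simp]:
  "pure_tensor (module.extend A e) B = pure_tensor A B" "pure_tensor A' (module.extend B' e) = pure_tensor A' B'"
  by (simp_all add: pure_tensor_def fun_eq_iff)

lemma extend_tensor_map [simp]:
  "tensor_map (module.extend A e) B = tensor_map A B" "tensor_map A' (module.extend B' e) = tensor_map A' B'"
  by (simp_all add: tensor_map_def fun_eq_iff)

lemma extend_gr [simp]:
  "fil_below (module.extend A e) = fil_below A" "gr (module.extend A e) = gr A"
  "gr_degree (module.extend A e) = gr_degree A"
proof -
  show 1: "fil_below (module.extend A e) = fil_below A" by (intro HOL.ext) (simp add: fil_below_def split: nat.split)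
  show 2: "gr (module.extend A e) = gr A"
    by (intro HOL.ext) (simp add: gr_def 1 gr_bilinear_def[abs_def] cong: if_cong)
  show "gr_degree (module.extend A e) = gr_degree A" by (intro HOL.ext) (simp add: gr_degree_def 1 2)
qed

lemma extend_gr_tensor [simp]:
  "tensor_filtration (module.extend A e) FA B FB = tensor_filtration A FA B FB"
  "tensor_filtration A' FA' (module.extend B' e) FB' = tensor_filtration A' FA' B' FB'"
  by (simp_all add: tensor_filtration_def fun_eq_iff)

lemma extend_gr_map [simp]:
  "gr_tensor (module.extend A e) FA B FB = gr_tensor A FA B FB"
  "gr_tensor A' FA' (module.extend B' e) FB' = gr_tensor A' FA' B' FB'"
  by (simp_all add: gr_tensor_def)

lemma extend_gr_comap [simp]:
  "gr_comap (module.extend A e) FA B FB \<delta> = gr_comap A FA B FB \<delta>"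
  "gr_comap A' FA' (module.extend B' e) FB' \<delta>' = gr_comap A' FA' B' FB' \<delta>'"
  by (simp_all add: gr_comap_def fun_eq_iff)

lemma extend_hom [simp]:
  "algebra_hom (module.extend A e) B = algebra_hom A B" "algebra_hom A' (module.extend B' e) = algebra_hom A' B'"
  by (simp_all add: algebra_hom_def ring_hom_def k_linear_def fun_eq_iff)

lemma extend_graded_algebra_iso [simp]:
  "graded_algebra_iso (module.extend A e) dA B dB = graded_algebra_iso A dA B dB"
  "graded_algebra_iso A' dA' (module.extend B' e) dB' = graded_algebra_iso A' dA' B' dB'"
  by (simp_all add: graded_algebra_iso_def fun_eq_iff)

lemma kalg_extend: "kalg A \<Longrightarrow> kalg (module.extend A e)"
  by (rule kalg_surj_image(1)[where f = "\<lambda>x. x"]) simp_all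

lemma (in hopf_data) epi_extend: "epi A s \<Longrightarrow> epi (module.extend A e) s"
  by (simp add: epi_def kalg_extend)

section \<open>Proof of the theorem\<close>

context characters
begin

lemma counit_proj:
  assumes "ideal J F" "\<And>f. f \<in> J \<Longrightarrow> F_counit f = 0"
  shows "on_cosets F_counit (proj J f) = F_counit f" and "k_linear (Fq J) base_ring (on_cosets F_counit)"
proof -
  interpret S: submod F J by (rule ideal_submod[OF kalg_F assms(1)])
  have ker: "F_counit j = \<zero>\<^bsub>base_ring\<^esub>" if "j \<in> J" for j using assms(2)[OF that] by simp
  note l = S.on_cosets_linear[OF kmod_base_ring algebra_hom_linear[OF F_counit_hom] ker]
  show "on_cosets F_counit (proj J f) = F_counit f" "k_linear (Fq J) base_ring (on_cosets F_counit)"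
    using l by (simp_all add: F_proj_def F_quotient_def)
qed

end

lemma (in linked) deformed: "deformed \<chi> g blk R Rc L (I m n) Phi"
proof (rule deformed.intro[OF presentation_axioms deformed_axioms.intro])
  show "\<exists>l. keys l \<subseteq> {p. length (fst p) < 2} \<and> ad i j - l \<in> I m n" if "blk j < blk i" for i j
    using I_ad[OF that] by (intro exI[of _ "linking g m n i j"] conjI) (simp_all add: linking_def)
qed (simp_all add: I_R Phi_linear Phi_ideal Phi_low)

text \<open>The degree 0 entry of a symbol is a coset of the zero submodule whose element is itself
  a coset of \<open>J\<close>; hence two nested \<open>on_cosets\<close>.\<close>

lemma (in deformed) counit_sy:
  assumes "\<And>f. f \<in> J \<Longrightarrow> F_counit f = 0"
  shows "on_cosets (on_cosets F_counit) (sy f 0) = F_counit f"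
proof -
  note c = counit_proj[OF J_ideal assms]
  have "on_cosets (on_cosets F_counit) (sy f 0) = on_cosets F_counit (lift f 0)"
    unfolding sy_eq
  proof (rule Q.fb.on_cosets_linear(1)[OF kmod_base_ring c(2)])
    show "on_cosets F_counit j = \<zero>\<^bsub>base_ring\<^esub>" if "j \<in> Q.fb 0" for j
      using that k_linear_zero[OF Q.kmod_axioms kmod_base_ring c(2)] by (simp add: Q.fb_0)
  qed (assumption, rule lift_closed)
  then show ?thesis by (simp add: lift_def c(1) F_counit_comp)
qed

context presentation
begin

lemma deformed_I:
  assumes "\<And>i j. m i j \<noteq> 0 \<Longrightarrow> (i, j) \<in> Xi \<chi> blk" "\<And>i j. n i j \<noteq> 0 \<Longrightarrow> (i, j) \<in> Xi \<chi> blk"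
  shows "\<exists>P. deformed \<chi> g blk R Rc L (I m n) P"
proof -
  interpret linked \<chi> g blk R Rc L m n by unfold_locales (use assms in auto)
  show ?thesis using deformed by blast
qed

text \<open>Formulated with the ideals \<open>I m n\<close>, so that \<open>H^0\<close>,
  \<open>A(\<lambda>)\<close> and \<open>H^\<lambda>\<close> are three instances of
  \<open>deformed\<close>; the named objects are unfolded to these quotients afterwards.\<close>

lemma gr_of_presentation:
  fixes lam
  defines "lm \<equiv> \<lambda>i j. extend_by_zero \<chi> blk lam (i, j)"
  defines "IA \<equiv> I lm (\<lambda>_ _. 0)" and "IH \<equiv> I lm (\<lambda>i j. - lm i j)"
  shows "bicleft_object (F_quotient_hopf g \<chi> I0)
      (gr_hopf (F_quotient_hopf g \<chi> IH) (quotient_filtration \<chi> IH)) (gr (Fq IA) (quotient_filtration \<chi> IA))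
      (\<lambda>y. inv_into (carrier (tensor (Fq I0) (gr (Fq IA) (quotient_filtration \<chi> IA))))
         (gr_tensor (Fq I0) (quotient_filtration \<chi> I0) (Fq IA) (quotient_filtration \<chi> IA) \<circ>
            tensor_map (gr (Fq I0) (quotient_filtration \<chi> I0)) (gr (Fq IA) (quotient_filtration \<chi> IA)) (H0_to_gr \<chi> I0) id)
         (gr_map (tensor (Fq I0) (Fq IA)) (tensor_filtration (Fq I0) (quotient_filtration \<chi> I0) (Fq IA) (quotient_filtration \<chi> IA))
            (induced_comult g \<chi> I0 IA) y))
      (gr_comap (Fq IA) (quotient_filtration \<chi> IA) (Fq IH) (quotient_filtration \<chi> IH) (induced_comult g \<chi> IA IH))"
    and "graded_algebra_iso (Fq I0) (\<lambda>n. proj I0 ` F_degree n)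
      (gr (Fq IA) (quotient_filtration \<chi> IA)) (gr_degree (Fq IA) (quotient_filtration \<chi> IA)) (H0_to_gr \<chi> IA)"
    and "graded_hopf_iso (F_quotient_hopf g \<chi> I0) (\<lambda>n. proj I0 ` F_degree n)
      (gr_hopf (F_quotient_hopf g \<chi> IH) (quotient_filtration \<chi> IH)) (gr_degree (Fq IH) (quotient_filtration \<chi> IH))
      (H0_to_gr \<chi> IH)"
proof -
  have lm: "lm i j \<noteq> 0 \<Longrightarrow> (i, j) \<in> Xi \<chi> blk" for i j
    by (auto simp: lm_def extend_by_zero_def split: if_splits)
  \<comment> \<open>\<open>H^0\<close> is treated as the deformation with zero data, since the left
    coaction uses its filtration and identifies \<open>H^0\<close> with
    \<open>gr H^0\<close>.\<close>
  obtain P0 where "deformed \<chi> g blk R Rc L I0 P0" using deformed_I[of "\<lambda>_ _. 0" "\<lambda>_ _. 0"] by auto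
  then interpret Z: deformed \<chi> g blk R Rc L I0 P0 .
  obtain PA where "deformed \<chi> g blk R Rc L IA PA" using deformed_I[of lm "\<lambda>_ _. 0"] lm unfolding IA_def by auto
  then interpret A: deformed \<chi> g blk R Rc L IA PA .
  obtain PH where "deformed \<chi> g blk R Rc L IH PH" using deformed_I[of lm "\<lambda>i j. - lm i j"] lm unfolding IH_def by auto
  then interpret H: deformed \<chi> g blk R Rc L IH PH .
  \<comment> \<open>The four uses of \<open>comult_I\<close>: the coproduct of \<open>H^0\<close>,
    the left and the right coaction on \<open>A(\<lambda>)\<close>, the coproduct of
    \<open>H^\<lambda>\<close>. The condition \<open>n' = - m\<close> reads \<open>0 = 0\<close> in
    the first two cases and \<open>- \<lambda> = - \<lambda>\<close> in the last two.\<close>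
  interpret ZZ: deformed_comult \<chi> g blk R Rc L I0 P0 I0 P0 I0 P0
    by unfold_locales (rule comult_I, simp_all)
  interpret ZA: deformed_comult \<chi> g blk R Rc L I0 P0 IA PA IA PA
    by unfold_locales (unfold IA_def, rule comult_I, simp_all)
  interpret AH: deformed_comult \<chi> g blk R Rc L IA PA IH PH IA PA
    by unfold_locales (unfold IA_def IH_def, rule comult_I, simp_all)
  interpret HH: deformed_comult \<chi> g blk R Rc L IH PH IH PH IH PH
    by unfold_locales (unfold IH_def, rule comult_I, simp_all)
  have counit_IH: "F_counit f = 0" if "f \<in> IH" for f by (rule counit_I) (use that in \<open>simp_all add: IH_def\<close>)
  note c0 = counit_proj[OF I_ideal counit_I0]
  let ?H0 = "F_quotient_hopf g \<chi> I0" and ?grH = "gr_hopf (F_quotient_hopf g \<chi> IH) H.qf"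
  show "graded_algebra_iso (Fq I0) (\<lambda>n. proj I0 ` F_degree n) (gr (Fq IA) A.qf) (gr_degree (Fq IA) A.qf) (H0_to_gr \<chi> IA)"
    by (rule A.H0_to_gr_iso)
  show "graded_hopf_iso ?H0 (\<lambda>n. proj I0 ` F_degree n) ?grH (gr_degree (Fq IH) H.qf) (H0_to_gr \<chi> IH)"
    unfolding graded_hopf_iso_def
  proof (intro conjI ballI)
    show "graded_algebra_iso ?H0 (\<lambda>n. proj I0 ` F_degree n) ?grH (gr_degree (Fq IH) H.qf) (H0_to_gr \<chi> IH)"
      using H.H0_to_gr_iso by (simp add: F_quotient_hopf_def gr_hopf_def)
    fix h assume "h \<in> carrier ?H0"
    then obtain f where f: "h = proj I0 f" using H.Fq_I0_cases by (auto simp: F_quotient_hopf_def)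
    show "comult ?grH (H0_to_gr \<chi> IH h) = tensor_map ?grH ?grH (H0_to_gr \<chi> IH) (H0_to_gr \<chi> IH) (comult ?H0 h)"
      using HH.gr_comap_sy[of f] HH.syy_H0[of "\<Delta> f"]
      by (simp add: f F_quotient_hopf_def gr_hopf_def H.H0_to_gr_proj ZZ.\<delta>_proj)
    show "counit ?grH (H0_to_gr \<chi> IH h) = counit ?H0 h"
      by (simp add: f F_quotient_hopf_def gr_hopf_def H.H0_to_gr_proj H.counit_sy[OF counit_IH] c0(1))
  qed
  let ?\<rho> = "\<lambda>y. inv_into (carrier (tensor (Fq I0) (gr (Fq IA) A.qf)))
         (gr_tensor (Fq I0) Z.qf (Fq IA) A.qf \<circ> tensor_map (gr (Fq I0) Z.qf) (gr (Fq IA) A.qf) (H0_to_gr \<chi> I0) id)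
         (gr_map (tensor (Fq I0) (Fq IA)) (tensor_filtration (Fq I0) Z.qf (Fq IA) A.qf) (induced_comult g \<chi> I0 IA) y)"
  show "bicleft_object ?H0 ?grH (gr (Fq IA) A.qf) ?\<rho>
      (gr_comap (Fq IA) A.qf (Fq IH) H.qf (induced_comult g \<chi> IA IH))"
  \<comment> \<open>All structure maps are now images of those of \<open>F\<close> under
    \<open>proj I0\<close> and the two symbol maps, each of which has kernel
    \<open>I0\<close>.\<close>
  proof (rule bicleft_object_epi[where \<pi> = "proj I0" and t = H.sy and s = A.sy])
    show "epi ?H0 (proj I0)" unfolding F_quotient_hopf_def by (rule epi_extend[OF epi_Fq]) simp
    show "epi ?grH H.sy"
      using epi_extend[OF H.epi_sy] by (simp add: gr_hopf_def F_quotient_hopf_def)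
    show "epi (gr (Fq IA) A.qf) A.sy" by (rule A.epi_sy)
    show "comult ?H0 (proj I0 f) = tensor_map ?H0 ?H0 (proj I0) (proj I0) (\<Delta> f)" for f
      by (simp add: F_quotient_hopf_def ZZ.\<delta>_proj)
    show "counit ?H0 (proj I0 f) = F_counit f" for f by (simp add: F_quotient_hopf_def c0(1))
    show "comult ?grH (H.sy f) = tensor_map ?grH ?grH H.sy H.sy (\<Delta> f)" for f
      using HH.gr_comap_sy[of f] by (simp add: F_quotient_hopf_def gr_hopf_def)
    show "counit ?grH (H.sy f) = F_counit f" for f
      by (simp add: F_quotient_hopf_def gr_hopf_def H.counit_sy[OF counit_IH])
    show "?\<rho> (A.sy f) = tensor_map ?H0 (gr (Fq IA) A.qf) (proj I0) A.sy (\<Delta> f)" for f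
      using ZA.gr_left_comap_sy[of f] by (simp add: F_quotient_hopf_def)
    show "gr_comap (Fq IA) A.qf (Fq IH) H.qf (induced_comult g \<chi> IA IH) (A.sy f)
      = tensor_map (gr (Fq IA) A.qf) ?grH A.sy H.sy (\<Delta> f)" for f
      using AH.gr_comap_sy[of f] by (simp add: F_quotient_hopf_def gr_hopf_def)
    have z: "proj I0 f = \<zero>\<^bsub>?H0\<^esub> \<longleftrightarrow> f \<in> I0" for f
      by (simp add: F_quotient_hopf_def proj_zero_iff)
    show "A.sy f = \<zero>\<^bsub>gr (Fq IA) A.qf\<^esub> \<longleftrightarrow> proj I0 f = \<zero>\<^bsub>?H0\<^esub>" for f
      by (simp add: z A.sy_zero_iff)
    show "H.sy f = \<zero>\<^bsub>?grH\<^esub> \<longleftrightarrow> proj I0 f = \<zero>\<^bsub>?H0\<^esub>" for f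
      unfolding z by (simp add: gr_hopf_def F_quotient_hopf_def H.sy_zero_iff)
    show "proj I0 (S f) = \<zero>\<^bsub>?H0\<^esub>" if "proj I0 f = \<zero>\<^bsub>?H0\<^esub>" for f
      using that unfolding z by (rule antipode_I0)
    show "F_counit f = 0" if "proj I0 f = \<zero>\<^bsub>?H0\<^esub>" for f
      using that unfolding z by (rule counit_I0)
  qed
qed

lemma H0_ideal_eq: "H0_ideal g \<chi> blk R = I0"
  unfolding H0_ideal_def I_def by (simp add: case_prod_unfold)

lemma A_ideal_eq: "A_ideal g \<chi> blk R lam = I (\<lambda>i j. extend_by_zero \<chi> blk lam (i, j)) (\<lambda>_ _. 0)"
  unfolding A_ideal_def I_def
  by (rule arg_cong[where f = "defining_ideal g \<chi> blk R"]) (auto simp: linking_def grouplike_def fun_eq_iff)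

lemma H_ideal_eq: "H_ideal g \<chi> blk R lam
    = I (\<lambda>i j. extend_by_zero \<chi> blk lam (i, j)) (\<lambda>i j. - extend_by_zero \<chi> blk lam (i, j))"
  unfolding H_ideal_def I_def
  by (rule arg_cong[where f = "defining_ideal g \<chi> blk R"])
    (auto simp: linking_def grouplike_def fun_eq_iff fscale_simps single_uminus)

end

theorem proposition4p4:
  fixes g :: "'i::finite \<Rightarrow> 'g::ab_group_add"
    and \<chi> :: "'i \<Rightarrow> 'g \<Rightarrow> 'k::comm_ring_1"
    and blk :: "'i \<Rightarrow> nat" and N :: nat
    and R :: "('i list \<Rightarrow>\<^sub>0 'k) set"
    and Rc :: "nat \<Rightarrow> ('i list \<Rightarrow>\<^sub>0 'k) set" and L :: nat
    and lam :: "'i \<times> 'i \<Rightarrow> 'k"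
  assumes "\<And>i. character (\<chi> i)"
    and "range blk = {1..N}"
    and "\<And>i j. blk i \<noteq> blk j \<Longrightarrow> \<chi> j (g i) * \<chi> i (g j) = 1"
    and "R \<subseteq> braid_relators g \<chi> blk"
    and "Rc 0 = {}" and "\<And>h. h < L \<Longrightarrow> Rc h \<subseteq> Rc (Suc h)" and "Rc L = R"
    and "\<And>h r. h < L \<Longrightarrow> r \<in> Rc (Suc h) \<Longrightarrow>
           primitive_modulo g \<chi> (Idl\<^bsub>tensor_algebra\<^esub> (Rc h)) r"
  shows "bicleft_object (H0 g \<chi> blk R) (gr_H g \<chi> blk R lam) (gr_A g \<chi> blk R lam)
           (gr_A_left_coaction g \<chi> blk R lam) (gr_A_right_coaction g \<chi> blk R lam)
         \<and> graded_algebra_iso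
           (H0 g \<chi> blk R) (H0_degree g \<chi> blk R)
           (gr_A g \<chi> blk R lam) (gr_degree (A_lam g \<chi> blk R lam) (A_filtration g \<chi> blk R lam))
           (H0_to_gr \<chi> (A_ideal g \<chi> blk R lam))
         \<and> graded_hopf_iso
           (H0 g \<chi> blk R) (H0_degree g \<chi> blk R)
           (gr_H g \<chi> blk R lam) (gr_degree (H_lam g \<chi> blk R lam) (H_filtration g \<chi> blk R lam))
           (H0_to_gr \<chi> (H_ideal g \<chi> blk R lam))"
proof -
  interpret presentation \<chi> g blk R Rc L
    by unfold_locales (fact assms)+
  note ideals = H0_ideal_eq A_ideal_eq H_ideal_eq
  note defs = H0_def gr_H_def gr_A_def H_lam_def A_lam_def H_filtration_def A_filtration_def H0_filtration_def
    A_left_coaction_def A_right_coaction_def H0_degree_def[abs_def] ideals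
  \<comment> \<open>The coalgebra fields of \<open>H0\<close> do not enter the tensor products and
    filtrations, so the coaction is the one computed with the bare quotient
    \<open>Fq I0\<close>.\<close>
  have left: "gr_A_left_coaction g \<chi> blk R lam = (\<lambda>y. inv_into
      (carrier (tensor (Fq I0) (gr (Fq (A_ideal g \<chi> blk R lam)) (quotient_filtration \<chi> (A_ideal g \<chi> blk R lam)))))
      (gr_tensor (Fq I0) (quotient_filtration \<chi> I0) (Fq (A_ideal g \<chi> blk R lam)) (quotient_filtration \<chi> (A_ideal g \<chi> blk R lam)) \<circ>
        tensor_map (gr (Fq I0) (quotient_filtration \<chi> I0)) (gr (Fq (A_ideal g \<chi> blk R lam)) (quotient_filtration \<chi> (A_ideal g \<chi> blk R lam))) (H0_to_gr \<chi> I0) id)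
      (gr_map (tensor (Fq I0) (Fq (A_ideal g \<chi> blk R lam)))
        (tensor_filtration (Fq I0) (quotient_filtration \<chi> I0) (Fq (A_ideal g \<chi> blk R lam)) (quotient_filtration \<chi> (A_ideal g \<chi> blk R lam)))
        (induced_comult g \<chi> I0 (A_ideal g \<chi> blk R lam)) y))"
    by (rule HOL.ext)
      (simp add: gr_A_left_coaction_def Let_def H0_def A_lam_def H0_filtration_def A_filtration_def
        A_left_coaction_def H0_ideal_eq F_quotient_hopf_def)
  have right: "gr_A_right_coaction g \<chi> blk R lam
    = gr_comap (Fq (A_ideal g \<chi> blk R lam)) (quotient_filtration \<chi> (A_ideal g \<chi> blk R lam))
        (Fq (H_ideal g \<chi> blk R lam)) (quotient_filtration \<chi> (H_ideal g \<chi> blk R lam))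
        (induced_comult g \<chi> (A_ideal g \<chi> blk R lam) (H_ideal g \<chi> blk R lam))"
    by (simp add: gr_A_right_coaction_def H_lam_def A_lam_def H_filtration_def A_filtration_def
        A_right_coaction_def F_quotient_hopf_def)
  show ?thesis
    using gr_of_presentation[of lam]
    unfolding left right
    by (simp add: defs, simp add: F_quotient_hopf_def)
qed

end
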